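(* Let $\Gamma$ be a polyhedral cone with Neumann--Poincaré operator $K$, let $0 \leq \alpha < 1$ and $\lambda\in\mathbb{C}$. Then $K - \lambda\colon L^2_{\alpha}(\Gamma) \to L^2_{\alpha}(\Gamma)$ is invertible if and only if $\lambda\not\in \sigma(H(z), L^2_\alpha(\gamma))$ for every $z$ with $\operatorname{Re} z = 0$, and $$\sup_{\operatorname{Re} z = 0} \|(H(z)-\lambda)^{-1}\|_{\mathcal{L}(L^2_\alpha(\gamma))} < \infty.$$ Let $d > 0$. If $K - \lambda$ is not invertible on $L^2_\alpha(\Gamma)$, then there is a sequence $(w_n)_{n=1}^\infty$ with $\operatorname{supp} w_n \subset [0, d] \times \gamma$ that is either a singular Weyl sequence for $K-\lambda$ or one for $K^\dagger - \bar{\lambda}$. That is, in the former case, $\|w_n\|_{L^2_{\alpha}(\Gamma)} = 1$ for every $n$, $w_n \to 0$ weakly in $L^2_\alpha(\Gamma)$, and $\|(K-\lambda)w_n\|_{L^2_\alpha(\Gamma)} \to 0$; in the latter case, $\|w_n\|_{L^2_{-\alpha}(\Gamma)} = 1$ for every $n$, $w_n \to 0$ weakly in $L^2_{-\alpha}(\Gamma)$, and $\|(K^\dagger-\bar{\lambda})w_n\|_{L^2_{-\alpha}(\Gamma)} \to 0$. In particular, $$\sigma(K, L^2_{\alpha}(\Gamma)) = \sigma_{\mathrm{ess}}(K, L^2_{\alpha}(\Gamma)).$$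
   Context: Polyhedral cone: $\hat\Gamma\subset\mathbb{R}^3$ is an open infinite polyhedral cone with vertex at the origin, coinciding near the origin with a translate of a simply connected bounded polyhedron (flat faces, straight edges, not necessarily Lipschitz) near one of its vertices; $\Gamma=\partial\hat\Gamma$ consists of open plane sectors $F_1,\dots,F_J$ and edges $\upsilon_1,\dots,\upsilon_J$. $\gamma=\Gamma\cap S^2$ is a spherical polygon with circular arcs $\gamma_j=F_j\cap S^2$ and corners $E_j=\upsilon_j\cap S^2$; $d\omega$ is arc length on $\gamma$; points of $\Gamma$ are written $x=r\omega$, $r>0$, $\omega\in\gamma$, identifying $\Gamma$ with $\mathbb{R}_+\times\gamma$; $n_y$ is the outward unit normal of $\hat\Gamma$ at a.e. $y\in\Gamma$; $dS$ is surface measure. Spaces: $q$ is a fixed Lipschitz function on $\gamma$, smooth on each closed arc $\bar\gamma_j$, equal near each corner $E_j$ to the arc-length distance to $E_j$, and non-vanishing except at corners. $L^2_\alpha(\gamma)=L^2(\gamma,q^{-\alpha}d\omega)$ and $L^2_\alpha(\Gamma)=L^2(\mathbb{R}_+\times\gamma,\,q(\omega)^{-\alpha}\,dr\,d\omega)$ for $\alpha\in\mathbb{R}$. Operators: $Ku(x)=\frac{1}{4\pi}\int_{\Gamma} u(y)\frac{(y-x)\cdot n_y}{|x-y|^3}\,dS(y)$, bounded on $L^2_\alpha(\Gamma)$ for $0\le\alpha<1$; $K^\dagger$ is the adjoint of $K$ with respect to the $L^2_0(\Gamma)$-pairing, acting on $L^2_{-\alpha}(\Gamma)$. For $-3/2<\operatorname{Re}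 z<3/2$, $$H(z)v(\omega)=-\frac1{4\pi}\int_\gamma\int_0^\infty t^{z+1/2}\,\frac{t\,\omega\cdot n_{\omega'}}{|t\omega-\omega'|^3}\,\frac{dt}{t}\,v(\omega')\,d\omega',$$ where the kernel is $0$ when $\omega,\omega'$ lie on the same arc; it is bounded on $L^2_\alpha(\gamma)$. $\sigma(T,X)$ is the spectrum of $T$ on $X$; $\sigma_{\mathrm{ess}}(T,X)$ is the set of $\lambda\in\mathbb{C}$ such that $T-\lambda$ is not Fredholm on $X$. *)

theory Defs
  imports "HOL-Analysis.Analysis"
begin

section \<open>Polyhedral cones\<close>

text \<open>
  A closed spherical polygon is given by its corners, the unit tangent at which each arc leaves its
  starting corner, and the length of each arc. Angles of size \<open>\<ge> \<pi>\<close> occur, since a face of a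
  non-convex polyhedron may have a reflex corner; such an arc is not determined by its end points.
\<close>

record spherical_polygon =
  sides :: nat
  corner :: "nat \<Rightarrow> real^3"
  tangent :: "nat \<Rightarrow> real^3"
  angle :: "nat \<Rightarrow> real"

definition arc_point :: "spherical_polygon \<Rightarrow> nat \<Rightarrow> real \<Rightarrow> real^3" where
  "arc_point P j t = cos t *\<^sub>R corner P j + sin t *\<^sub>R tangent P j"

definition face :: "spherical_polygon \<Rightarrow> nat \<Rightarrow> (real^3) set" where
  "face P j = {r *\<^sub>R arc_point P j t | r t. 0 < r \<and> 0 < t \<and> t < angle P j}"

definition edge :: "spherical_polygon \<Rightarrow> nat \<Rightarrow> (real^3) set" where
  "edge P j = {r *\<^sub>R corner P j | r. 0 < r}"

definition cone_surface :: "spherical_polygon \<Rightarrow> (real^3) set" where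
  "cone_surface P = {0} \<union> (\<Union>j<sides P. face P j \<union> edge P j)"

definition polygon_curve :: "spherical_polygon \<Rightarrow> (real^3) set" where
  "polygon_curve P = cone_surface P \<inter> sphere 0 1"

text \<open>
  The injectivity condition says that the polygon does not intersect itself, the span condition that
  consecutive sectors are not coplanar, i.e. that every edge is a genuine one.
\<close>

definition simple_spherical_polygon :: "spherical_polygon \<Rightarrow> bool" where
  "simple_spherical_polygon P \<longleftrightarrow>
     3 \<le> sides P \<and>
     (\<forall>j<sides P. norm (corner P j) = 1 \<and> norm (tangent P j) = 1 \<and> corner P j \<bullet> tangent P j = 0 \<and>
        0 < angle P j \<and> angle P j < 2 * pi \<and>
        arc_point P j (angle P j) = corner P (Suc j mod sides P) \<and>
        tangent P (Suc j mod sides P) \<notin> span {corner P j, tangent P j}) \<and>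
     inj_on (\<lambda>(j, t). arc_point P j t) (SIGMA j:{..<sides P}. {0..<angle P j})"

definition simply_connected_polyhedron :: "(real^3) set \<Rightarrow> bool" where
  "simply_connected_polyhedron \<Omega> \<longleftrightarrow>
     open \<Omega> \<and> bounded \<Omega> \<and> simply_connected \<Omega> \<and> interior (closure \<Omega>) = \<Omega> \<and>
     (\<exists>\<P>. finite \<P> \<and> (\<forall>p\<in>\<P>. \<exists>n c. n \<noteq> 0 \<and> p = {x. n \<bullet> x = c}) \<and> frontier \<Omega> \<subseteq> \<Union>\<P>)"

text \<open>Outward unit normals at points near which the set is an open half space.\<close>

definition is_outward_normal :: "(real^3) set \<Rightarrow> real^3 \<Rightarrow> real^3 \<Rightarrow> bool" where
  "is_outward_normal C y n \<longleftrightarrow>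
     norm n = 1 \<and> (\<exists>\<epsilon>>0. C \<inter> ball y \<epsilon> = {x \<in> ball y \<epsilon>. (x - y) \<bullet> n < 0})"

definition outward_normal :: "(real^3) set \<Rightarrow> real^3 \<Rightarrow> real^3" where
  "outward_normal C y = (THE n. is_outward_normal C y n)"

text \<open>
  \<open>C\<close> is the open solid cone; its boundary is the cone over the polygon. The library predicates
  \<^const>\<open>cone\<close> and \<^const>\<open>conic\<close> force the vertex to be a member, which an open cone excludes.
\<close>

definition polyhedral_cone :: "(real^3) set \<Rightarrow> spherical_polygon \<Rightarrow> bool" where
  "polyhedral_cone C P \<longleftrightarrow>
     simple_spherical_polygon P \<and>
     open C \<and> connected C \<and> (\<forall>x\<in>C. \<forall>r>0. r *\<^sub>R x \<in> C) \<and>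
     frontier C = cone_surface P \<and>
     (\<forall>j<sides P. \<forall>y\<in>face P j. \<exists>n. is_outward_normal C y n) \<and>
     (\<exists>\<Omega> p \<rho>. simply_connected_polyhedron \<Omega> \<and> 0 < \<rho> \<and>
        C \<inter> ball 0 \<rho> = (\<lambda>x. x - p) ` \<Omega> \<inter> ball 0 \<rho>)"

section \<open>Measures\<close>

definition arc_length :: "spherical_polygon \<Rightarrow> (real^3) measure" where
  "arc_length P =
     distr
       (restrict_space (count_space {..<sides P} \<Otimes>\<^sub>M lborel)
          (SIGMA j:{..<sides P}. {0<..<angle P j}))
       (restrict_space borel (polygon_curve P))
       (\<lambda>(j, t). arc_point P j t)"

text \<open>Each face is measured by planar Lebesgue measure in orthonormal coordinates of its plane.\<close>

definition face_chart :: "spherical_polygon \<Rightarrow> nat \<Rightarrow> real \<times> real \<Rightarrow> real^3" where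
  "face_chart P j = (\<lambda>(u, v). u *\<^sub>R corner P j + v *\<^sub>R tangent P j)"

definition surface_measure :: "spherical_polygon \<Rightarrow> (real^3) measure" where
  "surface_measure P =
     distr
       (restrict_space (count_space {..<sides P} \<Otimes>\<^sub>M lborel)
          (SIGMA j:{..<sides P}. face_chart P j -` face P j))
       (restrict_space borel (cone_surface P))
       (\<lambda>(j, p). face_chart P j p)"

text \<open>Smoothness on a closed arc means that a smooth extension in the arc-length variable exists.\<close>

definition smooth_real :: "(real \<Rightarrow> real) \<Rightarrow> bool" where
  "smooth_real g \<longleftrightarrow> (\<forall>k x. (deriv ^^ k) g differentiable (at x))"

definition corner_weight :: "spherical_polygon \<Rightarrow> (real^3 \<Rightarrow> real) \<Rightarrow> bool" where
  "corner_weight P q \<longleftrightarrow>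
     (\<exists>L. L-lipschitz_on (polygon_curve P) q) \<and>
     (\<forall>j<sides P. \<exists>g. smooth_real g \<and> (\<forall>t\<in>{0..angle P j}. q (arc_point P j t) = g t)) \<and>
     (\<forall>j<sides P. \<exists>\<delta>>0. \<forall>t\<in>{0..angle P j}.
        (t < \<delta> \<longrightarrow> q (arc_point P j t) = t) \<and>
        (angle P j - t < \<delta> \<longrightarrow> q (arc_point P j t) = angle P j - t)) \<and>
     (\<forall>\<omega>\<in>polygon_curve P. \<omega> \<notin> corner P ` {..<sides P} \<longrightarrow> q \<omega> \<noteq> 0)"

definition curve_measure :: "spherical_polygon \<Rightarrow> (real^3 \<Rightarrow> real) \<Rightarrow> real \<Rightarrow> (real^3) measure" where
  "curve_measure P q \<alpha> = density (arc_length P) (\<lambda>\<omega>. ennreal (q \<omega> powr (- \<alpha>)))"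

text \<open>
  The measure \<open>q(\<omega>)\<^sup>-\<^sup>\<alpha> dr d\<omega>\<close> transported to the surface by \<open>(r, \<omega>) \<mapsto> r \<omega>\<close>; note that it has
  \<open>dr\<close> and not the factor \<open>r dr\<close> of the surface measure.
\<close>

definition cone_measure :: "spherical_polygon \<Rightarrow> (real^3 \<Rightarrow> real) \<Rightarrow> real \<Rightarrow> (real^3) measure" where
  "cone_measure P q \<alpha> =
     distr (restrict_space lborel {0<..} \<Otimes>\<^sub>M curve_measure P q \<alpha>)
       (restrict_space borel (cone_surface P))
       (\<lambda>(r, \<omega>). r *\<^sub>R \<omega>)"

section \<open>Operators on complex square-integrable functions\<close>

text \<open>
  Elements of the Hilbert space of a measure are represented by functions, and identities between
  them are required almost everywhere. A bounded operator respects equality almost everywhere, by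
  linearity and boundedness.
\<close>

definition L2 :: "'a measure \<Rightarrow> ('a \<Rightarrow> complex) set" where
  "L2 M = {f \<in> borel_measurable M. integrable M (\<lambda>x. (cmod (f x))\<^sup>2)}"

definition L2_norm :: "'a measure \<Rightarrow> ('a \<Rightarrow> complex) \<Rightarrow> real" where
  "L2_norm M f = sqrt (\<integral>x. (cmod (f x))\<^sup>2 \<partial>M)"

definition L2_inner :: "'a measure \<Rightarrow> ('a \<Rightarrow> complex) \<Rightarrow> ('a \<Rightarrow> complex) \<Rightarrow> complex" where
  "L2_inner M f g = (\<integral>x. f x * cnj (g x) \<partial>M)"

type_synonym 'a op = "('a \<Rightarrow> complex) \<Rightarrow> ('a \<Rightarrow> complex)"

definition bounded_op :: "'a measure \<Rightarrow> 'a op \<Rightarrow> bool" where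
  "bounded_op M T \<longleftrightarrow>
     (\<forall>f\<in>L2 M. T f \<in> L2 M) \<and>
     (\<forall>f\<in>L2 M. \<forall>g\<in>L2 M. AE x in M. T (\<lambda>x. f x + g x) x = T f x + T g x) \<and>
     (\<forall>f\<in>L2 M. \<forall>c. AE x in M. T (\<lambda>x. c * f x) x = c * T f x) \<and>
     (\<exists>B. \<forall>f\<in>L2 M. L2_norm M (T f) \<le> B * L2_norm M f)"

definition op_norm :: "'a measure \<Rightarrow> 'a op \<Rightarrow> real" where
  "op_norm M T = (SUP f\<in>{f \<in> L2 M. L2_norm M f \<le> 1}. L2_norm M (T f))"

definition shift :: "'a op \<Rightarrow> complex \<Rightarrow> 'a op" where
  "shift T \<mu> = (\<lambda>f x. T f x - \<mu> * f x)"

definition is_inverse_op :: "'a measure \<Rightarrow> 'a op \<Rightarrow> 'a op \<Rightarrow> bool" where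
  "is_inverse_op M T S \<longleftrightarrow>
     bounded_op M S \<and> (\<forall>f\<in>L2 M. (AE x in M. S (T f) x = f x) \<and> (AE x in M. T (S f) x = f x))"

definition invertible_op :: "'a measure \<Rightarrow> 'a op \<Rightarrow> bool" where
  "invertible_op M T \<longleftrightarrow> bounded_op M T \<and> (\<exists>S. is_inverse_op M T S)"

definition inverse_op :: "'a measure \<Rightarrow> 'a op \<Rightarrow> 'a op" where
  "inverse_op M T = (SOME S. is_inverse_op M T S)"

definition spectrum :: "'a measure \<Rightarrow> 'a op \<Rightarrow> complex set" where
  "spectrum M T = {\<mu>. \<not> invertible_op M (shift T \<mu>)}"

text \<open>Finite-dimensional kernel, closed range and finite-dimensional cokernel.\<close>

definition fredholm :: "'a measure \<Rightarrow> 'a op \<Rightarrow> bool" where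
  "fredholm M T \<longleftrightarrow>
     bounded_op M T \<and>
     (\<exists>B. finite B \<and> B \<subseteq> L2 M \<and>
        (\<forall>f\<in>L2 M. (AE x in M. T f x = 0) \<longrightarrow> (\<exists>c. AE x in M. f x = (\<Sum>b\<in>B. c b * b x)))) \<and>
     (\<forall>f g. (\<forall>n::nat. f n \<in> L2 M) \<and> g \<in> L2 M \<and>
        (\<lambda>n. L2_norm M (\<lambda>x. T (f n) x - g x)) \<longlonglongrightarrow> 0 \<longrightarrow>
        (\<exists>h\<in>L2 M. AE x in M. T h x = g x)) \<and>
     (\<exists>B. finite B \<and> B \<subseteq> L2 M \<and>
        (\<forall>g\<in>L2 M. \<exists>h\<in>L2 M. \<exists>c. AE x in M. g x = T h x + (\<Sum>b\<in>B. c b * b x)))"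

definition essential_spectrum :: "'a measure \<Rightarrow> 'a op \<Rightarrow> complex set" where
  "essential_spectrum M T = {\<mu>. \<not> fredholm M (shift T \<mu>)}"

definition L2_weakly_null :: "'a measure \<Rightarrow> (nat \<Rightarrow> 'a \<Rightarrow> complex) \<Rightarrow> bool" where
  "L2_weakly_null M w \<longleftrightarrow> (\<forall>g\<in>L2 M. (\<lambda>n. L2_inner M (w n) g) \<longlonglongrightarrow> 0)"

definition singular_Weyl_sequence :: "'a measure \<Rightarrow> 'a op \<Rightarrow> (nat \<Rightarrow> 'a \<Rightarrow> complex) \<Rightarrow> bool" where
  "singular_Weyl_sequence M T w \<longleftrightarrow>
     (\<forall>n. w n \<in> L2 M \<and> L2_norm M (w n) = 1) \<and>
     L2_weakly_null M w \<and>
     (\<lambda>n. L2_norm M (T (w n))) \<longlonglongrightarrow> 0"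

section \<open>The Neumann--Poincare operator and its Mellin symbol\<close>

definition NP_op :: "(real^3) set \<Rightarrow> spherical_polygon \<Rightarrow> (real^3) op" where
  "NP_op C P u x =
     complex_of_real (1 / (4 * pi)) *
     (\<integral>y. u y * complex_of_real (((y - x) \<bullet> outward_normal C y) / norm (x - y) ^ 3) \<partial>surface_measure P)"

text \<open>The adjoint for the unweighted pairing; it is determined almost everywhere.\<close>

definition NP_adj ::
    "(real^3) set \<Rightarrow> spherical_polygon \<Rightarrow> (real^3 \<Rightarrow> real) \<Rightarrow> real \<Rightarrow> (real^3) op" where
  "NP_adj C P q \<alpha> = (SOME T.
     bounded_op (cone_measure P q (- \<alpha>)) T \<and>
     (\<forall>u\<in>L2 (cone_measure P q \<alpha>). \<forall>v\<in>L2 (cone_measure P q (- \<alpha>)).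
        L2_inner (cone_measure P q 0) (NP_op C P u) v = L2_inner (cone_measure P q 0) u (T v)))"

text \<open>
  The kernel vanishes when both points lie on the same arc, because \<open>\<omega>\<close> is then orthogonal to the
  normal at \<open>\<omega>'\<close> (the value at the singularity \<open>t \<omega> = \<omega>'\<close> is \<open>0\<close> by the convention on division).
\<close>

definition mellin_kernel ::
    "(real^3) set \<Rightarrow> complex \<Rightarrow> real^3 \<Rightarrow> real^3 \<Rightarrow> complex" where
  "mellin_kernel C z \<omega> \<omega>' =
     (LINT t:{0<..}|lborel.
        complex_of_real t powr (z + 1/2) *
        complex_of_real ((t *\<^sub>R \<omega>) \<bullet> outward_normal C \<omega>' / norm (t *\<^sub>R \<omega> - \<omega>') ^ 3) / complex_of_real t)"

definition mellin_op :: "(real^3) set \<Rightarrow> spherical_polygon \<Rightarrow> complex \<Rightarrow> (real^3) op" where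
  "mellin_op C P z v \<omega> =
     - complex_of_real (1 / (4 * pi)) * (\<integral>\<omega>'. mellin_kernel C z \<omega> \<omega>' * v \<omega>' \<partial>arc_length P)"

end

theory Submission
 imports Defs "HOL-Probability.Characteristic_Functions"
begin

text \<open>
  Write points of the cone as \<open>x = e\<^sup>s \<omega>\<close> with \<open>s\<close> real and \<open>\<omega>\<close> on the spherical polygon. The map
  \<open>u \<mapsto> e\<^sup>s\<^sup>/\<^sup>2 q(\<omega>)\<^sup>-\<^sup>\<alpha>\<^sup>/\<^sup>2 u(e\<^sup>s \<omega>)\<close> is unitary from the weighted space on the cone to the unweighted space
  on the cylinder, and since the kernel of \<open>K\<close> is homogeneous, \<open>K\<close> becomes convolution in \<open>s\<close> with a
  kernel \<open>k s \<omega> \<omega>'\<close> (\<open>cone_intertwines\<close>). Its Fourier transform in \<open>s\<close> is the Mellin operator: the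
  symbol at frequency \<open>\<xi>\<close> is unitarily equivalent to \<open>H(-i\<xi>)\<close> (\<open>curve_intertwines\<close>). The adjoint for the
  unweighted pairing becomes convolution with the flipped kernel (\<open>dual_intertwines\<close>).

  The theorem is thus one about convolutions whose kernel takes values in integral operators on a
  measure space and satisfies Schur's test with the additional moment \<open>1 + \<bar>s\<bar>\<close>. Call \<open>\<mu>\<close> elliptic
  if the operators \<open>symbol \<xi> - \<mu>\<close> and their adjoints are bounded below by one constant for all \<open>\<xi>\<close>;
  for operators on a Hilbert space this says that they are invertible with uniformly bounded inverses.

  If \<open>\<mu>\<close> is elliptic, Plancherel's theorem in the variable \<open>s\<close> carries the lower bounds over to the
  convolution and its adjoint (\<open>conv_bounded_below\<close>), which is therefore invertible. If it is not, some
  symbol or adjoint symbol has approximate null vectors \<open>v\<close> with arbitrarily small defect, and the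
  wave packet \<open>e\<^sup>i\<^sup>\<xi>\<^sup>s v(\<omega>)\<close>, cut off to an interval of length \<open>L\<close>, has norm \<open>\<surd>L \<parallel>v\<parallel>\<close>, while the cutoff
  contributes an error that is bounded in \<open>L\<close> thanks to the moment condition (\<open>packet_estimate\<close>). Long
  packets over disjoint intervals to the left of \<open>ln d\<close> form an orthonormal Weyl sequence supported in
  \<open>\<bar>x\<bar> \<le> d\<close>. Such sequences for the operator or for its adjoint are incompatible with the Fredholm
  property, because they produce an infinite-dimensional kernel or cokernel
  (\<open>not_fredholm_if_Weyl\<close>, \<open>not_fredholm_if_adjoint_Weyl\<close>); so spectrum and essential spectrum agree.

  The geometric input is Schur's test for the kernel (\<open>convolution_kernel_k\<close>). The normal is constant on
  each face, and \<open>\<omega> \<bullet> n(\<omega>')\<close> vanishes when both points lie on the same face. Integrating out \<open>s\<close> leaves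
  \<open>\<bar>\<omega> \<bullet> n(\<omega>')\<bar> / \<bar>\<omega> - \<omega>'\<bar>\<^sup>2\<close>, which is a bounded function as long as the points
  stay at a distance from the corners; next to a corner it is at most of order
  \<open>q(\<omega>) / (q(\<omega>) + q(\<omega>'))\<^sup>2\<close>, since adjacent faces are not coplanar. The power \<open>q\<^sup>-\<^sup>1\<^sup>/\<^sup>2\<close> is a Schur weight
  for this homogeneous kernel because \<open>\<alpha> < 1\<close>.
\<close>

text \<open>The analogue of the notation \<open>LBINT\<close> for nonnegative integrals.\<close>

abbreviation nn_lborel_integral :: "('a::euclidean_space => ennreal) => ennreal" (binder "LNINT " 10) where
 "nn_lborel_integral == integral\<^sup>N lborel"

section \<open>Square-integrable functions and bounded operators\<close>

lemma le_if_mult_self_le: "a * a <= a * b ==> 0 <= b ==> a <= (b::real)"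
 by (cases "a <= 0") (simp_all add: mult_le_cancel_left_pos)

lemma L2_iff:
 "f \<in> L2 M \<longleftrightarrow> f \<in> borel_measurable M \<and> (\<integral>\<^sup>+x. ennreal ((cmod (f x))\<^sup>2) \<partial>M) < \<infinity>"
 by (auto simp: L2_def integrable_iff_bounded)

lemma L2_measurable: "f \<in> L2 M ==> f \<in> borel_measurable M"
 by (simp add: L2_def)

lemma L2_integrable: "f \<in> L2 M ==> integrable M (%x. (cmod (f x))\<^sup>2)"
 by (simp add: L2_def)

lemma L2_norm_nonneg: "0 <= L2_norm M f"
 by (simp add: L2_norm_def)

lemma L2_norm_sq: "(L2_norm M f)\<^sup>2 = (\<integral>x. (cmod (f x))\<^sup>2 \<partial>M)"
 by (simp add: L2_norm_def)

lemma L2_norm_nn: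
 "f \<in> L2 M ==> ennreal ((L2_norm M f)\<^sup>2) = (\<integral>\<^sup>+x. ennreal ((cmod (f x))\<^sup>2) \<partial>M)"
 unfolding L2_norm_sq by (subst nn_integral_eq_integral) (auto simp: L2_integrable)

lemma L2_norm_leI:
 assumes "f \<in> L2 M" "0 <= b" "(\<integral>\<^sup>+x. ennreal ((cmod (f x))\<^sup>2) \<partial>M) <= ennreal (b\<^sup>2)"
 shows "L2_norm M f <= b"
proof -
 have "ennreal ((L2_norm M f)\<^sup>2) <= ennreal (b\<^sup>2)"
  using assms L2_norm_nn by metis
 hence "(L2_norm M f)\<^sup>2 <= b\<^sup>2" by (simp add: ennreal_le_iff)
 thus ?thesis using assms(2) by (rule power2_le_imp_le)
qed

lemma L2_I_le:
 assumes "f \<in> borel_measurable M" "(\<integral>\<^sup>+x. ennreal ((cmod (f x))\<^sup>2) \<partial>M) <= ennreal b"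
 shows "f \<in> L2 M"
 using assms unfolding L2_iff by (auto intro: le_less_trans)

lemma L2_mono:
 assumes "g \<in> L2 M" "f \<in> borel_measurable M" "AE x in M. cmod (f x) <= cmod (g x)"
 shows "f \<in> L2 M" "L2_norm M f <= L2_norm M g"
proof -
 have *: "(\<integral>\<^sup>+x. ennreal ((cmod (f x))\<^sup>2) \<partial>M) <= (\<integral>\<^sup>+x. ennreal ((cmod (g x))\<^sup>2) \<partial>M)"
  by (rule nn_integral_mono_AE) (use assms(3) in \<open>auto elim!: eventually_mono intro!: ennreal_leI power_mono\<close>)
 show f: "f \<in> L2 M"
  using * assms unfolding L2_iff by (auto intro: le_less_trans)
 show "L2_norm M f <= L2_norm M g"
  using * by (intro L2_norm_leI[OF f L2_norm_nonneg]) (simp add: L2_norm_nn[OF assms(1)])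
qed

lemma L2_norm_cong_AE:
 assumes "f \<in> L2 M" "g \<in> L2 M" "AE x in M. f x = g x"
 shows "L2_norm M f = L2_norm M g"
 by (rule antisym; rule L2_mono) (use assms in \<open>auto simp: L2_measurable elim: eventually_mono\<close>)

lemma L2_cong_AE:
 assumes "g \<in> L2 M" "f \<in> borel_measurable M" "AE x in M. f x = g x"
 shows "f \<in> L2 M"
 by (rule L2_mono(1)[OF assms(1,2)]) (use assms in \<open>auto elim: eventually_mono\<close>)

lemma L2_zero: "(%x. 0) \<in> L2 M"
 by (simp add: L2_def)

lemma L2_norm_zero: "L2_norm M (%x. 0) = 0"
 by (simp add: L2_norm_def)

lemma L2_scale: "f \<in> L2 M ==> (%x. c * f x) \<in> L2 M"
 by (auto simp: L2_def norm_mult power_mult_distrib)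

lemma L2_norm_scale: "L2_norm M (%x. c * f x) = cmod c * L2_norm M f"
 by (simp add: L2_norm_def norm_mult power_mult_distrib real_sqrt_mult)

lemma L2_uminus: "f \<in> L2 M ==> (%x. - f x) \<in> L2 M"
 using L2_scale[of f M "-1"] by simp

lemma borel_measurable_cnj [measurable]: "cnj \<in> borel_measurable borel"
 by (intro borel_measurable_continuous_onI continuous_intros)

lemma L2_add:
 assumes "f \<in> L2 M" "g \<in> L2 M" shows "(%x. f x + g x) \<in> L2 M"
proof -
 have [measurable]: "f \<in> borel_measurable M" "g \<in> borel_measurable M"
  using assms by (auto simp: L2_measurable)
 have "(cmod (f x + g x))\<^sup>2 <= 2 * (cmod (f x))\<^sup>2 + 2 * (cmod (g x))\<^sup>2" for x
 proof -
  have "(cmod (f x + g x))\<^sup>2 <= (cmod (f x) + cmod (g x))\<^sup>2"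
   by (intro power_mono norm_triangle_ineq) auto
  also have "... <= 2 * (cmod (f x))\<^sup>2 + 2 * (cmod (g x))\<^sup>2"
   using sum_squares_bound[of "cmod (f x)" "cmod (g x)"] by (simp add: power2_sum)
  finally show ?thesis .
 qed
 note * = this
 have "integrable M (%x. (cmod (f x + g x))\<^sup>2)"
  by (rule Bochner_Integration.integrable_bound[where g="%x. (cmod (f x + g x))\<^sup>2" and
    f="%x. 2 * (cmod (f x))\<^sup>2 + 2 * (cmod (g x))\<^sup>2"]) (use assms * in \<open>auto simp: L2_integrable\<close>)
 thus ?thesis by (simp add: L2_def)
qed

lemma L2_diff: "f \<in> L2 M ==> g \<in> L2 M ==> (%x. f x - g x) \<in> L2 M"
 using L2_add[of f M "%x. - g x"] L2_uminus[of g M] by simp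

lemma L2_sum: "(\<And>i. i \<in> I ==> f i \<in> L2 M) ==> (%x. \<Sum>i\<in>I. f i x) \<in> L2 M"
proof (induction I rule: infinite_finite_induct)
 case (insert i I)
 have "(%x. f i x + (\<Sum>i\<in>I. f i x)) \<in> L2 M"
  by (rule L2_add) (use insert in auto)
 thus ?case using insert by simp
qed (simp_all add: L2_zero)

lemma L2_inner_integrable:
 assumes "f \<in> L2 M" "g \<in> L2 M" shows "integrable M (%x. f x * cnj (g x))"
proof -
 have [measurable]: "f \<in> borel_measurable M" "g \<in> borel_measurable M"
  using assms by (auto simp: L2_measurable)
 have *: "cmod (f x * cnj (g x)) <= (cmod (f x))\<^sup>2 + (cmod (g x))\<^sup>2" for x
  using sum_squares_bound[of "cmod (f x)" "cmod (g x)"]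
   mult_nonneg_nonneg[OF norm_ge_zero[of "f x"] norm_ge_zero[of "g x"]]
  by (simp only: norm_mult complex_mod_cnj)
 show ?thesis
  by (rule Bochner_Integration.integrable_bound[where g="%x. f x * cnj (g x)" and
    f="%x. (cmod (f x))\<^sup>2 + (cmod (g x))\<^sup>2"]) (use assms * in \<open>auto simp: L2_integrable\<close>)
qed

lemma L2_inner_self: "L2_inner M f f = of_real ((L2_norm M f)\<^sup>2)"
 unfolding L2_inner_def L2_norm_sq
 by (simp add: complex_norm_square[symmetric] integral_complex_of_real[symmetric] del: integral_complex_of_real of_real_power)

lemma L2_inner_add:
 assumes "f \<in> L2 M" "g \<in> L2 M" "h \<in> L2 M"
 shows "L2_inner M (%x. f x + g x) h = L2_inner M f h + L2_inner M g h"
 using assms by (simp add: L2_inner_def distrib_right L2_inner_integrable)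

lemma L2_inner_diff:
 assumes "f \<in> L2 M" "g \<in> L2 M" "h \<in> L2 M"
 shows "L2_inner M (%x. f x - g x) h = L2_inner M f h - L2_inner M g h"
 using assms by (simp add: L2_inner_def left_diff_distrib L2_inner_integrable)

lemma L2_inner_scale: "L2_inner M (%x. c * f x) h = c * L2_inner M f h"
 by (simp add: L2_inner_def mult.assoc)

lemma L2_inner_cnj: "L2_inner M g f = cnj (L2_inner M f g)"
proof -
 have "cnj (\<integral>x. f x * cnj (g x) \<partial>M) = (\<integral>x. cnj (f x * cnj (g x)) \<partial>M)"
  by (rule Bochner_Integration.integral_cnj[symmetric])
 also have "(%x. cnj (f x * cnj (g x))) = (%x. g x * cnj (f x))" by (simp add: fun_eq_iff)
 finally show ?thesis by (simp only: L2_inner_def)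
qed

lemma L2_inner_sum:
 assumes "\<And>i. i \<in> I ==> f i \<in> L2 M" "h \<in> L2 M"
 shows "L2_inner M (%x. \<Sum>i\<in>I. f i x) h = (\<Sum>i\<in>I. L2_inner M (f i) h)"
 using assms by (simp add: L2_inner_def sum_distrib_right L2_inner_integrable)

lemma L2_inner_cong_AE:
 assumes "f \<in> L2 M" "f' \<in> L2 M" "g \<in> L2 M" "g' \<in> L2 M"
  and "AE x in M. f x = f' x" "AE x in M. g x = g' x"
 shows "L2_inner M f g = L2_inner M f' g'"
proof -
 have [measurable]: "f \<in> borel_measurable M" "f' \<in> borel_measurable M"
  "g \<in> borel_measurable M" "g' \<in> borel_measurable M"
  using assms by (auto simp: L2_measurable)
 have "AE x in M. f x * cnj (g x) = f' x * cnj (g' x)"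
  using assms(5,6) by eventually_elim auto
 thus ?thesis unfolding L2_inner_def
  by (intro integral_cong_AE) measurable
qed

lemma L2_Cauchy_Schwarz:
 assumes "f \<in> L2 M" "g \<in> L2 M"
 shows "cmod (L2_inner M f g) <= L2_norm M f * L2_norm M g"
proof -
 define a b where "a = L2_norm M f" and "b = L2_norm M g"
 define z where "z = L2_inner M f g"
 have ab: "0 <= a" "0 <= b" by (auto simp: a_def b_def L2_norm_nonneg)
 \<comment> \<open>Nonnegativity of the squared norm of \<open>s f - t z g\<close>, with real \<open>s, t\<close> chosen afterwards.\<close>
 have key: "2 * s * t * (cmod z)\<^sup>2 <= s\<^sup>2 * a\<^sup>2 + t\<^sup>2 * (cmod z)\<^sup>2 * b\<^sup>2" for s t :: real
 proof -
  define h where "h x = of_real s * f x - (of_real t * z) * g x" for x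
  have L: "(%x. of_real s * f x) \<in> L2 M" "(%x. (of_real t * z) * g x) \<in> L2 M" "h \<in> L2 M"
   unfolding h_def by (intro L2_scale L2_diff assms)+
  have fh: "L2_inner M f h = of_real s * of_real (a\<^sup>2) - of_real t * cnj z * z"
  proof -
   have "L2_inner M h f = of_real s * of_real (a\<^sup>2) - of_real t * z * cnj z"
    unfolding h_def using assms
    by (subst L2_inner_diff[OF L(1,2)], simp)
      (simp only: L2_inner_scale L2_inner_self L2_inner_cnj[of M g f] a_def z_def)
   from arg_cong[OF this, of cnj] show ?thesis by (simp add: L2_inner_cnj[of M f h])
  qed
  have gh: "L2_inner M g h = of_real s * cnj z - of_real t * cnj z * of_real (b\<^sup>2)"
  proof -
   have "L2_inner M h g = of_real s * z - of_real t * z * of_real (b\<^sup>2)"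
    unfolding h_def using assms
    by (subst L2_inner_diff[OF L(1,2)], simp)
      (simp only: L2_inner_scale L2_inner_self b_def z_def)
   from arg_cong[OF this, of cnj] show ?thesis by (simp add: L2_inner_cnj[of M g h])
  qed
  have "of_real ((L2_norm M h)\<^sup>2) = L2_inner M h h" by (simp add: L2_inner_self)
  also have "... = of_real s * L2_inner M f h - (of_real t * z) * L2_inner M g h"
   using L2_inner_diff[OF L] by (simp only: L2_inner_scale h_def[abs_def, symmetric])
  also have "... = of_real (s\<^sup>2 * a\<^sup>2 - 2 * s * t * (cmod z)\<^sup>2 + t\<^sup>2 * (cmod z)\<^sup>2 * b\<^sup>2)"
  proof -
   have zz: "complex_of_real ((cmod z)\<^sup>2) = z * cnj z" by (rule complex_norm_square)
   show ?thesis unfolding fh gh of_real_add of_real_diff of_real_mult zz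
    by (simp add: algebra_simps power2_eq_square)
  qed
  finally have "(L2_norm M h)\<^sup>2 = s\<^sup>2 * a\<^sup>2 - 2 * s * t * (cmod z)\<^sup>2 + t\<^sup>2 * (cmod z)\<^sup>2 * b\<^sup>2"
   using of_real_eq_iff by blast
  thus ?thesis using zero_le_power2[of "L2_norm M h"] by linarith
 qed
 have "cmod z <= a * b"
 proof (cases "b = 0")
  case True
  show ?thesis
  proof (rule ccontr)
   assume "\<not> ?thesis"
   hence z: "cmod z > 0" using True by simp
   have "2 * 1 * ((a\<^sup>2 + 1) / (cmod z)\<^sup>2) * (cmod z)\<^sup>2 <= a\<^sup>2"
    using key[of 1 "(a\<^sup>2 + 1) / (cmod z)\<^sup>2"] True by simp
   thus False using z by simp (smt (verit) zero_le_power2)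
  qed
 next
  case False
  hence b: "b > 0" using ab by simp
  have "(cmod z)\<^sup>2 <= (a * b)\<^sup>2"
  proof (cases "z = 0")
   case nz: False
   have "2 * b\<^sup>2 * 1 * (cmod z)\<^sup>2 <= (b\<^sup>2)\<^sup>2 * a\<^sup>2 + (cmod z)\<^sup>2 * b\<^sup>2"
    using key[of "b\<^sup>2" 1] by simp
   hence "b\<^sup>2 * (cmod z)\<^sup>2 <= b\<^sup>2 * (a * b)\<^sup>2"
    by (simp add: power_mult_distrib power2_eq_square algebra_simps)
   thus ?thesis using b by simp
  qed simp
  thus ?thesis using ab by (meson mult_nonneg_nonneg power2_le_imp_le)
 qed
 thus ?thesis by (simp add: a_def b_def z_def)
qed

lemma L2_norm_triangle:
 assumes "f \<in> L2 M" "g \<in> L2 M"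
 shows "L2_norm M (%x. f x + g x) <= L2_norm M f + L2_norm M g"
proof -
 let ?h = "%x. f x + g x"
 have h: "?h \<in> L2 M" using assms by (rule L2_add)
 have "of_real ((L2_norm M ?h)\<^sup>2) = L2_inner M f ?h + L2_inner M g ?h"
  using L2_inner_add[OF assms h] by (simp only: L2_inner_self)
 hence "(L2_norm M ?h)\<^sup>2 = cmod (L2_inner M f ?h + L2_inner M g ?h)"
  by (metis norm_of_real abs_of_nonneg zero_le_power2)
 also have "... <= L2_norm M f * L2_norm M ?h + L2_norm M g * L2_norm M ?h"
  by (rule order.trans[OF norm_triangle_ineq add_mono]) (auto intro!: L2_Cauchy_Schwarz assms h)
 finally have "L2_norm M ?h * L2_norm M ?h <= L2_norm M ?h * (L2_norm M f + L2_norm M g)"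
  by (simp add: power2_eq_square algebra_simps)
 thus ?thesis using L2_norm_nonneg[of M ?h] L2_norm_nonneg[of M f] L2_norm_nonneg[of M g]
  by (cases "L2_norm M ?h = 0") (auto simp: mult_le_cancel_left)
qed

lemma L2_norm_triangle_diff:
 assumes "f \<in> L2 M" "g \<in> L2 M"
 shows "L2_norm M (%x. f x - g x) <= L2_norm M f + L2_norm M g"
 using L2_norm_triangle[OF assms(1) L2_uminus[OF assms(2)]] L2_norm_scale[of M "-1" g] by simp

lemma L2_norm_triangle_rev:
 assumes "f \<in> L2 M" "g \<in> L2 M"
 shows "L2_norm M f <= L2_norm M g + L2_norm M (%x. f x - g x)"
 using L2_norm_triangle[OF assms(2) L2_diff[OF assms]] by simp

lemma L2_norm_minus_commute: "L2_norm M (%x. f x - g x) = L2_norm M (%x. g x - f x)"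
 by (simp add: L2_norm_def norm_minus_commute)

lemma L2_norm_sum:
 assumes "\<And>i. i \<in> I ==> f i \<in> L2 M"
 shows "L2_norm M (%x. \<Sum>i\<in>I. f i x) <= (\<Sum>i\<in>I. L2_norm M (f i))"
 using assms
proof (induction I rule: infinite_finite_induct)
 case (insert i I)
 have "L2_norm M (%x. f i x + (\<Sum>j\<in>I. f j x)) <= L2_norm M (f i) + L2_norm M (%x. \<Sum>j\<in>I. f j x)"
  using insert by (intro L2_norm_triangle L2_sum) auto
 thus ?case using insert by force
qed (auto simp: L2_norm_zero)

lemma L2_norm_eq_0_AE:
 assumes "f \<in> L2 M" "L2_norm M f = 0" shows "AE x in M. f x = 0"
proof -
 have "(\<integral>\<^sup>+x. ennreal ((cmod (f x))\<^sup>2) \<partial>M) = 0"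
  using L2_norm_nn[OF assms(1)] assms(2) by simp
 hence "AE x in M. ennreal ((cmod (f x))\<^sup>2) = 0"
  using L2_measurable[OF assms(1)] by (subst (asm) nn_integral_0_iff_AE) auto
 thus ?thesis by eventually_elim auto
qed

lemma L2_eqI:
 assumes "f \<in> L2 M" "g \<in> L2 M" "L2_norm M (%x. f x - g x) <= 0"
 shows "AE x in M. f x = g x"
 using L2_norm_eq_0_AE[OF L2_diff[OF assms(1,2)]] assms(3) L2_norm_nonneg[of M "%x. f x - g x"]
 by (auto elim: eventually_mono)

text \<open>
  The Riesz--Fischer argument for geometrically convergent sequences: the increments are absolutely
  summable almost everywhere by monotone convergence, and Fatou's lemma controls the tail.
\<close>

lemma L2_complete_geometric:
 assumes f: "\<And>n::nat. f n \<in> L2 M" and r: "0 <= r" "r < 1"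
  and step: "\<And>n. L2_norm M (%x. f (Suc n) x - f n x) <= b * r ^ n"
 shows "\<exists>g\<in>L2 M. (%n. L2_norm M (%x. f n x - g x)) \<longlonglongrightarrow> 0"
proof -
 have [measurable]: "f n \<in> borel_measurable M" for n using f by (rule L2_measurable)
 have b: "0 <= b" using step[of 0] L2_norm_nonneg[of M "%x. f (Suc 0) x - f 0 x"] by simp
 define d where "d n x = cmod (f (Suc n) x - f n x)" for n x
 have [measurable]: "d n \<in> borel_measurable M" for n unfolding d_def by measurable
 define D where "D N x = complex_of_real (\<Sum>n<N. d n x)" for N x
 have d_L2: "(%x. complex_of_real (d n x)) \<in> L2 M" for n
  using L2_diff[OF f[of "Suc n"] f[of n]] by (simp add: L2_def d_def)
 have d_norm: "L2_norm M (%x. complex_of_real (d n x)) <= b * r ^ n" for n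
  using step[of n] by (simp add: L2_norm_def d_def)
 have geo: "(\<Sum>n<N. b * r ^ n) <= b / (1 - r)" for N
 proof -
  have "(\<Sum>n<N. b * r ^ n) = b * ((1 - r ^ N) / (1 - r))"
   using r by (simp add: sum_distrib_left[symmetric] sum_gp_strict)
  also have "... <= b * (1 / (1 - r))"
   using r b by (intro mult_left_mono divide_right_mono) auto
  finally show ?thesis by simp
 qed
 have D_L2: "D N \<in> L2 M" for N
  unfolding D_def of_real_sum using d_L2 by (intro L2_sum)
 have D_norm: "L2_norm M (D N) <= b / (1 - r)" for N
 proof -
  have "L2_norm M (D N) <= (\<Sum>n<N. L2_norm M (%x. complex_of_real (d n x)))"
   unfolding D_def of_real_sum using d_L2 by (intro L2_norm_sum)
  also have "... <= (\<Sum>n<N. b * r ^ n)" by (intro sum_mono d_norm)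
  finally show ?thesis using geo[of N] by linarith
 qed
 have "(\<integral>\<^sup>+x. (SUP N. ennreal ((\<Sum>n<N. d n x)\<^sup>2)) \<partial>M) = (SUP N. (\<integral>\<^sup>+x. ennreal ((\<Sum>n<N. d n x)\<^sup>2) \<partial>M))"
  by (rule nn_integral_monotone_convergence_SUP)
    (auto simp: incseq_def le_fun_def d_def intro!: ennreal_leI power_mono sum_mono2 sum_nonneg)
 also have "... <= ennreal ((b / (1 - r))\<^sup>2)"
 proof (rule SUP_least)
  fix N
  have "(\<integral>\<^sup>+x. ennreal ((\<Sum>n<N. d n x)\<^sup>2) \<partial>M) = ennreal ((L2_norm M (D N))\<^sup>2)"
   unfolding L2_norm_nn[OF D_L2] by (simp add: D_def del: of_real_sum)
  also have "... <= ennreal ((b / (1 - r))\<^sup>2)"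
   using D_norm by (intro ennreal_leI power_mono L2_norm_nonneg)
  finally show "(\<integral>\<^sup>+x. ennreal ((\<Sum>n<N. d n x)\<^sup>2) \<partial>M) <= ennreal ((b / (1 - r))\<^sup>2)" .
 qed
 finally have "(\<integral>\<^sup>+x. (SUP N. ennreal ((\<Sum>n<N. d n x)\<^sup>2)) \<partial>M) \<noteq> \<infinity>"
  by (auto simp: top_unique)
 hence "AE x in M. (SUP N. ennreal ((\<Sum>n<N. d n x)\<^sup>2)) \<noteq> \<infinity>"
  by (intro nn_integral_noteq_infinite) auto
 hence conv: "AE x in M. convergent (%n. f n x)"
 proof eventually_elim
  case (elim x)
  define c where "c = enn2real (SUP N. ennreal ((\<Sum>n<N. d n x)\<^sup>2))"
  have c: "(SUP N. ennreal ((\<Sum>n<N. d n x)\<^sup>2)) = ennreal c" "c \<ge> 0"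
   unfolding c_def using ennreal_enn2real[of "SUP N. ennreal ((\<Sum>n<N. d n x)\<^sup>2)"] elim
   by (metis infinity_ennreal_def less_top, simp)
  have "(\<Sum>n<N. d n x) <= sqrt c" for N
  proof -
   have "ennreal ((\<Sum>n<N. d n x)\<^sup>2) <= ennreal c" unfolding c(1)[symmetric] by (rule SUP_upper) simp
   hence "(\<Sum>n<N. d n x)\<^sup>2 <= c" using c(2) by (simp add: ennreal_le_iff)
   thus ?thesis by (rule real_le_rsqrt)
  qed
  hence "summable (%n. d n x)"
   by (intro bounded_imp_summable[where B="sqrt c"])
     (auto simp: d_def lessThan_Suc_atMost[symmetric] simp del: sum.lessThan_Suc)
  hence "summable (%n. f (Suc n) x - f n x)" unfolding d_def by (rule summable_norm_cancel)
  then obtain l where "(%N. \<Sum>n<N. f (Suc n) x - f n x) \<longlonglongrightarrow> l"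
   by (auto simp: summable_def sums_def)
  hence "(%N. f N x - f 0 x) \<longlonglongrightarrow> l" by (simp only: sum_lessThan_telescope[of "%n. f n x"])
  hence "(%N. (f N x - f 0 x) + f 0 x) \<longlonglongrightarrow> l + f 0 x" by (intro tendsto_intros)
  thus ?case by (auto simp: convergent_def)
 qed
 define g where "g x = lim (%n. f n x)" for x
 have [measurable]: "g \<in> borel_measurable M"
  unfolding g_def by (rule borel_measurable_lim_metric) measurable
 have far: "L2_norm M (%x. f (n + k) x - f n x) <= b * r ^ n / (1 - r)" for n k
 proof -
  have "f (n + k) x - f n x = (\<Sum>i<k. f (Suc (n + i)) x - f (n + i) x)" for x
   by (induction k) (auto simp: algebra_simps)
  hence "L2_norm M (%x. f (n + k) x - f n x) <= (\<Sum>i<k. L2_norm M (%x. f (Suc (n + i)) x - f (n + i) x))"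
   by (simp only:) (intro L2_norm_sum L2_diff f)
  also have "... <= (\<Sum>i<k. b * r ^ (n + i))" by (intro sum_mono step)
  also have "... = r ^ n * (\<Sum>i<k. b * r ^ i)" by (simp add: sum_distrib_left power_add mult_ac)
  also have "... <= r ^ n * (b / (1 - r))" using r by (intro mult_left_mono geo) auto
  finally show ?thesis by (simp add: mult_ac)
 qed
 have tail: "(\<integral>\<^sup>+x. ennreal ((cmod (g x - f n x))\<^sup>2) \<partial>M) <= ennreal ((b * r ^ n / (1 - r))\<^sup>2)" for n
 proof -
  have "(\<integral>\<^sup>+x. ennreal ((cmod (g x - f n x))\<^sup>2) \<partial>M)
    = (\<integral>\<^sup>+x. liminf (%k. ennreal ((cmod (f (n + k) x - f n x))\<^sup>2)) \<partial>M)"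
  proof (rule nn_integral_cong_AE)
   show "AE x in M. ennreal ((cmod (g x - f n x))\<^sup>2)
     = liminf (%k. ennreal ((cmod (f (n + k) x - f n x))\<^sup>2))"
    using conv
   proof eventually_elim
    case (elim x)
    hence "(%k. f k x) \<longlonglongrightarrow> g x" by (simp add: g_def convergent_LIMSEQ_iff)
    hence "(%k. f (k + n) x) \<longlonglongrightarrow> g x" by (rule LIMSEQ_ignore_initial_segment)
    hence "(%k. ennreal ((cmod (f (n + k) x - f n x))\<^sup>2)) \<longlonglongrightarrow> ennreal ((cmod (g x - f n x))\<^sup>2)"
     by (intro tendsto_intros) (simp add: add.commute)
    thus ?case by (rule lim_imp_Liminf[OF trivial_limit_sequentially, symmetric])
   qed
  qed
  also have "... <= liminf (%k. (\<integral>\<^sup>+x. ennreal ((cmod (f (n + k) x - f n x))\<^sup>2) \<partial>M))"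
   by (rule nn_integral_liminf) measurable
  also have "... <= ennreal ((b * r ^ n / (1 - r))\<^sup>2)"
  proof (rule Liminf_le, simp, rule always_eventually, rule allI)
   fix k
   show "(\<integral>\<^sup>+x. ennreal ((cmod (f (n + k) x - f n x))\<^sup>2) \<partial>M) <= ennreal ((b * r ^ n / (1 - r))\<^sup>2)"
    unfolding L2_norm_nn[OF L2_diff[OF f f], symmetric]
    by (intro ennreal_leI power_mono far L2_norm_nonneg)
  qed
  finally show ?thesis .
 qed
 have gd: "(%x. g x - f n x) \<in> L2 M" for n
  using tail[of n] by (intro L2_I_le) auto
 have g: "g \<in> L2 M" using L2_add[OF gd[of 0] f[of 0]] by simp
 have "L2_norm M (%x. f n x - g x) <= b * r ^ n / (1 - r)" for n
  using L2_norm_leI[OF gd _ tail, of n] r b by (simp add: L2_norm_minus_commute)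
 note far_lim = this
 have "(%n. b / (1 - r) * r ^ n) \<longlonglongrightarrow> b / (1 - r) * 0"
  by (rule tendsto_mult_left[OF LIMSEQ_realpow_zero[OF r]])
 hence "(%n. b * r ^ n / (1 - r)) \<longlonglongrightarrow> 0" by (simp add: field_simps)
 hence "(%n. L2_norm M (%x. f n x - g x)) \<longlonglongrightarrow> 0"
  by (rule real_tendsto_sandwich[OF always_eventually always_eventually tendsto_const, rotated 2])
    (simp_all add: L2_norm_nonneg far_lim)
 with g show ?thesis by blast
qed

lemma bounded_op_L2: "bounded_op M T ==> f \<in> L2 M ==> T f \<in> L2 M"
 by (simp add: bounded_op_def)

lemma bounded_op_add:
 "bounded_op M T ==> f \<in> L2 M ==> g \<in> L2 M ==> AE x in M. T (%x. f x + g x) x = T f x + T g x"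
 by (simp add: bounded_op_def)

lemma bounded_op_scale:
 "bounded_op M T ==> f \<in> L2 M ==> AE x in M. T (%x. c * f x) x = c * T f x"
 by (simp add: bounded_op_def)

lemma bounded_op_bound:
 assumes "bounded_op M T"
 obtains B where "0 < B" "\<And>f. f \<in> L2 M ==> L2_norm M (T f) <= B * L2_norm M f"
proof -
 obtain B where B: "\<And>f. f \<in> L2 M ==> L2_norm M (T f) <= B * L2_norm M f"
  using assms unfolding bounded_op_def by blast
 have "L2_norm M (T f) <= (\<bar>B\<bar> + 1) * L2_norm M f" if "f \<in> L2 M" for f
 proof -
  have "B * L2_norm M f <= (\<bar>B\<bar> + 1) * L2_norm M f"
   by (intro mult_right_mono L2_norm_nonneg) auto
  thus ?thesis using B[OF that] by linarith
 qed
 thus thesis by (intro that[of "\<bar>B\<bar> + 1"]) auto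
qed

lemma bounded_op_diff:
 assumes "bounded_op M T" "f \<in> L2 M" "g \<in> L2 M"
 shows "AE x in M. T (%x. f x - g x) x = T f x - T g x"
proof -
 have "(%x. f x - g x) = (%x. f x + (-1) * g x)" by (simp add: fun_eq_iff)
 hence "AE x in M. T (%x. f x - g x) x = T f x + T (%x. (-1) * g x) x"
  using bounded_op_add[OF assms(1,2) L2_scale[OF assms(3), of "-1"]] by simp
 thus ?thesis using bounded_op_scale[OF assms(1,3), of "-1"] by eventually_elim simp
qed

lemma bounded_op_cong_AE:
 assumes "bounded_op M T" "f \<in> L2 M" "g \<in> L2 M" "AE x in M. f x = g x"
 shows "AE x in M. T f x = T g x"
proof -
 obtain B where B: "0 < B" "\<And>f. f \<in> L2 M ==> L2_norm M (T f) <= B * L2_norm M f"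
  using bounded_op_bound[OF assms(1)] by metis
 note L = L2_diff[OF assms(2,3)]
 have "L2_norm M (%x. f x - g x) = L2_norm M (%x. 0)"
  by (rule L2_norm_cong_AE[OF L L2_zero]) (use assms(4) in \<open>auto elim: eventually_mono\<close>)
 hence "L2_norm M (T (%x. f x - g x)) <= 0" using B(2)[OF L] by (simp add: L2_norm_zero)
 hence "L2_norm M (T (%x. f x - g x)) = 0"
  using L2_norm_nonneg[of M "T (%x. f x - g x)"] by linarith
 from L2_norm_eq_0_AE[OF bounded_op_L2[OF assms(1) L] this] bounded_op_diff[OF assms(1-3)]
 show ?thesis by eventually_elim simp
qed

lemma bounded_op_zero:
 assumes "bounded_op M T" shows "AE x in M. T (%x. 0) x = 0"
 using bounded_op_scale[OF assms L2_zero, of 0] by simp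

lemma bounded_op_sum:
 assumes T: "bounded_op M T" and "finite I" "\<And>i. i \<in> I ==> f i \<in> L2 M"
 shows "AE x in M. T (%x. \<Sum>i\<in>I. f i x) x = (\<Sum>i\<in>I. T (f i) x)"
 using assms(2,3)
proof (induction I rule: finite_induct)
 case empty
 thus ?case using bounded_op_zero[OF T] by simp
next
 case (insert i I)
 have "(%x. \<Sum>j\<in>insert i I. f j x) = (%x. f i x + (\<Sum>j\<in>I. f j x))"
  using insert by simp
 moreover have "AE x in M. T (%x. f i x + (\<Sum>j\<in>I. f j x)) x = T (f i) x + T (%x. \<Sum>j\<in>I. f j x) x"
  by (rule bounded_op_add[OF T]) (use insert in \<open>auto intro: L2_sum\<close>)
 moreover have "AE x in M. T (%x. \<Sum>j\<in>I. f j x) x = (\<Sum>j\<in>I. T (f j) x)"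
  using insert by auto
 ultimately show ?case using insert by (auto elim: eventually_elim2)
qed

lemma bounded_op_shift:
 assumes "bounded_op M T" shows "bounded_op M (shift T \<mu>)"
proof -
 obtain B where B: "0 < B" "\<And>f. f \<in> L2 M ==> L2_norm M (T f) <= B * L2_norm M f"
  using bounded_op_bound[OF assms] by metis
 have L: "shift T \<mu> f \<in> L2 M" if "f \<in> L2 M" for f
  unfolding shift_def using that by (intro L2_diff L2_scale bounded_op_L2[OF assms])
 have "AE x in M. shift T \<mu> (%x. f x + g x) x = shift T \<mu> f x + shift T \<mu> g x"
  if "f \<in> L2 M" "g \<in> L2 M" for f g
  using bounded_op_add[OF assms that] unfolding shift_def by eventually_elim (simp add: algebra_simps)
 moreover have "AE x in M. shift T \<mu> (%x. c * f x) x = c * shift T \<mu> f x"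
  if "f \<in> L2 M" for f c
  using bounded_op_scale[OF assms that] unfolding shift_def by eventually_elim (simp add: algebra_simps)
 moreover have "L2_norm M (shift T \<mu> f) <= (B + cmod \<mu>) * L2_norm M f" if "f \<in> L2 M" for f
  using L2_norm_triangle_diff[OF bounded_op_L2[OF assms that] L2_scale[OF that, of \<mu>]] B(2)[OF that]
  unfolding shift_def by (simp add: L2_norm_scale algebra_simps)
 ultimately show ?thesis unfolding bounded_op_def using L by blast
qed

definition adjoint_pair :: "'a measure => 'a op => 'a op => bool" where
 "adjoint_pair M T T' \<longleftrightarrow> bounded_op M T \<and> bounded_op M T' \<and>
   (\<forall>u\<in>L2 M. \<forall>v\<in>L2 M. L2_inner M (T u) v = L2_inner M u (T' v))"

definition bounded_below :: "'a measure => 'a op => real => bool" where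
 "bounded_below M T c \<longleftrightarrow> (\<forall>u\<in>L2 M. c * L2_norm M u <= L2_norm M (T u))"

lemma bounded_belowD: "bounded_below M T c ==> u \<in> L2 M ==> c * L2_norm M u <= L2_norm M (T u)"
 by (simp add: bounded_below_def)

lemma adjoint_pair_shift:
 assumes "adjoint_pair M T T'" shows "adjoint_pair M (shift T \<mu>) (shift T' (cnj \<mu>))"
proof -
 have b: "bounded_op M T" "bounded_op M T'" using assms by (auto simp: adjoint_pair_def)
 have "L2_inner M (shift T \<mu> u) v = L2_inner M u (shift T' (cnj \<mu>) v)"
  if u: "u \<in> L2 M" and v: "v \<in> L2 M" for u v
 proof -
  have "L2_inner M (shift T \<mu> u) v = L2_inner M (T u) v - \<mu> * L2_inner M u v"
   unfolding shift_def using u v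
   by (subst L2_inner_diff) (auto simp: L2_inner_scale intro!: bounded_op_L2[OF b(1)] L2_scale)
  also have "... = L2_inner M u (T' v) - \<mu> * L2_inner M u v"
   using assms u v by (simp add: adjoint_pair_def)
  also have "... = cnj (L2_inner M (T' v) u - cnj \<mu> * L2_inner M v u)"
   by (simp add: L2_inner_cnj[of M u "T' v"] L2_inner_cnj[of M u v])
  also have "L2_inner M (T' v) u - cnj \<mu> * L2_inner M v u = L2_inner M (shift T' (cnj \<mu>) v) u"
   unfolding shift_def using u v
   by (subst L2_inner_diff) (auto simp: L2_inner_scale intro!: bounded_op_L2[OF b(2)] L2_scale)
  also have "cnj ... = L2_inner M u (shift T' (cnj \<mu>) v)"
   by (rule L2_inner_cnj[symmetric])
  finally show ?thesis .
 qed
 thus ?thesis using b by (simp add: adjoint_pair_def bounded_op_shift)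
qed

text \<open>
  If the adjoint is bounded below then \<open>G = T T'\<close> is coercive, and \<open>G v = f\<close> is solved by
  Richardson's iteration with step \<open>1/B\<^sup>2\<close>, which contracts the residual. The preimage
  \<open>u = T' v\<close> of \<open>f\<close> is then orthogonal to the kernel, whence the norm estimate.
\<close>

lemma adjoint_bounded_below_imp_surjective:
 assumes adj: "adjoint_pair M T T'" and c: "0 < c" and bb: "bounded_below M T' c" and f: "f \<in> L2 M"
 shows "\<exists>u\<in>L2 M. (AE x in M. T u x = f x) \<and> L2_norm M u <= L2_norm M f / c"
proof -
 have b: "bounded_op M T" "bounded_op M T'" using adj by (auto simp: adjoint_pair_def)
 note TL = bounded_op_L2[OF b(1)] and TL' = bounded_op_L2[OF b(2)]
 have ip: "L2_inner M (T u) v = L2_inner M u (T' v)" if "u \<in> L2 M" "v \<in> L2 M" for u v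
  using adj that by (simp add: adjoint_pair_def)
 obtain B where B: "0 < B" "\<And>f. f \<in> L2 M ==> L2_norm M (T f) <= B * L2_norm M f"
  using bounded_op_bound[OF b(1)] by metis
 obtain B' where B': "0 < B'" "\<And>f. f \<in> L2 M ==> L2_norm M (T' f) <= B' * L2_norm M f"
  using bounded_op_bound[OF b(2)] by metis
 define G where "G v = T (T' v)" for v
 define \<rho> where "\<rho> = 1 / B\<^sup>2"
 have \<rho>: "0 < \<rho>" using B by (simp add: \<rho>_def)
 define \<theta> where "\<theta> = sqrt (max 0 (1 - c\<^sup>2 / B\<^sup>2))"
 have \<theta>: "0 <= \<theta>" "\<theta> < 1" using c B by (auto simp: \<theta>_def real_sqrt_lt_1_iff)
 define R where "R r = (%x. r x - of_real \<rho> * G r x)" for r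
 have GL: "G r \<in> L2 M" if "r \<in> L2 M" for r unfolding G_def using that by (intro TL TL')
 have RL: "R r \<in> L2 M" if "r \<in> L2 M" for r
  unfolding R_def using that by (intro L2_diff L2_scale GL)
 have contract: "L2_norm M (R r) <= \<theta> * L2_norm M r" if r: "r \<in> L2 M" for r
 proof -
  let ?a = "L2_norm M r" and ?b = "L2_norm M (T' r)" and ?g = "L2_norm M (G r)"
  have Gr: "L2_inner M (G r) r = of_real (?b\<^sup>2)"
   unfolding G_def by (subst ip[OF TL'[OF r] r]) (rule L2_inner_self)
  have rG: "L2_inner M r (G r) = of_real (?b\<^sup>2)"
   using Gr L2_inner_cnj[of M r "G r"] by simp
  have sG: "(%x. of_real \<rho> * G r x) \<in> L2 M" by (intro L2_scale GL r)
  have e1: "L2_inner M (R r) h = L2_inner M r h - of_real \<rho> * L2_inner M (G r) h"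
   if "h \<in> L2 M" for h
   unfolding R_def by (subst L2_inner_diff[OF r sG that]) (simp add: L2_inner_scale)
  have "L2_inner M r (R r) = of_real (?a\<^sup>2 - \<rho> * ?b\<^sup>2)"
   using e1[OF r] by (subst L2_inner_cnj) (simp only: Gr L2_inner_self, simp)
  moreover have "L2_inner M (G r) (R r) = of_real (?b\<^sup>2 - \<rho> * ?g\<^sup>2)"
   using e1[OF GL[OF r]] by (subst L2_inner_cnj) (simp only: rG L2_inner_self, simp)
  ultimately have "complex_of_real ((L2_norm M (R r))\<^sup>2) =
    of_real (?a\<^sup>2 - \<rho> * ?b\<^sup>2 - \<rho> * (?b\<^sup>2 - \<rho> * ?g\<^sup>2))"
   using e1[OF RL[OF r]] by (simp only: L2_inner_self of_real_diff of_real_mult)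
  hence "(L2_norm M (R r))\<^sup>2 = ?a\<^sup>2 - \<rho> * ?b\<^sup>2 - \<rho> * (?b\<^sup>2 - \<rho> * ?g\<^sup>2)"
   using of_real_eq_iff by blast
  also have "... <= ?a\<^sup>2 - \<rho> * ?b\<^sup>2"
  proof -
   have "?g\<^sup>2 <= (B * ?b)\<^sup>2"
    unfolding G_def by (intro power_mono B TL' r L2_norm_nonneg)
   hence "\<rho> * ?g\<^sup>2 <= ?b\<^sup>2" using B(1) by (simp add: \<rho>_def power_mult_distrib field_simps)
   hence "0 <= \<rho> * (?b\<^sup>2 - \<rho> * ?g\<^sup>2)" using \<rho> by simp
   thus ?thesis by linarith
  qed
  also have "... <= ?a\<^sup>2 - \<rho> * (c * ?a)\<^sup>2"
  proof -
   have "(c * ?a)\<^sup>2 <= ?b\<^sup>2"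
    using c L2_norm_nonneg[of M r] by (intro power_mono bounded_belowD[OF bb r]) simp
   hence "\<rho> * (c * ?a)\<^sup>2 <= \<rho> * ?b\<^sup>2" using \<rho> by (intro mult_left_mono) auto
   thus ?thesis by linarith
  qed
  also have "... = (1 - c\<^sup>2 / B\<^sup>2) * ?a\<^sup>2"
   by (simp add: \<rho>_def power_mult_distrib algebra_simps)
  also have "... <= \<theta>\<^sup>2 * ?a\<^sup>2"
   by (rule mult_right_mono) (simp_all add: \<theta>_def)
  finally have "(L2_norm M (R r))\<^sup>2 <= (\<theta> * ?a)\<^sup>2" by (simp add: power_mult_distrib)
  thus ?thesis using \<theta>(1) L2_norm_nonneg[of M r] by (rule power2_le_imp_le[OF _ mult_nonneg_nonneg])
 qed
 define r where "r n = (R ^^ n) f" for n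
 have rS: "r (Suc n) = R (r n)" for n by (simp add: r_def)
 have rL: "r n \<in> L2 M" for n by (induction n) (auto simp: r_def f RL)
 have rn: "L2_norm M (r n) <= \<theta> ^ n * L2_norm M f" for n
 proof (induction n)
  case (Suc n)
  have "L2_norm M (r (Suc n)) <= \<theta> * L2_norm M (r n)" unfolding rS by (rule contract[OF rL])
  also have "... <= \<theta> * (\<theta> ^ n * L2_norm M f)" by (rule mult_left_mono[OF Suc \<theta>(1)])
  finally show ?case by (simp add: mult_ac)
 qed (simp add: r_def)
 define v where "v n = (%x. \<Sum>k<n. of_real \<rho> * r k x)" for n
 have vL: "v n \<in> L2 M" for n unfolding v_def by (intro L2_sum L2_scale rL)
 have vS: "v (Suc n) = (%x. v n x + of_real \<rho> * r n x)" for n by (simp add: v_def)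
 have res: "AE x in M. G (v n) x + r n x = f x" for n
 proof (induction n)
  case 0
  have "AE x in M. T' (%x. 0) x = 0" by (rule bounded_op_zero[OF b(2)])
  hence "AE x in M. T (T' (%x. 0)) x = T (%x. 0) x"
   by (intro bounded_op_cong_AE[OF b(1)] TL' L2_zero)
  with bounded_op_zero[OF b(1)] show ?case
   unfolding G_def v_def r_def by eventually_elim simp
 next
  case (Suc n)
  have s: "(%x. of_real \<rho> * r n x) \<in> L2 M" by (intro L2_scale rL)
  have "AE x in M. T' (v (Suc n)) x = T' (v n) x + of_real \<rho> * T' (r n) x"
   using bounded_op_add[OF b(2) vL s, of n] bounded_op_scale[OF b(2) rL, of "of_real \<rho>" n]
   unfolding vS by eventually_elim simp
  hence "AE x in M. G (v (Suc n)) x = T (%x. T' (v n) x + of_real \<rho> * T' (r n) x) x"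
   unfolding G_def by (intro bounded_op_cong_AE[OF b(1)] TL' L2_add L2_scale vL rL)
  moreover have "AE x in M. T (%x. T' (v n) x + of_real \<rho> * T' (r n) x) x
    = T (T' (v n)) x + T (%x. of_real \<rho> * T' (r n) x) x"
   by (intro bounded_op_add[OF b(1)] TL' L2_scale vL rL)
  moreover have "AE x in M. T (%x. of_real \<rho> * T' (r n) x) x = of_real \<rho> * T (T' (r n)) x"
   by (intro bounded_op_scale[OF b(1)] TL' rL)
  ultimately show ?case using Suc.IH
   by eventually_elim (simp add: rS R_def G_def)
 qed
 have step: "L2_norm M (%x. v (Suc n) x - v n x) <= (\<rho> * L2_norm M f) * \<theta> ^ n" for n
 proof -
  have "L2_norm M (%x. v (Suc n) x - v n x) = \<rho> * L2_norm M (r n)"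
   using \<rho> by (simp add: vS L2_norm_scale)
  also have "... <= \<rho> * (\<theta> ^ n * L2_norm M f)" using \<rho> by (intro mult_left_mono rn) auto
  finally show ?thesis by (simp add: mult_ac)
 qed
 obtain w where w: "w \<in> L2 M" "(%n. L2_norm M (%x. v n x - w x)) \<longlonglongrightarrow> 0"
  using L2_complete_geometric[of v M, OF vL \<theta> step] by blast
 have "L2_norm M (%x. f x - G w x) <= B * (B' * L2_norm M (%x. v n x - w x)) + \<theta> ^ n * L2_norm M f" for n
 proof -
  have vw: "(%x. v n x - w x) \<in> L2 M" by (intro L2_diff vL w)
  have "AE x in M. T' (%x. v n x - w x) x = T' (v n) x - T' w x"
   by (intro bounded_op_diff[OF b(2)] vL w)
  hence "AE x in M. G (%x. v n x - w x) x = T (%x. T' (v n) x - T' w x) x"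
   unfolding G_def by (intro bounded_op_cong_AE[OF b(1)] TL' L2_diff vL w)
  moreover have "AE x in M. T (%x. T' (v n) x - T' w x) x = G (v n) x - G w x"
   unfolding G_def by (intro bounded_op_diff[OF b(1)] TL' vL w)
  ultimately have "AE x in M. f x - G w x = G (%x. v n x - w x) x + r n x"
   using res[of n]
  proof eventually_elim
   case (elim x)
   show ?case unfolding elim(3)[symmetric] elim(1) elim(2) by simp
  qed
  hence "L2_norm M (%x. f x - G w x) = L2_norm M (%x. G (%x. v n x - w x) x + r n x)"
   by (intro L2_norm_cong_AE L2_add L2_diff GL f w vw rL)
  also have "... <= L2_norm M (G (%x. v n x - w x)) + L2_norm M (r n)"
   by (intro L2_norm_triangle GL vw rL)
  also have "... <= B * (B' * L2_norm M (%x. v n x - w x)) + \<theta> ^ n * L2_norm M f"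
  proof (rule add_mono[OF _ rn])
   have "L2_norm M (G (%x. v n x - w x)) <= B * L2_norm M (T' (%x. v n x - w x))"
    unfolding G_def by (rule B(2)[OF TL'[OF vw]])
   also have "... <= B * (B' * L2_norm M (%x. v n x - w x))"
    using B(1) by (intro mult_left_mono B'(2)[OF vw]) auto
   finally show "L2_norm M (G (%x. v n x - w x)) <= B * (B' * L2_norm M (%x. v n x - w x))" .
  qed
  finally show ?thesis .
 qed
 note bound = this
 have "(%n. B * (B' * L2_norm M (%x. v n x - w x)) + \<theta> ^ n * L2_norm M f)
   \<longlonglongrightarrow> B * (B' * 0) + 0 * L2_norm M f"
  by (rule tendsto_add[OF tendsto_mult_left[OF tendsto_mult_left[OF w(2)]]
     tendsto_mult_right[OF LIMSEQ_realpow_zero[OF \<theta>]]])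
 from LIMSEQ_le_const[OF this] bound have "L2_norm M (%x. f x - G w x) <= 0" by simp
 hence fG: "AE x in M. f x = G w x" by (intro L2_eqI f GL w)
 let ?u = "L2_norm M (T' w)"
 have "complex_of_real (?u\<^sup>2) = L2_inner M (T (T' w)) w"
  by (subst ip) (auto simp: L2_inner_self intro: w TL')
 also have "... = L2_inner M f w"
  by (rule L2_inner_cong_AE) (use fG in \<open>auto simp: G_def intro: w TL TL' f elim: eventually_mono\<close>)
 finally have "?u\<^sup>2 = cmod (L2_inner M f w)"
  by (metis norm_of_real abs_of_nonneg zero_le_power2)
 also have "... <= L2_norm M f * L2_norm M w" by (rule L2_Cauchy_Schwarz[OF f w(1)])
 also have "... <= L2_norm M f * (?u / c)"
  using bounded_belowD[OF bb w(1)] c by (intro mult_left_mono L2_norm_nonneg) (simp add: field_simps)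
 finally have "?u * ?u <= ?u * (L2_norm M f / c)" by (simp add: power2_eq_square mult_ac)
 hence "?u <= L2_norm M f / c"
  by (rule le_if_mult_self_le) (use c L2_norm_nonneg[of M f] in simp)
 moreover have "AE x in M. T (T' w) x = f x"
  using fG unfolding G_def by eventually_elim (rule sym)
 ultimately show ?thesis using TL'[OF w(1)] by blast
qed

lemma bounded_below_imp_AE_eq:
 assumes T: "bounded_op M T" and c: "0 < c" "bounded_below M T c"
  and fg: "f \<in> L2 M" "g \<in> L2 M" "AE x in M. T f x = T g x"
 shows "AE x in M. f x = g x"
proof -
 note L = L2_diff[OF fg(1,2)]
 have "AE x in M. T (%x. f x - g x) x = 0"
  using bounded_op_diff[OF T fg(1,2)] fg(3) by eventually_elim simp
 hence "L2_norm M (T (%x. f x - g x)) = L2_norm M (%x. 0)"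
  by (intro L2_norm_cong_AE bounded_op_L2[OF T L] L2_zero)
 with bounded_belowD[OF c(2) L] have "c * L2_norm M (%x. f x - g x) <= c * 0"
  unfolding L2_norm_zero by simp
 hence "L2_norm M (%x. f x - g x) <= 0" using c(1) by (rule mult_left_le_imp_le)
 thus ?thesis by (rule L2_eqI[OF fg(1,2)])
qed

lemma invertible_if_bounded_below:
 assumes adj: "adjoint_pair M T T'" and c: "0 < c" "bounded_below M T c" "bounded_below M T' c"
 shows "invertible_op M T"
proof -
 have b: "bounded_op M T" using adj by (auto simp: adjoint_pair_def)
 note TL = bounded_op_L2[OF b]
 define S where "S f = (SOME u. u \<in> L2 M \<and> (AE x in M. T u x = f x) \<and> L2_norm M u <= L2_norm M f / c)" for f
 have S: "S f \<in> L2 M \<and> (AE x in M. T (S f) x = f x) \<and> L2_norm M (S f) <= L2_norm M f / c" if "f \<in> L2 M" for f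
 proof -
  have "\<exists>u. u \<in> L2 M \<and> (AE x in M. T u x = f x) \<and> L2_norm M u <= L2_norm M f / c"
   using adjoint_bounded_below_imp_surjective[OF adj c(1,3) that] by blast
  thus ?thesis unfolding S_def by (rule someI_ex)
 qed
 note inj = bounded_below_imp_AE_eq[OF b c(1,2)]
 have "AE x in M. S (%x. f x + g x) x = S f x + S g x" if "f \<in> L2 M" "g \<in> L2 M" for f g
 proof (rule inj)
  have "AE x in M. T (S (%x. f x + g x)) x = f x + g x" using S[OF L2_add[OF that]] by blast
  moreover have "AE x in M. T (S f) x = f x" "AE x in M. T (S g) x = g x" using S that by blast+
  moreover have "AE x in M. T (%x. S f x + S g x) x = T (S f) x + T (S g) x"
   using S that by (intro bounded_op_add[OF b]) auto
  ultimately show "AE x in M. T (S (%x. f x + g x)) x = T (%x. S f x + S g x) x"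
   by eventually_elim simp
 qed (use S that in \<open>auto intro: L2_add\<close>)
 moreover have "AE x in M. S (%x. a * f x) x = a * S f x" if "f \<in> L2 M" for f a
 proof (rule inj)
  have "AE x in M. T (S (%x. a * f x)) x = a * f x" using S[OF L2_scale[OF that]] by blast
  moreover have "AE x in M. T (S f) x = f x" using S that by blast
  moreover have "AE x in M. T (%x. a * S f x) x = a * T (S f) x"
   using S that by (intro bounded_op_scale[OF b]) auto
  ultimately show "AE x in M. T (S (%x. a * f x)) x = T (%x. a * S f x) x"
   by eventually_elim simp
 qed (use S that in \<open>auto intro: L2_scale\<close>)
 moreover have "\<exists>B. \<forall>f\<in>L2 M. L2_norm M (S f) <= B * L2_norm M f"
  by (rule exI[of _ "1 / c"]) (use S in simp)
 ultimately have "bounded_op M S" unfolding bounded_op_def using S by simp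
 moreover have "AE x in M. S (T f) x = f x" if f: "f \<in> L2 M" for f
 proof (rule inj)
  show "S (T f) \<in> L2 M" "AE x in M. T (S (T f)) x = T f x" using S[OF TL[OF f]] by simp_all
 qed (rule f)
 ultimately have "is_inverse_op M T S" unfolding is_inverse_op_def using S by simp
 thus ?thesis using b by (auto simp: invertible_op_def)
qed

lemma op_norm_bound:
 assumes "bounded_op M S" "f \<in> L2 M"
 shows "L2_norm M (S f) <= op_norm M S * L2_norm M f"
proof -
 obtain B where B: "0 < B" "\<And>f. f \<in> L2 M ==> L2_norm M (S f) <= B * L2_norm M f"
  using bounded_op_bound[OF assms(1)] by metis
 have bdd: "bdd_above ((%f. L2_norm M (S f)) ` {f \<in> L2 M. L2_norm M f <= 1})"
 proof (rule bdd_aboveI2)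
  fix f assume f: "f \<in> {f \<in> L2 M. L2_norm M f <= 1}"
  hence "L2_norm M (S f) <= B * L2_norm M f" using B by auto
  also have "... <= B * 1" using f B by (intro mult_left_mono) auto
  finally show "L2_norm M (S f) <= B" by simp
 qed
 show ?thesis
 proof (cases "L2_norm M f = 0")
  case True
  thus ?thesis using B(2)[OF assms(2)] by simp
 next
  case False
  hence p: "0 < L2_norm M f" using L2_norm_nonneg[of M f] by linarith
  define g where "g = (%x. of_real (1 / L2_norm M f) * f x)"
  have g: "g \<in> L2 M" "L2_norm M g = 1"
   unfolding g_def using p by (auto intro: L2_scale assms simp: L2_norm_scale simp del: of_real_divide)
  have "AE x in M. S g x = of_real (1 / L2_norm M f) * S f x"
   unfolding g_def by (rule bounded_op_scale[OF assms])
  hence "L2_norm M (S g) = L2_norm M (%x. of_real (1 / L2_norm M f) * S f x)"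
   by (intro L2_norm_cong_AE bounded_op_L2[OF assms(1)] g L2_scale assms(2))
  also have "... = L2_norm M (S f) / L2_norm M f"
   unfolding L2_norm_scale using p by (simp add: norm_divide)
  finally have "L2_norm M (S f) / L2_norm M f <= op_norm M S"
   unfolding op_norm_def using g by (metis (mono_tags, lifting) cSUP_upper[OF _ bdd] mem_Collect_eq order_refl)
  thus ?thesis using p by (simp add: field_simps)
 qed
qed

lemma op_norm_inverse_le:
 assumes S: "is_inverse_op M T S" and T: "bounded_op M T" and c: "0 < c" "bounded_below M T c"
 shows "op_norm M S <= 1 / c"
 unfolding op_norm_def
proof (rule cSUP_least)
 show "{f \<in> L2 M. L2_norm M f <= 1} \<noteq> {}" using L2_zero L2_norm_zero by (metis (mono_tags, lifting) empty_iff mem_Collect_eq zero_le_one)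
next
 fix f assume f: "f \<in> {f \<in> L2 M. L2_norm M f <= 1}"
 have SL: "S f \<in> L2 M" using S f by (auto simp: is_inverse_op_def intro: bounded_op_L2)
 have "c * L2_norm M (S f) <= L2_norm M (T (S f))" by (rule bounded_belowD[OF c(2) SL])
 also have "... = L2_norm M f"
  using S f by (intro L2_norm_cong_AE bounded_op_L2[OF T] SL) (auto simp: is_inverse_op_def)
 finally show "L2_norm M (S f) <= 1 / c" using f c by (simp add: field_simps)
qed

text \<open>
  With an inverse \<open>S\<close> of \<open>T\<close> and \<open>u\<close> in the space, \<open>\<langle>u, u\<rangle> = \<langle>T (S u), u\<rangle> = \<langle>S u, T' u\<rangle>\<close>; this gives the adjoint
  the same lower bound.
\<close>

lemma bounded_below_if_inverse:
 assumes S: "is_inverse_op M T S" and adj: "adjoint_pair M T T'"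
  and b: "0 < b" and Sb: "\<And>f. f \<in> L2 M ==> L2_norm M (S f) <= b * L2_norm M f"
 shows "bounded_below M T (1 / b)" "bounded_below M T' (1 / b)"
proof -
 have bd: "bounded_op M T" "bounded_op M T'" "bounded_op M S"
  using adj S by (auto simp: adjoint_pair_def is_inverse_op_def)
 show "bounded_below M T (1 / b)"
  unfolding bounded_below_def
 proof
  fix u assume u: "u \<in> L2 M"
  have "L2_norm M u = L2_norm M (S (T u))"
   using S u by (intro L2_norm_cong_AE bounded_op_L2[OF bd(3)] bounded_op_L2[OF bd(1)])
    (auto simp: is_inverse_op_def elim: eventually_mono)
  also have "... <= b * L2_norm M (T u)" by (intro Sb bounded_op_L2[OF bd(1)] u)
  finally show "1 / b * L2_norm M u <= L2_norm M (T u)" using b by (simp add: field_simps)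
 qed
 show "bounded_below M T' (1 / b)"
  unfolding bounded_below_def
 proof
  fix v assume v: "v \<in> L2 M"
  have SL: "S v \<in> L2 M" by (intro bounded_op_L2[OF bd(3)] v)
  have "complex_of_real ((L2_norm M v)\<^sup>2) = L2_inner M v v" by (simp add: L2_inner_self)
  also have "... = L2_inner M (T (S v)) v"
   using S v by (intro L2_inner_cong_AE bounded_op_L2[OF bd(1)] SL)
    (auto simp: is_inverse_op_def elim: eventually_mono)
  also have "... = L2_inner M (S v) (T' v)" using adj SL v by (simp add: adjoint_pair_def)
  finally have "(L2_norm M v)\<^sup>2 = cmod (L2_inner M (S v) (T' v))"
   by (metis norm_of_real abs_of_nonneg zero_le_power2)
  also have "... <= L2_norm M (S v) * L2_norm M (T' v)"
   by (intro L2_Cauchy_Schwarz SL bounded_op_L2[OF bd(2)] v)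
  also have "... <= b * L2_norm M v * L2_norm M (T' v)" by (intro mult_right_mono Sb v L2_norm_nonneg)
  finally have "L2_norm M v * L2_norm M v <= L2_norm M v * (b * L2_norm M (T' v))"
   by (simp add: power2_eq_square mult_ac)
  hence "L2_norm M v <= b * L2_norm M (T' v)"
   using L2_norm_nonneg[of M v] L2_norm_nonneg[of M "T' v"] b
   by (cases "L2_norm M v = 0") (auto simp: mult_le_cancel_left)
  thus "1 / b * L2_norm M v <= L2_norm M (T' v)" using b by (simp add: field_simps)
 qed
qed

section \<open>Fredholm operators and Weyl sequences\<close>

text \<open>
  More unknowns than equations: used to find, in a space that is finite dimensional modulo a
  subspace, a nontrivial combination of given vectors lying in that subspace.
\<close>

lemma linear_dependence:
 fixes c :: "'i => 'b => complex"
 assumes "finite B" "finite I" "card B < card I"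
 shows "\<exists>a. (\<exists>i\<in>I. a i \<noteq> 0) \<and> (\<forall>b\<in>B. (\<Sum>i\<in>I. a i * c i b) = 0)"
 using assms
proof (induction B arbitrary: I c rule: finite_induct)
 case empty
 then obtain i where "i \<in> I" by (metis card_gt_0_iff ex_in_conv card.empty)
 thus ?case by (intro exI[of _ "%_. 1"]) auto
next
 case (insert b B)
 show ?case
 proof (cases "\<forall>i\<in>I. c i b = 0")
  case True
  have "card B < card I" using insert by simp
  then obtain a where "\<exists>i\<in>I. a i \<noteq> 0" "\<forall>b\<in>B. (\<Sum>i\<in>I. a i * c i b) = 0"
   using insert.IH[OF insert.prems(1), of c] by blast
  thus ?thesis using True by (intro exI[of _ a]) auto
 next
  case False
  then obtain j where j: "j \<in> I" "c j b \<noteq> 0" by blast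
  define J where "J = I - {j}"
  have J: "finite J" "card B < card J" "j \<notin> J" "I = insert j J"
   using insert j by (auto simp: J_def)
  define c' where "c' i b' = c i b' - c i b / c j b * c j b'" for i b'
  obtain a where a: "\<exists>i\<in>J. a i \<noteq> 0" "\<forall>b\<in>B. (\<Sum>i\<in>J. a i * c' i b) = 0"
   using insert.IH[OF J(1,2), of c'] by blast
  define s where "s = - (\<Sum>i\<in>J. a i * c i b) / c j b"
  define a' where "a' = a(j := s)"
  have sum: "(\<Sum>i\<in>I. a' i * c i b') = s * c j b' + (\<Sum>i\<in>J. a i * c i b')" for b'
   using J by (simp add: a'_def) (intro sum.cong, auto)
  have "(\<Sum>i\<in>I. a' i * c i b') = 0" if "b' \<in> B" for b'
  proof -
   have "(\<Sum>i\<in>J. a i * c' i b') = (\<Sum>i\<in>J. a i * c i b') - (\<Sum>i\<in>J. a i * c i b) / c j b * c j b'"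
    by (simp add: c'_def algebra_simps sum_subtractf sum_distrib_left sum_distrib_right sum_divide_distrib)
   thus ?thesis using a(2) that unfolding sum by (simp add: s_def)
  qed
  moreover have "(\<Sum>i\<in>I. a' i * c i b) = 0" unfolding sum using j by (simp add: s_def)
  moreover have "\<exists>i\<in>I. a' i \<noteq> 0" using a(1) J(3,4) by (auto simp: a'_def)
  ultimately show ?thesis by (intro exI[of _ a']) auto
 qed
qed

definition orthonormal_seq :: "'a measure => (nat => 'a => complex) => bool" where
 "orthonormal_seq M w \<longleftrightarrow>
   (\<forall>n. w n \<in> L2 M) \<and> (\<forall>m n. L2_inner M (w m) (w n) = (if m = n then 1 else 0))"

lemma orthonormal_seq_norm:
 assumes "orthonormal_seq M w" shows "L2_norm M (w n) = 1"
proof -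
 have "complex_of_real ((L2_norm M (w n))\<^sup>2) = of_real 1"
  using assms L2_inner_self[of M "w n"] by (simp add: orthonormal_seq_def)
 hence "(L2_norm M (w n))\<^sup>2 = 1" using of_real_eq_iff by blast
 thus ?thesis using L2_norm_nonneg[of M "w n"] by (simp add: power2_eq_1_iff)
qed

lemma orthonormal_series:
 assumes w: "orthonormal_seq M w" and r: "0 <= r" "r < 1" and a: "\<And>n. cmod (a n) <= r ^ n"
 shows "\<exists>g\<in>L2 M. \<forall>k. L2_inner M g (w k) = a k"
proof -
 have wL: "w n \<in> L2 M" for n using w by (simp add: orthonormal_seq_def)
 define f where "f n = (%x. \<Sum>k<n. a k * w k x)" for n
 have fL: "f n \<in> L2 M" for n unfolding f_def by (intro L2_sum L2_scale wL)
 have step: "L2_norm M (%x. f (Suc n) x - f n x) <= 1 * r ^ n" for n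
  using a[of n] by (simp add: f_def L2_norm_scale orthonormal_seq_norm[OF w])
 obtain g where g: "g \<in> L2 M" "(%n. L2_norm M (%x. f n x - g x)) \<longlonglongrightarrow> 0"
  using L2_complete_geometric[of f M r 1, OF fL r step] by blast
 have fi: "L2_inner M (f n) (w k) = a k" if "k < n" for n k
 proof -
  have "L2_inner M (f n) (w k) = (\<Sum>i<n. a i * L2_inner M (w i) (w k))"
   unfolding f_def by (subst L2_inner_sum) (auto simp: L2_inner_scale intro: L2_scale wL)
  also have "... = (\<Sum>i<n. if i = k then a i else 0)"
   using w by (intro sum.cong) (auto simp: orthonormal_seq_def)
  finally show ?thesis using that by simp
 qed
 have "L2_inner M g (w k) = a k" for k
 proof -
  have "cmod (a k - L2_inner M g (w k)) <= L2_norm M (%x. f n x - g x)" if "n \<ge> Suc k" for n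
  proof -
   have "a k - L2_inner M g (w k) = L2_inner M (%x. f n x - g x) (w k)"
    using fi[of k n] that by (subst L2_inner_diff[OF fL g(1) wL]) auto
   thus ?thesis using L2_Cauchy_Schwarz[OF L2_diff[OF fL g(1)] wL, of n k]
    by (simp add: orthonormal_seq_norm[OF w])
  qed
  hence "cmod (a k - L2_inner M g (w k)) <= 0"
   by (intro LIMSEQ_le_const[OF g(2)]) blast
  thus ?thesis by simp
 qed
 with g(1) show ?thesis by blast
qed

text \<open>
  Weyl sequences are thinned out so that their defects are dominated by a geometric series.
\<close>

lemma null_sequence_fast_subsequence:
 fixes x :: "nat => real"
 assumes "x \<longlonglongrightarrow> 0" "0 < r"
 shows "\<exists>\<phi>. strict_mono \<phi> \<and> (\<forall>n. x (\<phi> n) <= r ^ n)"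
proof -
 have ex: "\<exists>m>N. x m <= r ^ n" for N n :: nat
 proof -
  have "eventually (%m. x m < r ^ n) sequentially"
   using assms by (intro order_tendstoD(2)) auto
  hence "eventually (%m. x m < r ^ n \<and> N < m) sequentially"
   using eventually_gt_at_top[of N] by (rule eventually_conj)
  then obtain m where "x m < r ^ n" "N < m" by (auto simp: eventually_sequentially)
  thus ?thesis by (intro exI[of _ m]) auto
 qed
 define \<phi> where "\<phi> = rec_nat (SOME m. x m <= r ^ 0) (%n N. SOME m. N < m \<and> x m <= r ^ Suc n)"
 have 0: "x (\<phi> 0) <= r ^ 0"
  using someI_ex[of "%m. x m <= r ^ 0"] ex[of 0 0] by (auto simp: \<phi>_def)
 have S: "\<phi> n < \<phi> (Suc n) \<and> x (\<phi> (Suc n)) <= r ^ Suc n" for n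
  using someI_ex[of "%m. \<phi> n < m \<and> x m <= r ^ Suc n"] ex[of "\<phi> n" "Suc n"] by (auto simp: \<phi>_def)
 have "x (\<phi> n) <= r ^ n" for n using 0 S by (cases n) auto
 moreover have "strict_mono \<phi>" using S by (simp add: strict_mono_Suc_iff)
 ultimately show ?thesis by blast
qed

lemma orthonormal_subseq:
 "orthonormal_seq M w ==> strict_mono \<phi> ==> orthonormal_seq M (%n. w (\<phi> n))"
 by (simp add: orthonormal_seq_def strict_mono_eq)

lemma fredholmD:
 assumes "fredholm M T"
 shows "bounded_op M T"
  and "\<exists>B. finite B \<and> B \<subseteq> L2 M \<and>
    (\<forall>f\<in>L2 M. (AE x in M. T f x = 0) --> (\<exists>c. AE x in M. f x = (\<Sum>b\<in>B. c b * b x)))"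
  and "\<forall>f g. (\<forall>n::nat. f n \<in> L2 M) \<and> g \<in> L2 M \<and>
    (%n. L2_norm M (%x. T (f n) x - g x)) \<longlonglongrightarrow> 0 --> (\<exists>h\<in>L2 M. AE x in M. T h x = g x)"
  and "\<exists>B. finite B \<and> B \<subseteq> L2 M \<and>
    (\<forall>g\<in>L2 M. \<exists>h\<in>L2 M. \<exists>c. AE x in M. g x = T h x + (\<Sum>b\<in>B. c b * b x))"
 using assms unfolding fredholm_def by - (elim conjE, assumption)+

text \<open>
  An orthonormal approximate kernel \<open>\<psi>\<^sub>k\<close> of the adjoint, with \<open>\<parallel>T' \<psi>\<^sub>k\<parallel> \<le> 4\<^sup>-\<^sup>k\<close>, makes the cokernel
  infinite dimensional: an element \<open>g = T h\<close> of the range satisfies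
  \<open>\<bar>\<langle>g, \<psi>\<^sub>k\<rangle>\<bar> \<le> \<parallel>h\<parallel> 4\<^sup>-\<^sup>k\<close>, which fails for each nontrivial combination of the vectors
  \<open>g\<^sub>i = \<Sum> 2\<^sup>-\<^sup>k \<psi>\<^sub>k\<close>, summed over a residue class of \<open>k\<close>.
\<close>

lemma not_fredholm_if_adjoint_Weyl:
 assumes adj: "adjoint_pair M T T'" and w: "orthonormal_seq M w"
  and lim: "(%n. L2_norm M (T' (w n))) \<longlonglongrightarrow> 0"
 shows "\<not> fredholm M T"
proof
 assume F: "fredholm M T"
 obtain B where B: "finite B" "B \<subseteq> L2 M"
  and cok: "\<And>g. g \<in> L2 M ==> \<exists>h\<in>L2 M. \<exists>c. AE x in M. g x = T h x + (\<Sum>b\<in>B. c b * b x)"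
  using fredholmD(4)[OF F] by blast
 have bd: "bounded_op M T" "bounded_op M T'" using adj by (auto simp: adjoint_pair_def)
 obtain \<phi> where \<phi>: "strict_mono \<phi>" "\<And>n. L2_norm M (T' (w (\<phi> n))) <= (1/4) ^ n"
  using null_sequence_fast_subsequence[OF lim, of "1/4"] by auto
 define \<psi> where "\<psi> n = w (\<phi> n)" for n
 have \<psi>: "orthonormal_seq M \<psi>" unfolding \<psi>_def by (rule orthonormal_subseq[OF w \<phi>(1)])
 have \<psi>L: "\<psi> n \<in> L2 M" for n using \<psi> by (simp add: orthonormal_seq_def)
 have small: "L2_norm M (T' (\<psi> n)) <= (1/4) ^ n" for n using \<phi> by (simp add: \<psi>_def)
 define m where "m = Suc (card B)"
 define a where "a i k = (if k mod m = i then (1/2) ^ k else 0 :: complex)" for i k :: nat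
 have "\<exists>g\<in>L2 M. \<forall>k. L2_inner M g (\<psi> k) = a i k" for i
  by (rule orthonormal_series[OF \<psi>, of "1/2"]) (auto simp: a_def norm_power norm_divide)
 hence "\<forall>i. \<exists>g. g \<in> L2 M \<and> (\<forall>k. L2_inner M g (\<psi> k) = a i k)" by blast
 from choice[OF this] obtain g where g: "\<And>i. g i \<in> L2 M" "\<And>i k. L2_inner M (g i) (\<psi> k) = a i k"
  by blast
 have "\<forall>i. \<exists>h. h \<in> L2 M \<and> (\<exists>c. AE x in M. g i x = T h x + (\<Sum>b\<in>B. c b * b x))"
  using cok[OF g(1)] by blast
 from choice[OF this] obtain h where h: "\<And>i. h i \<in> L2 M"
  and "\<forall>i. \<exists>c. AE x in M. g i x = T (h i) x + (\<Sum>b\<in>B. c b * b x)" by blast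
 from choice[OF this(2)] obtain c
  where hc: "\<And>i. AE x in M. g i x = T (h i) x + (\<Sum>b\<in>B. c i b * b x)" by blast
 obtain e where e: "\<exists>i\<in>{..<m}. e i \<noteq> 0" "\<forall>b\<in>B. (\<Sum>i<m. e i * c i b) = 0"
  using linear_dependence[OF B(1), of "{..<m}" c] by (auto simp: m_def)
 then obtain j where j: "j < m" "e j \<noteq> 0" by auto
 define H where "H = (%x. \<Sum>i<m. e i * h i x)"
 have HL: "H \<in> L2 M" unfolding H_def by (intro L2_sum L2_scale h)
 have 1: "AE x in M. T H x = (\<Sum>i<m. T (%x. e i * h i x) x)"
  unfolding H_def by (intro bounded_op_sum[OF bd(1)] L2_scale h) auto
 have 2: "AE x in M. \<forall>i\<in>{..<m}. T (%x. e i * h i x) x = e i * T (h i) x"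
  by (intro AE_finite_allI bounded_op_scale[OF bd(1) h]) auto
 have 3: "AE x in M. \<forall>i\<in>{..<m}. g i x = T (h i) x + (\<Sum>b\<in>B. c i b * b x)"
  by (intro AE_finite_allI hc) auto
 have eq: "AE x in M. T H x = (\<Sum>i<m. e i * g i x)"
  using 1 2 3
 proof eventually_elim
  case (elim x)
  have "(\<Sum>i<m. e i * g i x) = (\<Sum>i<m. e i * T (h i) x) + (\<Sum>i<m. \<Sum>b\<in>B. e i * c i b * b x)"
   using elim(3) by (simp add: sum.distrib distrib_left sum_distrib_left mult.assoc)
  also have "(\<Sum>i<m. \<Sum>b\<in>B. e i * c i b * b x) = (\<Sum>b\<in>B. (\<Sum>i<m. e i * c i b) * b x)"
   by (subst sum.swap) (simp add: sum_distrib_right)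
  also have "... = 0" using e(2) by simp
  finally show ?case using elim(1,2) by simp
 qed
 have bound: "cmod (e j) <= L2_norm M H * (1/2) ^ n" for n
 proof -
  define k where "k = n * m + j"
  have k: "k mod m = j" unfolding k_def using j(1) by simp
  have nk: "n <= k" by (simp add: k_def m_def)
  have "L2_inner M (T H) (\<psi> k) = L2_inner M (%x. \<Sum>i<m. e i * g i x) (\<psi> k)"
   by (intro L2_inner_cong_AE eq bounded_op_L2[OF bd(1)] HL \<psi>L L2_sum L2_scale g) auto
  also have "... = (\<Sum>i<m. e i * a i k)"
   by (subst L2_inner_sum) (auto simp: L2_inner_scale g intro: L2_scale g \<psi>L)
  also have "... = (\<Sum>i<m. if i = j then e i * (1/2) ^ k else 0)"
   using k by (intro sum.cong) (auto simp: a_def)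
  also have "... = e j * (1/2) ^ k" using j by simp
  finally have "L2_inner M H (T' (\<psi> k)) = e j * (1/2) ^ k"
   using adj HL \<psi>L by (simp add: adjoint_pair_def)
  hence "cmod (e j) * (1/2) ^ k = cmod (L2_inner M H (T' (\<psi> k)))"
   by (simp add: norm_mult norm_power norm_divide)
  also have "... <= L2_norm M H * L2_norm M (T' (\<psi> k))"
   by (rule L2_Cauchy_Schwarz[OF HL bounded_op_L2[OF bd(2) \<psi>L]])
  also have "... <= L2_norm M H * (1/4) ^ k" by (rule mult_left_mono[OF small L2_norm_nonneg])
  also have "(1/4 :: real) ^ k = (1/2) ^ k * (1/2) ^ k" by (simp flip: power_mult_distrib)
  finally have "cmod (e j) * (1/2) ^ k <= (L2_norm M H * (1/2) ^ k) * (1/2) ^ k" by (simp only: mult.assoc)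
  hence "cmod (e j) <= L2_norm M H * (1/2) ^ k" by (rule mult_right_le_imp_le) simp
  also have "... <= L2_norm M H * (1/2) ^ n"
   using nk by (intro mult_left_mono power_decreasing L2_norm_nonneg) auto
  finally show ?thesis .
 qed
 have "(%n. L2_norm M H * (1/2) ^ n) \<longlonglongrightarrow> L2_norm M H * 0"
  by (rule tendsto_mult_left[OF LIMSEQ_realpow_zero]) auto
 from LIMSEQ_le_const[OF this, of "cmod (e j)"] bound have "cmod (e j) <= 0" by auto
 with j show False by simp
qed

text \<open>
  If the adjoint is bounded below, then \<open>T w\<^sub>n\<close> has a small preimage \<open>u\<^sub>n\<close>, so that a Weyl sequence
  \<open>w\<^sub>n\<close> of \<open>T\<close> lies close to the kernel elements \<open>w\<^sub>n - u\<^sub>n\<close>; these are almost orthonormal.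
\<close>

lemma not_fredholm_if_Weyl:
 assumes adj: "adjoint_pair M T T'" and w: "orthonormal_seq M w"
  and lim: "(%n. L2_norm M (T (w n))) \<longlonglongrightarrow> 0"
  and c: "0 < c" "bounded_below M T' c"
 shows "\<not> fredholm M T"
proof
 assume F: "fredholm M T"
 obtain B where B: "finite B" "B \<subseteq> L2 M"
  and ker: "\<And>f. f \<in> L2 M ==> AE x in M. T f x = 0 ==> \<exists>c. AE x in M. f x = (\<Sum>b\<in>B. c b * b x)"
  using fredholmD(2)[OF F] by blast
 have bd: "bounded_op M T" using adj by (auto simp: adjoint_pair_def)
 have wL: "w n \<in> L2 M" for n using w by (simp add: orthonormal_seq_def)
 define m where "m = Suc (card B)"
 define \<epsilon> where "\<epsilon> = 1 / (2 * real m)"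
 have \<epsilon>: "0 < \<epsilon>" by (simp add: \<epsilon>_def m_def)
 have "eventually (%n. L2_norm M (T (w n)) < c * \<epsilon>) sequentially"
  using lim \<epsilon> c by (intro order_tendstoD(2)) auto
 then obtain N where N: "\<And>n. n \<ge> N ==> L2_norm M (T (w n)) < c * \<epsilon>"
  by (auto simp: eventually_sequentially)
 have "\<forall>i. \<exists>u. u \<in> L2 M \<and> (AE x in M. T u x = T (w (N + i)) x)
   \<and> L2_norm M u <= L2_norm M (T (w (N + i))) / c"
  using adjoint_bounded_below_imp_surjective[OF adj c bounded_op_L2[OF bd wL]] by blast
 from choice[OF this] obtain u where u: "\<And>i. u i \<in> L2 M" "\<And>i. AE x in M. T (u i) x = T (w (N + i)) x"
  "\<And>i. L2_norm M (u i) <= L2_norm M (T (w (N + i))) / c" by blast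
 have us: "L2_norm M (u i) <= \<epsilon>" for i
 proof -
  have "L2_norm M (u i) <= L2_norm M (T (w (N + i))) / c" by (rule u(3))
  also have "... <= (c * \<epsilon>) / c" using N[of "N + i"] c(1) by (intro divide_right_mono) auto
  finally show ?thesis using c(1) by simp
 qed
 have "\<exists>e. AE x in M. w (N + i) x - u i x = (\<Sum>b\<in>B. e b * b x)" for i
 proof (rule ker)
  show "AE x in M. T (%x. w (N + i) x - u i x) x = 0"
   using bounded_op_diff[OF bd wL u(1), of "N + i" i] u(2)[of i] by eventually_elim simp
 qed (intro L2_diff wL u)
 hence "\<forall>i. \<exists>e. AE x in M. w (N + i) x - u i x = (\<Sum>b\<in>B. e b * b x)" by blast
 from choice[OF this] obtain e
  where e: "\<And>i. AE x in M. w (N + i) x - u i x = (\<Sum>b\<in>B. e i b * b x)" by blast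
 obtain a where a: "\<exists>i\<in>{..<m}. a i \<noteq> 0" "\<forall>b\<in>B. (\<Sum>i<m. a i * e i b) = 0"
  using linear_dependence[OF B(1), of "{..<m}" e] by (auto simp: m_def)
 define A where "A = Max ((%i. cmod (a i)) ` {..<m})"
 have "A \<in> (%i. cmod (a i)) ` {..<m}" unfolding A_def by (rule Max_in) (auto simp: m_def)
 then obtain j where j: "j < m" "A = cmod (a j)" by auto
 have A: "cmod (a i) <= A" if "i < m" for i unfolding A_def using that by (intro Max_ge) auto
 have Apos: "0 < A"
 proof -
  obtain i where "i < m" "a i \<noteq> 0" using a(1) by auto
  thus ?thesis using A[of i] by (auto intro: less_le_trans[of 0 "cmod (a i)"])
 qed
 have "AE x in M. \<forall>i\<in>{..<m}. w (N + i) x - u i x = (\<Sum>b\<in>B. e i b * b x)"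
  by (intro AE_finite_allI e) auto
 hence eq: "AE x in M. (\<Sum>i<m. a i * w (N + i) x) = (\<Sum>i<m. a i * u i x)"
 proof eventually_elim
  case (elim x)
  have "(\<Sum>i<m. a i * w (N + i) x) - (\<Sum>i<m. a i * u i x) = (\<Sum>i<m. a i * (w (N + i) x - u i x))"
   by (simp add: right_diff_distrib sum_subtractf)
  also have "... = (\<Sum>i<m. \<Sum>b\<in>B. a i * e i b * b x)"
   using elim by (simp add: sum_distrib_left mult.assoc)
  also have "... = (\<Sum>b\<in>B. (\<Sum>i<m. a i * e i b) * b x)"
   by (subst sum.swap) (simp add: sum_distrib_right)
  also have "... = 0" using a(2) by simp
  finally show ?case by simp
 qed
 let ?U = "%x. \<Sum>i<m. a i * u i x"
 have UL: "?U \<in> L2 M" by (intro L2_sum L2_scale u)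
 have "L2_inner M ?U (w (N + j)) = L2_inner M (%x. \<Sum>i<m. a i * w (N + i) x) (w (N + j))"
  by (rule L2_inner_cong_AE[OF UL _ wL wL])
    (use eq in \<open>auto intro!: L2_sum L2_scale wL elim: eventually_mono\<close>)
 also have "... = (\<Sum>i<m. a i * L2_inner M (w (N + i)) (w (N + j)))"
  by (subst L2_inner_sum) (auto simp: L2_inner_scale intro: L2_scale wL)
 also have "... = (\<Sum>i<m. if i = j then a i else 0)"
  using w by (intro sum.cong) (auto simp: orthonormal_seq_def)
 also have "... = a j" using j by simp
 finally have "A = cmod (L2_inner M ?U (w (N + j)))" using j by simp
 also have "... <= L2_norm M ?U * 1"
  using L2_Cauchy_Schwarz[OF UL wL, of "N + j"] by (simp add: orthonormal_seq_norm[OF w])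
 also have "... <= (\<Sum>i<m. L2_norm M (%x. a i * u i x))"
  using L2_norm_sum[of "{..<m}" "%i x. a i * u i x" M] L2_scale[OF u(1)] by simp
 also have "... <= (\<Sum>i<m. A * \<epsilon>)"
  unfolding L2_norm_scale using \<epsilon> Apos
  by (intro sum_mono mult_mono us A L2_norm_nonneg) auto
 also have "... = A / 2" by (simp add: \<epsilon>_def m_def field_simps)
 finally show False using Apos by simp
qed

lemma fredholm_if_invertible:
 assumes "invertible_op M T" shows "fredholm M T"
proof -
 obtain S where T: "bounded_op M T" and S: "bounded_op M S"
  and ST: "\<And>f. f \<in> L2 M ==> AE x in M. S (T f) x = f x"
  and TS: "\<And>f. f \<in> L2 M ==> AE x in M. T (S f) x = f x"
  using assms by (auto simp: invertible_op_def is_inverse_op_def)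
 have "AE x in M. f x = 0" if f: "f \<in> L2 M" "AE x in M. T f x = 0" for f
 proof -
  have "AE x in M. S (T f) x = S (%x. 0) x"
   by (rule bounded_op_cong_AE[OF S bounded_op_L2[OF T f(1)] L2_zero f(2)])
  with ST[OF f(1)] bounded_op_zero[OF S] show ?thesis by eventually_elim simp
 qed
 moreover have "\<exists>h\<in>L2 M. AE x in M. T h x = g x" if "g \<in> L2 M" for g
  using TS[OF that] bounded_op_L2[OF S that] by blast
 moreover have "\<exists>h\<in>L2 M. AE x in M. g x = T h x" if "g \<in> L2 M" for g
  using TS[OF that] bounded_op_L2[OF S that] by (intro bexI[of _ "S g"]) (auto elim: eventually_mono)
 ultimately show ?thesis unfolding fredholm_def using T
  by (intro conjI exI[of _ "{}"] allI impI ballI) auto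
qed

section \<open>Unitary equivalence\<close>

text \<open>
  A unitary operator together with its inverse, acting on representatives. Linearity is asked for as
  an equality of functions, which holds for weighted substitutions; the maps are mutually inverse only
  up to null sets.
\<close>

locale unitary_equivalence =
 fixes M :: "'a measure" and N :: "'b measure"
  and V :: "('a => complex) => 'b => complex" and W :: "('b => complex) => 'a => complex"
 assumes V_L2: "f \<in> L2 M ==> V f \<in> L2 N" and W_L2: "h \<in> L2 N ==> W h \<in> L2 M"
  and V_inner: "f \<in> L2 M ==> g \<in> L2 M ==> L2_inner N (V f) (V g) = L2_inner M f g"
  and V_add: "V (%x. f x + g x) = (%y. V f y + V g y)"
  and V_scale: "V (%x. a * f x) = (%y. a * V f y)"
  and W_add: "W (%y. h y + k y) = (%x. W h x + W k x)"
  and W_scale: "W (%y. a * h y) = (%x. a * W h x)"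
  and WV: "f \<in> L2 M ==> AE x in M. W (V f) x = f x"
  and VW: "h \<in> L2 N ==> AE y in N. V (W h) y = h y"
begin

lemma V_norm: "f \<in> L2 M ==> L2_norm N (V f) = L2_norm M f"
proof -
 assume f: "f \<in> L2 M"
 have "complex_of_real ((L2_norm N (V f))\<^sup>2) = of_real ((L2_norm M f)\<^sup>2)"
  using V_inner[OF f f] by (simp only: L2_inner_self)
 hence "(L2_norm N (V f))\<^sup>2 = (L2_norm M f)\<^sup>2" using of_real_eq_iff by blast
 thus ?thesis by (simp add: L2_norm_nonneg)
qed

lemma V_diff: "V (%x. f x - g x) = (%y. V f y - V g y)"
 using V_add[of f "%x. (-1) * g x"] V_scale[of "-1" g] by simp

lemma W_diff: "W (%x. f x - g x) = (%y. W f y - W g y)"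
 using W_add[of f "%x. (-1) * g x"] W_scale[of "-1" g] by simp

lemma W_norm: "g \<in> L2 N ==> L2_norm M (W g) = L2_norm N g"
 using V_norm[OF W_L2] L2_norm_cong_AE[OF V_L2[OF W_L2] _ VW] by metis

lemma V_cong_AE:
 assumes "f \<in> L2 M" "g \<in> L2 M" "AE x in M. f x = g x" shows "AE y in N. V f y = V g y"
proof (rule L2_eqI)
 have "L2_norm N (%y. V f y - V g y) = L2_norm M (%x. f x - g x)"
  using V_norm[OF L2_diff[OF assms(1,2)]] by (simp only: V_diff)
 also have "... = L2_norm M (%x. 0)"
  by (rule L2_norm_cong_AE[OF L2_diff[OF assms(1,2)] L2_zero]) (use assms(3) in \<open>auto elim: eventually_mono\<close>)
 finally show "L2_norm N (%y. V f y - V g y) <= 0" by (simp add: L2_norm_zero)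
qed (use assms in \<open>auto intro: V_L2\<close>)

lemma V_reflect_AE:
 assumes "f \<in> L2 M" "g \<in> L2 M" "AE y in N. V f y = V g y" shows "AE x in M. f x = g x"
proof (rule L2_eqI)
 have "L2_norm M (%x. f x - g x) = L2_norm N (%y. V f y - V g y)"
  using V_norm[OF L2_diff[OF assms(1,2)]] by (simp only: V_diff)
 also have "... = L2_norm N (%x. 0)"
  by (rule L2_norm_cong_AE[OF L2_diff L2_zero]) (use assms in \<open>auto intro: V_L2 elim: eventually_mono\<close>)
 finally show "L2_norm M (%x. f x - g x) <= 0" by (simp add: L2_norm_zero)
qed (use assms in auto)

lemma W_cong_AE:
 assumes "f \<in> L2 N" "g \<in> L2 N" "AE x in N. f x = g x" shows "AE y in M. W f y = W g y"
proof (rule V_reflect_AE)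
 show "AE y in N. V (W f) y = V (W g) y"
  using VW[OF assms(1)] VW[OF assms(2)] assms(3) by eventually_elim simp
qed (use assms in \<open>auto intro: W_L2\<close>)

lemma unitary_equivalence_sym: "unitary_equivalence N M W V"
proof
 fix f g assume fg: "f \<in> L2 N" "g \<in> L2 N"
 have "L2_inner M (W f) (W g) = L2_inner N (V (W f)) (V (W g))"
  using fg by (simp add: V_inner W_L2)
 also have "... = L2_inner N f g"
  using fg by (intro L2_inner_cong_AE V_L2 W_L2 VW)
 finally show "L2_inner M (W f) (W g) = L2_inner N f g" .
qed (fact V_L2 W_L2 V_add V_scale W_add W_scale WV VW)+

definition intertwines :: "'a op => 'b op => bool" where
 "intertwines T S \<longleftrightarrow> (\<forall>f\<in>L2 M. T f \<in> L2 M \<and> (AE y in N. V (T f) y = S (V f) y))"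

lemma intertwines_shift:
 assumes "intertwines T S" shows "intertwines (shift T \<mu>) (shift S \<mu>)"
 unfolding intertwines_def
proof (intro ballI conjI)
 fix f assume f: "f \<in> L2 M"
 show "shift T \<mu> f \<in> L2 M" unfolding shift_def
  using assms f by (intro L2_diff L2_scale) (auto simp: intertwines_def)
 have "AE y in N. V (T f) y = S (V f) y" using assms f by (auto simp: intertwines_def)
 thus "AE y in N. V (shift T \<mu> f) y = shift S \<mu> (V f) y"
  unfolding shift_def V_diff V_scale by eventually_elim simp
qed

lemma bounded_op_pullback:
 assumes TS: "intertwines T S" and S: "bounded_op N S" shows "bounded_op M T"
proof -
 have T: "T f \<in> L2 M" "AE y in N. V (T f) y = S (V f) y" if "f \<in> L2 M" for f
  using TS that by (auto simp: intertwines_def)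
 obtain B where B: "0 < B" "\<And>f. f \<in> L2 N ==> L2_norm N (S f) <= B * L2_norm N f"
  using bounded_op_bound[OF S] by metis
 have "AE x in M. T (%x. f x + g x) x = T f x + T g x" if fg: "f \<in> L2 M" "g \<in> L2 M" for f g
 proof (rule V_reflect_AE)
  show "AE y in N. V (T (%x. f x + g x)) y = V (%x. T f x + T g x) y"
   using T(2)[OF L2_add[OF fg]] T(2)[OF fg(1)] T(2)[OF fg(2)]
    bounded_op_add[OF S V_L2[OF fg(1)] V_L2[OF fg(2)]]
   unfolding V_add by eventually_elim simp
 qed (auto intro: T(1) L2_add fg)
 moreover have "AE x in M. T (%x. c * f x) x = c * T f x" if f: "f \<in> L2 M" for f c
 proof (rule V_reflect_AE)
  show "AE y in N. V (T (%x. c * f x)) y = V (%x. c * T f x) y"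
   using T(2)[OF L2_scale[OF f, of c]] T(2)[OF f] bounded_op_scale[OF S V_L2[OF f], of c]
   unfolding V_scale by eventually_elim simp
 qed (auto intro: T(1) L2_scale f)
 moreover have "L2_norm M (T f) <= B * L2_norm M f" if f: "f \<in> L2 M" for f
 proof -
  have "L2_norm M (T f) = L2_norm N (S (V f))"
   using V_norm[OF T(1)[OF f]] L2_norm_cong_AE[OF V_L2[OF T(1)[OF f]] bounded_op_L2[OF S V_L2[OF f]] T(2)[OF f]]
   by simp
  thus ?thesis using B(2)[OF V_L2[OF f]] V_norm[OF f] by simp
 qed
 ultimately show ?thesis unfolding bounded_op_def using T(1) by blast
qed

lemma bounded_below_pullback:
 assumes TS: "intertwines T S" and S: "bounded_op N S" "bounded_below N S c"
 shows "bounded_below M T c"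
 unfolding bounded_below_def
proof
 fix f assume f: "f \<in> L2 M"
 have T: "T f \<in> L2 M" "AE y in N. V (T f) y = S (V f) y"
  using TS f by (auto simp: intertwines_def)
 have "L2_norm M (T f) = L2_norm N (S (V f))"
  using V_norm[OF T(1)] L2_norm_cong_AE[OF V_L2[OF T(1)] bounded_op_L2[OF S(1) V_L2[OF f]] T(2)]
  by simp
 thus "c * L2_norm M f <= L2_norm M (T f)"
  using bounded_belowD[OF S(2) V_L2[OF f]] V_norm[OF f] by simp
qed

lemma intertwines_converse:
 assumes TS: "intertwines T S" and S: "bounded_op N S"
 shows "unitary_equivalence.intertwines N M W S T"
proof -
 interpret sym: unitary_equivalence N M W V by (rule unitary_equivalence_sym)
 show ?thesis unfolding sym.intertwines_def
 proof (intro ballI conjI)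
  fix g assume g: "g \<in> L2 N"
  show SL: "S g \<in> L2 N" by (rule bounded_op_L2[OF S g])
  have T: "T (W g) \<in> L2 M" "AE y in N. V (T (W g)) y = S (V (W g)) y"
   using TS W_L2[OF g] by (auto simp: intertwines_def)
  have "AE y in N. S (V (W g)) y = S g y"
   by (rule bounded_op_cong_AE[OF S V_L2[OF W_L2[OF g]] g VW[OF g]])
  with T(2) VW[OF SL] have "AE y in N. V (W (S g)) y = V (T (W g)) y" by eventually_elim simp
  thus "AE x in M. W (S g) x = T (W g) x" by (rule V_reflect_AE[OF W_L2[OF SL] T(1)])
 qed
qed

text \<open>
  The inverse itself is transported, not merely its existence, because norms of inverses matter.
\<close>

lemma inverse_pushforward:
 assumes TS: "intertwines T S" and S: "bounded_op N S" and R: "is_inverse_op M T R"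
 shows "is_inverse_op N S (%g. V (R (W g)))"
proof -
 interpret sym: unitary_equivalence N M W V by (rule unitary_equivalence_sym)
 have RB: "bounded_op M R" and RT: "\<And>f. f \<in> L2 M ==> AE x in M. R (T f) x = f x"
  and TR: "\<And>f. f \<in> L2 M ==> AE x in M. T (R f) x = f x"
  using R by (auto simp: is_inverse_op_def)
 note RL = bounded_op_L2[OF RB]
 have iT: "T f \<in> L2 M" "AE y in N. V (T f) y = S (V f) y" if "f \<in> L2 M" for f
  using TS that by (auto simp: intertwines_def)
 have ST: "AE x in M. W (S g) x = T (W g) x" if "g \<in> L2 N" for g
  using intertwines_converse[OF TS S] that by (auto simp: sym.intertwines_def)
 have "sym.intertwines (%g. V (R (W g))) R"
  unfolding sym.intertwines_def using WV[OF RL[OF W_L2]] V_L2[OF RL[OF W_L2]] by blast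
 hence "bounded_op N (%g. V (R (W g)))" by (rule sym.bounded_op_pullback[OF _ RB])
 moreover have "AE y in N. V (R (W (S g))) y = g y" if g: "g \<in> L2 N" for g
 proof -
  note SL = bounded_op_L2[OF S g]
  have "AE x in M. R (W (S g)) x = R (T (W g)) x"
   by (rule bounded_op_cong_AE[OF RB W_L2[OF SL] iT(1)[OF W_L2[OF g]] ST[OF g]])
  with RT[OF W_L2[OF g]] have "AE x in M. R (W (S g)) x = W g x" by eventually_elim simp
  hence "AE y in N. V (R (W (S g))) y = V (W g) y"
   by (rule V_cong_AE[OF RL[OF W_L2[OF SL]] W_L2[OF g]])
  with VW[OF g] show ?thesis by eventually_elim simp
 qed
 moreover have "AE y in N. S (V (R (W g))) y = g y" if g: "g \<in> L2 N" for g
 proof -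
  note RW = RL[OF W_L2[OF g]]
  have "AE y in N. V (T (R (W g))) y = V (W g) y"
   by (rule V_cong_AE[OF iT(1)[OF RW] W_L2[OF g] TR[OF W_L2[OF g]]])
  with iT(2)[OF RW] VW[OF g] show ?thesis by eventually_elim simp
 qed
 ultimately show ?thesis by (simp add: is_inverse_op_def)
qed

lemma invertible_pullback:
 assumes TS: "intertwines T S" and S: "invertible_op N S"
 shows "invertible_op M T"
proof -
 interpret sym: unitary_equivalence N M W V by (rule unitary_equivalence_sym)
 obtain R where R: "bounded_op N S" "is_inverse_op N S R"
  using S by (auto simp: invertible_op_def)
 have T: "bounded_op M T" by (rule bounded_op_pullback[OF TS R(1)])
 show ?thesis
  using sym.inverse_pushforward[OF intertwines_converse[OF TS R(1)] T R(2)] T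
  by (auto simp: invertible_op_def)
qed

lemma fredholm_pushforward:
 assumes TS: "intertwines T S" and S: "bounded_op N S" and F: "fredholm M T"
 shows "fredholm N S"
proof -
 interpret sym: unitary_equivalence N M W V by (rule unitary_equivalence_sym)
 note T = fredholmD(1)[OF F] and cl = fredholmD(3)[OF F, rule_format]
 obtain B1 where B1: "finite B1" "B1 \<subseteq> L2 M"
   "\<And>f. f \<in> L2 M ==> AE x in M. T f x = 0 ==> \<exists>c. AE x in M. f x = (\<Sum>b\<in>B1. c b * b x)"
  using fredholmD(2)[OF F] by blast
 obtain B2 where B2: "finite B2" "B2 \<subseteq> L2 M"
   "\<And>g. g \<in> L2 M ==> \<exists>h\<in>L2 M. \<exists>c. AE x in M. g x = T h x + (\<Sum>b\<in>B2. c b * b x)"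
  using fredholmD(4)[OF F] by blast
 have iT: "AE y in N. V (T f) y = S (V f) y" if "f \<in> L2 M" for f
  using TS that by (auto simp: intertwines_def)
 have ST: "AE x in M. W (S g) x = T (W g) x" if "g \<in> L2 N" for g
  using intertwines_converse[OF TS S] that by (auto simp: sym.intertwines_def)
 have comb: "\<exists>c'. AE y in N. g y = S' y + (\<Sum>b\<in>V ` B. c' b * b y)"
  if B: "finite B" "B \<subseteq> L2 M" and f: "f \<in> L2 M" "AE x in M. f x = h x + (\<Sum>b\<in>B. c b * b x)"
   and h: "h \<in> L2 M" and g: "AE y in N. V f y = g y" "AE y in N. V h y = S' y"
  for B f h c g S'
 proof -
  have sumL: "(%x. \<Sum>b\<in>B. c b * b x) \<in> L2 M" using B by (intro L2_sum L2_scale) auto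
  have Vs: "V (%x. \<Sum>b\<in>B'. c b * b x) = (%y. \<Sum>b\<in>B'. c b * V b y)" if "finite B'" for B'
   using that
  proof (induction B')
   case empty
   show ?case using V_scale[of 0 "%_. 0"] by simp
  next
   case (insert b B')
   have "V (%x. c b * b x + (\<Sum>b\<in>B'. c b * b x)) = (%y. c b * V b y + (\<Sum>b\<in>B'. c b * V b y))"
    by (simp only: V_add V_scale insert.IH)
   thus ?case using insert by simp
  qed
  have "AE y in N. V f y = V (%x. h x + (\<Sum>b\<in>B. c b * b x)) y"
   by (rule V_cong_AE[OF f(1) L2_add[OF h sumL] f(2)])
  hence e: "AE y in N. g y = S' y + (\<Sum>b\<in>B. c b * V b y)"
   using g unfolding V_add Vs[OF B(1)] by eventually_elim simp
  define c' where "c' d = (\<Sum>b | b \<in> B \<and> V b = d. c b)" for d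
  have "(\<Sum>b\<in>B. c b * V b y) = (\<Sum>d\<in>V ` B. c' d * d y)" for y
  proof -
   have "(\<Sum>b\<in>B. c b * V b y) = (\<Sum>d\<in>V ` B. \<Sum>b | b \<in> B \<and> V b = d. c b * V b y)"
    by (rule sum.image_gen[OF B(1)])
   also have "... = (\<Sum>d\<in>V ` B. c' d * d y)"
    unfolding c'_def sum_distrib_right by (intro sum.cong refl) auto
   finally show ?thesis .
  qed
  with e show ?thesis by (intro exI[of _ c']) simp
 qed
 have "\<exists>B. finite B \<and> B \<subseteq> L2 N \<and>
    (\<forall>f\<in>L2 N. (AE x in N. S f x = 0) --> (\<exists>c. AE x in N. f x = (\<Sum>b\<in>B. c b * b x)))"
 proof (intro exI[of _ "V ` B1"] conjI ballI impI)
  fix g assume g: "g \<in> L2 N" "AE x in N. S g x = 0"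
  have "AE x in M. W (S g) x = W (%x. 0) x"
   by (rule W_cong_AE[OF bounded_op_L2[OF S g(1)] L2_zero g(2)])
  moreover have "W (%x. 0) = (%x. 0)" using W_scale[of 0 "%_. 0"] by simp
  ultimately have "AE x in M. T (W g) x = 0" using ST[OF g(1)]
   by (auto elim: eventually_elim2)
  then obtain c where c: "AE x in M. W g x = (\<Sum>b\<in>B1. c b * b x)" using B1(3)[OF W_L2[OF g(1)]] by blast
  have V0: "V (%x. 0) = (%x. 0)" using V_scale[of 0 "%_. 0"] by simp
  show "\<exists>c. AE y in N. g y = (\<Sum>b\<in>V ` B1. c b * b y)"
   using comb[OF B1(1,2) W_L2[OF g(1)], of "%x. 0" c g "%x. 0"] c VW[OF g(1)] L2_zero[of M] V0 by simp
 qed (use B1 V_L2 in auto)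
 moreover have "\<exists>h\<in>L2 N. AE x in N. S h x = g x"
  if "(\<forall>n::nat. f n \<in> L2 N) \<and> g \<in> L2 N \<and> (%n. L2_norm N (%x. S (f n) x - g x)) \<longlonglongrightarrow> 0" for f g
 proof -
  have f: "f n \<in> L2 N" and g: "g \<in> L2 N" for n using that by auto
  have "L2_norm M (%x. T (W (f n)) x - W g x) = L2_norm N (%x. S (f n) x - g x)" for n
  proof -
   have "L2_norm M (%x. T (W (f n)) x - W g x) = L2_norm M (%x. W (S (f n)) x - W g x)"
    by (rule L2_norm_cong_AE[OF L2_diff L2_diff])
      (use ST[OF f, of n] in \<open>auto intro: W_L2 bounded_op_L2[OF S] bounded_op_L2[OF T] f g elim: eventually_mono\<close>)
   also have "... = L2_norm N (%x. S (f n) x - g x)"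
    using W_norm[OF L2_diff[OF bounded_op_L2[OF S f] g]] by (simp only: W_diff)
   finally show ?thesis .
  qed
  hence "\<exists>h\<in>L2 M. AE x in M. T h x = W g x"
   using that W_L2[OF f] W_L2[OF g] by (intro cl[of "%n. W (f n)"] conjI allI) simp_all
  then obtain h where h: "h \<in> L2 M" "AE x in M. T h x = W g x" by blast
  have "AE y in N. V (T h) y = V (W g) y"
   by (rule V_cong_AE[OF bounded_op_L2[OF T h(1)] W_L2[OF g] h(2)])
  with iT[OF h(1)] VW[OF g] have "AE y in N. S (V h) y = g y" by eventually_elim simp
  thus ?thesis using V_L2[OF h(1)] by blast
 qed
 moreover have "\<exists>B. finite B \<and> B \<subseteq> L2 N \<and>
    (\<forall>g\<in>L2 N. \<exists>h\<in>L2 N. \<exists>c. AE x in N. g x = S h x + (\<Sum>b\<in>B. c b * b x))"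
 proof (intro exI[of _ "V ` B2"] conjI ballI)
  fix g assume g: "g \<in> L2 N"
  obtain h c where h: "h \<in> L2 M" "AE x in M. W g x = T h x + (\<Sum>b\<in>B2. c b * b x)"
   using B2(3)[OF W_L2[OF g]] by blast
  show "\<exists>h\<in>L2 N. \<exists>c. AE x in N. g x = S h x + (\<Sum>b\<in>V ` B2. c b * b x)"
   using comb[OF B2(1,2) W_L2[OF g] h(2) bounded_op_L2[OF T h(1)] VW[OF g] iT[OF h(1)]]
    V_L2[OF h(1)] by blast
 qed (use B2 V_L2 in auto)
 ultimately show ?thesis unfolding fredholm_def using S by blast
qed

end

section \<open>Schur's test\<close>

lemma weighted_Cauchy_Schwarz:
 fixes b p f :: "'a => real"
 assumes [measurable]: "b \<in> borel_measurable M" "p \<in> borel_measurable M" "f \<in> borel_measurable M"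
  and pos: "\<And>x. x \<in> space M ==> 0 <= b x" "\<And>x. x \<in> space M ==> 0 < p x"
   "\<And>x. x \<in> space M ==> 0 <= f x"
 shows "(\<integral>\<^sup>+x. ennreal (b x * f x) \<partial>M)\<^sup>2
  <= (\<integral>\<^sup>+x. ennreal (b x * p x) \<partial>M) * (\<integral>\<^sup>+x. ennreal (b x * (f x)\<^sup>2 / p x) \<partial>M)"
proof -
 have split: "(\<integral>\<^sup>+x. ennreal (b x * f x) \<partial>M)
   = (\<integral>\<^sup>+x. ennreal (sqrt (b x * p x)) * ennreal (sqrt (b x / p x) * f x) \<partial>M)"
 proof (rule nn_integral_cong)
  fix x assume x: "x \<in> space M"
  have "sqrt (b x * p x) * sqrt (b x / p x) = b x"
   using pos[OF x] by (simp add: real_sqrt_mult real_sqrt_divide)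
  hence e: "b x * f x = sqrt (b x * p x) * (sqrt (b x / p x) * f x)" by (simp only: mult.assoc[symmetric])
  show "ennreal (b x * f x) = ennreal (sqrt (b x * p x)) * ennreal (sqrt (b x / p x) * f x)"
   unfolding e by (rule ennreal_mult) (use pos[OF x] in auto)
 qed
 have 1: "(\<integral>\<^sup>+x. (ennreal (sqrt (b x * p x)))\<^sup>2 \<partial>M) = (\<integral>\<^sup>+x. ennreal (b x * p x) \<partial>M)"
  by (rule nn_integral_cong) (use pos in \<open>simp add: ennreal_power less_imp_le\<close>)
 have 2: "(\<integral>\<^sup>+x. (ennreal (sqrt (b x / p x) * f x))\<^sup>2 \<partial>M) = (\<integral>\<^sup>+x. ennreal (b x * (f x)\<^sup>2 / p x) \<partial>M)"
  by (rule nn_integral_cong) (use pos in \<open>simp add: ennreal_power power_mult_distrib less_imp_le\<close>)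
 show ?thesis unfolding split 1[symmetric] 2[symmetric]
  by (rule Cauchy_Schwarz_nn_integral) measurable
qed

text \<open>
  Schur's test with a single positive test function \<open>p\<close> for both marginals of the modulus of the kernel.
\<close>

locale schur_kernel = sigma_finite_measure M for M :: "'a measure" +
 fixes b :: "'a => 'a => complex" and p :: "'a => real" and C :: real
 assumes kernel_measurable [measurable]: "(%(x, y). b x y) \<in> borel_measurable (M \<Otimes>\<^sub>M M)"
  and weight_measurable [measurable]: "p \<in> borel_measurable M"
  and weight_pos: "x \<in> space M ==> 0 < p x"
  and C_nonneg: "0 <= C"
  and row: "x \<in> space M ==> (\<integral>\<^sup>+y. ennreal (cmod (b x y) * p y) \<partial>M) <= ennreal (C * p x)"
  and col: "y \<in> space M ==> (\<integral>\<^sup>+x. ennreal (cmod (b x y) * p x) \<partial>M) <= ennreal (C * p y)"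
begin

sublocale pair: pair_sigma_finite M M ..

definition int_op :: "'a op" where
 "int_op f x = (\<integral>y. b x y * f y \<partial>M)"

lemma abs_bound:
 assumes [measurable]: "f \<in> borel_measurable M"
 shows "(\<integral>\<^sup>+x. (\<integral>\<^sup>+y. ennreal (cmod (b x y) * cmod (f y)) \<partial>M)\<^sup>2 \<partial>M)
  <= ennreal (C\<^sup>2) * (\<integral>\<^sup>+y. ennreal ((cmod (f y))\<^sup>2) \<partial>M)"
proof -
 have bm [measurable]: "b x \<in> borel_measurable M" if "x \<in> space M" for x
  using measurable_compose[OF measurable_Pair1'[OF that] kernel_measurable] by (simp add: comp_def)
 have "(\<integral>\<^sup>+x. (\<integral>\<^sup>+y. ennreal (cmod (b x y) * cmod (f y)) \<partial>M)\<^sup>2 \<partial>M)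
   <= (\<integral>\<^sup>+x. (\<integral>\<^sup>+y. ennreal (C * p x) * ennreal (cmod (b x y) * (cmod (f y))\<^sup>2 / p y) \<partial>M) \<partial>M)"
 proof (rule nn_integral_mono)
  fix x assume x: "x \<in> space M"
  note [measurable] = bm[OF x]
  have "(\<integral>\<^sup>+y. ennreal (cmod (b x y) * cmod (f y)) \<partial>M)\<^sup>2
    <= (\<integral>\<^sup>+y. ennreal (cmod (b x y) * p y) \<partial>M)
     * (\<integral>\<^sup>+y. ennreal (cmod (b x y) * (cmod (f y))\<^sup>2 / p y) \<partial>M)"
   by (rule weighted_Cauchy_Schwarz) (simp_all add: weight_pos)
  also have "... <= ennreal (C * p x) * (\<integral>\<^sup>+y. ennreal (cmod (b x y) * (cmod (f y))\<^sup>2 / p y) \<partial>M)"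
   by (rule mult_right_mono[OF row[OF x]]) simp
  finally show "(\<integral>\<^sup>+y. ennreal (cmod (b x y) * cmod (f y)) \<partial>M)\<^sup>2
    <= (\<integral>\<^sup>+y. ennreal (C * p x) * ennreal (cmod (b x y) * (cmod (f y))\<^sup>2 / p y) \<partial>M)"
   by (simp add: nn_integral_cmult)
 qed
 also have "... = (\<integral>\<^sup>+y. (\<integral>\<^sup>+x. ennreal (C * p x) * ennreal (cmod (b x y) * (cmod (f y))\<^sup>2 / p y) \<partial>M) \<partial>M)"
  by (rule pair.Fubini'[symmetric]) measurable
 also have "... = (\<integral>\<^sup>+y. ennreal (C * (cmod (f y))\<^sup>2 / p y) * (\<integral>\<^sup>+x. ennreal (cmod (b x y) * p x) \<partial>M) \<partial>M)"
 proof (rule nn_integral_cong)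
  fix y assume y: "y \<in> space M"
  have [measurable]: "(%x. b x y) \<in> borel_measurable M"
   using measurable_compose[OF measurable_Pair2'[OF y] kernel_measurable] by (simp add: comp_def)
  have "(\<integral>\<^sup>+x. ennreal (C * p x) * ennreal (cmod (b x y) * (cmod (f y))\<^sup>2 / p y) \<partial>M)
    = (\<integral>\<^sup>+x. ennreal (C * (cmod (f y))\<^sup>2 / p y) * ennreal (cmod (b x y) * p x) \<partial>M)"
   by (rule nn_integral_cong)
     (use y in \<open>simp add: C_nonneg weight_pos less_imp_le ac_simps flip: ennreal_mult\<close>)
  thus "(\<integral>\<^sup>+x. ennreal (C * p x) * ennreal (cmod (b x y) * (cmod (f y))\<^sup>2 / p y) \<partial>M)
    = ennreal (C * (cmod (f y))\<^sup>2 / p y) * (\<integral>\<^sup>+x. ennreal (cmod (b x y) * p x) \<partial>M)"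
   by (simp add: nn_integral_cmult)
 qed
 also have "... <= (\<integral>\<^sup>+y. ennreal (C * (cmod (f y))\<^sup>2 / p y) * ennreal (C * p y) \<partial>M)"
  by (intro nn_integral_mono mult_left_mono col) auto
 also have "... = (\<integral>\<^sup>+y. ennreal (C\<^sup>2) * ennreal ((cmod (f y))\<^sup>2) \<partial>M)"
 proof (rule nn_integral_cong)
  fix y assume y: "y \<in> space M"
  have "C * (cmod (f y))\<^sup>2 / p y * (C * p y) = C\<^sup>2 * (cmod (f y))\<^sup>2"
   using weight_pos[OF y] by (simp add: power2_eq_square)
  thus "ennreal (C * (cmod (f y))\<^sup>2 / p y) * ennreal (C * p y) = ennreal (C\<^sup>2) * ennreal ((cmod (f y))\<^sup>2)"
   using weight_pos[OF y] C_nonneg by (simp flip: ennreal_mult)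
 qed
 finally show ?thesis by (simp add: nn_integral_cmult)
qed

lemma abs_bound_L2:
 assumes "f \<in> L2 M"
 shows "(\<integral>\<^sup>+x. (\<integral>\<^sup>+y. ennreal (cmod (b x y) * cmod (f y)) \<partial>M)\<^sup>2 \<partial>M) <= ennreal ((C * L2_norm M f)\<^sup>2)"
 using abs_bound[OF L2_measurable[OF assms]] C_nonneg
 by (simp add: L2_norm_nn[OF assms, symmetric] power_mult_distrib flip: ennreal_mult)

lemma int_op_measurable:
 assumes [measurable]: "f \<in> borel_measurable M" shows "int_op f \<in> borel_measurable M"
 unfolding int_op_def[abs_def] by measurable

lemma AE_integrable:
 assumes f: "f \<in> L2 M" shows "AE x in M. integrable M (%y. b x y * f y)"
proof -
 have [measurable]: "f \<in> borel_measurable M" by (rule L2_measurable[OF f])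
 have "(\<integral>\<^sup>+x. (\<integral>\<^sup>+y. ennreal (cmod (b x y) * cmod (f y)) \<partial>M)\<^sup>2 \<partial>M) \<noteq> \<infinity>"
  using abs_bound_L2[OF f] by (auto simp: top_unique)
 hence "AE x in M. (\<integral>\<^sup>+y. ennreal (cmod (b x y) * cmod (f y)) \<partial>M)\<^sup>2 \<noteq> \<infinity>"
  by (intro nn_integral_PInf_AE) measurable
 thus ?thesis using AE_space
 proof eventually_elim
  case (elim x)
  note x = elim(2)
  have [measurable]: "b x \<in> borel_measurable M"
   using measurable_compose[OF measurable_Pair1'[OF x] kernel_measurable] by (simp add: comp_def)
  have "(\<integral>\<^sup>+y. ennreal (cmod (b x y) * cmod (f y)) \<partial>M) < \<infinity>"
   using elim(1) by (auto simp: less_top power2_eq_square ennreal_mult_eq_top_iff)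
  thus ?case by (intro integrableI_bounded) (simp_all add: norm_mult)
 qed
qed

lemma norm_int_op_le:
 "ennreal (cmod (int_op f x)) <= (\<integral>\<^sup>+y. ennreal (cmod (b x y) * cmod (f y)) \<partial>M)"
proof (cases "integrable M (%y. b x y * f y)")
 case True
 from integral_norm_bound_ennreal[OF this] show ?thesis by (simp add: int_op_def norm_mult)
qed (simp add: int_op_def not_integrable_integral_eq)

lemma int_op_bound_nn:
 assumes f: "f \<in> L2 M"
 shows "(\<integral>\<^sup>+x. ennreal ((cmod (int_op f x))\<^sup>2) \<partial>M) <= ennreal ((C * L2_norm M f)\<^sup>2)"
proof -
 have "(\<integral>\<^sup>+x. ennreal ((cmod (int_op f x))\<^sup>2) \<partial>M)
   <= (\<integral>\<^sup>+x. (\<integral>\<^sup>+y. ennreal (cmod (b x y) * cmod (f y)) \<partial>M)\<^sup>2 \<partial>M)"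
  by (rule nn_integral_mono) (simp flip: ennreal_power add: power_mono norm_int_op_le)
 thus ?thesis using abs_bound_L2[OF f] by (rule order.trans)
qed

lemma int_op_L2: "f \<in> L2 M ==> int_op f \<in> L2 M"
 by (rule L2_I_le[OF int_op_measurable[OF L2_measurable] int_op_bound_nn])

lemma int_op_bound: "f \<in> L2 M ==> L2_norm M (int_op f) <= C * L2_norm M f"
 by (rule L2_norm_leI[OF int_op_L2 _ int_op_bound_nn]) (simp_all add: C_nonneg L2_norm_nonneg)

lemma bounded_int_op: "bounded_op M int_op"
 unfolding bounded_op_def
proof (intro conjI ballI allI)
 show "int_op f \<in> L2 M" if "f \<in> L2 M" for f using that by (rule int_op_L2)
 show "AE x in M. int_op (%x. f x + g x) x = int_op f x + int_op g x"
  if "f \<in> L2 M" "g \<in> L2 M" for f g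
  using AE_integrable[OF that(1)] AE_integrable[OF that(2)]
  by eventually_elim (simp add: int_op_def distrib_left)
 show "AE x in M. int_op (%x. c * f x) x = c * int_op f x" for f c
  by (rule AE_I2) (simp add: int_op_def mult.left_commute[of _ c])
 show "\<exists>B. \<forall>f\<in>L2 M. L2_norm M (int_op f) <= B * L2_norm M f"
  using int_op_bound by blast
qed

lemma transposed: "schur_kernel M (%x y. cnj (b y x)) p C"
proof
 have "(%z. case (snd z, fst z) of (x, y) => b x y) \<in> borel_measurable (M \<Otimes>\<^sub>M M)"
  by measurable
 hence [measurable]: "(%z. b (snd z) (fst z)) \<in> borel_measurable (M \<Otimes>\<^sub>M M)" by simp
 show "(%(x, y). cnj (b y x)) \<in> borel_measurable (M \<Otimes>\<^sub>M M)"
  unfolding split_beta' by measurable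
qed (use weight_pos C_nonneg row col in auto)

lemma transposed_adjoint: "adjoint_pair M int_op (schur_kernel.int_op M (%x y. cnj (b y x)))"
proof -
 interpret t: schur_kernel M "%x y. cnj (b y x)" p C by (rule transposed)
 have "L2_inner M (int_op u) v = L2_inner M u (t.int_op v)" if u: "u \<in> L2 M" and v: "v \<in> L2 M" for u v
 proof -
  have [measurable]: "u \<in> borel_measurable M" "v \<in> borel_measurable M"
   using u v by (auto intro: L2_measurable)
  define F where "F = (%(x, y). b x y * u y * cnj (v x))"
  have Fm [measurable]: "F \<in> borel_measurable (M \<Otimes>\<^sub>M M)"
   unfolding F_def by measurable
  have "(\<integral>\<^sup>+z. ennreal (cmod (F z)) \<partial>(M \<Otimes>\<^sub>M M)) = (\<integral>\<^sup>+x. (\<integral>\<^sup>+y. ennreal (cmod (F (x, y))) \<partial>M) \<partial>M)"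
   by (rule nn_integral_fst[symmetric]) measurable
  also have "... = (\<integral>\<^sup>+x. (\<integral>\<^sup>+y. ennreal (cmod (b x y) * cmod (u y)) \<partial>M) * ennreal (cmod (v x)) \<partial>M)"
  proof (rule nn_integral_cong)
   fix x assume x: "x \<in> space M"
   have [measurable]: "b x \<in> borel_measurable M"
    using measurable_compose[OF measurable_Pair1'[OF x] kernel_measurable] by (simp add: comp_def)
   show "(\<integral>\<^sup>+y. ennreal (cmod (F (x, y))) \<partial>M)
     = (\<integral>\<^sup>+y. ennreal (cmod (b x y) * cmod (u y)) \<partial>M) * ennreal (cmod (v x))"
    by (subst nn_integral_multc[symmetric]) (simp_all add: F_def norm_mult ennreal_mult)
  qed
  finally have e: "(\<integral>\<^sup>+z. ennreal (cmod (F z)) \<partial>(M \<Otimes>\<^sub>M M)) = ..." .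
  have "(\<integral>\<^sup>+z. ennreal (cmod (F z)) \<partial>(M \<Otimes>\<^sub>M M))\<^sup>2
    <= (\<integral>\<^sup>+x. (\<integral>\<^sup>+y. ennreal (cmod (b x y) * cmod (u y)) \<partial>M)\<^sup>2 \<partial>M) * (\<integral>\<^sup>+x. (ennreal (cmod (v x)))\<^sup>2 \<partial>M)"
   unfolding e by (rule Cauchy_Schwarz_nn_integral) measurable
  also have "... <= ennreal ((C * L2_norm M u)\<^sup>2) * ennreal ((L2_norm M v)\<^sup>2)"
   using L2_norm_nn[OF v] by (intro mult_mono abs_bound_L2[OF u]) (simp_all add: ennreal_power)
  also have "... < \<infinity>" by (simp add: ennreal_mult_less_top)
  finally have "(\<integral>\<^sup>+z. ennreal (cmod (F z)) \<partial>(M \<Otimes>\<^sub>M M)) < \<infinity>"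
   by (auto simp: power2_eq_square ennreal_mult_less_top)
  hence F: "integrable (M \<Otimes>\<^sub>M M) F" by (intro integrableI_bounded Fm) simp
  have "L2_inner M (int_op u) v = (\<integral>x. (\<integral>y. F (x, y) \<partial>M) \<partial>M)"
   unfolding L2_inner_def int_op_def F_def by simp
  also have "... = (\<integral>y. (\<integral>x. F (x, y) \<partial>M) \<partial>M)"
   using pair.Fubini_integral[of "%x y. F (x, y)"] F by (simp add: case_prod_eta)
  also have "... = (\<integral>y. u y * cnj (t.int_op v y) \<partial>M)"
  proof (rule Bochner_Integration.integral_cong[OF refl])
   fix y
   have "cnj (t.int_op v y) = (\<integral>x. cnj (cnj (b x y) * v x) \<partial>M)"
    unfolding t.int_op_def by (rule Bochner_Integration.integral_cnj[symmetric])
   hence "u y * cnj (t.int_op v y) = (\<integral>x. u y * (b x y * cnj (v x)) \<partial>M)" by simp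
   thus "(\<integral>x. F (x, y) \<partial>M) = u y * cnj (t.int_op v y)"
    by (auto simp: F_def ac_simps)
  qed
  finally show ?thesis by (simp add: L2_inner_def)
 qed
 thus ?thesis by (simp add: adjoint_pair_def bounded_int_op t.bounded_int_op)
qed

end

lemma cis_measurable [measurable (raw)]:
 "f \<in> borel_measurable M ==> (%x. cis (f x)) \<in> borel_measurable M"
 by (rule borel_measurable_continuous_on[where f=cis]) (auto intro!: continuous_intros simp: cis_conv_exp)

lemma nn_integral_reflect:
 assumes [measurable]: "f \<in> borel_measurable borel"
 shows "(LNINT t. f ((s::real) - t)) = (LNINT t. f t)"
 by (subst nn_integral_real_affine[of f "-1" s]) simp_all

section \<open>Convolution kernels with values in operators\<close>

text \<open>
  The hypotheses are Schur's test for the integrated kernel, with the extra moment \<open>1 + \<bar>s\<bar>\<close>, which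
  measures how far a translation in \<open>s\<close> moves mass across the ends of a long interval.
\<close>

locale convolution_kernel = sigma_finite_measure \<nu> for \<nu> :: "'b measure" +
 fixes k :: "real => 'b => 'b => real" and p :: "'b => real" and C :: real
 assumes k_measurable: "(%(s, x, y). k s x y) \<in> borel_measurable (borel \<Otimes>\<^sub>M \<nu> \<Otimes>\<^sub>M \<nu>)"
  and p_measurable [measurable]: "p \<in> borel_measurable \<nu>"
  and p_pos: "x \<in> space \<nu> ==> 0 < p x"
  and C_nonneg: "0 <= C"
  and row: "x \<in> space \<nu> ==>
   (\<integral>\<^sup>+y. (LNINT s. ennreal ((1 + \<bar>s\<bar>) * \<bar>k s x y\<bar>)) * ennreal (p y) \<partial>\<nu>) <= ennreal (C * p x)"
  and col: "y \<in> space \<nu> ==>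
   (\<integral>\<^sup>+x. (LNINT s. ennreal ((1 + \<bar>s\<bar>) * \<bar>k s x y\<bar>)) * ennreal (p x) \<partial>\<nu>) <= ennreal (C * p y)"

text \<open>
  Reflection in \<open>s\<close> and transposition preserve the hypotheses, so that every result about a
  convolution applies to its adjoint.
\<close>

lemma (in convolution_kernel) flipped:
 "convolution_kernel \<nu> (%s x y. k (- s) y x) p C"
proof
 have "(%z. case (- fst z, snd (snd z), fst (snd z)) of (s, x, y) => k s x y) \<in> borel_measurable (borel \<Otimes>\<^sub>M \<nu> \<Otimes>\<^sub>M \<nu>)"
  by (rule measurable_compose[OF _ k_measurable]) measurable
 thus "(%(s, x, y). k (- s) y x) \<in> borel_measurable (borel \<Otimes>\<^sub>M \<nu> \<Otimes>\<^sub>M \<nu>)"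
  by (simp add: split_beta')
 have km: "(%s. k s x y) \<in> borel_measurable borel" if "x \<in> space \<nu>" "y \<in> space \<nu>" for x y
  using measurable_compose[OF measurable_Pair2'[of "(x, y)" "\<nu> \<Otimes>\<^sub>M \<nu>" borel] k_measurable] that
  by (simp add: space_pair_measure comp_def)
 have r: "(LNINT s. ennreal ((1 + \<bar>s\<bar>) * \<bar>k (- s) x y\<bar>)) = (LNINT s. ennreal ((1 + \<bar>s\<bar>) * \<bar>k s x y\<bar>))"
  if "x \<in> space \<nu>" "y \<in> space \<nu>" for x y
  using nn_integral_reflect[of "%s. ennreal ((1 + \<bar>s\<bar>) * \<bar>k s x y\<bar>)" 0] km[OF that] by simp
 show "(\<integral>\<^sup>+y. (LNINT s. ennreal ((1 + \<bar>s\<bar>) * \<bar>k (- s) y x\<bar>)) * ennreal (p y) \<partial>\<nu>) <= ennreal (C * p x)"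
  if "x \<in> space \<nu>" for x
  using col[OF that] r that by (simp cong: nn_integral_cong)
 show "(\<integral>\<^sup>+x. (LNINT s. ennreal ((1 + \<bar>s\<bar>) * \<bar>k (- s) y x\<bar>)) * ennreal (p x) \<partial>\<nu>) <= ennreal (C * p y)"
  if "y \<in> space \<nu>" for y
  using row[OF that] r that by (simp cong: nn_integral_cong)
qed (use p_pos C_nonneg in auto)

context convolution_kernel
begin

abbreviation cyl :: "(real \<times> 'b) measure" where "cyl == lborel \<Otimes>\<^sub>M \<nu>"

definition cyl_kernel :: "real \<times> 'b => real \<times> 'b => complex" where
 "cyl_kernel z w = of_real (k (fst z - fst w) (snd z) (snd w))"

definition symbol_kernel :: "real => 'b => 'b => complex" where
 "symbol_kernel \<xi> x y = (\<integral>s. of_real (k s x y) * cis (- (\<xi> * s)) \<partial>lborel)"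

sublocale real_pair: pair_sigma_finite lborel \<nu>
 by (intro pair_sigma_finite.intro sigma_finite_measure_axioms sigma_finite_lborel)

lemma k_measurable_comp [measurable (raw)]:
 assumes "f \<in> M \<rightarrow>\<^sub>M borel" "g \<in> M \<rightarrow>\<^sub>M \<nu>" "h \<in> M \<rightarrow>\<^sub>M \<nu>"
 shows "(%x. k (f x) (g x) (h x)) \<in> borel_measurable M"
 using measurable_compose[OF _ k_measurable, of "%x. (f x, g x, h x)" M] assms by simp

lemma abs_k_le: "\<bar>k s x y\<bar> <= (1 + \<bar>s\<bar>) * \<bar>k s x y\<bar>"
 using mult_right_mono[of 1 "1 + \<bar>s\<bar>" "\<bar>k s x y\<bar>"] by simp

lemma row': "x \<in> space \<nu> ==>
  (\<integral>\<^sup>+y. (LNINT s. ennreal \<bar>k s x y\<bar>) * ennreal (p y) \<partial>\<nu>) <= ennreal (C * p x)"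
 by (rule order.trans[OF nn_integral_mono row]) (auto intro!: mult_right_mono nn_integral_mono ennreal_leI abs_k_le)

lemma col': "y \<in> space \<nu> ==>
  (\<integral>\<^sup>+x. (LNINT s. ennreal \<bar>k s x y\<bar>) * ennreal (p x) \<partial>\<nu>) <= ennreal (C * p y)"
 by (rule order.trans[OF nn_integral_mono col]) (auto intro!: mult_right_mono nn_integral_mono ennreal_leI abs_k_le)

lemma cyl_schur: "schur_kernel cyl cyl_kernel (%z. p (snd z)) C"
proof -
 have s: "sigma_finite_measure cyl"
  by (rule sigma_finite_pair_measure[OF sigma_finite_lborel sigma_finite_measure_axioms])
 have r: "(\<integral>\<^sup>+w. ennreal (cmod (cyl_kernel (s, x) w) * p (snd w)) \<partial>cyl) <= ennreal (C * p x)"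
  if x: "x \<in> space \<nu>" for s x
 proof -
  have "(\<integral>\<^sup>+w. ennreal (cmod (cyl_kernel (s, x) w) * p (snd w)) \<partial>cyl)
    = (\<integral>\<^sup>+y. (LNINT t. ennreal (\<bar>k (s - t) x y\<bar> * p y)) \<partial>\<nu>)"
   using x by (subst real_pair.nn_integral_snd[symmetric]) (simp_all add: cyl_kernel_def)
  also have "... = (\<integral>\<^sup>+y. (LNINT t. ennreal \<bar>k t x y\<bar>) * ennreal (p y) \<partial>\<nu>)"
  proof (rule nn_integral_cong)
   fix y assume y: "y \<in> space \<nu>"
   have "(LNINT t. ennreal (\<bar>k (s - t) x y\<bar> * p y)) = (LNINT t. ennreal \<bar>k (s - t) x y\<bar> * ennreal (p y))"
    using p_pos[OF y] by (simp add: ennreal_mult)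
   also have "... = (LNINT t. ennreal \<bar>k (s - t) x y\<bar>) * ennreal (p y)"
    using x y by (intro nn_integral_multc) measurable
   also have "(LNINT t. ennreal \<bar>k (s - t) x y\<bar>) = (LNINT t. ennreal \<bar>k t x y\<bar>)"
    using x y by (intro nn_integral_reflect[of "%t. ennreal \<bar>k t x y\<bar>"]) measurable
   finally show "(LNINT t. ennreal (\<bar>k (s - t) x y\<bar> * p y)) = (LNINT t. ennreal \<bar>k t x y\<bar>) * ennreal (p y)" .
  qed
  also have "... <= ennreal (C * p x)" by (rule row'[OF x])
  finally show ?thesis .
 qed
 have c: "(\<integral>\<^sup>+z. ennreal (cmod (cyl_kernel z (t, y)) * p (snd z)) \<partial>cyl) <= ennreal (C * p y)"
  if y: "y \<in> space \<nu>" for t y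
 proof -
  have "(\<integral>\<^sup>+z. ennreal (cmod (cyl_kernel z (t, y)) * p (snd z)) \<partial>cyl)
    = (\<integral>\<^sup>+x. (LNINT s. ennreal (\<bar>k (s - t) x y\<bar> * p x)) \<partial>\<nu>)"
   using y by (subst real_pair.nn_integral_snd[symmetric]) (simp_all add: cyl_kernel_def)
  also have "... = (\<integral>\<^sup>+x. (LNINT s. ennreal \<bar>k s x y\<bar>) * ennreal (p x) \<partial>\<nu>)"
  proof (rule nn_integral_cong)
   fix x assume x: "x \<in> space \<nu>"
   have "(LNINT s. ennreal (\<bar>k (s - t) x y\<bar> * p x)) = (LNINT s. ennreal \<bar>k (s - t) x y\<bar> * ennreal (p x))"
    using p_pos[OF x] by (simp add: ennreal_mult)
   also have "... = (LNINT s. ennreal \<bar>k (s - t) x y\<bar>) * ennreal (p x)"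
    using x y by (intro nn_integral_multc) measurable
   also have "(LNINT s. ennreal \<bar>k (s - t) x y\<bar>) = (LNINT s. ennreal \<bar>k s x y\<bar>)"
    using x y nn_integral_real_affine[of "%s. ennreal \<bar>k s x y\<bar>" 1 "- t"] by simp
   finally show "(LNINT s. ennreal (\<bar>k (s - t) x y\<bar> * p x)) = (LNINT s. ennreal \<bar>k s x y\<bar>) * ennreal (p x)" .
  qed
  also have "... <= ennreal (C * p y)" by (rule col'[OF y])
  finally show ?thesis .
 qed
 show ?thesis
 proof (intro schur_kernel.intro s schur_kernel_axioms.intro)
  show "(%(z, w). cyl_kernel z w) \<in> borel_measurable (cyl \<Otimes>\<^sub>M cyl)"
   unfolding cyl_kernel_def split_beta' by measurable
  show "(%z. p (snd z)) \<in> borel_measurable cyl" by measurable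
 qed (use r c p_pos C_nonneg in \<open>auto simp: space_pair_measure\<close>)
qed

lemma norm_symbol_kernel: "ennreal (cmod (symbol_kernel \<xi> x y)) <= (LNINT s. ennreal \<bar>k s x y\<bar>)"
proof (cases "integrable lborel (%s. of_real (k s x y) * cis (- (\<xi> * s)))")
 case True
 from integral_norm_bound_ennreal[OF this] show ?thesis by (simp add: symbol_kernel_def norm_mult)
qed (simp add: symbol_kernel_def not_integrable_integral_eq)

lemma symbol_schur: "schur_kernel \<nu> (symbol_kernel \<xi>) p C"
proof
 show "(%(x, y). symbol_kernel \<xi> x y) \<in> borel_measurable (\<nu> \<Otimes>\<^sub>M \<nu>)"
  unfolding symbol_kernel_def split_beta' by measurable
 show "(\<integral>\<^sup>+y. ennreal (cmod (symbol_kernel \<xi> x y) * p y) \<partial>\<nu>) <= ennreal (C * p x)" if "x \<in> space \<nu>" for x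
  by (rule order.trans[OF nn_integral_mono row'[OF that]])
    (auto simp: ennreal_mult'' p_pos less_imp_le intro!: mult_right_mono norm_symbol_kernel)
 show "(\<integral>\<^sup>+x. ennreal (cmod (symbol_kernel \<xi> x y) * p x) \<partial>\<nu>) <= ennreal (C * p y)" if "y \<in> space \<nu>" for y
  by (rule order.trans[OF nn_integral_mono col'[OF that]])
    (auto simp: ennreal_mult'' p_pos less_imp_le intro!: mult_right_mono norm_symbol_kernel)
qed (use p_pos C_nonneg in auto)

definition conv :: "(real \<times> 'b) op" where
 "conv U z = (\<integral>w. cyl_kernel z w * U w \<partial>cyl)"

definition symbol :: "real => 'b op" where
 "symbol \<xi> v x = (\<integral>y. symbol_kernel \<xi> x y * v y \<partial>\<nu>)"

lemma conv_int_op: "schur_kernel.int_op cyl cyl_kernel = conv"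
 by (intro ext) (simp add: schur_kernel.int_op_def[OF cyl_schur] conv_def)

lemma symbol_int_op: "schur_kernel.int_op \<nu> (symbol_kernel \<xi>) = symbol \<xi>"
 by (intro ext) (simp add: schur_kernel.int_op_def[OF symbol_schur] symbol_def)

lemmas bounded_conv = schur_kernel.bounded_int_op[OF cyl_schur, unfolded conv_int_op]
lemmas bounded_symbol = schur_kernel.bounded_int_op[OF symbol_schur, unfolded symbol_int_op]

lemma conv_adjoint:
 "adjoint_pair cyl conv (convolution_kernel.conv \<nu> (%s x y. k (- s) y x))"
proof -
 interpret f: convolution_kernel \<nu> "%s x y. k (- s) y x" p C by (rule flipped)
 have "(%x y. cnj (cyl_kernel y x)) = f.cyl_kernel"
  by (intro ext) (simp add: cyl_kernel_def f.cyl_kernel_def)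
 thus ?thesis using schur_kernel.transposed_adjoint[OF cyl_schur] f.conv_int_op conv_int_op by simp
qed

lemma symbol_adjoint:
 "adjoint_pair \<nu> (symbol \<xi>) (convolution_kernel.symbol \<nu> (%s x y. k (- s) y x) \<xi>)"
proof -
 interpret f: convolution_kernel \<nu> "%s x y. k (- s) y x" p C by (rule flipped)
 have "cnj (symbol_kernel \<xi> y x) = f.symbol_kernel \<xi> x y" for x y
 proof -
  have "cnj (symbol_kernel \<xi> y x) = (\<integral>s. cnj (of_real (k s y x) * cis (- (\<xi> * s))) \<partial>lborel)"
   unfolding symbol_kernel_def by (rule Bochner_Integration.integral_cnj[symmetric])
  also have "... = (\<integral>s. of_real (k (0 + (-1) * s) y x) * cis (- (\<xi> * s)) \<partial>lborel)"
   using lborel_integral_real_affine[of "-1" "%s. of_real (k s y x) * cis (\<xi> * s)" 0]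
   by (simp add: cis_cnj)
  finally show ?thesis by (simp add: f.symbol_kernel_def)
 qed
 hence "(%x y. cnj (symbol_kernel \<xi> y x)) = f.symbol_kernel \<xi>" by (intro ext)
 thus ?thesis using schur_kernel.transposed_adjoint[OF symbol_schur, of \<xi>]
  by (simp only: f.symbol_int_op symbol_int_op)
qed

end

text \<open>
  Bessel's inequality makes the coefficients square summable.
\<close>

lemma orthonormal_weakly_null:
 assumes w: "orthonormal_seq M w" shows "L2_weakly_null M w"
 unfolding L2_weakly_null_def
proof
 fix g assume g: "g \<in> L2 M"
 have wL: "w n \<in> L2 M" for n using w by (simp add: orthonormal_seq_def)
 define c where "c n = L2_inner M g (w n)" for n
 have bessel: "(\<Sum>n<N. (cmod (c n))\<^sup>2) <= (L2_norm M g)\<^sup>2" for N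
 proof -
  define S where "S = (%x. \<Sum>n<N. c n * w n x)"
  define A where "A = (\<Sum>n<N. (cmod (c n))\<^sup>2)"
  have SL: "S \<in> L2 M" unfolding S_def by (intro L2_sum L2_scale wL)
  have SI: "L2_inner M S h = (\<Sum>n<N. c n * L2_inner M (w n) h)" if "h \<in> L2 M" for h
   unfolding S_def by (subst L2_inner_sum) (auto simp: L2_inner_scale that intro: L2_scale wL)
  have "L2_inner M S g = (\<Sum>n<N. c n * cnj (c n))"
   unfolding SI[OF g] c_def by (intro sum.cong refl arg_cong2[of _ _ _ _ "(*)"] L2_inner_cnj)
  also have "... = of_real A" by (simp only: A_def of_real_sum complex_norm_square)
  finally have Sg: "L2_inner M S g = of_real A" .
  have Sw: "L2_inner M S (w m) = c m" if "m < N" for m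
  proof -
   have "L2_inner M S (w m) = (\<Sum>n<N. if n = m then c n else 0)"
    unfolding SI[OF wL] using w by (intro sum.cong) (auto simp: orthonormal_seq_def)
   thus ?thesis using that by simp
  qed
  have "L2_inner M S S = (\<Sum>n<N. c n * cnj (c n))"
   unfolding SI[OF SL] using Sw by (intro sum.cong refl) (simp add: L2_inner_cnj[of M "w _" S])
  also have "... = of_real A" by (simp only: A_def of_real_sum complex_norm_square)
  finally have "complex_of_real ((L2_norm M S)\<^sup>2) = of_real A" by (simp only: L2_inner_self)
  hence SS: "(L2_norm M S)\<^sup>2 = A" using of_real_eq_iff by blast
  have "A = cmod (L2_inner M S g)" unfolding Sg norm_of_real by (simp add: A_def sum_nonneg)
  also have "... <= L2_norm M S * L2_norm M g" by (rule L2_Cauchy_Schwarz[OF SL g])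
  finally have "L2_norm M S * L2_norm M S <= L2_norm M S * L2_norm M g"
   unfolding SS[symmetric] power2_eq_square .
  hence "L2_norm M S <= L2_norm M g" by (rule le_if_mult_self_le[OF _ L2_norm_nonneg])
  thus ?thesis unfolding A_def[symmetric] SS[symmetric] by (rule power_mono[OF _ L2_norm_nonneg])
 qed
 have "summable (%n. (cmod (c n))\<^sup>2)"
  by (rule bounded_imp_summable[where B="(L2_norm M g)\<^sup>2"])
    (use bessel in \<open>auto simp: lessThan_Suc_atMost[symmetric] simp del: sum.lessThan_Suc\<close>)
 hence "(%n. (cmod (c n))\<^sup>2) \<longlonglongrightarrow> 0" by (rule summable_LIMSEQ_zero)
 hence "(%n. sqrt ((cmod (c n))\<^sup>2)) \<longlonglongrightarrow> sqrt 0" by (rule tendsto_real_sqrt)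
 hence "(%n. cmod (L2_inner M (w n) g)) \<longlonglongrightarrow> 0"
  by (simp add: c_def L2_inner_cnj[of M "w _" g])
 thus "(%n. L2_inner M (w n) g) \<longlonglongrightarrow> 0" by (rule tendsto_norm_zero_cancel)
qed

context convolution_kernel
begin

text \<open>
  Here \<open>\<Delta> s r\<close> is the size of the change of a cutoff function between \<open>s - r\<close> and \<open>s\<close>. A cutoff whose
  total change under a shift by \<open>r\<close> is at most linear in \<open>r\<close> yields an error independent of the length
  of the interval; Cauchy--Schwarz with the Schur weight splits the square.
\<close>

lemma smeared_bound:
 fixes \<Delta> :: "real => real => real"
 assumes \<Delta>_meas: "(%(s, r). \<Delta> s r) \<in> borel_measurable (borel \<Otimes>\<^sub>M borel)"
  and \<Delta>: "\<And>s r. 0 <= \<Delta> s r" "\<And>s r. \<Delta> s r <= 1"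
  and D: "0 <= D" "\<And>r. (LNINT s. ennreal (\<Delta> s r)) <= ennreal (D * (1 + \<bar>r\<bar>))"
  and v_meas [measurable]: "v \<in> borel_measurable \<nu>"
 shows "(LNINT s. (\<integral>\<^sup>+x. (\<integral>\<^sup>+w. ennreal (\<bar>k (fst w) x (snd w)\<bar> * \<Delta> s (fst w) * cmod (v (snd w))) \<partial>cyl)\<^sup>2 \<partial>\<nu>))
  <= ennreal (D * C\<^sup>2) * (\<integral>\<^sup>+y. ennreal ((cmod (v y))\<^sup>2) \<partial>\<nu>)"
proof -
 have [measurable (raw)]: "(%x. \<Delta> (f x) (g x)) \<in> borel_measurable M"
  if "f \<in> borel_measurable M" "g \<in> borel_measurable M" for f g and M :: "'z measure"
  using measurable_compose[OF measurable_Pair[OF that] \<Delta>_meas] by simp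
 interpret rc: pair_sigma_finite lborel cyl
  by (intro pair_sigma_finite.intro sigma_finite_lborel
    sigma_finite_pair_measure[OF sigma_finite_lborel sigma_finite_measure_axioms])
 interpret xx: pair_sigma_finite \<nu> \<nu>
  by (intro pair_sigma_finite.intro sigma_finite_measure_axioms)
 define G where "G s x w = ennreal (C * p x) *
   ennreal (\<bar>k (fst w) x (snd w)\<bar> * \<Delta> s (fst w) * (cmod (v (snd w)))\<^sup>2 / p (snd w))" for s x w
 have "(LNINT s. (\<integral>\<^sup>+x. (\<integral>\<^sup>+w. ennreal (\<bar>k (fst w) x (snd w)\<bar> * \<Delta> s (fst w) * cmod (v (snd w))) \<partial>cyl)\<^sup>2 \<partial>\<nu>))
   <= (LNINT s. (\<integral>\<^sup>+x. (\<integral>\<^sup>+w. G s x w \<partial>cyl) \<partial>\<nu>))"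
 proof (intro nn_integral_mono)
  fix s x assume x: "x \<in> space \<nu>"
  have "(\<integral>\<^sup>+w. ennreal (\<bar>k (fst w) x (snd w)\<bar> * \<Delta> s (fst w) * cmod (v (snd w))) \<partial>cyl)\<^sup>2
    <= (\<integral>\<^sup>+w. ennreal (\<bar>k (fst w) x (snd w)\<bar> * \<Delta> s (fst w) * p (snd w)) \<partial>cyl)
     * (\<integral>\<^sup>+w. ennreal (\<bar>k (fst w) x (snd w)\<bar> * \<Delta> s (fst w) * (cmod (v (snd w)))\<^sup>2 / p (snd w)) \<partial>cyl)"
   using x by (intro weighted_Cauchy_Schwarz) (auto simp: \<Delta> space_pair_measure p_pos)
  also have "... <= ennreal (C * p x) *
     (\<integral>\<^sup>+w. ennreal (\<bar>k (fst w) x (snd w)\<bar> * \<Delta> s (fst w) * (cmod (v (snd w)))\<^sup>2 / p (snd w)) \<partial>cyl)"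
  proof (rule mult_right_mono)
   have "(\<integral>\<^sup>+w. ennreal (\<bar>k (fst w) x (snd w)\<bar> * \<Delta> s (fst w) * p (snd w)) \<partial>cyl)
     <= (\<integral>\<^sup>+w. ennreal \<bar>k (fst w) x (snd w)\<bar> * ennreal (p (snd w)) \<partial>cyl)"
   proof (rule nn_integral_mono)
    fix w assume w: "w \<in> space cyl"
    have "\<bar>k (fst w) x (snd w)\<bar> * \<Delta> s (fst w) * p (snd w) <= \<bar>k (fst w) x (snd w)\<bar> * 1 * p (snd w)"
     using w by (intro mult_right_mono mult_left_mono \<Delta>) (auto simp: space_pair_measure p_pos less_imp_le)
    thus "ennreal (\<bar>k (fst w) x (snd w)\<bar> * \<Delta> s (fst w) * p (snd w))
      <= ennreal \<bar>k (fst w) x (snd w)\<bar> * ennreal (p (snd w))"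
     using w by (subst ennreal_mult[symmetric]) (auto simp: space_pair_measure p_pos less_imp_le intro!: ennreal_leI)
   qed
   also have "... = (\<integral>\<^sup>+y. (LNINT r. ennreal \<bar>k r x y\<bar> * ennreal (p y)) \<partial>\<nu>)"
    using x by (subst real_pair.nn_integral_snd[symmetric]) simp_all
   also have "... = (\<integral>\<^sup>+y. (LNINT r. ennreal \<bar>k r x y\<bar>) * ennreal (p y) \<partial>\<nu>)"
    using x by (intro nn_integral_cong nn_integral_multc) measurable
   also have "... <= ennreal (C * p x)" by (rule row'[OF x])
   finally show "(\<integral>\<^sup>+w. ennreal (\<bar>k (fst w) x (snd w)\<bar> * \<Delta> s (fst w) * p (snd w)) \<partial>cyl) <= ennreal (C * p x)" .
  qed simp
  also have "... = (\<integral>\<^sup>+w. G s x w \<partial>cyl)"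
   unfolding G_def using x by (subst nn_integral_cmult) simp_all
  finally show "(\<integral>\<^sup>+w. ennreal (\<bar>k (fst w) x (snd w)\<bar> * \<Delta> s (fst w) * cmod (v (snd w))) \<partial>cyl)\<^sup>2
    <= (\<integral>\<^sup>+w. G s x w \<partial>cyl)" .
 qed
 also have "... = (\<integral>\<^sup>+x. (LNINT s. (\<integral>\<^sup>+w. G s x w \<partial>cyl)) \<partial>\<nu>)"
  unfolding G_def by (rule real_pair.Fubini'[symmetric]) measurable
 also have "... = (\<integral>\<^sup>+x. (\<integral>\<^sup>+w. (LNINT s. G s x w) \<partial>cyl) \<partial>\<nu>)"
  unfolding G_def by (intro nn_integral_cong rc.Fubini'[symmetric]) measurable
 also have "... <= (\<integral>\<^sup>+x. (\<integral>\<^sup>+w. ennreal (C * D * (cmod (v (snd w)))\<^sup>2 / p (snd w)) *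
   (ennreal ((1 + \<bar>fst w\<bar>) * \<bar>k (fst w) x (snd w)\<bar>) * ennreal (p x)) \<partial>cyl) \<partial>\<nu>)"
 proof (intro nn_integral_mono)
  fix x w assume x: "x \<in> space \<nu>" and "w \<in> space cyl"
  hence w: "0 < p (snd w)" by (auto simp: space_pair_measure p_pos)
  let ?a = "C * p x * \<bar>k (fst w) x (snd w)\<bar> * (cmod (v (snd w)))\<^sup>2 / p (snd w)"
  have a: "0 <= ?a" using w p_pos[OF x] C_nonneg by simp
  have "(LNINT s. G s x w) = (LNINT s. ennreal ?a * ennreal (\<Delta> s (fst w)))"
   unfolding G_def using w p_pos[OF x] C_nonneg
   by (intro nn_integral_cong) (simp add: \<Delta> ac_simps flip: ennreal_mult)
  also have "... = ennreal ?a * (LNINT s. ennreal (\<Delta> s (fst w)))"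
   by (rule nn_integral_cmult) measurable
  also have "... <= ennreal ?a * ennreal (D * (1 + \<bar>fst w\<bar>))"
   by (rule mult_left_mono[OF D(2)]) simp
  also have "... = ennreal (C * D * (cmod (v (snd w)))\<^sup>2 / p (snd w)) *
   (ennreal ((1 + \<bar>fst w\<bar>) * \<bar>k (fst w) x (snd w)\<bar>) * ennreal (p x))"
   using w p_pos[OF x] C_nonneg D(1) by (simp add: ac_simps flip: ennreal_mult)
  finally show "(LNINT s. G s x w) <= ..." .
 qed
 also have "... = (\<integral>\<^sup>+x. (\<integral>\<^sup>+y. (LNINT r. ennreal (C * D * (cmod (v y))\<^sup>2 / p y) *
   (ennreal ((1 + \<bar>r\<bar>) * \<bar>k r x y\<bar>) * ennreal (p x))) \<partial>\<nu>) \<partial>\<nu>)"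
  by (intro nn_integral_cong, subst real_pair.nn_integral_snd[symmetric]) simp_all
 also have "... = (\<integral>\<^sup>+y. (\<integral>\<^sup>+x. (LNINT r. ennreal (C * D * (cmod (v y))\<^sup>2 / p y) *
   (ennreal ((1 + \<bar>r\<bar>) * \<bar>k r x y\<bar>) * ennreal (p x))) \<partial>\<nu>) \<partial>\<nu>)"
  by (rule xx.Fubini'[symmetric]) measurable
 also have "... = (\<integral>\<^sup>+y. ennreal (C * D * (cmod (v y))\<^sup>2 / p y) *
   (\<integral>\<^sup>+x. (LNINT r. ennreal ((1 + \<bar>r\<bar>) * \<bar>k r x y\<bar>)) * ennreal (p x) \<partial>\<nu>) \<partial>\<nu>)"
 proof (rule nn_integral_cong)
  fix y assume y: "y \<in> space \<nu>"
  have "(\<integral>\<^sup>+x. (LNINT r. ennreal (C * D * (cmod (v y))\<^sup>2 / p y) *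
    (ennreal ((1 + \<bar>r\<bar>) * \<bar>k r x y\<bar>) * ennreal (p x))) \<partial>\<nu>)
    = (\<integral>\<^sup>+x. ennreal (C * D * (cmod (v y))\<^sup>2 / p y) *
      ((LNINT r. ennreal ((1 + \<bar>r\<bar>) * \<bar>k r x y\<bar>)) * ennreal (p x)) \<partial>\<nu>)"
   using y by (intro nn_integral_cong) (subst nn_integral_cmult, simp, subst nn_integral_multc, simp_all)
  also have "... = ennreal (C * D * (cmod (v y))\<^sup>2 / p y) *
   (\<integral>\<^sup>+x. (LNINT r. ennreal ((1 + \<bar>r\<bar>) * \<bar>k r x y\<bar>)) * ennreal (p x) \<partial>\<nu>)"
   using y by (intro nn_integral_cmult) measurable
  finally show "(\<integral>\<^sup>+x. (LNINT r. ennreal (C * D * (cmod (v y))\<^sup>2 / p y) *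
    (ennreal ((1 + \<bar>r\<bar>) * \<bar>k r x y\<bar>) * ennreal (p x))) \<partial>\<nu>) = ..." .
 qed
 also have "... <= (\<integral>\<^sup>+y. ennreal (C * D * (cmod (v y))\<^sup>2 / p y) * ennreal (C * p y) \<partial>\<nu>)"
  by (intro nn_integral_mono mult_left_mono col) auto
 also have "... = (\<integral>\<^sup>+y. ennreal (D * C\<^sup>2) * ennreal ((cmod (v y))\<^sup>2) \<partial>\<nu>)"
 proof (rule nn_integral_cong)
  fix y assume y: "y \<in> space \<nu>"
  have "C * D * (cmod (v y))\<^sup>2 / p y * (C * p y) = D * C\<^sup>2 * (cmod (v y))\<^sup>2"
   using p_pos[OF y] by (simp add: power2_eq_square)
  thus "ennreal (C * D * (cmod (v y))\<^sup>2 / p y) * ennreal (C * p y) = ennreal (D * C\<^sup>2) * ennreal ((cmod (v y))\<^sup>2)"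
   using p_pos[OF y] C_nonneg D(1) by (simp flip: ennreal_mult)
 qed
 finally show ?thesis by (simp add: nn_integral_cmult)
qed

lemma AE_finite_row:
 assumes v: "v \<in> L2 \<nu>"
 shows "AE x in \<nu>. (\<integral>\<^sup>+w. ennreal (\<bar>k (fst w) x (snd w)\<bar> * cmod (v (snd w))) \<partial>cyl) < \<infinity>"
proof -
 have [measurable]: "v \<in> borel_measurable \<nu>" by (rule L2_measurable[OF v])
 define X where "X x = (\<integral>\<^sup>+w. ennreal (\<bar>k (fst w) x (snd w)\<bar> * cmod (v (snd w))) \<partial>cyl)" for x
 have [measurable]: "X \<in> borel_measurable \<nu>" unfolding X_def by measurable
 have "(\<integral>\<^sup>+x. (X x)\<^sup>2 \<partial>\<nu>) = (LNINT s. (\<integral>\<^sup>+x. (X x)\<^sup>2 \<partial>\<nu>) * indicator {0..1::real} s)"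
  by (subst nn_integral_cmult_indicator) simp_all
 also have "... = (LNINT s. (\<integral>\<^sup>+x. (\<integral>\<^sup>+w. ennreal (\<bar>k (fst w) x (snd w)\<bar> * indicator {0..1::real} s * cmod (v (snd w))) \<partial>cyl)\<^sup>2 \<partial>\<nu>))"
  by (intro nn_integral_cong) (auto simp: X_def split: split_indicator)
 also have "... <= ennreal (1 * C\<^sup>2) * (\<integral>\<^sup>+y. ennreal ((cmod (v y))\<^sup>2) \<partial>\<nu>)"
 proof (rule smeared_bound)
  fix r :: real
  have "(LNINT s. ennreal (indicator {0..1::real} s)) = ennreal 1"
   by (simp add: ennreal_indicator)
  thus "(LNINT s. ennreal (indicator {0..1::real} s)) <= ennreal (1 * (1 + \<bar>r\<bar>))"
   using ennreal_leI[of 1 "1 * (1 + \<bar>r\<bar>)"] by (simp del: ennreal_1)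
 qed (auto split: split_indicator)
 also have "... < \<infinity>" using v by (simp add: L2_iff ennreal_mult_less_top)
 finally have "AE x in \<nu>. (X x)\<^sup>2 \<noteq> \<infinity>" by (intro nn_integral_PInf_AE) auto
 thus ?thesis unfolding X_def
  by eventually_elim (auto simp: less_top power2_eq_square ennreal_mult_eq_top_iff)
qed

lemma symbol_cyl:
 assumes v [measurable]: "v \<in> borel_measurable \<nu>" and x: "x \<in> space \<nu>"
  and fin: "(\<integral>\<^sup>+w. ennreal (\<bar>k (fst w) x (snd w)\<bar> * cmod (v (snd w))) \<partial>cyl) < \<infinity>"
 shows "integrable cyl (%w. of_real (k (fst w) x (snd w)) * cis (- (\<xi> * fst w)) * v (snd w))"
  and "symbol \<xi> v x = (\<integral>w. of_real (k (fst w) x (snd w)) * cis (- (\<xi> * fst w)) * v (snd w) \<partial>cyl)"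
proof -
 let ?F = "%r y. of_real (k r x y) * cis (- (\<xi> * r)) * v y"
 show I: "integrable cyl (%w. of_real (k (fst w) x (snd w)) * cis (- (\<xi> * fst w)) * v (snd w))"
  using x fin by (intro integrableI_bounded) (auto simp: norm_mult)
 hence "integrable cyl (case_prod ?F)" by (simp add: split_beta')
 hence "(\<integral>y. (\<integral>r. ?F r y \<partial>lborel) \<partial>\<nu>) = integral\<^sup>L cyl (case_prod ?F)"
  by (rule real_pair.integral_snd)
 thus "symbol \<xi> v x = (\<integral>w. of_real (k (fst w) x (snd w)) * cis (- (\<xi> * fst w)) * v (snd w) \<partial>cyl)"
  by (simp add: symbol_def symbol_kernel_def split_beta')
qed

lemma reflect_cyl: "distr cyl cyl (%w. (s - fst w, snd w)) = cyl"
proof (rule measure_eqI)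
 fix A assume A: "A \<in> sets (distr cyl cyl (%w. (s - fst w, snd w)))"
 hence [measurable]: "A \<in> sets cyl" by simp
 have "emeasure (distr cyl cyl (%w. (s - fst w, snd w))) A
   = (\<integral>\<^sup>+w. indicator A w \<partial>distr cyl cyl (%w. (s - fst w, snd w)))"
  using A by (rule nn_integral_indicator[symmetric])
 also have "... = (\<integral>\<^sup>+w. indicator A (s - fst w, snd w) \<partial>cyl)"
  by (rule nn_integral_distr) measurable
 also have "... = (\<integral>\<^sup>+y. (LNINT t. indicator A (s - t, y)) \<partial>\<nu>)"
  by (subst real_pair.nn_integral_snd[symmetric]) simp_all
 also have "... = (\<integral>\<^sup>+y. (LNINT t. indicator A (t, y)) \<partial>\<nu>)"
 proof (rule nn_integral_cong)
  fix y assume "y \<in> space \<nu>"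
  hence "(%t. indicator A (t, y) :: ennreal) \<in> borel_measurable borel" by measurable
  thus "(LNINT t. indicator A (s - t, y)) = (LNINT t. indicator A (t, y))"
   by (rule nn_integral_reflect)
 qed
 also have "... = (\<integral>\<^sup>+w. indicator A w \<partial>cyl)" by (rule real_pair.nn_integral_snd) measurable
 also have "... = emeasure cyl A" by (rule nn_integral_indicator) measurable
 finally show "emeasure (distr cyl cyl (%w. (s - fst w, snd w))) A = emeasure cyl A" .
qed simp

lemma conv_reflected:
 assumes [measurable]: "U \<in> borel_measurable cyl" and x: "x \<in> space \<nu>"
 shows "conv U (s, x) = (\<integral>w. of_real (k (fst w) x (snd w)) * U (s - fst w, snd w) \<partial>cyl)"
proof -
 have "conv U (s, x) = (\<integral>w. of_real (k (s - fst w) x (snd w)) * U w \<partial>distr cyl cyl (%w. (s - fst w, snd w)))"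
  unfolding reflect_cyl conv_def cyl_kernel_def by simp
 also have "... = (\<integral>w. of_real (k (s - (s - fst w)) x (snd w)) * U (s - fst w, snd w) \<partial>cyl)"
  using x by (subst integral_distr) simp_all
 finally show ?thesis by simp
qed

lemma L2_tensor:
 assumes h: "h \<in> L2 lborel" and v: "v \<in> L2 \<nu>"
 shows "(%z. h (fst z) * v (snd z)) \<in> L2 cyl"
  and "L2_norm cyl (%z. h (fst z) * v (snd z)) = L2_norm lborel h * L2_norm \<nu> v"
proof -
 have [measurable]: "h \<in> borel_measurable borel" "v \<in> borel_measurable \<nu>"
  using L2_measurable[OF h] L2_measurable[OF v] by simp_all
 have "(\<integral>\<^sup>+z. ennreal ((cmod (h (fst z) * v (snd z)))\<^sup>2) \<partial>cyl)
   = (LNINT s. (\<integral>\<^sup>+x. ennreal ((cmod (h s))\<^sup>2) * ennreal ((cmod (v x))\<^sup>2) \<partial>\<nu>))"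
  by (subst nn_integral_fst[symmetric]) (simp_all add: norm_mult power_mult_distrib ennreal_mult)
 also have "... = ennreal ((L2_norm lborel h)\<^sup>2) * ennreal ((L2_norm \<nu> v)\<^sup>2)"
  by (simp add: nn_integral_cmult nn_integral_multc L2_norm_nn[OF h] L2_norm_nn[OF v])
 finally have e: "(\<integral>\<^sup>+z. ennreal ((cmod (h (fst z) * v (snd z)))\<^sup>2) \<partial>cyl)
   = ennreal ((L2_norm lborel h * L2_norm \<nu> v)\<^sup>2)" by (simp add: power_mult_distrib ennreal_mult)
 show m: "(%z. h (fst z) * v (snd z)) \<in> L2 cyl"
  by (rule L2_I_le[OF _ eq_refl[OF e]]) measurable
 have "(L2_norm cyl (%z. h (fst z) * v (snd z)))\<^sup>2 = (L2_norm lborel h * L2_norm \<nu> v)\<^sup>2"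
  using L2_norm_nn[OF m] e by (simp add: L2_norm_nonneg)
 thus "L2_norm cyl (%z. h (fst z) * v (snd z)) = L2_norm lborel h * L2_norm \<nu> v"
  by (simp add: L2_norm_nonneg)
qed

definition wave :: "real => real => real => real => complex" where
 "wave a b \<xi> s = of_real (indicator {a<..b} s) * cis (\<xi> * s)"

lemma wave_L2:
 assumes "a < b" shows "wave a b \<xi> \<in> L2 lborel" "L2_norm lborel (wave a b \<xi>) = sqrt (b - a)"
proof -
 have [measurable]: "wave a b \<xi> \<in> borel_measurable lborel" unfolding wave_def[abs_def] by measurable
 have "(LNINT s. ennreal ((cmod (wave a b \<xi> s))\<^sup>2)) = (LNINT s. indicator {a<..b} s)"
  by (intro nn_integral_cong) (auto simp: wave_def norm_mult split: split_indicator)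
 also have "... = ennreal ((sqrt (b - a))\<^sup>2)" using assms by simp
 finally have e: "(LNINT s. ennreal ((cmod (wave a b \<xi> s))\<^sup>2)) = ennreal ((sqrt (b - a))\<^sup>2)" .
 show m: "wave a b \<xi> \<in> L2 lborel" by (rule L2_I_le[OF _ eq_refl[OF e]]) measurable
 have "(L2_norm lborel (wave a b \<xi>))\<^sup>2 = (sqrt (b - a))\<^sup>2"
  using L2_norm_nn[OF m] e assms by (simp add: L2_norm_nonneg del: real_sqrt_pow2 real_sqrt_pow2_iff)
 thus "L2_norm lborel (wave a b \<xi>) = sqrt (b - a)" using assms by (simp add: L2_norm_nonneg del: real_sqrt_pow2 real_sqrt_pow2_iff)
qed

definition packet :: "real => real => real => ('b => complex) => real \<times> 'b => complex" where
 "packet a b \<xi> v z = wave a b \<xi> (fst z) * v (snd z)"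

lemma packet_L2:
 assumes "a < b" "v \<in> L2 \<nu>"
 shows "packet a b \<xi> v \<in> L2 cyl" "L2_norm cyl (packet a b \<xi> v) = sqrt (b - a) * L2_norm \<nu> v"
 using L2_tensor[OF wave_L2(1)[OF assms(1)] assms(2), of \<xi>] wave_L2(2)[OF assms(1)]
 by (simp_all add: packet_def[abs_def])

text \<open>
  On a wave packet the convolution acts like its symbol up to an error caused by the two ends of the
  interval. The ends contribute in proportion to \<open>\<bar>r\<bar>\<close> for a translation by \<open>r\<close>, which the factor
  \<open>1 + \<bar>s\<bar>\<close> in the Schur bounds absorbs, so the error does not grow with the length of the packet.
\<close>

lemma packet_estimate:
 assumes ab: "a < b" and v: "v \<in> L2 \<nu>"
 shows "L2_norm cyl (shift conv \<mu> (packet a b \<xi> v))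
  <= sqrt (b - a) * L2_norm \<nu> (shift (symbol \<xi>) \<mu> v) + sqrt 2 * C * L2_norm \<nu> v"
proof -
 have vm [measurable]: "v \<in> borel_measurable \<nu>" by (rule L2_measurable[OF v])
 have [measurable]: "wave a b \<xi> \<in> borel_measurable borel"
  unfolding wave_def[abs_def] by measurable
 have pm [measurable]: "packet a b \<xi> v \<in> borel_measurable cyl"
  unfolding packet_def[abs_def] by measurable
 note pL = packet_L2[OF ab v, of \<xi>]
 define Z where "Z = packet a b \<xi> (shift (symbol \<xi>) \<mu> v)"
 have SL: "shift (symbol \<xi>) \<mu> v \<in> L2 \<nu>" by (rule bounded_op_L2[OF bounded_op_shift[OF bounded_symbol] v])
 have ZL: "Z \<in> L2 cyl" unfolding Z_def by (rule packet_L2[OF ab SL])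
 have TL: "shift conv \<mu> (packet a b \<xi> v) \<in> L2 cyl"
  by (rule bounded_op_L2[OF bounded_op_shift[OF bounded_conv] pL(1)])
 define E where "E = (%z. shift conv \<mu> (packet a b \<xi> v) z - Z z)"
 have EL: "E \<in> L2 cyl" unfolding E_def by (rule L2_diff[OF TL ZL])
 define \<Delta> :: "real => real => real"
  where "\<Delta> s r = \<bar>indicator {a<..b} (s - r) - indicator {a<..b} s\<bar>" for s r
 have \<Delta>_int: "(LNINT s. ennreal (\<Delta> s r)) <= ennreal (2 * (1 + \<bar>r\<bar>))" for r
 proof -
  let ?I = "%c. {min c (c + r)..max c (c + r)}"
  have "(LNINT s. ennreal (\<Delta> s r)) <= (LNINT s. indicator (?I a) s + indicator (?I b) s)"
   by (intro nn_integral_mono) (auto simp: \<Delta>_def min_def max_def split: split_indicator)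
  also have "... = ennreal \<bar>r\<bar> + ennreal \<bar>r\<bar>"
   by (subst nn_integral_add) (auto simp: min_def max_def)
  also have "... <= ennreal (2 * (1 + \<bar>r\<bar>))"
   by (subst ennreal_plus[symmetric]) (auto intro!: ennreal_leI)
  finally show ?thesis .
 qed
 have Ept: "ennreal (cmod (E (s, x)))
   <= (\<integral>\<^sup>+w. ennreal (\<bar>k (fst w) x (snd w)\<bar> * \<Delta> s (fst w) * cmod (v (snd w))) \<partial>cyl)"
  if x: "x \<in> space \<nu>" and fin: "(\<integral>\<^sup>+w. ennreal (\<bar>k (fst w) x (snd w)\<bar> * cmod (v (snd w))) \<partial>cyl) < \<infinity>"
  for s x
 proof -
  let ?A = "%w. of_real (k (fst w) x (snd w)) * packet a b \<xi> v (s - fst w, snd w)"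
  let ?B = "%w. of_real (k (fst w) x (snd w)) * cis (- (\<xi> * fst w)) * v (snd w)"
  have I2: "integrable cyl ?B" and S: "symbol \<xi> v x = integral\<^sup>L cyl ?B"
   using symbol_cyl[OF vm x fin] by auto
  have I1: "integrable cyl ?A"
  proof (rule Bochner_Integration.integrable_bound[OF I2])
   show "?A \<in> borel_measurable cyl" using x by measurable
   show "AE w in cyl. cmod (?A w) <= cmod (?B w)"
    by (rule AE_I2) (auto simp: packet_def wave_def norm_mult intro!: mult_left_mono split: split_indicator)
  qed
  have "E (s, x) = conv (packet a b \<xi> v) (s, x) - wave a b \<xi> s * symbol \<xi> v x"
   by (simp add: E_def Z_def shift_def packet_def algebra_simps)
  also have "... = (\<integral>w. ?A w - wave a b \<xi> s * ?B w \<partial>cyl)"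
   unfolding conv_reflected[OF pm x] S using I1 I2 by simp
  finally have e: "E (s, x) = (\<integral>w. ?A w - wave a b \<xi> s * ?B w \<partial>cyl)" .
  have "integrable cyl (%w. ?A w - wave a b \<xi> s * ?B w)" using I1 I2 by simp
  from integral_norm_bound_ennreal[OF this, folded e]
  have "ennreal (cmod (E (s, x))) <= (\<integral>\<^sup>+w. ennreal (cmod (?A w - wave a b \<xi> s * ?B w)) \<partial>cyl)" .
  also have "... = (\<integral>\<^sup>+w. ennreal (\<bar>k (fst w) x (snd w)\<bar> * \<Delta> s (fst w) * cmod (v (snd w))) \<partial>cyl)"
  proof (rule nn_integral_cong)
   fix w :: "real \<times> 'b"
   have "cis (\<xi> * (s - fst w)) = cis (\<xi> * s) * cis (- (\<xi> * fst w))"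
    by (simp add: cis_mult algebra_simps)
   hence "?A w - wave a b \<xi> s * ?B w = of_real (k (fst w) x (snd w)) *
     of_real (indicator {a<..b} (s - fst w) - indicator {a<..b} s) * cis (\<xi> * (s - fst w)) * v (snd w)"
    by (simp add: packet_def wave_def algebra_simps)
   hence "cmod (?A w - wave a b \<xi> s * ?B w) = \<bar>k (fst w) x (snd w)\<bar> * \<Delta> s (fst w) * cmod (v (snd w))"
    by (simp only: norm_mult norm_of_real norm_cis \<Delta>_def mult_1_right)
   thus "ennreal (cmod (?A w - wave a b \<xi> s * ?B w)) = ennreal (\<bar>k (fst w) x (snd w)\<bar> * \<Delta> s (fst w) * cmod (v (snd w)))"
    by simp
  qed
  finally show ?thesis .
 qed
 have [measurable]: "E \<in> borel_measurable cyl" by (rule L2_measurable[OF EL])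
 have "(\<integral>\<^sup>+z. ennreal ((cmod (E z))\<^sup>2) \<partial>cyl) = (LNINT s. (\<integral>\<^sup>+x. ennreal ((cmod (E (s, x)))\<^sup>2) \<partial>\<nu>))"
  by (rule nn_integral_fst[symmetric]) measurable
 also have "... <= (LNINT s. (\<integral>\<^sup>+x. (\<integral>\<^sup>+w. ennreal (\<bar>k (fst w) x (snd w)\<bar> * \<Delta> s (fst w) * cmod (v (snd w))) \<partial>cyl)\<^sup>2 \<partial>\<nu>))"
 proof (rule nn_integral_mono, rule nn_integral_mono_AE)
  fix s
  show "AE x in \<nu>. ennreal ((cmod (E (s, x)))\<^sup>2)
    <= (\<integral>\<^sup>+w. ennreal (\<bar>k (fst w) x (snd w)\<bar> * \<Delta> s (fst w) * cmod (v (snd w))) \<partial>cyl)\<^sup>2"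
   using AE_finite_row[OF v] AE_space
   by eventually_elim (simp flip: ennreal_power add: power_mono Ept)
 qed
 also have "... <= ennreal (2 * C\<^sup>2) * (\<integral>\<^sup>+y. ennreal ((cmod (v y))\<^sup>2) \<partial>\<nu>)"
  by (rule smeared_bound) (use \<Delta>_int in \<open>auto simp: \<Delta>_def split_beta' split: split_indicator\<close>)
 also have "... = ennreal ((sqrt 2 * C * L2_norm \<nu> v)\<^sup>2)"
  by (simp add: L2_norm_nn[OF v, symmetric] power_mult_distrib flip: ennreal_mult)
 finally have "L2_norm cyl E <= sqrt 2 * C * L2_norm \<nu> v"
  by (intro L2_norm_leI[OF EL]) (simp_all add: C_nonneg L2_norm_nonneg)
 moreover have "L2_norm cyl Z = sqrt (b - a) * L2_norm \<nu> (shift (symbol \<xi>) \<mu> v)"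
  unfolding Z_def by (rule packet_L2[OF ab SL])
 ultimately show ?thesis using L2_norm_triangle_rev[OF TL ZL] by (simp add: E_def)
qed

text \<open>
  Divide \<open>packet_estimate\<close> by the square root of the length of the interval and let the length
  tend to infinity.
\<close>

lemma symbol_bounded_below:
 assumes bb: "bounded_below cyl (shift conv \<mu>) c"
 shows "bounded_below \<nu> (shift (symbol \<xi>) \<mu>) c"
 unfolding bounded_below_def
proof
 fix v assume v: "v \<in> L2 \<nu>"
 have "c * L2_norm \<nu> v - L2_norm \<nu> (shift (symbol \<xi>) \<mu> v) <= sqrt 2 * C * L2_norm \<nu> v / real (Suc n)" for n
 proof -
  let ?b = "(real (Suc n))\<^sup>2"
  have s: "sqrt (?b - 0) = real (Suc n)" by simp
  have "c * (real (Suc n) * L2_norm \<nu> v) <= L2_norm cyl (shift conv \<mu> (packet 0 ?b \<xi> v))"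
   using bounded_belowD[OF bb packet_L2(1)[of 0 ?b, OF _ v]] packet_L2(2)[of 0 ?b, OF _ v] s by simp
  also have "... <= real (Suc n) * L2_norm \<nu> (shift (symbol \<xi>) \<mu> v) + sqrt 2 * C * L2_norm \<nu> v"
   using packet_estimate[of 0 ?b, OF _ v] s by simp
  finally have "real (Suc n) * (c * L2_norm \<nu> v - L2_norm \<nu> (shift (symbol \<xi>) \<mu> v)) <= sqrt 2 * C * L2_norm \<nu> v"
   by (simp only: right_diff_distrib) (simp add: mult_ac)
  thus ?thesis by (simp only: pos_le_divide_eq of_nat_0_less_iff zero_less_Suc) (simp add: mult_ac)
 qed
 moreover have "(%n. sqrt 2 * C * L2_norm \<nu> v / real (Suc n)) \<longlonglongrightarrow> 0"
  by (rule LIMSEQ_Suc[OF lim_const_over_n])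
 ultimately have "c * L2_norm \<nu> v - L2_norm \<nu> (shift (symbol \<xi>) \<mu> v) <= 0"
  by (intro LIMSEQ_le_const) auto
 thus "c * L2_norm \<nu> v <= L2_norm \<nu> (shift (symbol \<xi>) \<mu> v)" by simp
qed

text \<open>
  If the symbols are not uniformly bounded below, wave packets built on approximate null vectors
  of the symbols form a Weyl sequence. Placed in adjacent intervals of growing length to the left
  of a given point they are automatically orthonormal.
\<close>

lemma packet_Weyl_sequence:
 assumes nb: "\<And>c. 0 < c ==> \<exists>\<xi>. \<not> bounded_below \<nu> (shift (symbol \<xi>) \<mu>) c"
 shows "\<exists>w. orthonormal_seq cyl w \<and> (\<forall>n z. fst z > d --> w n z = 0) \<and>
  (%n. L2_norm cyl (shift conv \<mu> (w n))) \<longlonglongrightarrow> 0"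
proof -
 have "\<exists>\<xi> v. v \<in> L2 \<nu> \<and> L2_norm \<nu> v = 1 \<and> L2_norm \<nu> (shift (symbol \<xi>) \<mu> v) <= 1 / real (Suc n)" for n
 proof -
  obtain \<xi> where "\<not> bounded_below \<nu> (shift (symbol \<xi>) \<mu>) (1 / real (Suc n))"
   using nb[of "1 / real (Suc n)"] by auto
  then obtain u where u: "u \<in> L2 \<nu>" "L2_norm \<nu> (shift (symbol \<xi>) \<mu> u) < 1 / real (Suc n) * L2_norm \<nu> u"
   by (auto simp: bounded_below_def not_le)
  have pos: "0 < L2_norm \<nu> u"
   using u(2) L2_norm_nonneg[of \<nu> u] L2_norm_nonneg[of \<nu> "shift (symbol \<xi>) \<mu> u"]
   by (cases "L2_norm \<nu> u = 0") auto
  let ?a = "complex_of_real (1 / L2_norm \<nu> u)"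
  note bs = bounded_op_shift[OF bounded_symbol, of \<xi> \<mu>]
  have "L2_norm \<nu> (shift (symbol \<xi>) \<mu> (%x. ?a * u x)) = L2_norm \<nu> (%x. ?a * shift (symbol \<xi>) \<mu> u x)"
   by (rule L2_norm_cong_AE[OF bounded_op_L2[OF bs L2_scale[OF u(1)]]
      L2_scale[OF bounded_op_L2[OF bs u(1)]] bounded_op_scale[OF bs u(1)]])
  also have "... <= 1 / real (Suc n)"
   unfolding L2_norm_scale norm_of_real using u(2) pos by (simp add: field_simps)
  finally have "L2_norm \<nu> (shift (symbol \<xi>) \<mu> (%x. ?a * u x)) <= 1 / real (Suc n)" .
  moreover have "L2_norm \<nu> (%x. ?a * u x) = 1"
   unfolding L2_norm_scale norm_of_real using pos by simp
  ultimately show ?thesis using L2_scale[OF u(1), of ?a] by blast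
 qed
 hence "\<forall>n. \<exists>\<xi>v. snd \<xi>v \<in> L2 \<nu> \<and> L2_norm \<nu> (snd \<xi>v) = 1 \<and>
   L2_norm \<nu> (shift (symbol (fst \<xi>v)) \<mu> (snd \<xi>v)) <= 1 / real (Suc n)" by simp
 from choice[OF this] obtain f where f: "\<And>n. snd (f n) \<in> L2 \<nu>" "\<And>n. L2_norm \<nu> (snd (f n)) = 1"
  "\<And>n. L2_norm \<nu> (shift (symbol (fst (f n))) \<mu> (snd (f n))) <= 1 / real (Suc n)" by blast
 define a where "a n = d - (real n)\<^sup>2" for n
 have step: "a n - a (Suc n) = 2 * real n + 1" for n by (simp add: a_def power2_eq_square algebra_simps)
 hence lt: "a (Suc n) < a n" for n using step[of n] by linarith
 hence dec: "decseq a" by (simp add: decseq_SucI less_imp_le)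
 define s where "s n = sqrt (2 * real n + 1)" for n
 have s: "0 < s n" for n by (simp add: s_def)
 define w where "w n = (%z. of_real (1 / s n) * packet (a (Suc n)) (a n) (fst (f n)) (snd (f n)) z)" for n
 note pk = packet_L2[OF lt f(1)]
 have wL: "w n \<in> L2 cyl" for n unfolding w_def by (rule L2_scale[OF pk(1)])
 have wN: "L2_norm cyl (w n) = 1" for n
  unfolding w_def L2_norm_scale norm_of_real pk(2) f(2) step s_def by simp
 have supp: "w n z = 0" if "fst z \<notin> {a (Suc n)<..a n}" for n z
  using that by (simp add: w_def packet_def wave_def)
 have disj: "{a (Suc n)<..a n} \<inter> {a (Suc m)<..a m} = {}" if "n < m" for n m
  using decseqD[OF dec, of "Suc n" m] that by auto
 have orth: "L2_inner cyl (w n) (w m) = 0" if "n \<noteq> m" for n m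
 proof -
  have "w n z * cnj (w m z) = 0" for z
  proof -
   have "{a (Suc n)<..a n} \<inter> {a (Suc m)<..a m} = {}"
   proof (cases "n < m")
    case False
    hence "m < n" using \<open>n \<noteq> m\<close> by simp
    from disj[OF this] show ?thesis by (subst Int_commute)
   qed (rule disj)
   hence "fst z \<notin> {a (Suc n)<..a n} \<or> fst z \<notin> {a (Suc m)<..a m}" by blast
   hence "w n z = 0 \<or> w m z = 0" using supp[of z n] supp[of z m] by blast
   thus ?thesis by auto
  qed
  hence e: "(%z. w n z * cnj (w m z)) = (%z. 0)" by (intro ext)
  show ?thesis unfolding L2_inner_def e by simp
 qed
 have "orthonormal_seq cyl w"
  unfolding orthonormal_seq_def using wL orth L2_inner_self[of cyl "w _"] wN by auto
 moreover have "w n z = 0" if "fst z > d" for n z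
 proof (rule supp)
  have "a n <= d" by (simp add: a_def)
  thus "fst z \<notin> {a (Suc n)<..a n}" using that by auto
 qed
 moreover have "(%n. L2_norm cyl (shift conv \<mu> (w n))) \<longlonglongrightarrow> 0"
 proof -
  have bound: "L2_norm cyl (shift conv \<mu> (w n)) <= 1 / real (Suc n) + sqrt 2 * C * (1 / s n)" for n
  proof -
   let ?p = "packet (a (Suc n)) (a n) (fst (f n)) (snd (f n))"
   note bs = bounded_op_shift[OF bounded_conv, of \<mu>]
   have "L2_norm cyl (shift conv \<mu> (w n)) = L2_norm cyl (%z. of_real (1 / s n) * shift conv \<mu> ?p z)"
    unfolding w_def
    by (rule L2_norm_cong_AE[OF bounded_op_L2[OF bs L2_scale[OF pk(1)]]
      L2_scale[OF bounded_op_L2[OF bs pk(1)]] bounded_op_scale[OF bs pk(1)]])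
   also have "... = (1 / s n) * L2_norm cyl (shift conv \<mu> ?p)"
    unfolding L2_norm_scale norm_of_real using s[of n] by simp
   also have "... <= (1 / s n) * (s n * (1 / real (Suc n)) + sqrt 2 * C * 1)"
   proof (rule mult_left_mono)
    have "L2_norm cyl (shift conv \<mu> ?p)
      <= s n * L2_norm \<nu> (shift (symbol (fst (f n))) \<mu> (snd (f n))) + sqrt 2 * C * 1"
     using packet_estimate[OF lt[of n] f(1)[of n], where \<mu>=\<mu> and \<xi>="fst (f n)"] by (simp add: f(2) step s_def)
    moreover have "s n * L2_norm \<nu> (shift (symbol (fst (f n))) \<mu> (snd (f n))) <= s n * (1 / real (Suc n))"
     using s[of n] by (intro mult_left_mono f(3)) simp
    ultimately show "L2_norm cyl (shift conv \<mu> ?p) <= s n * (1 / real (Suc n)) + sqrt 2 * C * 1" by linarith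
   qed (use s[of n] in simp)
   also have "... = 1 / real (Suc n) + sqrt 2 * C * (1 / s n)" using s[of n] by (simp add: field_simps)
   finally show ?thesis .
  qed
  have "1 / s n <= 1 / sqrt (real (Suc n))" for n
   unfolding s_def by (intro divide_left_mono) auto
  moreover have "(%n. 1 / sqrt (real (Suc n))) \<longlonglongrightarrow> 0"
  proof -
   have "(%n. sqrt (1 / real (Suc n))) \<longlonglongrightarrow> sqrt 0"
    by (rule tendsto_real_sqrt[OF LIMSEQ_Suc[OF lim_1_over_n]])
   thus ?thesis by (simp add: real_sqrt_divide)
  qed
  ultimately have s0: "(%n. 1 / s n) \<longlonglongrightarrow> 0"
   by (intro real_tendsto_sandwich[of "%_. 0" "%n. 1 / s n" sequentially "%n. 1 / sqrt (real (Suc n))"])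
     (use s in \<open>auto simp: less_imp_le\<close>)
  have "(%n. 1 / real (Suc n) + sqrt 2 * C * (1 / s n)) \<longlonglongrightarrow> 0 + sqrt 2 * C * 0"
   by (rule tendsto_add[OF LIMSEQ_Suc[OF lim_1_over_n] tendsto_mult_left[OF s0]])
  hence "(%n. 1 / real (Suc n) + sqrt 2 * C * (1 / s n)) \<longlonglongrightarrow> 0" by simp
  thus ?thesis
   by (rule real_tendsto_sandwich[OF always_eventually always_eventually tendsto_const, rotated 2])
     (use bound in \<open>auto simp: L2_norm_nonneg\<close>)
 qed
 ultimately show ?thesis by blast
qed

end

section \<open>Gaussian averages of the Fourier transform\<close>

lemma nn_integral_translate:
 assumes [measurable]: "f \<in> borel_measurable borel"
 shows "(LNINT s. f (s - r)) = (LNINT s. f (s::real))"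
 using nn_integral_real_affine[of f 1 "- r"] by simp

lemma emeasure_Diff_plus_Int:
 assumes "A \<in> sets M" "B \<in> sets M"
 shows "emeasure M (A - B) + emeasure M (A \<inter> B) = emeasure M A"
proof -
 have "emeasure M (A - B) + emeasure M (A \<inter> B) = emeasure M ((A - B) \<union> (A \<inter> B))"
  by (rule plus_emeasure) (use assms in auto)
 also have "(A - B) \<union> (A \<inter> B) = A" by blast
 finally show ?thesis .
qed

lemma ennreal_tendsto_0I:
 fixes f :: "'a => ennreal"
 assumes "\<And>e. 0 < e ==> eventually (%m. f m < ennreal e) F"
 shows "(f \<longlongrightarrow> 0) F"
proof (rule order_tendstoI)
 fix a :: ennreal assume a: "0 < a"
 show "eventually (%m. f m < a) F"
 proof (cases a)
  case (real b)
  thus ?thesis using a assms[of b] by simp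
 next
  case top
  have "eventually (%m. f m < ennreal 1) F" by (rule assms) simp
  thus ?thesis by eventually_elim (simp add: top order.strict_trans)
 qed
qed simp

text \<open>
  For an open set the points that leave it under a small translation disappear in the limit by
  dominated convergence; translation invariance of Lebesgue measure makes the points that enter it
  equally few.
\<close>

lemma translation_continuous_open:
 fixes r :: "nat => real"
 assumes r: "r \<longlonglongrightarrow> 0" and U: "open U" and fin: "emeasure lborel U < \<infinity>"
 shows "(%m. LNINT s. ennreal \<bar>indicator U (s - r m) - indicator U s\<bar>) \<longlonglongrightarrow> 0"
proof -
 have [measurable]: "U \<in> sets borel" using U by simp
 define N where "N m = (LNINT s. indicator (U - {s. s - r m \<in> U}) s)" for m
 have [measurable]: "{s. s - r m \<in> U} \<in> sets borel" for m
  using measurable_sets[of "%s. s - r m" borel borel U] by (simp add: vimage_def)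
 have "(%m. LNINT s. indicator (U - {s. s - r m \<in> U}) s) \<longlonglongrightarrow> integral\<^sup>N (lborel :: real measure) (%s. 0)"
 proof (rule nn_integral_dominated_convergence[where w="indicator U"])
  show "AE s in lborel. (%m. indicator (U - {s. s - r m \<in> U}) s :: ennreal) \<longlonglongrightarrow> 0"
  proof (rule AE_I2)
   fix s :: real
   have "eventually (%m. indicator (U - {s. s - r m \<in> U}) s = (0::ennreal)) sequentially"
   proof (cases "s \<in> U")
    case True
    have "(%m. s - r m) \<longlonglongrightarrow> s - 0" by (rule tendsto_diff[OF tendsto_const r])
    hence "eventually (%m. s - r m \<in> U) sequentially"
     using U True by (intro topological_tendstoD) auto
    thus ?thesis by eventually_elim simp
   qed simp
   thus "(%m. indicator (U - {s. s - r m \<in> U}) s :: ennreal) \<longlonglongrightarrow> 0"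
    by (rule tendsto_eventually)
  qed
  show "(LNINT s. indicator U s) < \<infinity>" using fin by simp
  show "\<And>m. AE s in lborel. indicator (U - {s. s - r m \<in> U}) s <= (indicator U s :: ennreal)"
   by (intro AE_I2) (auto split: split_indicator)
 qed measurable
 hence N0: "N \<longlonglongrightarrow> 0" by (simp add: N_def[abs_def])
 have eq: "(LNINT s. ennreal \<bar>indicator U (s - r m) - indicator U s\<bar>) = N m + N m" for m
 proof -
  define Q where "Q = (LNINT s. indicator ({s. s - r m \<in> U} - U) s)"
  have e1: "emeasure lborel {s. s - r m \<in> U} = emeasure lborel U"
  proof -
   have "emeasure lborel {s. s - r m \<in> U} = (LNINT s. indicator {s. s - r m \<in> U} s)"
    by simp
   also have "... = (LNINT s. indicator U (s - r m))"
    by (intro nn_integral_cong) (auto split: split_indicator)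
   also have "... = emeasure lborel U" by (subst nn_integral_translate) simp_all
   finally show ?thesis .
  qed
  have "Q + emeasure lborel ({s. s - r m \<in> U} \<inter> U) = emeasure lborel {s. s - r m \<in> U}"
   unfolding Q_def by (subst nn_integral_indicator) (auto intro!: emeasure_Diff_plus_Int)
  moreover have "N m + emeasure lborel ({s. s - r m \<in> U} \<inter> U) = emeasure lborel U"
   unfolding N_def by (subst nn_integral_indicator, simp, subst Int_commute) (auto intro!: emeasure_Diff_plus_Int)
  moreover have "emeasure lborel ({s. s - r m \<in> U} \<inter> U) \<noteq> \<infinity>"
   using fin emeasure_mono[of "{s. s - r m \<in> U} \<inter> U" U lborel] by (auto simp: top_unique less_top)
  ultimately have QN: "Q = N m" using e1 by (metis ennreal_add_left_cancel add.commute infinity_ennreal_def)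
  have "(LNINT s. ennreal \<bar>indicator U (s - r m) - indicator U s\<bar>)
    = (LNINT s. indicator ({s. s - r m \<in> U} - U) s + indicator (U - {s. s - r m \<in> U}) s)"
   by (intro nn_integral_cong) (auto split: split_indicator)
  also have "... = Q + N m" unfolding Q_def N_def by (rule nn_integral_add) measurable
  finally show ?thesis using QN by simp
 qed
 have "(%m. N m + N m) \<longlonglongrightarrow> 0 + 0" by (rule tendsto_add[OF N0 N0])
 thus ?thesis unfolding eq by simp
qed

lemma translation_continuous_indicator:
 fixes r :: "nat => real"
 assumes r: "r \<longlonglongrightarrow> 0" and A: "A \<in> sets lborel" and fin: "emeasure lborel A < \<infinity>"
 shows "(%m. LNINT s. ennreal \<bar>indicator A (s - r m) - indicator A s\<bar>) \<longlonglongrightarrow> 0"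
proof (rule ennreal_tendsto_0I)
 fix e :: real assume e: "0 < e"
 have Ab [measurable]: "A \<in> sets borel" using A by simp
 obtain U where U: "open U" "A \<subseteq> U" "emeasure lborel (U - A) < ennreal (e / 4)"
  using outer_regular_lborel[OF Ab, of "e / 4"] e by auto
 have [measurable]: "U \<in> sets borel" using U by simp
 have "emeasure lborel U = emeasure lborel A + emeasure lborel (U - A)"
  using U(2) by (subst plus_emeasure) (auto intro!: arg_cong[where f="emeasure lborel"])
 also have "... < \<infinity>" using fin order.strict_trans[OF U(3) ennreal_less_top] by (simp add: less_top[symmetric] ennreal_add_eq_top)
 finally have Ufin: "emeasure lborel U < \<infinity>" .
 have "eventually (%m. (LNINT s. ennreal \<bar>indicator U (s - r m) - indicator U s\<bar>) < ennreal (e / 4)) sequentially"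
  using translation_continuous_open[OF r U(1) Ufin] e by (intro order_tendstoD(2)) auto
 thus "eventually (%m. (LNINT s. ennreal \<bar>indicator A (s - r m) - indicator A s\<bar>) < ennreal e) sequentially"
 proof eventually_elim
  case (elim m)
  have D: "(LNINT s. indicator (U - A) (s - r m)) = emeasure lborel (U - A)"
   by (subst nn_integral_translate) simp_all
  have "(LNINT s. ennreal \<bar>indicator A (s - r m) - indicator A s\<bar>)
    <= (LNINT s. ennreal \<bar>indicator U (s - r m) - indicator U s\<bar> + (indicator (U - A) (s - r m) + indicator (U - A) s))"
   by (intro nn_integral_mono) (use U(2) in \<open>auto split: split_indicator\<close>)
  also have "... = (LNINT s. ennreal \<bar>indicator U (s - r m) - indicator U s\<bar>)
    + (emeasure lborel (U - A) + emeasure lborel (U - A))"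
   by (simp add: nn_integral_add D)
  also have "... <= ennreal (e / 4) + (ennreal (e / 4) + ennreal (e / 4))"
   using elim U(3) by (intro add_mono) auto
  also have "... = ennreal (3 * e / 4)" using e by (simp flip: ennreal_plus)
  also have "... < ennreal e" using e by (intro ennreal_lessI) auto
  finally show ?case .
 qed
qed

lemma translation_continuous_L1:
 fixes r :: "nat => real" and f :: "real => complex"
 assumes r: "r \<longlonglongrightarrow> 0" and f: "integrable lborel f"
 shows "(%m. LNINT s. ennreal (cmod (f (s - r m) - f s))) \<longlonglongrightarrow> 0"
 using f
proof (induction rule: integrable_induct)
 case (base A c)
 have [measurable]: "A \<in> sets borel" using base by simp
 have "(LNINT s. ennreal (cmod (indicator A (s - r m) *\<^sub>R c - indicator A s *\<^sub>R c)))
   = (LNINT s. ennreal \<bar>indicator A (s - r m) - indicator A s\<bar>) * ennreal (cmod c)" for m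
  by (subst nn_integral_multc[symmetric]) (auto simp flip: scaleR_left_diff_distrib ennreal_mult intro!: nn_integral_cong)
 moreover have "(%m. (LNINT s. ennreal \<bar>indicator A (s - r m) - indicator A s\<bar>) * ennreal (cmod c))
   \<longlonglongrightarrow> 0 * ennreal (cmod c)"
  by (rule tendsto_mult_ennreal[OF translation_continuous_indicator[OF r base] tendsto_const]) simp
 ultimately show ?case by simp
next
 case (add f g)
 have [measurable]: "f \<in> borel_measurable borel" "g \<in> borel_measurable borel"
  using add by (auto dest: borel_measurable_integrable)
 have lim: "(%m. (LNINT s. ennreal (cmod (f (s - r m) - f s)))
   + (LNINT s. ennreal (cmod (g (s - r m) - g s)))) \<longlonglongrightarrow> 0 + 0"
  by (rule tendsto_add[OF add.IH])
 have le: "(LNINT s. ennreal (cmod (f (s - r m) + g (s - r m) - (f s + g s))))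
   <= (LNINT s. ennreal (cmod (f (s - r m) - f s)))
   + (LNINT s. ennreal (cmod (g (s - r m) - g s)))" for m
  by (subst nn_integral_add[symmetric])
    (auto simp: add_diff_add norm_triangle_ineq simp flip: ennreal_plus intro!: nn_integral_mono ennreal_leI)
 show ?case
  by (rule tendsto_sandwich[OF always_eventually always_eventually tendsto_const, rotated 2])
    (use lim le in auto)
next
 case (lim f s)
 have [measurable]: "f \<in> borel_measurable borel" "\<And>i. s i \<in> borel_measurable borel"
  using lim by (auto dest: borel_measurable_integrable)
 show ?case
 proof (rule ennreal_tendsto_0I)
  fix e :: real assume e: "0 < e"
  have "(%i. LNINT x. ennreal (cmod (s i x - f x))) \<longlonglongrightarrow> integral\<^sup>N (lborel :: real measure) (%x. 0)"
  proof (rule nn_integral_dominated_convergence[where w="%x. ennreal (3 * cmod (f x))"])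
   show "AE x in lborel. ennreal (cmod (s i x - f x)) <= ennreal (3 * cmod (f x))" for i
   proof (rule AE_I2, rule ennreal_leI)
    fix x
    show "cmod (s i x - f x) <= 3 * cmod (f x)"
     using norm_triangle_ineq4[of "s i x" "f x"] lim.hyps(3)[of x i] by simp
   qed
   show "(LNINT x. ennreal (3 * cmod (f x))) < \<infinity>"
    using lim.hyps(4) by (simp add: integrable_iff_bounded ennreal_mult nn_integral_cmult ennreal_mult_less_top)
   show "AE x in lborel. (%i. ennreal (cmod (s i x - f x))) \<longlonglongrightarrow> 0"
   proof (rule AE_I2)
    fix x :: real
    have "(%i. cmod (s i x - f x)) \<longlonglongrightarrow> cmod (f x - f x)"
     using lim.hyps(2)[of x] by (intro tendsto_norm tendsto_diff tendsto_const) simp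
    hence "(%i. ennreal (cmod (s i x - f x))) \<longlonglongrightarrow> ennreal (cmod (f x - f x))" by (rule tendsto_ennrealI)
    thus "(%i. ennreal (cmod (s i x - f x))) \<longlonglongrightarrow> 0" by simp
   qed
  qed measurable
  hence "eventually (%i. (LNINT x. ennreal (cmod (s i x - f x))) < ennreal (e / 4)) sequentially"
   using e by (intro order_tendstoD(2)[where y=0]) auto
  then obtain i where i: "(LNINT x. ennreal (cmod (s i x - f x))) < ennreal (e / 4)"
   by (auto simp: eventually_sequentially)
  have "eventually (%m. (LNINT x. ennreal (cmod (s i (x - r m) - s i x))) < ennreal (e / 4)) sequentially"
   using lim.IH[of i] e by (intro order_tendstoD(2)[where y=0]) auto
  thus "eventually (%m. (LNINT x. ennreal (cmod (f (x - r m) - f x))) < ennreal e) sequentially"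
  proof eventually_elim
   case (elim m)
   have D: "(LNINT x. ennreal (cmod (s i (x - r m) - f (x - r m)))) = (LNINT x. ennreal (cmod (s i x - f x)))"
    using nn_integral_translate[of "%x. ennreal (cmod (s i x - f x))" "r m"] by simp
   have "(LNINT x. ennreal (cmod (f (x - r m) - f x)))
     <= (LNINT x. ennreal (cmod (s i (x - r m) - s i x))
       + (ennreal (cmod (s i (x - r m) - f (x - r m))) + ennreal (cmod (s i x - f x))))"
   proof (rule nn_integral_mono)
    fix x
    have "f (x - r m) - f x = (s i (x - r m) - s i x) - (s i (x - r m) - f (x - r m)) + (s i x - f x)" by simp
    hence "cmod (f (x - r m) - f x) <= cmod (s i (x - r m) - s i x) + (cmod (s i (x - r m) - f (x - r m)) + cmod (s i x - f x))"
     by (smt (verit) norm_triangle_ineq norm_triangle_ineq4)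
    thus "ennreal (cmod (f (x - r m) - f x)) <= ennreal (cmod (s i (x - r m) - s i x))
       + (ennreal (cmod (s i (x - r m) - f (x - r m))) + ennreal (cmod (s i x - f x)))"
     by (simp flip: ennreal_plus add: ennreal_leI)
   qed
   also have "... = (LNINT x. ennreal (cmod (s i (x - r m) - s i x)))
     + ((LNINT x. ennreal (cmod (s i x - f x))) + (LNINT x. ennreal (cmod (s i x - f x))))"
    by (simp add: nn_integral_add D)
   also have "... <= ennreal (e / 4) + (ennreal (e / 4) + ennreal (e / 4))"
    using elim i by (intro add_mono) auto
   also have "... = ennreal (3 * e / 4)" using e by (simp flip: ennreal_plus)
   also have "... < ennreal e" using e by (intro ennreal_lessI) auto
   finally show ?case .
  qed
 qed
qed

abbreviation std_normal :: "real measure" where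
 "std_normal == std_normal_distribution"

definition FT :: "(real => complex) => real => complex" where
 "FT f \<xi> = (\<integral>s. f s * cis (- (\<xi> * s)) \<partial>lborel)"

definition gauss :: "real => real => real" where
 "gauss \<sigma> r = exp (- (r\<^sup>2 / (2 * \<sigma>\<^sup>2)))"

lemma gauss_measurable [measurable]: "gauss \<sigma> \<in> borel_measurable borel"
 unfolding gauss_def[abs_def] by measurable

lemma gauss_pos: "0 < gauss \<sigma> r" by (simp add: gauss_def)

lemma gauss_nn_integral:
 assumes "0 < \<sigma>"
 shows "(LNINT r. ennreal (gauss \<sigma> r)) = ennreal (\<sigma> * sqrt (2 * pi))"
proof -
 have e: "gauss \<sigma> r = \<sigma> * sqrt (2 * pi) * normal_density 0 \<sigma> r" for r
  using assms by (simp add: gauss_def normal_density_def real_sqrt_mult)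
 have "(LNINT r. ennreal (normal_density 0 \<sigma> r)) = 1"
  using prob_space.emeasure_space_1[OF prob_space_normal_density[OF assms, of 0]]
  by (simp add: emeasure_density)
 thus ?thesis unfolding e using assms by (simp add: ennreal_mult nn_integral_cmult)
qed

lemma integrable_cis_mult:
 assumes "integrable M f" "g \<in> borel_measurable M"
 shows "integrable M (%x. f x * cis (g x))"
 by (rule Bochner_Integration.integrable_bound[OF assms(1)])
   (use assms in \<open>auto simp: norm_mult dest: borel_measurable_integrable\<close>)

lemma integrable_tensor:
 fixes f g :: "real => complex"
 assumes f: "integrable lborel f" and g: "integrable lborel g"
 shows "integrable (lborel \<Otimes>\<^sub>M lborel) (%z. f (fst z) * g (snd z))"
proof (rule integrableI_bounded)
 have [measurable]: "f \<in> borel_measurable borel" "g \<in> borel_measurable borel"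
  using f g by (auto dest: borel_measurable_integrable)
 show "(%z. f (fst z) * g (snd z)) \<in> borel_measurable (lborel \<Otimes>\<^sub>M lborel)" by measurable
 have "(\<integral>\<^sup>+z. ennreal (cmod (f (fst z) * g (snd z))) \<partial>(lborel \<Otimes>\<^sub>M lborel))
   = (LNINT s. ennreal (cmod (f s))) * (LNINT s. ennreal (cmod (g s)))"
  by (subst lborel.nn_integral_fst[symmetric])
    (simp_all add: norm_mult ennreal_mult nn_integral_cmult nn_integral_multc)
 thus "(\<integral>\<^sup>+z. ennreal (cmod (f (fst z) * g (snd z))) \<partial>(lborel \<Otimes>\<^sub>M lborel)) < \<infinity>"
  using f g by (simp add: integrable_iff_bounded ennreal_mult_less_top)
qed

text \<open>
  An averaged form of Plancherel's identity: averaging \<open>\<bar>FT f\<bar>\<^sup>2\<close> over a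
  normally distributed frequency of variance \<open>1/\<sigma>\<^sup>2\<close> amounts to integrating \<open>f(s) cnj (f(t))\<close>
  against the Gaussian \<open>gauss \<sigma> (s - t)\<close>, the characteristic function of that distribution.
\<close>

lemma gaussian_Plancherel:
 assumes f: "integrable lborel f" and \<sigma>: "0 < \<sigma>"
 shows "(\<integral>\<^sup>+x. ennreal ((cmod (FT f (x / \<sigma>)))\<^sup>2) \<partial>std_normal)
  = ennreal (cmod (\<integral>z. f (fst z) * cnj (f (snd z)) * of_real (gauss \<sigma> (fst z - snd z)) \<partial>(lborel \<Otimes>\<^sub>M lborel)))"
proof -
 have [measurable]: "f \<in> borel_measurable borel" using f by (auto dest: borel_measurable_integrable)
 interpret G: real_distribution std_normal by (rule real_dist_normal_dist)
 interpret GP: pair_sigma_finite std_normal "lborel \<Otimes>\<^sub>M lborel :: (real \<times> real) measure"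
  by (intro pair_sigma_finite.intro G.sigma_finite_measure_axioms lborel_pair.sigma_finite_measure_axioms)
 define h where "h z = f (fst z) * cnj (f (snd z))" for z
 have h: "integrable (lborel \<Otimes>\<^sub>M lborel) h"
  unfolding h_def by (rule integrable_tensor[OF f Bochner_Integration.integrable_cnj[OF f]])
 have [measurable]: "h \<in> borel_measurable (lborel \<Otimes>\<^sub>M lborel)" unfolding h_def by measurable
 have sq: "of_real ((cmod (FT f \<xi>))\<^sup>2) = (\<integral>z. h z * cis (- (\<xi> * (fst z - snd z))) \<partial>(lborel \<Otimes>\<^sub>M lborel))" for \<xi>
 proof -
  let ?g = "%s. f s * cis (- (\<xi> * s))"
  have g: "integrable lborel ?g" by (rule integrable_cis_mult[OF f]) measurable
  have "integrable (lborel \<Otimes>\<^sub>M lborel) (%z. ?g (fst z) * cnj (?g (snd z)))"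
   by (rule integrable_tensor[OF g Bochner_Integration.integrable_cnj[OF g]])
  hence "(\<integral>s. (\<integral>t. ?g s * cnj (?g t) \<partial>lborel) \<partial>lborel) = (\<integral>z. ?g (fst z) * cnj (?g (snd z)) \<partial>(lborel \<Otimes>\<^sub>M lborel))"
   using lborel_pair.integral_fst'[of "%z. ?g (fst z) * cnj (?g (snd z))"] by simp
  moreover have "(\<integral>s. (\<integral>t. ?g s * cnj (?g t) \<partial>lborel) \<partial>lborel) = FT f \<xi> * cnj (FT f \<xi>)"
  proof -
   have "cnj (FT f \<xi>) = (\<integral>t. cnj (?g t) \<partial>lborel)"
    unfolding FT_def by (rule Bochner_Integration.integral_cnj[symmetric])
   thus ?thesis unfolding FT_def by simp
  qed
  moreover have "?g (fst z) * cnj (?g (snd z)) = h z * cis (- (\<xi> * (fst z - snd z)))" for z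
  proof -
   have "cis (- (\<xi> * fst z)) * cis (\<xi> * snd z) = cis (- (\<xi> * (fst z - snd z)))"
    by (simp add: cis_mult algebra_simps)
   thus ?thesis by (simp add: h_def cis_cnj mult_ac)
  qed
  ultimately show ?thesis by (simp only: complex_norm_square)
 qed
 have prod: "integrable (std_normal \<Otimes>\<^sub>M (lborel \<Otimes>\<^sub>M lborel)) (%(x, z). h z * cis (- (x / \<sigma> * (fst z - snd z))))"
 proof (rule integrableI_bounded)
  show "(%(x, z). h z * cis (- (x / \<sigma> * (fst z - snd z)))) \<in> borel_measurable (std_normal \<Otimes>\<^sub>M (lborel \<Otimes>\<^sub>M lborel))"
   by measurable
  have "(\<integral>\<^sup>+y. ennreal (cmod (case y of (x, z) => h z * cis (- (x / \<sigma> * (fst z - snd z))))) \<partial>(std_normal \<Otimes>\<^sub>M (lborel \<Otimes>\<^sub>M lborel)))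
    = (\<integral>\<^sup>+x. (\<integral>\<^sup>+z. ennreal (cmod (h z)) \<partial>(lborel \<Otimes>\<^sub>M lborel)) \<partial>std_normal)"
   by (subst lborel_pair.nn_integral_fst[symmetric]) (simp_all add: norm_mult)
  also have "... < \<infinity>" using h G.emeasure_space_1 by (simp add: integrable_iff_bounded)
  finally show "(\<integral>\<^sup>+y. ennreal (cmod (case y of (x, z) => h z * cis (- (x / \<sigma> * (fst z - snd z))))) \<partial>(std_normal \<Otimes>\<^sub>M (lborel \<Otimes>\<^sub>M lborel))) < \<infinity>" .
 qed
 have ch: "(\<integral>x. cis (- (x / \<sigma> * r)) \<partial>std_normal) = of_real (gauss \<sigma> r)" for r
 proof -
  have "(\<integral>x. cis (- (x / \<sigma> * r)) \<partial>std_normal) = char std_normal (- (r / \<sigma>))"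
   unfolding char_def cis_conv_exp by (intro Bochner_Integration.integral_cong) (auto simp: mult_ac)
  thus ?thesis unfolding char_std_normal_distribution gauss_def by (simp add: power_divide)
 qed
 have "(\<integral>x. of_real ((cmod (FT f (x / \<sigma>)))\<^sup>2) \<partial>std_normal)
   = (\<integral>x. (\<integral>z. h z * cis (- (x / \<sigma> * (fst z - snd z))) \<partial>(lborel \<Otimes>\<^sub>M lborel)) \<partial>std_normal)"
  by (simp only: sq)
 also have "... = (\<integral>z. (\<integral>x. h z * cis (- (x / \<sigma> * (fst z - snd z))) \<partial>std_normal) \<partial>(lborel \<Otimes>\<^sub>M lborel))"
  by (rule GP.Fubini_integral[OF prod, symmetric])
 also have "... = (\<integral>z. h z * of_real (gauss \<sigma> (fst z - snd z)) \<partial>(lborel \<Otimes>\<^sub>M lborel))"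
  by (simp only: integral_mult_right_zero ch)
 finally have main: "complex_of_real (\<integral>x. (cmod (FT f (x / \<sigma>)))\<^sup>2 \<partial>std_normal)
   = (\<integral>z. h z * of_real (gauss \<sigma> (fst z - snd z)) \<partial>(lborel \<Otimes>\<^sub>M lborel))"
  by (simp only: integral_complex_of_real)
 have [measurable]: "(%x. FT f (x / \<sigma>)) \<in> borel_measurable std_normal"
  unfolding FT_def by measurable
 have int: "integrable std_normal (%x. (cmod (FT f (x / \<sigma>)))\<^sup>2)"
 proof (rule G.integrable_const_bound[where B="(\<integral>s. cmod (f s) \<partial>lborel)\<^sup>2"])
  have "cmod (FT f \<xi>) <= (\<integral>s. cmod (f s) \<partial>lborel)" for \<xi>
   unfolding FT_def using integral_norm_bound[of lborel "%s. f s * cis (- (\<xi> * s))"] by (simp add: norm_mult)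
  thus "AE x in std_normal. norm ((cmod (FT f (x / \<sigma>)))\<^sup>2) <= (\<integral>s. cmod (f s) \<partial>lborel)\<^sup>2"
   by (intro AE_I2) (simp add: power_mono)
 qed measurable
 have "(\<integral>\<^sup>+x. ennreal ((cmod (FT f (x / \<sigma>)))\<^sup>2) \<partial>std_normal) = ennreal (\<integral>x. (cmod (FT f (x / \<sigma>)))\<^sup>2 \<partial>std_normal)"
  by (rule nn_integral_eq_integral[OF int]) simp
 also have "(\<integral>x. (cmod (FT f (x / \<sigma>)))\<^sup>2 \<partial>std_normal) = cmod (complex_of_real (\<integral>x. (cmod (FT f (x / \<sigma>)))\<^sup>2 \<partial>std_normal))"
  by simp
 finally show ?thesis unfolding main by (simp add: h_def)
qed

lemma gaussian_FT_le:
 assumes f: "integrable lborel f" and \<sigma>: "0 < \<sigma>"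
 shows "(\<integral>\<^sup>+x. ennreal ((cmod (FT f (x / \<sigma>)))\<^sup>2) \<partial>std_normal)
  <= ennreal (\<sigma> * sqrt (2 * pi)) * (LNINT s. ennreal ((cmod (f s))\<^sup>2))"
proof -
 have [measurable]: "f \<in> borel_measurable borel" using f by (auto dest: borel_measurable_integrable)
 let ?PP = "lborel \<Otimes>\<^sub>M lborel :: (real \<times> real) measure"
 let ?F = "%z. f (fst z) * cnj (f (snd z)) * of_real (gauss \<sigma> (fst z - snd z))"
 let ?q = "%s t. ennreal (1/2 * (cmod (f s))\<^sup>2) * ennreal (gauss \<sigma> (s - t))"
 have "ennreal (cmod (integral\<^sup>L ?PP ?F)) <= (\<integral>\<^sup>+z. ennreal (cmod (?F z)) \<partial>?PP)"
  by (cases "integrable ?PP ?F") (auto simp: not_integrable_integral_eq intro: integral_norm_bound_ennreal)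
 also have "... <= (\<integral>\<^sup>+z. ?q (fst z) (snd z) + ?q (snd z) (fst z) \<partial>?PP)"
 proof (rule nn_integral_mono)
  fix z
  have g: "gauss \<sigma> (snd z - fst z) = gauss \<sigma> (fst z - snd z)" by (simp add: gauss_def power2_commute)
  have "cmod (f (fst z)) * cmod (f (snd z)) <= 1/2 * (cmod (f (fst z)))\<^sup>2 + 1/2 * (cmod (f (snd z)))\<^sup>2"
   using sum_squares_bound[of "cmod (f (fst z))" "cmod (f (snd z))"] by simp
  hence "cmod (?F z) <= (1/2 * (cmod (f (fst z)))\<^sup>2 + 1/2 * (cmod (f (snd z)))\<^sup>2) * gauss \<sigma> (fst z - snd z)"
   using gauss_pos[of \<sigma> "fst z - snd z"] by (auto simp: norm_mult intro!: mult_right_mono)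
  thus "ennreal (cmod (?F z)) <= ?q (fst z) (snd z) + ?q (snd z) (fst z)"
   using gauss_pos[of \<sigma> "fst z - snd z"] unfolding g
   by (simp flip: ennreal_mult ennreal_plus add: distrib_right ennreal_leI)
 qed
 also have "... = (\<integral>\<^sup>+z. ?q (fst z) (snd z) \<partial>?PP) + (\<integral>\<^sup>+z. ?q (snd z) (fst z) \<partial>?PP)"
  by (rule nn_integral_add) measurable
 also have "(\<integral>\<^sup>+z. ?q (fst z) (snd z) \<partial>?PP) = (LNINT s. ennreal (1/2 * (cmod (f s))\<^sup>2) * ennreal (\<sigma> * sqrt (2 * pi)))"
  by (subst lborel.nn_integral_fst[symmetric], measurable)
    (simp add: nn_integral_cmult nn_integral_reflect[of "%t. ennreal (gauss \<sigma> t)"] gauss_nn_integral[OF \<sigma>] del: ennreal_half)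
 also have "(\<integral>\<^sup>+z. ?q (snd z) (fst z) \<partial>?PP) = (LNINT s. ennreal (1/2 * (cmod (f s))\<^sup>2) * ennreal (\<sigma> * sqrt (2 * pi)))"
  by (subst lborel_pair.nn_integral_snd[symmetric], measurable)
    (simp add: nn_integral_cmult nn_integral_reflect[of "%t. ennreal (gauss \<sigma> t)"] gauss_nn_integral[OF \<sigma>] del: ennreal_half)
 also have "(LNINT s. ennreal (1/2 * (cmod (f s))\<^sup>2) * ennreal (\<sigma> * sqrt (2 * pi)))
   + (LNINT s. ennreal (1/2 * (cmod (f s))\<^sup>2) * ennreal (\<sigma> * sqrt (2 * pi)))
   = (LNINT s. ennreal (\<sigma> * sqrt (2 * pi)) * ennreal ((cmod (f s))\<^sup>2))"
 proof (subst nn_integral_add[symmetric])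
  show "(LNINT s. ennreal (1/2 * (cmod (f s))\<^sup>2) * ennreal (\<sigma> * sqrt (2 * pi))
    + ennreal (1/2 * (cmod (f s))\<^sup>2) * ennreal (\<sigma> * sqrt (2 * pi)))
    = (LNINT s. ennreal (\<sigma> * sqrt (2 * pi)) * ennreal ((cmod (f s))\<^sup>2))"
  proof (rule nn_integral_cong)
   fix s
   have "1/2 * (cmod (f s))\<^sup>2 * (\<sigma> * sqrt (2 * pi)) + 1/2 * (cmod (f s))\<^sup>2 * (\<sigma> * sqrt (2 * pi))
     = \<sigma> * sqrt (2 * pi) * (cmod (f s))\<^sup>2" by simp
   thus "ennreal (1/2 * (cmod (f s))\<^sup>2) * ennreal (\<sigma> * sqrt (2 * pi))
    + ennreal (1/2 * (cmod (f s))\<^sup>2) * ennreal (\<sigma> * sqrt (2 * pi))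
    = ennreal (\<sigma> * sqrt (2 * pi)) * ennreal ((cmod (f s))\<^sup>2)"
    using \<sigma> by (subst (1 2 3) ennreal_mult[symmetric]) (auto simp flip: ennreal_plus)
  qed
 qed measurable
 also have "... = ennreal (\<sigma> * sqrt (2 * pi)) * (LNINT s. ennreal ((cmod (f s))\<^sup>2))"
  by (rule nn_integral_cmult) measurable
 finally show ?thesis unfolding gaussian_Plancherel[OF f \<sigma>] .
qed

lemma integrable_bounded_support:
 fixes f :: "real => complex"
 assumes [measurable]: "f \<in> borel_measurable borel" and "\<And>s. cmod (f s) <= B" and "\<And>s. \<bar>s\<bar> > n ==> f s = 0"
 shows "integrable lborel f"
proof (rule Bochner_Integration.integrable_bound)
 show "integrable lborel (%s. indicator {-n..n} s *\<^sub>R B)"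
  by (rule integrable_indicator) (simp_all add: emeasure_lborel_Icc_eq)
 show "AE s in lborel. cmod (f s) <= norm (indicator {-n..n} s *\<^sub>R B)"
 proof (rule AE_I2)
  fix s
  show "cmod (f s) <= norm (indicator {-n..n} s *\<^sub>R B)"
   using assms(2)[of s] assms(3)[of s] order.trans[OF norm_ge_zero assms(2)[of s]]
   by (cases "\<bar>s\<bar> > n") (auto split: split_indicator)
 qed
qed measurable

text \<open>
  As \<open>\<sigma> \<rightarrow> 0\<close> the rescaled Gaussian becomes an approximate identity, so that the averaged square of
  the transform tends to the full norm. Rescaling the inner variable turns the claim into continuity
  of translations in the mean.
\<close>

lemma gaussian_FT_tendsto:
 fixes f :: "real => complex"
 assumes fm [measurable]: "f \<in> borel_measurable borel" and B: "\<And>s. cmod (f s) <= B"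
  and supp: "\<And>s. \<bar>s\<bar> > n ==> f s = 0" and \<sigma>: "\<And>m. 0 < \<sigma> m" "\<sigma> \<longlonglongrightarrow> 0"
 shows "(%m. ennreal (1 / (\<sigma> m * sqrt (2 * pi))) * (\<integral>\<^sup>+x. ennreal ((cmod (FT f (x / \<sigma> m)))\<^sup>2) \<partial>std_normal))
  \<longlonglongrightarrow> (LNINT s. ennreal ((cmod (f s))\<^sup>2))"
proof -
 have B0: "0 <= B" using order.trans[OF norm_ge_zero B[of 0]] .
 have f: "integrable lborel f" by (rule integrable_bounded_support[OF fm B supp])
 have cf: "integrable lborel (%s. cnj (f s))" by (rule Bochner_Integration.integrable_cnj[OF f])
 have nd: "integrable lborel std_normal_density" by (rule integrable_normal_density) simp
 have nd1: "(\<integral>x. std_normal_density x \<partial>lborel) = 1" by (rule integral_normal_density) simp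
 have ndc: "integrable lborel (%x. complex_of_real (std_normal_density x))"
  using nd by (rule integrable_of_real)
 define J where "J m = (\<integral>z. f (fst z) * cnj (f (snd z)) * of_real (gauss (\<sigma> m) (fst z - snd z)) \<partial>(lborel \<Otimes>\<^sub>M lborel))" for m
 define g where "g m s = (\<integral>x. cnj (f (s - \<sigma> m * x)) * of_real (std_normal_density x) \<partial>lborel)" for m s
 have [measurable]: "g m \<in> borel_measurable borel" for m unfolding g_def[abs_def] by measurable
 have inner_int: "integrable lborel (%x. cnj (f (s - \<sigma> m * x)) * of_real (std_normal_density x))" for s m
  by (rule Bochner_Integration.integrable_bound[OF integrable_mult_left[OF nd, of B]])
    (auto simp: norm_mult abs_mult B0 mult.commute[of _ B] intro!: AE_I2 mult_right_mono B)
 have gB: "cmod (g m s) <= B" for m s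
 proof -
  have "cmod (g m s) <= (\<integral>x. B * std_normal_density x \<partial>lborel)"
   unfolding g_def
  proof (rule order.trans[OF integral_norm_bound integral_mono])
   show "integrable lborel (%x. cmod (cnj (f (s - \<sigma> m * x)) * of_real (std_normal_density x)))"
    using inner_int by (rule integrable_norm)
   show "integrable lborel (%x. B * std_normal_density x)" using nd by simp
  qed (auto simp: norm_mult intro!: mult_right_mono B)
  thus ?thesis using nd1 by simp
 qed
 have JI: "J m = of_real (\<sigma> m * sqrt (2 * pi)) * (\<integral>s. f s * g m s \<partial>lborel)" for m
 proof -
  let ?F = "%z. f (fst z) * cnj (f (snd z)) * complex_of_real (gauss (\<sigma> m) (fst z - snd z))"
  have "integrable (lborel \<Otimes>\<^sub>M lborel) ?F"
  proof (rule Bochner_Integration.integrable_bound[OF integrable_tensor[OF f cf]])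
   show "AE z in lborel \<Otimes>\<^sub>M lborel. cmod (?F z) <= cmod (f (fst z) * cnj (f (snd z)))"
   proof (rule AE_I2)
    fix z :: "real \<times> real"
    have "gauss (\<sigma> m) (fst z - snd z) <= 1" by (simp add: gauss_def)
    thus "cmod (?F z) <= cmod (f (fst z) * cnj (f (snd z)))"
     using gauss_pos[of "\<sigma> m" "fst z - snd z"] by (simp add: norm_mult mult_left_le)
   qed
  qed measurable
  hence "J m = (\<integral>s. (\<integral>t. ?F (s, t) \<partial>lborel) \<partial>lborel)"
   unfolding J_def by (rule lborel_pair.integral_fst'[symmetric])
  also have "... = (\<integral>s. of_real (\<sigma> m * sqrt (2 * pi)) * (f s * g m s) \<partial>lborel)"
  proof (rule Bochner_Integration.integral_cong[OF refl])
   fix s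
   have "(\<integral>t. ?F (s, t) \<partial>lborel) = f s * (\<integral>t. cnj (f t) * of_real (gauss (\<sigma> m) (s - t)) \<partial>lborel)"
    by (simp add: mult.assoc)
   also have "(\<integral>t. cnj (f t) * of_real (gauss (\<sigma> m) (s - t)) \<partial>lborel)
     = \<bar>- \<sigma> m\<bar> *\<^sub>R (\<integral>x. cnj (f (s + (- \<sigma> m) * x)) * of_real (gauss (\<sigma> m) (s - (s + (- \<sigma> m) * x))) \<partial>lborel)"
    using \<sigma>(1)[of m] by (intro lborel_integral_real_affine) simp
   also have "(%x. cnj (f (s + (- \<sigma> m) * x)) * complex_of_real (gauss (\<sigma> m) (s - (s + (- \<sigma> m) * x))))
     = (%x. of_real (sqrt (2 * pi)) * (cnj (f (s - \<sigma> m * x)) * of_real (std_normal_density x)))"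
   proof
    fix x
    have "gauss (\<sigma> m) (s - (s + (- \<sigma> m) * x)) = sqrt (2 * pi) * std_normal_density x"
     using \<sigma>(1)[of m] by (simp add: gauss_def std_normal_density_def power_mult_distrib)
    thus "cnj (f (s + (- \<sigma> m) * x)) * complex_of_real (gauss (\<sigma> m) (s - (s + (- \<sigma> m) * x)))
     = of_real (sqrt (2 * pi)) * (cnj (f (s - \<sigma> m * x)) * of_real (std_normal_density x))"
     by (simp only: of_real_mult) simp
   qed
   also have "(\<integral>x. of_real (sqrt (2 * pi)) * (cnj (f (s - \<sigma> m * x)) * of_real (std_normal_density x)) \<partial>lborel)
     = of_real (sqrt (2 * pi)) * g m s"
    unfolding g_def by simp
   finally show "(\<integral>t. ?F (s, t) \<partial>lborel) = of_real (\<sigma> m * sqrt (2 * pi)) * (f s * g m s)"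
    using \<sigma>(1)[of m] by (simp add: scaleR_conv_of_real mult_ac)
  qed
  finally show ?thesis by simp
 qed
 define I where "I m = (\<integral>s. f s * g m s \<partial>lborel)" for m
 define I0 where "I0 = (\<integral>s. f s * cnj (f s) \<partial>lborel)"
 have fg: "integrable lborel (%s. f s * g m s)" for m
  by (rule Bochner_Integration.integrable_bound[OF integrable_mult_right[OF integrable_norm[OF f], of B]])
    (auto simp: norm_mult abs_mult B0 mult.commute[of B] intro!: AE_I2 mult_left_mono gB)
 have ff: "integrable lborel (%s. f s * cnj (f s))"
  by (rule Bochner_Integration.integrable_bound[OF integrable_mult_right[OF integrable_norm[OF f], of B]])
    (auto simp: norm_mult abs_mult B0 mult.commute[of B] intro!: AE_I2 mult_left_mono B)
 define D where "D r = (LNINT s. ennreal (cmod (f (s - r) - f s)))" for r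
 have [measurable]: "D \<in> borel_measurable borel" unfolding D_def[abs_def] by measurable
 have diff: "ennreal (cmod (I m - I0)) <= ennreal B * (LNINT x. ennreal (std_normal_density x) * D (\<sigma> m * x))" for m
 proof -
  have "I m - I0 = (\<integral>s. f s * (g m s - cnj (f s)) \<partial>lborel)"
   unfolding I_def I0_def right_diff_distrib by (rule Bochner_Integration.integral_diff[OF fg ff, symmetric])
  moreover have "integrable lborel (%s. f s * (g m s - cnj (f s)))"
   using Bochner_Integration.integrable_diff[OF fg ff] by (simp add: right_diff_distrib)
  ultimately have "ennreal (cmod (I m - I0)) <= (LNINT s. ennreal (cmod (f s * (g m s - cnj (f s)))))"
   using integral_norm_bound_ennreal by metis
  also have "... <= (LNINT s. (LNINT x. ennreal B * (ennreal (std_normal_density x) * ennreal (cmod (f (s - \<sigma> m * x) - f s)))))"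
  proof (rule nn_integral_mono)
   fix s
   have "g m s - cnj (f s) = (\<integral>x. cnj (f (s - \<sigma> m * x)) * of_real (std_normal_density x) \<partial>lborel)
     - (\<integral>x. cnj (f s) * of_real (std_normal_density x) \<partial>lborel)"
    unfolding g_def using nd1 by simp
   also have "... = (\<integral>x. cnj (f (s - \<sigma> m * x)) * of_real (std_normal_density x) - cnj (f s) * of_real (std_normal_density x) \<partial>lborel)"
    by (rule Bochner_Integration.integral_diff[symmetric]) (use inner_int ndc in auto)
   finally have e: "g m s - cnj (f s) = ..." .
   have "integrable lborel (%x. cnj (f (s - \<sigma> m * x)) * of_real (std_normal_density x) - cnj (f s) * of_real (std_normal_density x))"
    using inner_int ndc by auto
   from integral_norm_bound_ennreal[OF this, folded e]
   have le: "ennreal (cmod (g m s - cnj (f s))) <= (LNINT x. ennreal (cmod (cnj (f (s - \<sigma> m * x)) * of_real (std_normal_density x) - cnj (f s) * of_real (std_normal_density x))))" .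
   have n: "cmod (cnj (f (s - \<sigma> m * x)) * of_real (std_normal_density x) - cnj (f s) * of_real (std_normal_density x))
     = std_normal_density x * cmod (f (s - \<sigma> m * x) - f s)" for x
   proof -
    have "cnj (f (s - \<sigma> m * x)) * of_real (std_normal_density x) - cnj (f s) * of_real (std_normal_density x)
      = of_real (std_normal_density x) * cnj (f (s - \<sigma> m * x) - f s)" by (simp add: algebra_simps)
    thus ?thesis by (simp only: norm_mult norm_of_real complex_mod_cnj) simp
   qed
   have "ennreal (cmod (f s * (g m s - cnj (f s)))) <= ennreal B * ennreal (cmod (g m s - cnj (f s)))"
    using B[of s] by (simp add: norm_mult ennreal_mult mult_right_mono ennreal_leI)
   also have "... <= ennreal B * (LNINT x. ennreal (std_normal_density x) * ennreal (cmod (f (s - \<sigma> m * x) - f s)))"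
    using le unfolding n by (intro mult_left_mono) (auto simp: ennreal_mult)
   also have "... = (LNINT x. ennreal B * (ennreal (std_normal_density x) * ennreal (cmod (f (s - \<sigma> m * x) - f s))))"
    by (rule nn_integral_cmult[symmetric]) measurable
   finally show "ennreal (cmod (f s * (g m s - cnj (f s)))) <= ..." .
  qed
  also have "... = (LNINT x. (LNINT s. ennreal B * (ennreal (std_normal_density x) * ennreal (cmod (f (s - \<sigma> m * x) - f s)))))"
   by (rule lborel_pair.Fubini') measurable
  also have "... = (LNINT x. ennreal B * (ennreal (std_normal_density x) * D (\<sigma> m * x)))"
   by (simp add: nn_integral_cmult D_def)
  also have "... = ennreal B * (LNINT x. ennreal (std_normal_density x) * D (\<sigma> m * x))"
   by (rule nn_integral_cmult) measurable
  finally show ?thesis .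
 qed
 define F1 where "F1 = (LNINT s. ennreal (cmod (f s)))"
 have F1: "F1 < \<infinity>" using f by (simp add: F1_def integrable_iff_bounded)
 have DF: "D r <= F1 + F1" for r
 proof -
  have "D r <= (LNINT s. ennreal (cmod (f (s - r))) + ennreal (cmod (f s)))"
   unfolding D_def by (intro nn_integral_mono) (simp flip: ennreal_plus add: ennreal_leI norm_triangle_ineq4)
  also have "... = F1 + F1"
   using nn_integral_translate[of "%s. ennreal (cmod (f s))" r] by (simp add: nn_integral_add F1_def)
  finally show ?thesis .
 qed
 have "(%m. LNINT x. ennreal (std_normal_density x) * D (\<sigma> m * x)) \<longlonglongrightarrow> integral\<^sup>N (lborel :: real measure) (%x. 0)"
 proof (rule nn_integral_dominated_convergence[where w="%x. ennreal (std_normal_density x) * (F1 + F1)"])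
  show "AE x in lborel. ennreal (std_normal_density x) * D (\<sigma> m * x) <= ennreal (std_normal_density x) * (F1 + F1)" for m
   by (intro AE_I2 mult_left_mono DF) simp
  have "(LNINT x. ennreal (std_normal_density x)) < \<infinity>"
   using nd by (simp add: integrable_iff_bounded)
  thus "(LNINT x. ennreal (std_normal_density x) * (F1 + F1)) < \<infinity>"
   using F1 by (simp add: nn_integral_multc ennreal_mult_less_top)
  show "AE x in lborel. (%m. ennreal (std_normal_density x) * D (\<sigma> m * x)) \<longlonglongrightarrow> 0"
  proof (rule AE_I2)
   fix x :: real
   have "(%m. \<sigma> m * x) \<longlonglongrightarrow> 0 * x" by (rule tendsto_mult_right[OF \<sigma>(2)])
   hence "(%m. D (\<sigma> m * x)) \<longlonglongrightarrow> 0" unfolding D_def by (intro translation_continuous_L1[OF _ f]) simp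
   hence "(%m. ennreal (std_normal_density x) * D (\<sigma> m * x)) \<longlonglongrightarrow> ennreal (std_normal_density x) * 0"
    by (intro tendsto_mult_ennreal tendsto_const) auto
   thus "(%m. ennreal (std_normal_density x) * D (\<sigma> m * x)) \<longlonglongrightarrow> 0" by simp
  qed
 qed measurable
 hence "(%m. ennreal B * (LNINT x. ennreal (std_normal_density x) * D (\<sigma> m * x))) \<longlonglongrightarrow> ennreal B * 0"
  by (intro tendsto_mult_ennreal tendsto_const) auto
 hence "(%m. ennreal B * (LNINT x. ennreal (std_normal_density x) * D (\<sigma> m * x))) \<longlonglongrightarrow> 0"
  by simp
 hence "(%m. ennreal (cmod (I m - I0))) \<longlonglongrightarrow> 0"
  by (rule tendsto_sandwich[OF always_eventually always_eventually tendsto_const, rotated 2]) (use diff in auto)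
 hence "(%m. ennreal (cmod (I m - I0))) \<longlonglongrightarrow> ennreal 0" by simp
 hence "(%m. cmod (I m - I0)) \<longlonglongrightarrow> 0"
  by (rule tendsto_ennrealD) auto
 hence "(%m. I m - I0) \<longlonglongrightarrow> 0" by (rule tendsto_norm_zero_cancel)
 hence "I \<longlonglongrightarrow> I0" by (rule LIM_zero_cancel)
 hence lim: "(%m. ennreal (cmod (I m))) \<longlonglongrightarrow> ennreal (cmod I0)"
  by (intro tendsto_ennrealI tendsto_norm)
 have e1: "ennreal (1 / (\<sigma> m * sqrt (2 * pi))) * (\<integral>\<^sup>+x. ennreal ((cmod (FT f (x / \<sigma> m)))\<^sup>2) \<partial>std_normal)
   = ennreal (cmod (I m))" for m
 proof -
  have "1 / (\<sigma> m * sqrt (2 * pi)) * cmod (J m) = cmod (I m)"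
   unfolding JI I_def using \<sigma>(1)[of m] by (simp add: norm_mult)
  thus ?thesis unfolding gaussian_Plancherel[OF f \<sigma>(1)] J_def[symmetric]
   using \<sigma>(1)[of m] by (simp flip: ennreal_mult)
 qed
 have "I0 = of_real (\<integral>s. (cmod (f s))\<^sup>2 \<partial>lborel)"
  unfolding I0_def by (simp only: complex_norm_square[symmetric] integral_complex_of_real)
 moreover have "integrable lborel (%s. (cmod (f s))\<^sup>2)"
  using integrable_norm[OF ff] by (simp add: norm_mult power2_eq_square)
 ultimately have e2: "ennreal (cmod I0) = (LNINT s. ennreal ((cmod (f s))\<^sup>2))"
  by (subst nn_integral_eq_integral) auto
 show ?thesis unfolding e1 e2[symmetric] by (rule lim)
qed

context convolution_kernel
begin

text \<open>
  Boundedness of the support lets Cauchy--Schwarz control the \<open>L\<^sup>1\<close> norm on each line by the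
  \<open>L\<^sup>2\<close> norm, and hence justifies the convolution theorem on almost every line.
\<close>

lemma fibre_L1_L2:
 assumes U: "U \<in> L2 cyl" and B: "\<And>z. cmod (U z) <= B" and supp: "\<And>z. \<bar>fst z\<bar> > n ==> U z = 0" and n: "0 < n"
 shows "(%x. of_real (\<integral>s. cmod (U (s, x)) \<partial>lborel)) \<in> L2 \<nu>"
proof -
 have [measurable]: "U \<in> borel_measurable cyl" by (rule L2_measurable[OF U])
 have "(\<integral>\<^sup>+x. ennreal ((cmod (of_real (\<integral>s. cmod (U (s, x)) \<partial>lborel)))\<^sup>2) \<partial>\<nu>)
   <= (\<integral>\<^sup>+x. ennreal (2 * n) * (LNINT s. ennreal ((cmod (U (s, x)))\<^sup>2)) \<partial>\<nu>)"
 proof (rule nn_integral_mono)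
  fix x assume x: "x \<in> space \<nu>"
  have [measurable]: "(%s. U (s, x)) \<in> borel_measurable borel" using x by measurable
  have i: "integrable lborel (%s. U (s, x))" by (rule integrable_bounded_support[where B=B and n=n]) (use B supp in auto)
  have "ennreal ((cmod (of_real (\<integral>s. cmod (U (s, x)) \<partial>lborel)))\<^sup>2) = (LNINT s. ennreal (cmod (U (s, x))))\<^sup>2"
   using integrable_norm[OF i] by (subst nn_integral_eq_integral) (auto simp: ennreal_power)
  also have "(LNINT s. ennreal (cmod (U (s, x)))) = (LNINT s. indicator {-n..n} s * ennreal (cmod (U (s, x))))"
   by (intro nn_integral_cong) (use supp[of "(_, x)"] in \<open>auto split: split_indicator\<close>)
  also have "...\<^sup>2 <= (LNINT s. (indicator {-n..n} s)\<^sup>2) * (LNINT s. (ennreal (cmod (U (s, x))))\<^sup>2)"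
   by (rule Cauchy_Schwarz_nn_integral) measurable
  also have "(LNINT s. (indicator {-n..n} s)\<^sup>2) = (LNINT s. indicator {-n..n} s)"
   by (intro nn_integral_cong) (auto split: split_indicator)
  also have "... = ennreal (2 * n)" using n by simp
  finally show "ennreal ((cmod (of_real (\<integral>s. cmod (U (s, x)) \<partial>lborel)))\<^sup>2)
    <= ennreal (2 * n) * (LNINT s. ennreal ((cmod (U (s, x)))\<^sup>2))"
   by (simp add: ennreal_power)
 qed
 also have "... = ennreal (2 * n) * (\<integral>\<^sup>+z. ennreal ((cmod (U z))\<^sup>2) \<partial>cyl)"
  by (subst nn_integral_cmult) (simp_all add: real_pair.nn_integral_snd[of "%z. ennreal ((cmod (U z))\<^sup>2)"])
 also have "... < \<infinity>" using U by (simp add: L2_iff ennreal_mult_less_top)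
 finally show ?thesis by (subst L2_iff) simp
qed

text \<open>
  The convolution theorem. The finiteness hypothesis holds for almost every \<open>x\<close> and permits Fubini.
\<close>

lemma FT_conv:
 assumes U: "U \<in> L2 cyl" and B: "\<And>z. cmod (U z) <= B" and supp: "\<And>z. \<bar>fst z\<bar> > n ==> U z = 0"
  and x: "x \<in> space \<nu>"
  and fin: "(\<integral>\<^sup>+w. ennreal (\<bar>k (fst w) x (snd w)\<bar> * (\<integral>s. cmod (U (s, snd w)) \<partial>lborel)) \<partial>cyl) < \<infinity>"
 shows "integrable lborel (%s. conv U (s, x))"
  and "FT (%s. conv U (s, x)) \<xi> = symbol \<xi> (%y. FT (%s. U (s, y)) \<xi>) x"
proof -
 have Um [measurable]: "U \<in> borel_measurable cyl" by (rule L2_measurable[OF U])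
 have Ui: "integrable lborel (%s. U (s, y))" if "y \<in> space \<nu>" for y
  by (rule integrable_bounded_support[where B=B and n=n]) (use B supp that in auto)
 interpret rc: pair_sigma_finite lborel cyl
  by (intro pair_sigma_finite.intro sigma_finite_lborel
    sigma_finite_pair_measure[OF sigma_finite_lborel sigma_finite_measure_axioms])
 define H where "H = (%(s, w). complex_of_real (k (fst w) x (snd w)) * U (s - fst w, snd w))"
 have Hm [measurable]: "H \<in> borel_measurable (lborel \<Otimes>\<^sub>M cyl)"
  unfolding H_def split_beta' using x by measurable
 have H: "integrable (lborel \<Otimes>\<^sub>M cyl) H"
 proof (rule integrableI_bounded[OF Hm])
  have "(\<integral>\<^sup>+z. ennreal (cmod (H z)) \<partial>(lborel \<Otimes>\<^sub>M cyl)) = (\<integral>\<^sup>+w. (LNINT s. ennreal (cmod (H (s, w)))) \<partial>cyl)"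
   by (rule rc.nn_integral_snd[symmetric]) measurable
  also have "... = (\<integral>\<^sup>+w. ennreal (\<bar>k (fst w) x (snd w)\<bar> * (\<integral>s. cmod (U (s, snd w)) \<partial>lborel)) \<partial>cyl)"
  proof (rule nn_integral_cong)
   fix w :: "real \<times> 'b" assume "w \<in> space cyl"
   hence y: "snd w \<in> space \<nu>" by (auto simp: space_pair_measure)
   have [measurable]: "(%s. U (s, snd w)) \<in> borel_measurable borel" using y by measurable
   have "(LNINT s. ennreal (cmod (H (s, w))))
     = (LNINT s. ennreal \<bar>k (fst w) x (snd w)\<bar> * ennreal (cmod (U (s - fst w, snd w))))"
    by (simp add: H_def norm_mult ennreal_mult)
   also have "... = ennreal \<bar>k (fst w) x (snd w)\<bar> * (LNINT s. ennreal (cmod (U (s - fst w, snd w))))"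
    by (rule nn_integral_cmult) (use y in measurable)
   also have "(LNINT s. ennreal (cmod (U (s - fst w, snd w)))) = (LNINT s. ennreal (cmod (U (s, snd w))))"
    by (rule nn_integral_translate[of "%s. ennreal (cmod (U (s, snd w)))" "fst w"]) measurable
   also have "... = ennreal (\<integral>s. cmod (U (s, snd w)) \<partial>lborel)"
    by (rule nn_integral_eq_integral) (use Ui[OF y] in auto)
   finally show "(LNINT s. ennreal (cmod (H (s, w))))
     = ennreal (\<bar>k (fst w) x (snd w)\<bar> * (\<integral>s. cmod (U (s, snd w)) \<partial>lborel))"
    by (simp add: ennreal_mult)
  qed
  finally show "(\<integral>\<^sup>+z. ennreal (cmod (H z)) \<partial>(lborel \<Otimes>\<^sub>M cyl)) < \<infinity>" using fin by simp
 qed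
 have cH: "conv U (s, x) = (\<integral>w. H (s, w) \<partial>cyl)" for s
  unfolding conv_reflected[OF Um x] H_def by simp
 show "integrable lborel (%s. conv U (s, x))"
  unfolding cH by (rule rc.integrable_fst'[OF H])
 have Hc: "integrable (lborel \<Otimes>\<^sub>M cyl) (%(s, w). H (s, w) * cis (- (\<xi> * s)))"
  using integrable_cis_mult[OF H, of "%z. - (\<xi> * fst z)"] by (simp add: split_beta')
 have "FT (%s. conv U (s, x)) \<xi> = (\<integral>s. (\<integral>w. H (s, w) * cis (- (\<xi> * s)) \<partial>cyl) \<partial>lborel)"
  unfolding FT_def cH by simp
 also have "... = (\<integral>w. (\<integral>s. H (s, w) * cis (- (\<xi> * s)) \<partial>lborel) \<partial>cyl)"
  by (rule rc.Fubini_integral[OF Hc, symmetric])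
 also have "... = (\<integral>w. of_real (k (fst w) x (snd w)) * cis (- (\<xi> * fst w)) * FT (%s. U (s, snd w)) \<xi> \<partial>cyl)"
 proof (rule Bochner_Integration.integral_cong[OF refl])
  fix w :: "real \<times> 'b"
  have "(\<integral>s. U (s - fst w, snd w) * cis (- (\<xi> * s)) \<partial>lborel)
    = \<bar>1\<bar> *\<^sub>R (\<integral>s. U (fst w + 1 * s - fst w, snd w) * cis (- (\<xi> * (fst w + 1 * s))) \<partial>lborel)"
   by (rule lborel_integral_real_affine) simp
  also have "... = (\<integral>s. cis (- (\<xi> * fst w)) * (U (s, snd w) * cis (- (\<xi> * s))) \<partial>lborel)"
  proof -
   have "cis (- (\<xi> * (fst w + s))) = cis (- (\<xi> * fst w)) * cis (- (\<xi> * s))" for s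
    by (simp add: cis_mult algebra_simps)
   thus ?thesis by (simp add: mult_ac)
  qed
  also have "... = cis (- (\<xi> * fst w)) * FT (%s. U (s, snd w)) \<xi>" by (simp add: FT_def)
  finally show "(\<integral>s. H (s, w) * cis (- (\<xi> * s)) \<partial>lborel)
    = of_real (k (fst w) x (snd w)) * cis (- (\<xi> * fst w)) * FT (%s. U (s, snd w)) \<xi>"
   by (simp add: H_def mult.assoc)
 qed
 also have "... = symbol \<xi> (%y. FT (%s. U (s, y)) \<xi>) x"
 proof (rule symbol_cyl(2)[symmetric, OF _ x])
  show "(%y. FT (%s. U (s, y)) \<xi>) \<in> borel_measurable \<nu>" unfolding FT_def by measurable
  have "cmod (FT (%s. U (s, y)) \<xi>) <= (\<integral>s. cmod (U (s, y)) \<partial>lborel)" for y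
   unfolding FT_def using integral_norm_bound[of lborel "%s. U (s, y) * cis (- (\<xi> * s))"] by (simp add: norm_mult)
  hence "(\<integral>\<^sup>+w. ennreal (\<bar>k (fst w) x (snd w)\<bar> * cmod (FT (%s. U (s, snd w)) \<xi>)) \<partial>cyl)
    <= (\<integral>\<^sup>+w. ennreal (\<bar>k (fst w) x (snd w)\<bar> * (\<integral>s. cmod (U (s, snd w)) \<partial>lborel)) \<partial>cyl)"
   by (intro nn_integral_mono ennreal_leI mult_left_mono) auto
  thus "(\<integral>\<^sup>+w. ennreal (\<bar>k (fst w) x (snd w)\<bar> * cmod (FT (%s. U (s, snd w)) \<xi>)) \<partial>cyl) < \<infinity>"
   using fin by (rule le_less_trans)
 qed
 finally show "FT (%s. conv U (s, x)) \<xi> = symbol \<xi> (%y. FT (%s. U (s, y)) \<xi>) x" .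
qed

text \<open>
  Apply the lower bound for the symbol at each frequency to the Fourier transform of \<open>U\<close> in \<open>s\<close>, average
  over frequencies, and let the Gaussian average widen. For \<open>U\<close> the average converges to the norm; for
  its image an upper bound (\<open>gaussian_FT_le\<close>) suffices.
\<close>

lemma conv_bounded_below_bounded_support:
 assumes c: "0 < c" and sb: "\<And>\<xi>. bounded_below \<nu> (shift (symbol \<xi>) \<mu>) c"
  and U: "U \<in> L2 cyl" and B: "\<And>z. cmod (U z) <= B" and supp: "\<And>z. \<bar>fst z\<bar> > n ==> U z = 0" and n: "0 < n"
 shows "c * L2_norm cyl U <= L2_norm cyl (shift conv \<mu> U)"
proof -
 have Um [measurable]: "U \<in> borel_measurable cyl" by (rule L2_measurable[OF U])
 define W where "W = shift conv \<mu> U"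
 have WL: "W \<in> L2 cyl" unfolding W_def by (rule bounded_op_L2[OF bounded_op_shift[OF bounded_conv] U])
 have Wm [measurable]: "W \<in> borel_measurable cyl" by (rule L2_measurable[OF WL])
 interpret G: real_distribution std_normal by (rule real_dist_normal_dist)
 interpret GN: pair_sigma_finite std_normal \<nu>
  by (intro pair_sigma_finite.intro G.sigma_finite_measure_axioms sigma_finite_measure_axioms)
 note mL = fibre_L1_L2[OF U B supp n]
 have mpos: "cmod (of_real (\<integral>s. cmod (U (s, y)) \<partial>lborel)) = (\<integral>s. cmod (U (s, y)) \<partial>lborel)" for y
  by (simp add: integral_nonneg)
 have good: "AE x in \<nu>. (\<integral>\<^sup>+w. ennreal (\<bar>k (fst w) x (snd w)\<bar> * (\<integral>s. cmod (U (s, snd w)) \<partial>lborel)) \<partial>cyl) < \<infinity>"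
  using AE_finite_row[OF mL] unfolding mpos .
 define Uh where "Uh \<xi> x = FT (%s. U (s, x)) \<xi>" for \<xi> x
 define Wh where "Wh \<xi> x = FT (%s. W (s, x)) \<xi>" for \<xi> x
 have [measurable]: "(%(\<xi>, x). Uh \<xi> x) \<in> borel_measurable (borel \<Otimes>\<^sub>M \<nu>)"
  unfolding Uh_def FT_def split_beta' by measurable
 have [measurable]: "(%(\<xi>, x). Wh \<xi> x) \<in> borel_measurable (borel \<Otimes>\<^sub>M \<nu>)"
  unfolding Wh_def FT_def split_beta' by measurable
 have UhL: "Uh \<xi> \<in> L2 \<nu>" for \<xi>
 proof (rule L2_mono(1)[OF mL])
  show "Uh \<xi> \<in> borel_measurable \<nu>" by measurable
  show "AE x in \<nu>. cmod (Uh \<xi> x) <= cmod (of_real (\<integral>s. cmod (U (s, x)) \<partial>lborel))"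
   unfolding mpos Uh_def FT_def using integral_norm_bound[of lborel "%s. U (s, _) * cis (- (\<xi> * s))"]
   by (intro AE_I2) (simp add: norm_mult)
 qed
 have Ui: "integrable lborel (%s. U (s, y))" if "y \<in> space \<nu>" for y
  by (rule integrable_bounded_support[where B=B and n=n]) (use B supp that in auto)
 have WU: "AE x in \<nu>. integrable lborel (%s. W (s, x)) \<and> (\<forall>\<xi>. Wh \<xi> x = shift (symbol \<xi>) \<mu> (Uh \<xi>) x)"
  using good AE_space
 proof eventually_elim
  case (elim x)
  note F = FT_conv[where n=n, OF U B supp elim(2,1)]
  have Wx: "(%s. W (s, x)) = (%s. conv U (s, x) - \<mu> * U (s, x))" by (simp add: W_def shift_def)
  have "Wh \<xi> x = shift (symbol \<xi>) \<mu> (Uh \<xi>) x" for \<xi>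
  proof -
   have "Wh \<xi> x = FT (%s. conv U (s, x)) \<xi> - \<mu> * FT (%s. U (s, x)) \<xi>"
    unfolding Wh_def Wx FT_def
    using integrable_cis_mult[OF F(1), where g="%s. - (\<xi> * s)"] integrable_cis_mult[OF Ui[OF elim(2)], where g="%s. - (\<xi> * s)"]
    by (simp add: left_diff_distrib mult.assoc)
   thus ?thesis using F(2)[of \<xi>] by (simp add: shift_def Uh_def[abs_def])
  qed
  moreover have "integrable lborel (%s. W (s, x))" unfolding Wx using F(1) Ui[OF elim(2)] by simp
  ultimately show ?case by blast
 qed
 define \<sigma> where "\<sigma> m = 1 / real (Suc m)" for m
 have \<sigma>: "0 < \<sigma> m" "\<sigma> \<longlonglongrightarrow> 0" for m
  unfolding \<sigma>_def using LIMSEQ_Suc[OF lim_1_over_n] by simp_all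
 have main: "ennreal (c\<^sup>2) * (\<integral>\<^sup>+x. ennreal (1 / (\<sigma> m * sqrt (2 * pi))) * (\<integral>\<^sup>+X. ennreal ((cmod (Uh (X / \<sigma> m) x))\<^sup>2) \<partial>std_normal) \<partial>\<nu>)
   <= (\<integral>\<^sup>+z. ennreal ((cmod (W z))\<^sup>2) \<partial>cyl)" for m
 proof -
  have p: "0 < \<sigma> m * sqrt (2 * pi)" using \<sigma>(1)[of m] by simp
  have "ennreal (c\<^sup>2) * (\<integral>\<^sup>+x. (\<integral>\<^sup>+X. ennreal ((cmod (Uh (X / \<sigma> m) x))\<^sup>2) \<partial>std_normal) \<partial>\<nu>)
    = ennreal (c\<^sup>2) * (\<integral>\<^sup>+X. (\<integral>\<^sup>+x. ennreal ((cmod (Uh (X / \<sigma> m) x))\<^sup>2) \<partial>\<nu>) \<partial>std_normal)"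
   by (subst GN.Fubini') simp_all
  also have "... = (\<integral>\<^sup>+X. ennreal (c\<^sup>2) * (\<integral>\<^sup>+x. ennreal ((cmod (Uh (X / \<sigma> m) x))\<^sup>2) \<partial>\<nu>) \<partial>std_normal)"
   by (rule nn_integral_cmult[symmetric]) measurable
  also have "... <= (\<integral>\<^sup>+X. (\<integral>\<^sup>+x. ennreal ((cmod (Wh (X / \<sigma> m) x))\<^sup>2) \<partial>\<nu>) \<partial>std_normal)"
  proof (rule nn_integral_mono)
   fix X
   let ?\<xi> = "X / \<sigma> m"
   have SL: "shift (symbol ?\<xi>) \<mu> (Uh ?\<xi>) \<in> L2 \<nu>"
    by (rule bounded_op_L2[OF bounded_op_shift[OF bounded_symbol] UhL])
   have "ennreal (c\<^sup>2) * (\<integral>\<^sup>+x. ennreal ((cmod (Uh ?\<xi> x))\<^sup>2) \<partial>\<nu>) = ennreal ((c * L2_norm \<nu> (Uh ?\<xi>))\<^sup>2)"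
    by (simp add: L2_norm_nn[OF UhL, symmetric] power_mult_distrib ennreal_mult)
   also have "... <= ennreal ((L2_norm \<nu> (shift (symbol ?\<xi>) \<mu> (Uh ?\<xi>)))\<^sup>2)"
    using c by (intro ennreal_leI power_mono bounded_belowD[OF sb UhL] mult_nonneg_nonneg L2_norm_nonneg) simp
   also have "... = (\<integral>\<^sup>+x. ennreal ((cmod (shift (symbol ?\<xi>) \<mu> (Uh ?\<xi>) x))\<^sup>2) \<partial>\<nu>)"
    by (rule L2_norm_nn[OF SL])
   also have "... = (\<integral>\<^sup>+x. ennreal ((cmod (Wh ?\<xi> x))\<^sup>2) \<partial>\<nu>)"
    by (rule nn_integral_cong_AE) (use WU in \<open>auto elim: eventually_mono\<close>)
   finally show "ennreal (c\<^sup>2) * (\<integral>\<^sup>+x. ennreal ((cmod (Uh ?\<xi> x))\<^sup>2) \<partial>\<nu>)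
     <= (\<integral>\<^sup>+x. ennreal ((cmod (Wh ?\<xi> x))\<^sup>2) \<partial>\<nu>)" .
  qed
  also have "... = (\<integral>\<^sup>+x. (\<integral>\<^sup>+X. ennreal ((cmod (Wh (X / \<sigma> m) x))\<^sup>2) \<partial>std_normal) \<partial>\<nu>)"
   by (rule GN.Fubini'[symmetric]) measurable
  also have "... <= (\<integral>\<^sup>+x. ennreal (\<sigma> m * sqrt (2 * pi)) * (LNINT s. ennreal ((cmod (W (s, x)))\<^sup>2)) \<partial>\<nu>)"
  proof (rule nn_integral_mono_AE)
   show "AE x in \<nu>. (\<integral>\<^sup>+X. ennreal ((cmod (Wh (X / \<sigma> m) x))\<^sup>2) \<partial>std_normal)
     <= ennreal (\<sigma> m * sqrt (2 * pi)) * (LNINT s. ennreal ((cmod (W (s, x)))\<^sup>2))"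
    using WU unfolding Wh_def by eventually_elim (blast intro: gaussian_FT_le[OF _ \<sigma>(1)])
  qed
  also have "... = ennreal (\<sigma> m * sqrt (2 * pi)) * (\<integral>\<^sup>+z. ennreal ((cmod (W z))\<^sup>2) \<partial>cyl)"
   by (subst nn_integral_cmult) (simp_all add: real_pair.nn_integral_snd[of "%z. ennreal ((cmod (W z))\<^sup>2)"])
  finally have le: "ennreal (c\<^sup>2) * (\<integral>\<^sup>+x. (\<integral>\<^sup>+X. ennreal ((cmod (Uh (X / \<sigma> m) x))\<^sup>2) \<partial>std_normal) \<partial>\<nu>)
    <= ennreal (\<sigma> m * sqrt (2 * pi)) * (\<integral>\<^sup>+z. ennreal ((cmod (W z))\<^sup>2) \<partial>cyl)" .
  have "ennreal (c\<^sup>2) * (\<integral>\<^sup>+x. ennreal (1 / (\<sigma> m * sqrt (2 * pi))) * (\<integral>\<^sup>+X. ennreal ((cmod (Uh (X / \<sigma> m) x))\<^sup>2) \<partial>std_normal) \<partial>\<nu>)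
    = ennreal (1 / (\<sigma> m * sqrt (2 * pi))) * (ennreal (c\<^sup>2) * (\<integral>\<^sup>+x. (\<integral>\<^sup>+X. ennreal ((cmod (Uh (X / \<sigma> m) x))\<^sup>2) \<partial>std_normal) \<partial>\<nu>))"
   by (subst nn_integral_cmult) (simp_all add: mult_ac)
  also have "... <= ennreal (1 / (\<sigma> m * sqrt (2 * pi))) * (ennreal (\<sigma> m * sqrt (2 * pi)) * (\<integral>\<^sup>+z. ennreal ((cmod (W z))\<^sup>2) \<partial>cyl))"
   by (rule mult_left_mono[OF le]) simp
  also have "... = (ennreal (1 / (\<sigma> m * sqrt (2 * pi))) * ennreal (\<sigma> m * sqrt (2 * pi))) * (\<integral>\<^sup>+z. ennreal ((cmod (W z))\<^sup>2) \<partial>cyl)"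
   by (simp only: mult.assoc)
  also have "ennreal (1 / (\<sigma> m * sqrt (2 * pi))) * ennreal (\<sigma> m * sqrt (2 * pi)) = 1"
   using p by (subst ennreal_mult[symmetric]) auto
  finally show ?thesis by simp
 qed
 define A where "A m x = ennreal (1 / (\<sigma> m * sqrt (2 * pi))) *
  (\<integral>\<^sup>+X. ennreal ((cmod (Uh (X / \<sigma> m) x))\<^sup>2) \<partial>std_normal)" for m x
 have [measurable]: "A m \<in> borel_measurable \<nu>" for m unfolding A_def[abs_def] by measurable
 have "ennreal ((c * L2_norm cyl U)\<^sup>2) = ennreal (c\<^sup>2) * (\<integral>\<^sup>+x. (LNINT s. ennreal ((cmod (U (s, x)))\<^sup>2)) \<partial>\<nu>)"
  by (simp add: real_pair.nn_integral_snd[of "%z. ennreal ((cmod (U z))\<^sup>2)"] L2_norm_nn[OF U, symmetric] power_mult_distrib ennreal_mult)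
 also have "... = (\<integral>\<^sup>+x. ennreal (c\<^sup>2) * (LNINT s. ennreal ((cmod (U (s, x)))\<^sup>2)) \<partial>\<nu>)"
  by (rule nn_integral_cmult[symmetric]) measurable
 also have "... = (\<integral>\<^sup>+x. liminf (%m. ennreal (c\<^sup>2) * A m x) \<partial>\<nu>)"
 proof (rule nn_integral_cong)
  fix x assume x: "x \<in> space \<nu>"
  have "(%m. A m x) \<longlonglongrightarrow> (LNINT s. ennreal ((cmod (U (s, x)))\<^sup>2))"
   unfolding A_def Uh_def by (rule gaussian_FT_tendsto[where B=B and n=n]) (use B supp \<sigma> x in auto)
  hence "(%m. ennreal (c\<^sup>2) * A m x) \<longlonglongrightarrow> ennreal (c\<^sup>2) * (LNINT s. ennreal ((cmod (U (s, x)))\<^sup>2))"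
   using c by (intro tendsto_mult_ennreal tendsto_const) auto
  from lim_imp_Liminf[OF trivial_limit_sequentially this]
  show "ennreal (c\<^sup>2) * (LNINT s. ennreal ((cmod (U (s, x)))\<^sup>2)) = liminf (%m. ennreal (c\<^sup>2) * A m x)"
   by (rule sym)
 qed
 also have "... <= liminf (%m. \<integral>\<^sup>+x. ennreal (c\<^sup>2) * A m x \<partial>\<nu>)"
  by (rule nn_integral_liminf) measurable
 also have "... <= (\<integral>\<^sup>+z. ennreal ((cmod (W z))\<^sup>2) \<partial>cyl)"
  by (rule Liminf_le) (simp_all add: nn_integral_cmult main[folded A_def])
 also have "... = ennreal ((L2_norm cyl W)\<^sup>2)" by (rule L2_norm_nn[OF WL, symmetric])
 finally have "(c * L2_norm cyl U)\<^sup>2 <= (L2_norm cyl W)\<^sup>2" by (simp add: ennreal_le_iff)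
 thus ?thesis unfolding W_def by (rule power2_le_imp_le) (rule L2_norm_nonneg)
qed

lemma conv_bounded_below:
 assumes c: "0 < c" and sb: "\<And>\<xi>. bounded_below \<nu> (shift (symbol \<xi>) \<mu>) c"
 shows "bounded_below cyl (shift conv \<mu>) c"
 unfolding bounded_below_def
proof
 fix U assume U: "U \<in> L2 cyl"
 have [measurable]: "U \<in> borel_measurable cyl" by (rule L2_measurable[OF U])
 define V where "V n z = (if \<bar>fst z\<bar> <= real (Suc n) \<and> cmod (U z) <= real (Suc n) then U z else 0)" for n z
 have Vm [measurable]: "V n \<in> borel_measurable cyl" for n unfolding V_def[abs_def] by measurable
 have VL: "V n \<in> L2 cyl" for n
  by (rule L2_mono(1)[OF U Vm]) (auto simp: V_def)
 have lim: "(%n. L2_norm cyl (%z. U z - V n z)) \<longlonglongrightarrow> 0"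
 proof -
  have "(%n. \<integral>z. (cmod (U z - V n z))\<^sup>2 \<partial>cyl) \<longlonglongrightarrow> (\<integral>z. 0 \<partial>cyl)"
  proof (rule integral_dominated_convergence[where w="%z. (cmod (U z))\<^sup>2"])
   show "integrable cyl (%z. (cmod (U z))\<^sup>2)" by (rule L2_integrable[OF U])
   show "AE z in cyl. (%n. (cmod (U z - V n z))\<^sup>2) \<longlonglongrightarrow> 0"
   proof (rule AE_I2)
    fix z
    obtain N where N: "max \<bar>fst z\<bar> (cmod (U z)) <= real N" using real_arch_simple by blast
    have "eventually (%n. (cmod (U z - V n z))\<^sup>2 = 0) sequentially"
     unfolding eventually_sequentially
    proof (intro exI allI impI)
     fix n assume "N <= n"
     hence "max \<bar>fst z\<bar> (cmod (U z)) <= real (Suc n)" using N by linarith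
     thus "(cmod (U z - V n z))\<^sup>2 = 0" by (simp add: V_def)
    qed
    thus "(%n. (cmod (U z - V n z))\<^sup>2) \<longlonglongrightarrow> 0" by (rule tendsto_eventually)
   qed
   show "AE z in cyl. norm ((cmod (U z - V n z))\<^sup>2) <= (cmod (U z))\<^sup>2" for n
    by (rule AE_I2) (simp add: V_def)
  qed measurable
  hence "(%n. sqrt (\<integral>z. (cmod (U z - V n z))\<^sup>2 \<partial>cyl)) \<longlonglongrightarrow> sqrt 0"
   by (intro tendsto_real_sqrt) simp
  thus ?thesis by (simp add: L2_norm_def)
 qed
 note bs = bounded_op_shift[OF bounded_conv, of \<mu>]
 obtain A where A: "0 < A" "\<And>f. f \<in> L2 cyl ==> L2_norm cyl (shift conv \<mu> f) <= A * L2_norm cyl f"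
  using bounded_op_bound[OF bs] by metis
 have "c * L2_norm cyl U - L2_norm cyl (shift conv \<mu> U) <= (c + A) * L2_norm cyl (%z. U z - V n z)" for n
 proof -
  let ?d = "L2_norm cyl (%z. U z - V n z)"
  have 1: "L2_norm cyl U <= L2_norm cyl (V n) + ?d" by (rule L2_norm_triangle_rev[OF U VL])
  have 2: "c * L2_norm cyl (V n) <= L2_norm cyl (shift conv \<mu> (V n))"
   by (rule conv_bounded_below_bounded_support[OF c sb VL, where B="real (Suc n)" and n="real (Suc n)"])
     (auto simp: V_def simp del: of_nat_Suc)
  have 3: "L2_norm cyl (shift conv \<mu> (V n)) <= L2_norm cyl (shift conv \<mu> U) + A * ?d"
  proof -
   have "L2_norm cyl (%z. shift conv \<mu> U z - shift conv \<mu> (V n) z) = L2_norm cyl (shift conv \<mu> (%z. U z - V n z))"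
   proof (rule L2_norm_cong_AE[OF L2_diff[OF bounded_op_L2[OF bs U] bounded_op_L2[OF bs VL]] bounded_op_L2[OF bs L2_diff[OF U VL]]])
    show "AE z in cyl. shift conv \<mu> U z - shift conv \<mu> (V n) z = shift conv \<mu> (%z. U z - V n z) z"
     using bounded_op_diff[OF bs U VL, of n] by eventually_elim simp
   qed
   thus ?thesis using L2_norm_triangle_rev[OF bounded_op_L2[OF bs VL] bounded_op_L2[OF bs U], of n]
     A(2)[OF L2_diff[OF U VL], of n] L2_norm_minus_commute[of cyl "shift conv \<mu> (V n)" "shift conv \<mu> U"] by simp
  qed
  have "c * L2_norm cyl U <= c * (L2_norm cyl (V n) + ?d)" using c by (intro mult_left_mono 1) simp
  thus ?thesis using 2 3 by (simp add: distrib_left distrib_right)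
 qed
 moreover have "(%n. (c + A) * L2_norm cyl (%z. U z - V n z)) \<longlonglongrightarrow> (c + A) * 0"
  by (rule tendsto_mult_left[OF lim])
 ultimately have "c * L2_norm cyl U - L2_norm cyl (shift conv \<mu> U) <= (c + A) * 0"
  by (intro LIMSEQ_le_const) auto
 thus "c * L2_norm cyl U <= L2_norm cyl (shift conv \<mu> U)" by simp
qed

end

section \<open>Invertibility and Weyl sequences of convolutions\<close>

context convolution_kernel
begin

abbreviation conv' :: "(real \<times> 'b) op" where
 "conv' == convolution_kernel.conv \<nu> (%s x y. k (- s) y x)"

abbreviation symbol' :: "real => 'b op" where
 "symbol' == convolution_kernel.symbol \<nu> (%s x y. k (- s) y x)"

lemma shifted_conv_adjoint: "adjoint_pair cyl (shift conv \<mu>) (shift conv' (cnj \<mu>))"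
 by (rule adjoint_pair_shift[OF conv_adjoint])

lemma shifted_symbol_adjoint: "adjoint_pair \<nu> (shift (symbol \<xi>) \<mu>) (shift (symbol' \<xi>) (cnj \<mu>))"
 by (rule adjoint_pair_shift[OF symbol_adjoint])

text \<open>
  By \<open>invertible_if_bounded_below\<close> and its converse this says that the operators \<open>symbol \<xi> - \<mu>\<close>
  are invertible with uniformly bounded inverses.
\<close>

definition uniformly_elliptic :: "complex => bool" where
 "uniformly_elliptic \<mu> \<longleftrightarrow> (\<exists>c>0. \<forall>\<xi>. bounded_below \<nu> (shift (symbol \<xi>) \<mu>) c \<and>
   bounded_below \<nu> (shift (symbol' \<xi>) (cnj \<mu>)) c)"

lemma invertible_if_elliptic:
 assumes "uniformly_elliptic \<mu>" shows "invertible_op cyl (shift conv \<mu>)"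
proof -
 interpret f: convolution_kernel \<nu> "%s x y. k (- s) y x" p C by (rule flipped)
 obtain c where c: "0 < c" "\<And>\<xi>. bounded_below \<nu> (shift (symbol \<xi>) \<mu>) c"
  "\<And>\<xi>. bounded_below \<nu> (shift (symbol' \<xi>) (cnj \<mu>)) c"
  using assms by (auto simp: uniformly_elliptic_def)
 show ?thesis
  by (rule invertible_if_bounded_below[OF shifted_conv_adjoint c(1)
     conv_bounded_below[OF c(1,2)] f.conv_bounded_below[OF c(1,3)]])
qed

lemma elliptic_if_invertible:
 assumes "invertible_op cyl (shift conv \<mu>)" shows "uniformly_elliptic \<mu>"
proof -
 interpret f: convolution_kernel \<nu> "%s x y. k (- s) y x" p C by (rule flipped)
 obtain S where S: "is_inverse_op cyl (shift conv \<mu>) S" using assms by (auto simp: invertible_op_def)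
 hence "bounded_op cyl S" by (simp add: is_inverse_op_def)
 then obtain b where b: "0 < b" "\<And>f. f \<in> L2 cyl ==> L2_norm cyl (S f) <= b * L2_norm cyl f"
  by (rule bounded_op_bound) blast
 note bb = bounded_below_if_inverse[OF S shifted_conv_adjoint b]
 show ?thesis unfolding uniformly_elliptic_def
  using symbol_bounded_below[OF bb(1)] f.symbol_bounded_below[OF bb(2)] b(1)
  by (intro exI[of _ "1 / b"]) simp
qed

lemma bounded_below_mono:
 assumes "bounded_below M T c" "c' <= c" shows "bounded_below M T c'"
 unfolding bounded_below_def
proof
 fix u assume "u \<in> L2 M"
 from bounded_belowD[OF assms(1) this] mult_right_mono[OF assms(2) L2_norm_nonneg[of M u]]
 show "c' * L2_norm M u <= L2_norm M (T u)" by linarith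
qed

text \<open>
  Packets for the adjoint contradict the Fredholm property directly. Packets for the operator itself do
  so once the adjoint is known to be bounded below, which is the only case left to consider.
\<close>

lemma not_elliptic_cases:
 assumes "\<not> uniformly_elliptic \<mu>"
 shows "(\<forall>c>0. \<exists>\<xi>. \<not> bounded_below \<nu> (shift (symbol' \<xi>) (cnj \<mu>)) c) \<or>
  (\<forall>c>0. \<exists>\<xi>. \<not> bounded_below \<nu> (shift (symbol \<xi>) \<mu>) c) \<and>
  (\<exists>c>0. \<forall>\<xi>. bounded_below \<nu> (shift (symbol' \<xi>) (cnj \<mu>)) c)"
proof (rule ccontr)
 assume "\<not> ?thesis"
 then obtain c1 c2 where c: "0 < c1" "0 < c2" "\<And>\<xi>. bounded_below \<nu> (shift (symbol \<xi>) \<mu>) c1"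
  "\<And>\<xi>. bounded_below \<nu> (shift (symbol' \<xi>) (cnj \<mu>)) c2" by blast
 have "uniformly_elliptic \<mu>" unfolding uniformly_elliptic_def
  using bounded_below_mono[OF c(3), of "min c1 c2"] bounded_below_mono[OF c(4), of "min c1 c2"] c(1,2)
  by (intro exI[of _ "min c1 c2"]) simp
 with assms show False by contradiction
qed

lemma Weyl_sequence_if_not_elliptic:
 assumes "\<not> uniformly_elliptic \<mu>"
 shows "\<exists>w. (\<forall>n z. fst z > d --> w n z = 0) \<and>
  (singular_Weyl_sequence cyl (shift conv \<mu>) w \<or> singular_Weyl_sequence cyl (shift conv' (cnj \<mu>)) w)"
proof -
 interpret f: convolution_kernel \<nu> "%s x y. k (- s) y x" p C by (rule flipped)
 have W: "singular_Weyl_sequence cyl T w"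
  if "orthonormal_seq cyl w" "(%n. L2_norm cyl (T (w n))) \<longlonglongrightarrow> 0" for T w
  unfolding singular_Weyl_sequence_def
  using that orthonormal_weakly_null[OF that(1)] orthonormal_seq_norm[OF that(1)]
  by (auto simp: orthonormal_seq_def)
 from not_elliptic_cases[OF assms] show ?thesis
 proof
  assume "\<forall>c>0. \<exists>\<xi>. \<not> bounded_below \<nu> (shift (symbol' \<xi>) (cnj \<mu>)) c"
  from f.packet_Weyl_sequence[of "cnj \<mu>" d] this W show ?thesis by blast
 next
  assume "(\<forall>c>0. \<exists>\<xi>. \<not> bounded_below \<nu> (shift (symbol \<xi>) \<mu>) c) \<and>
   (\<exists>c>0. \<forall>\<xi>. bounded_below \<nu> (shift (symbol' \<xi>) (cnj \<mu>)) c)"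
  with packet_Weyl_sequence[of \<mu> d] W show ?thesis by blast
 qed
qed

lemma not_fredholm_if_not_elliptic:
 assumes "\<not> uniformly_elliptic \<mu>" shows "\<not> fredholm cyl (shift conv \<mu>)"
proof -
 interpret f: convolution_kernel \<nu> "%s x y. k (- s) y x" p C by (rule flipped)
 from not_elliptic_cases[OF assms] show ?thesis
 proof
  assume "\<forall>c>0. \<exists>\<xi>. \<not> bounded_below \<nu> (shift (symbol' \<xi>) (cnj \<mu>)) c"
  then obtain w where "orthonormal_seq cyl w" "(%n. L2_norm cyl (shift conv' (cnj \<mu>) (w n))) \<longlonglongrightarrow> 0"
   using f.packet_Weyl_sequence[of "cnj \<mu>" 0] by blast
  thus ?thesis by (rule not_fredholm_if_adjoint_Weyl[OF shifted_conv_adjoint])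
 next
  assume *: "(\<forall>c>0. \<exists>\<xi>. \<not> bounded_below \<nu> (shift (symbol \<xi>) \<mu>) c) \<and>
   (\<exists>c>0. \<forall>\<xi>. bounded_below \<nu> (shift (symbol' \<xi>) (cnj \<mu>)) c)"
  then obtain c where c: "0 < c" "\<And>\<xi>. bounded_below \<nu> (shift (symbol' \<xi>) (cnj \<mu>)) c" by blast
  obtain w where w: "orthonormal_seq cyl w" "(%n. L2_norm cyl (shift conv \<mu> (w n))) \<longlonglongrightarrow> 0"
   using packet_Weyl_sequence[of \<mu> 0] * by blast
  show ?thesis
   by (rule not_fredholm_if_Weyl[OF shifted_conv_adjoint w c(1) f.conv_bounded_below[OF c]])
 qed
qed

end

section \<open>Polar coordinates\<close>

lemma nn_integral_change_of_variables:
 fixes \<phi> \<phi>' f :: "real => real"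
 assumes S: "S \<in> sets borel" "\<phi> ` S \<in> sets borel"
  and der: "\<And>x. x \<in> S ==> (\<phi> has_field_derivative \<phi>' x) (at x within S)"
  and inj: "inj_on \<phi> S"
  and [measurable]: "f \<in> borel_measurable borel" "\<phi> \<in> borel_measurable borel" "\<phi>' \<in> borel_measurable borel"
  and f: "\<And>x. 0 <= f x"
 shows "(LNINT x. ennreal (f x) * indicator (\<phi> ` S) x)
  = (LNINT x. ennreal (\<bar>\<phi>' x\<bar> * f (\<phi> x)) * indicator S x)"
proof -
 have nn: "(LNINT x. ennreal (g x) * indicator A x) =
   (if g absolutely_integrable_on A then ennreal (integral A g) else \<infinity>)"
  if [measurable]: "A \<in> sets borel" "g \<in> borel_measurable borel" and g: "\<And>x. 0 <= g x" for A and g :: "real => real"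
 proof -
  let ?h = "%x. indicator A x *\<^sub>R g x"
  have e: "(LNINT x. ennreal (g x) * indicator A x) = (LNINT x. ennreal (?h x))"
   by (intro nn_integral_cong) (auto split: split_indicator)
  have ai: "g absolutely_integrable_on A \<longleftrightarrow> integrable lborel ?h"
   unfolding set_integrable_def by (rule integrable_completion) measurable
  show ?thesis
  proof (cases "integrable lborel ?h")
   case True
   have "integral A g = (\<integral>x. ?h x \<partial>lebesgue)"
    using True ai set_lebesgue_integral_eq_integral(2)[of A g] by (simp add: set_lebesgue_integral_def)
   also have "... = (\<integral>x. ?h x \<partial>lborel)" by (rule integral_completion) measurable
   finally show ?thesis using True ai g unfolding e
    by (subst nn_integral_eq_integral) (auto split: split_indicator)
  next
   case False
   have "(LNINT x. ennreal (?h x)) = \<infinity>"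
   proof (rule ccontr)
    assume "(LNINT x. ennreal (?h x)) \<noteq> \<infinity>"
    hence "integrable lborel ?h" using g
     by (intro integrableI_nonneg) (auto simp: less_top split: split_indicator)
    with False show False by contradiction
   qed
   with False ai show ?thesis unfolding e by simp
  qed
 qed
 have "f absolutely_integrable_on \<phi> ` S \<longleftrightarrow> (%x. \<bar>\<phi>' x\<bar> * f (\<phi> x)) absolutely_integrable_on S"
  "f absolutely_integrable_on \<phi> ` S ==> integral (\<phi> ` S) f = integral S (%x. \<bar>\<phi>' x\<bar> * f (\<phi> x))"
  using has_absolute_integral_change_of_variables_1'[OF _ der inj, of f] S(1) by (auto simp: sets_lborel)
 thus ?thesis using f by (subst (1 2) nn) (use S in auto)
qed

lemma nn_integral_exp_substitution:
 fixes f :: "real => real"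
 assumes [measurable]: "f \<in> borel_measurable borel" and f: "\<And>x. 0 <= f x"
 shows "(LNINT x. ennreal (f x) * indicator {0<..} x) = (LNINT s. ennreal (exp s * f (exp s)))"
proof -
 have im: "exp ` UNIV = {0::real<..}"
 proof -
  have "x \<in> range exp" if "0 < x" for x :: real
   using that by (intro image_eqI[of x exp "ln x"]) auto
  thus ?thesis by auto
 qed
 have "(LNINT x. ennreal (f x) * indicator (exp ` UNIV) x)
   = (LNINT s. ennreal (\<bar>exp s\<bar> * f (exp s)) * indicator UNIV s)"
  by (rule nn_integral_change_of_variables) (auto simp: im f inj_on_def intro!: derivative_eq_intros)
 thus ?thesis unfolding im by simp
qed

lemma exp_measure_eq:
 "density lborel (indicator {0<..}) = distr (density lborel (%s. ennreal (exp s))) borel (exp :: real => real)"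
proof (rule measure_eqI)
 fix A :: "real set" assume "A \<in> sets (density lborel (indicator {0<..}))"
 hence [measurable]: "A \<in> sets borel" by simp
 have [measurable]: "exp -` A \<in> sets borel"
  using measurable_sets[of "exp :: real => real" borel borel A] by simp
 have "emeasure (density lborel (indicator {0<..})) A = (LNINT x. ennreal (indicator A x) * indicator {0<..} x)"
  by (subst emeasure_density) (auto intro!: nn_integral_cong split: split_indicator)
 also have "... = (LNINT s. ennreal (exp s * indicator A (exp s)))"
  by (rule nn_integral_exp_substitution) auto
 also have "... = (LNINT s. ennreal (exp s) * indicator (exp -` A) s)"
  by (auto intro!: nn_integral_cong split: split_indicator)
 also have "... = emeasure (distr (density lborel (%s. ennreal (exp s))) borel exp) A"
  by (subst emeasure_distr, simp, simp, subst emeasure_density) auto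
 finally show "emeasure (density lborel (indicator {0<..})) A
   = emeasure (distr (density lborel (%s. ennreal (exp s))) borel exp) A" .
qed simp

text \<open>
  Polar coordinates from two substitutions in one variable: \<open>u = v tan \<theta>\<close> on each horizontal line, then
  \<open>v = r cos \<theta>\<close> for each angle.
\<close>

lemma polar_half_plane:
 fixes g :: "real \<times> real => real"
 assumes [measurable]: "g \<in> borel_measurable borel" and g: "\<And>z. 0 <= g z"
 shows "(LNINT v. (LNINT u. ennreal (g (u, v))) * indicator {0<..} v)
  = (LNINT t. (LNINT r. ennreal (r * g (r * cos t, r * sin t)) * indicator {0<..} r) * indicator {0<..<pi} t)"
proof -
 have [measurable]: "g \<in> borel_measurable (borel \<Otimes>\<^sub>M borel)" by (simp add: borel_prod)
 let ?I = "{-(pi/2)<..<pi/2}"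
 have inner: "(LNINT u. ennreal (g (u, v)))
   = (LNINT \<theta>. ennreal (v / (cos \<theta>)\<^sup>2 * g (v * tan \<theta>, v)) * indicator ?I \<theta>)" if v: "0 < v" for v
 proof -
  have im: "(%\<theta>. v * tan \<theta>) ` ?I = UNIV"
  proof -
   have "u \<in> (%\<theta>. v * tan \<theta>) ` ?I" for u
   proof (rule image_eqI)
    show "u = v * tan (arctan (u / v))" using v by (simp only: tan_arctan) simp
    show "arctan (u / v) \<in> ?I" using arctan_lbound[of "u / v"] arctan_ubound[of "u / v"] by simp
   qed
   thus ?thesis by auto
  qed
  have "(LNINT u. ennreal (g (u, v)) * indicator ((%\<theta>. v * tan \<theta>) ` ?I) u)
    = (LNINT \<theta>. ennreal (\<bar>v * inverse ((cos \<theta>)\<^sup>2)\<bar> * g (v * tan \<theta>, v)) * indicator ?I \<theta>)"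
  proof (rule nn_integral_change_of_variables)
   show "((%\<theta>. v * tan \<theta>) has_real_derivative v * inverse ((cos \<theta>)\<^sup>2)) (at \<theta> within ?I)" if "\<theta> \<in> ?I" for \<theta>
   proof -
    have "cos \<theta> \<noteq> 0" using that cos_gt_zero_pi[of \<theta>] by auto
    thus ?thesis by (auto intro!: derivative_eq_intros)
   qed
   show "inj_on (%\<theta>. v * tan \<theta>) ?I"
   proof (rule inj_onI)
    fix x y assume xy: "x \<in> ?I" "y \<in> ?I" "v * tan x = v * tan y"
    hence "arctan (tan x) = arctan (tan y)" using v by simp
    thus "x = y" using arctan_tan[of x] arctan_tan[of y] xy(1,2) by simp
   qed
   show "(%\<theta>. v * tan \<theta>) \<in> borel_measurable borel" unfolding tan_def by measurable
  qed (auto simp: im g)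
  moreover have "\<bar>v * inverse ((cos \<theta>)\<^sup>2)\<bar> = v / (cos \<theta>)\<^sup>2" for \<theta>
   using v by (simp only: divide_inverse abs_mult abs_inverse abs_power2 abs_of_pos)
  ultimately show ?thesis unfolding im by (simp only: indicator_UNIV mult_1_right)
 qed
 have "(LNINT v. (LNINT u. ennreal (g (u, v))) * indicator {0<..} v)
   = (LNINT v. (LNINT \<theta>. ennreal (v / (cos \<theta>)\<^sup>2 * g (v * tan \<theta>, v)) * indicator ?I \<theta> * indicator {0<..} v))"
 proof (rule nn_integral_cong)
  fix v :: real
  show "(LNINT u. ennreal (g (u, v))) * indicator {0<..} v
   = (LNINT \<theta>. ennreal (v / (cos \<theta>)\<^sup>2 * g (v * tan \<theta>, v)) * indicator ?I \<theta> * indicator {0<..} v)"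
   by (cases "0 < v") (simp_all add: inner)
 qed
 also have "... = (LNINT \<theta>. (LNINT v. ennreal (v / (cos \<theta>)\<^sup>2 * g (v * tan \<theta>, v)) * indicator ?I \<theta> * indicator {0<..} v))"
  unfolding tan_def by (rule lborel_pair.Fubini') measurable
 also have "... = (LNINT \<theta>. (LNINT r. ennreal (r * g (r * sin \<theta>, r * cos \<theta>)) * indicator {0<..} r) * indicator ?I \<theta>)"
 proof (rule nn_integral_cong)
  fix \<theta> :: real
  show "(LNINT v. ennreal (v / (cos \<theta>)\<^sup>2 * g (v * tan \<theta>, v)) * indicator ?I \<theta> * indicator {0<..} v)
    = (LNINT r. ennreal (r * g (r * sin \<theta>, r * cos \<theta>)) * indicator {0<..} r) * indicator ?I \<theta>"
  proof (cases "\<theta> \<in> ?I")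
   case True
   hence c: "0 < cos \<theta>" using cos_gt_zero_pi[of \<theta>] by auto
   have "(LNINT v. ennreal (v / (cos \<theta>)\<^sup>2 * g (v * tan \<theta>, v)) * indicator {0<..} v)
     = ennreal \<bar>cos \<theta>\<bar> * (LNINT r. ennreal ((0 + cos \<theta> * r) / (cos \<theta>)\<^sup>2 * g ((0 + cos \<theta> * r) * tan \<theta>, 0 + cos \<theta> * r)) * indicator {0<..} (0 + cos \<theta> * r))"
    by (rule nn_integral_real_affine) (use c in \<open>auto simp: borel_prod[symmetric]\<close>)
   also have "... = (LNINT r. ennreal \<bar>cos \<theta>\<bar> * (ennreal ((0 + cos \<theta> * r) / (cos \<theta>)\<^sup>2 * g ((0 + cos \<theta> * r) * tan \<theta>, 0 + cos \<theta> * r)) * indicator {0<..} (0 + cos \<theta> * r)))"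
    by (rule nn_integral_cmult[symmetric]) measurable
   also have "... = (LNINT r. ennreal (r * g (r * sin \<theta>, r * cos \<theta>)) * indicator {0<..} r)"
   proof (rule nn_integral_cong)
    fix r :: real
    have "cos \<theta> * ((cos \<theta> * r) / (cos \<theta>)\<^sup>2 * g (cos \<theta> * r * tan \<theta>, cos \<theta> * r)) = r * g (r * sin \<theta>, r * cos \<theta>)"
     using c by (simp add: tan_def power2_eq_square mult_ac)
    thus "ennreal \<bar>cos \<theta>\<bar> * (ennreal ((0 + cos \<theta> * r) / (cos \<theta>)\<^sup>2 * g ((0 + cos \<theta> * r) * tan \<theta>, 0 + cos \<theta> * r)) * indicator {0<..} (0 + cos \<theta> * r))
      = ennreal (r * g (r * sin \<theta>, r * cos \<theta>)) * indicator {0<..} r"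
     using c g by (auto simp: zero_less_mult_iff ennreal_mult[symmetric] split: split_indicator)
   qed
   finally show ?thesis using True by simp
  qed simp
 qed
 also have "... = ennreal \<bar>-1\<bar> * (LNINT t. (LNINT r. ennreal (r * g (r * sin (pi/2 + (-1) * t), r * cos (pi/2 + (-1) * t))) * indicator {0<..} r)
   * indicator ?I (pi/2 + (-1) * t))"
  by (rule nn_integral_real_affine) (auto simp: borel_prod[symmetric])
 also have "... = (LNINT t. (LNINT r. ennreal (r * g (r * cos t, r * sin t)) * indicator {0<..} r) * indicator {0<..<pi} t)"
 proof -
  have "sin (pi/2 + (-1) * t) = cos t" "cos (pi/2 + (-1) * t) = sin t" for t
   by (simp_all add: sin_diff cos_diff)
  moreover have "indicator ?I (pi/2 + (-1) * t) = (indicator {0<..<pi} t :: ennreal)" for t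
   by (auto split: split_indicator)
  ultimately show ?thesis by simp
 qed
 finally show ?thesis .
qed

lemma polar_coordinates:
 fixes g :: "real \<times> real => real"
 assumes gm [measurable]: "g \<in> borel_measurable borel" and g: "\<And>z. 0 <= g z"
 shows "(LNINT z. ennreal (g z))
  = (LNINT t. (LNINT r. ennreal (r * g (r * cos t, r * sin t)) * indicator {0<..} r) * indicator {0<..<2*pi} t)"
proof -
 have [measurable]: "g \<in> borel_measurable (borel \<Otimes>\<^sub>M borel)" by (simp add: borel_prod)
 define F where "F v = (LNINT u. ennreal (g (u, v)))" for v
 define R where "R t = (LNINT r. ennreal (r * g (r * cos t, r * sin t)) * indicator {0<..} r)" for t
 have [measurable]: "F \<in> borel_measurable borel" "R \<in> borel_measurable borel"
  unfolding F_def[abs_def] R_def[abs_def] by measurable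
 have "(LNINT z. ennreal (g z)) = (\<integral>\<^sup>+z. ennreal (g z) \<partial>(lborel \<Otimes>\<^sub>M lborel))"
  by (simp add: lborel_prod)
 also have "... = (LNINT v. F v)"
  unfolding F_def by (rule lborel_pair.nn_integral_snd[symmetric]) measurable
 also have "... = (LNINT v. F v * indicator {0<..} v + F v * indicator {..<0} v)"
  by (rule nn_integral_cong_AE) (use AE_lborel_singleton[of 0] in \<open>auto elim!: eventually_mono split: split_indicator\<close>)
 also have "... = (LNINT v. F v * indicator {0<..} v) + (LNINT v. F v * indicator {..<0} v)"
  by (rule nn_integral_add) measurable
 also have "(LNINT v. F v * indicator {0<..} v) = (LNINT t. R t * indicator {0<..<pi} t)"
  unfolding F_def R_def by (rule polar_half_plane[OF gm g])
 also have "(LNINT v. F v * indicator {..<0} v) = (LNINT t. R t * indicator {pi<..<2*pi} t)"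
 proof -
  have gm': "(%z. g (- z)) \<in> borel_measurable borel" by measurable
  have Fm: "F (- v) = (LNINT u. ennreal (g (- (u, v))))" for v
   unfolding F_def using nn_integral_real_affine[of "%u. ennreal (g (u, - v))" "-1" 0] by (simp add: borel_prod[symmetric])
  have "(LNINT v. F v * indicator {..<0} v) = (LNINT v. F (- v) * indicator {0<..} v)"
   using nn_integral_real_affine[of "%v. F v * indicator {..<0} v" "-1" 0]
   by (simp add: indicator_def)
  also have "... = (LNINT t. (LNINT r. ennreal (r * g (- (r * cos t, r * sin t))) * indicator {0<..} r) * indicator {0<..<pi} t)"
   unfolding Fm by (rule polar_half_plane[OF gm']) (rule g)
  also have "... = (LNINT t. R (pi + t) * indicator {pi<..<2*pi} (pi + t))"
   unfolding R_def by (intro nn_integral_cong) (auto simp: sin_add cos_add split: split_indicator)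
  also have "... = (LNINT t. R t * indicator {pi<..<2*pi} t)"
   using nn_integral_real_affine[of "%t. R t * indicator {pi<..<2*pi} t" 1 pi] by simp
  finally show ?thesis .
 qed
 also have "(LNINT t. R t * indicator {0<..<pi} t) + (LNINT t. R t * indicator {pi<..<2*pi} t)
   = (LNINT t. R t * indicator {0<..<pi} t + R t * indicator {pi<..<2*pi} t)"
  by (rule nn_integral_add[symmetric]) measurable
 also have "... = (LNINT t. R t * indicator {0<..<2*pi} t)"
  by (rule nn_integral_cong_AE) (use AE_lborel_singleton[of pi] in \<open>auto elim!: eventually_mono split: split_indicator\<close>)
 finally show ?thesis unfolding R_def .
qed

lemma nn_integral_exp:
 fixes f :: "real => ennreal"
 assumes [measurable]: "f \<in> borel_measurable borel"
 shows "(LNINT x. f x * indicator {0<..} x) = (LNINT s. ennreal (exp s) * f (exp s))"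
proof -
 have "(LNINT x. f x * indicator {0<..} x) = (\<integral>\<^sup>+x. f x \<partial>density lborel (indicator {0<..}))"
  by (subst nn_integral_density) (auto simp: mult.commute)
 also have "... = (\<integral>\<^sup>+s. f (exp s) \<partial>density lborel (%s. ennreal (exp s)))"
  unfolding exp_measure_eq by (subst nn_integral_distr) auto
 also have "... = (LNINT s. ennreal (exp s) * f (exp s))"
  by (subst nn_integral_density) auto
 finally show ?thesis .
qed

lemma integral_exp_substitution:
 fixes f :: "real => complex"
 assumes [measurable]: "f \<in> borel_measurable borel"
 shows "(LINT t:{0<..}|lborel. f t) = (\<integral>s. of_real (exp s) * f (exp s) \<partial>lborel)"
proof -
 have "(LINT t:{0<..}|lborel. f t) = (\<integral>t. f t \<partial>density lborel (%t. ennreal (indicator {0<..} t)))"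
  unfolding set_lebesgue_integral_def by (subst integral_density) auto
 also have "density lborel (%t. ennreal (indicator {0<..} t)) = density lborel (indicator {0::real<..})"
  by (simp add: ennreal_indicator[abs_def])
 also have "(\<integral>t. f t \<partial>density lborel (indicator {0<..})) = (\<integral>s. f (exp s) \<partial>density lborel (%s. ennreal (exp s)))"
  unfolding exp_measure_eq by (subst integral_distr) auto
 also have "... = (\<integral>s. of_real (exp s) * f (exp s) \<partial>lborel)"
  by (subst integral_density) (auto simp: scaleR_conv_of_real)
 finally show ?thesis .
qed

section \<open>Arcs and the measures of the cone\<close>

locale polygon =
 fixes P :: spherical_polygon
 assumes simple: "simple_spherical_polygon P"
begin

abbreviation n :: nat where "n == sides P"
abbreviation ap :: "nat => real => real^3" where "ap == arc_point P"
abbreviation ang :: "nat => real" where "ang == angle P"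
abbreviation \<gamma> :: "(real^3) set" where "\<gamma> == polygon_curve P"
abbreviation \<nu> :: "(real^3) measure" where "\<nu> == arc_length P"
abbreviation cyl :: "(real \<times> (real^3)) measure" where "cyl == lborel \<Otimes>\<^sub>M \<nu>"
abbreviation surf :: "(real^3) measure" where "surf == restrict_space borel (cone_surface P)"

definition arc :: "nat => (real^3) set" where "arc j = ap j ` {0<..<ang j}"
definition arcs :: "(real^3) set" where "arcs = (\<Union>j<n. arc j)"

lemma n_ge_3: "3 <= n" using simple by (simp add: simple_spherical_polygon_def)

lemma polygon_facts:
 assumes "j < n"
 shows "norm (corner P j) = 1" "norm (tangent P j) = 1" "corner P j \<bullet> tangent P j = 0"
  "0 < ang j" "ang j < 2 * pi" "ap j (ang j) = corner P (Suc j mod n)"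
  "tangent P (Suc j mod n) \<notin> span {corner P j, tangent P j}"
 using simple assms by (auto simp: simple_spherical_polygon_def)

lemma ap_inj:
 assumes "i < n" "j < n" "0 <= s" "s < ang i" "0 <= t" "t < ang j" "ap i s = ap j t"
 shows "i = j \<and> s = t"
proof -
 have "inj_on (%(j, t). ap j t) (SIGMA j:{..<n}. {0..<ang j})"
  using simple by (simp add: simple_spherical_polygon_def)
 from inj_onD[OF this, of "(i, s)" "(j, t)"] assms show ?thesis by auto
qed

lemma ap_0: "ap j 0 = corner P j" by (simp add: arc_point_def)

lemma Suc_mod_less: "Suc j mod n < n" using n_ge_3 by simp

lemma corner_inner: "j < n ==> corner P j \<bullet> corner P j = 1" "j < n ==> tangent P j \<bullet> tangent P j = 1"
 using polygon_facts(1,2) by (simp_all add: dot_square_norm)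

lemma norm_chart:
 assumes "j < n" shows "norm (u *\<^sub>R corner P j + v *\<^sub>R tangent P j) = sqrt (u\<^sup>2 + v\<^sup>2)"
 using corner_inner[OF assms] polygon_facts(3)[OF assms]
 by (simp add: norm_eq_sqrt_inner inner_add inner_commute[of "tangent P j" "corner P j"] power2_eq_square)

lemma norm_ap: "j < n ==> norm (ap j t) = 1"
 unfolding arc_point_def by (simp only: norm_chart) simp

lemma ap_continuous: "continuous_on S (ap j)"
 unfolding arc_point_def[abs_def] by (intro continuous_intros)

lemma ap_measurable [measurable]: "ap j \<in> borel_measurable borel"
 by (rule borel_measurable_continuous_onI[OF ap_continuous])

lemma face_subset_surface: "j < n ==> face P j \<subseteq> cone_surface P"
 unfolding cone_surface_def by blast

lemma edge_subset_surface: "j < n ==> edge P j \<subseteq> cone_surface P"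
 unfolding cone_surface_def by blast

lemma ap_in_curve: "j < n ==> 0 < t ==> t < ang j ==> ap j t \<in> \<gamma>"
proof -
 assume j: "j < n" and t: "0 < t" "t < ang j"
 have "ap j t \<in> face P j"
  unfolding face_def using t by (intro CollectI exI[of _ "1::real"] exI[of _ t]) simp
 hence "ap j t \<in> cone_surface P" using face_subset_surface[OF j] by blast
 thus ?thesis unfolding polygon_curve_def using norm_ap[OF j] by simp
qed

lemma corner_in_curve: "j < n ==> corner P j \<in> \<gamma>"
proof -
 assume j: "j < n"
 have "corner P j \<in> edge P j"
  unfolding edge_def by (intro CollectI exI[of _ "1::real"]) simp
 hence "corner P j \<in> cone_surface P" using edge_subset_surface[OF j] by blast
 thus ?thesis unfolding polygon_curve_def using polygon_facts(1)[OF j] by simp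
qed

lemma ap_in_curve_closed:
 assumes "j < n" "0 <= t" "t <= ang j" shows "ap j t \<in> \<gamma>"
proof -
 consider "t = 0" | "t = ang j" | "0 < t" "t < ang j" using assms by linarith
 thus ?thesis
 proof cases
  case 1 thus ?thesis using corner_in_curve[OF assms(1)] by (simp add: ap_0)
 next
  case 2 thus ?thesis using corner_in_curve[OF Suc_mod_less] polygon_facts(6)[OF assms(1)] by simp
 qed (rule ap_in_curve[OF assms(1)])
qed

lemma ap_in_arcs: "j < n ==> 0 < t ==> t < ang j ==> ap j t \<in> arcs"
 unfolding arcs_def arc_def by (rule UN_I[of j]) simp_all

lemma curve_split: "\<gamma> = arcs \<union> corner P ` {..<n}"
proof
 show "\<gamma> \<subseteq> arcs \<union> corner P ` {..<n}"
 proof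
  fix x assume x: "x \<in> \<gamma>"
  hence nx: "norm x = 1" by (auto simp: polygon_curve_def)
  have "x \<in> {0} \<union> (\<Union>j<n. face P j \<union> edge P j)" using x by (auto simp: polygon_curve_def cone_surface_def)
  then obtain j where j: "j < n" "x \<in> face P j \<or> x \<in> edge P j" using nx by auto
  from j(2) show "x \<in> arcs \<union> corner P ` {..<n}"
  proof
   assume "x \<in> face P j"
   then obtain r t where rt: "x = r *\<^sub>R ap j t" "0 < r" "0 < t" "t < ang j" by (auto simp: face_def)
   hence "r = 1" using nx norm_ap[OF j(1)] by simp
   hence "x \<in> arc j" using rt by (auto simp: arc_def)
   thus ?thesis using j(1) by (auto simp: arcs_def)
  next
   assume "x \<in> edge P j"
   then obtain r where r: "x = r *\<^sub>R corner P j" "0 < r" by (auto simp: edge_def)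
   hence "r = 1" using nx polygon_facts(1)[OF j(1)] by simp
   thus ?thesis using r j by auto
  qed
 qed
 show "arcs \<union> corner P ` {..<n} \<subseteq> \<gamma>"
  using ap_in_curve corner_in_curve by (auto simp: arcs_def arc_def)
qed

lemma arcs_eq: "arcs = \<gamma> - corner P ` {..<n}"
proof -
 have "corner P i \<notin> arcs" if "i < n" for i
 proof
  assume "corner P i \<in> arcs"
  then obtain j t where "j < n" "0 < t" "t < ang j" "ap i 0 = ap j t" by (auto simp: arcs_def arc_def ap_0)
  thus False using ap_inj[of i j 0 t] that polygon_facts(4)[OF that] by auto
 qed
 thus ?thesis using curve_split by auto
qed

lemma arcs_sub: "arcs \<subseteq> \<gamma>" by (auto simp: arcs_eq)

lemma arc_disjoint: "i < n ==> j < n ==> x \<in> arc i ==> x \<in> arc j ==> i = j"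
proof -
 assume ij: "i < n" "j < n" and x: "x \<in> arc i" "x \<in> arc j"
 obtain s where s: "x = ap i s" "0 < s" "s < ang i" using x(1) by (auto simp: arc_def)
 obtain t where t: "x = ap j t" "0 < t" "t < ang j" using x(2) by (auto simp: arc_def)
 show "i = j" using ap_inj[OF ij, of s t] s t by simp
qed

lemma arc_sets [measurable]: "arc j \<in> sets borel"
proof -
 have e: "{0<..<ang j} = (\<Union>m. {1 / real (Suc m)..ang j - 1 / real (Suc m)})"
 proof (rule set_eqI)
  fix t
  show "t \<in> {0<..<ang j} \<longleftrightarrow> t \<in> (\<Union>m. {1 / real (Suc m)..ang j - 1 / real (Suc m)})"
  proof
   assume t: "t \<in> {0<..<ang j}"
   then obtain m where "inverse (real (Suc m)) < min t (ang j - t)"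
    using reals_Archimedean[of "min t (ang j - t)"] by auto
   hence "t \<in> {1 / real (Suc m)..ang j - 1 / real (Suc m)}" by (auto simp: inverse_eq_divide)
   thus "t \<in> (\<Union>m. {1 / real (Suc m)..ang j - 1 / real (Suc m)})" by blast
  next
   assume "t \<in> (\<Union>m. {1 / real (Suc m)..ang j - 1 / real (Suc m)})"
   then obtain m where m: "1 / real (Suc m) <= t" "t <= ang j - 1 / real (Suc m)" by auto
   have "0 < 1 / real (Suc m)" by simp
   thus "t \<in> {0<..<ang j}" using m unfolding greaterThanLessThan_iff by linarith
  qed
 qed
 have "closed (ap j ` {1 / real (Suc m)..ang j - 1 / real (Suc m)})" for m
  by (intro compact_imp_closed compact_continuous_image ap_continuous) auto
 thus ?thesis unfolding arc_def e image_UN by (intro sets.countable_UN) auto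
qed

lemma curve_sets [measurable]: "\<gamma> \<in> sets borel"
 unfolding curve_split arcs_def by (intro sets.Un sets.finite_UN) (auto intro!: borel_closed finite_imp_closed)

lemma sets_nu [measurable_cong]: "sets \<nu> = sets (restrict_space borel \<gamma>)"
 by (simp add: arc_length_def)

lemma space_nu: "space \<nu> = \<gamma>"
 by (simp add: arc_length_def space_restrict_space)

abbreviation param :: "(nat \<times> real) measure" where
 "param == count_space {..<n} \<Otimes>\<^sub>M lborel"

lemma measurable_param:
 assumes "\<And>j. j < n ==> (%t. f (j, t)) \<in> borel \<rightarrow>\<^sub>M N" shows "f \<in> param \<rightarrow>\<^sub>M N"
 by (rule measurable_pair_measure_countable1) (use assms in auto)

lemma nn_integral_param:
 assumes "f \<in> borel_measurable param"
 shows "(\<integral>\<^sup>+z. f z \<partial>param) = (\<Sum>j<n. LNINT t. f (j, t))"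
 by (subst lborel.nn_integral_fst[OF assms, symmetric], subst nn_integral_count_space_finite) auto

lemma nn_integral_arc_length:
 assumes f: "f \<in> borel_measurable (restrict_space borel \<gamma>)"
 shows "(\<integral>\<^sup>+\<omega>. f \<omega> \<partial>\<nu>) = (\<Sum>j<n. LNINT t. f (ap j t) * indicator {0<..<ang j} t)"
proof -
 let ?\<Omega> = "SIGMA j:{..<n}. {0<..<ang j}"
 let ?m = "%(j, t). ap j t"
 have \<Omega>: "?\<Omega> \<in> sets param"
 proof -
  have "?\<Omega> = (\<Union>j<n. {j} \<times> {0<..<ang j})" by auto
  also have "... \<in> sets param" by (intro sets.finite_UN) (auto intro!: pair_measureI)
  finally show ?thesis .
 qed
 have m: "?m \<in> restrict_space param ?\<Omega> \<rightarrow>\<^sub>M restrict_space borel \<gamma>"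
 proof (rule measurable_restrict_space2)
  show "?m \<in> space (restrict_space param ?\<Omega>) \<rightarrow> \<gamma>"
   by (auto simp: space_restrict_space intro: ap_in_curve)
  show "?m \<in> borel_measurable (restrict_space param ?\<Omega>)"
   by (rule measurable_restrict_space1, rule measurable_param) simp
 qed
 have fm: "(%z. f (?m z)) \<in> borel_measurable (restrict_space param ?\<Omega>)"
  by (rule measurable_compose[OF m f])
 have "(\<integral>\<^sup>+\<omega>. f \<omega> \<partial>\<nu>) = (\<integral>\<^sup>+z. f (?m z) \<partial>restrict_space param ?\<Omega>)"
  unfolding arc_length_def by (rule nn_integral_distr[OF m]) (use f in simp)
 also have "... = (\<integral>\<^sup>+z. f (?m z) * indicator ?\<Omega> z \<partial>param)"
  by (rule nn_integral_restrict_space) (use \<Omega> in auto)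
 also have "... = (\<Sum>j<n. LNINT t. f (?m (j, t)) * indicator ?\<Omega> (j, t))"
  by (rule nn_integral_param)
    (use fm borel_measurable_restrict_space_iff_ennreal[of ?\<Omega> param "%z. f (?m z)"] \<Omega> in simp)
 also have "... = (\<Sum>j<n. LNINT t. f (ap j t) * indicator {0<..<ang j} t)"
  by (intro sum.cong refl nn_integral_cong) (auto split: split_indicator)
 finally show ?thesis .
qed

sublocale nu: finite_measure \<nu>
proof (rule finite_measureI)
 have "emeasure \<nu> (space \<nu>) = (\<integral>\<^sup>+\<omega>. 1 \<partial>\<nu>)" by simp
 also have "... = (\<Sum>j<n. ennreal (ang j))"
  by (subst nn_integral_arc_length) (auto intro!: sum.cong simp: polygon_facts less_imp_le)
 finally show "emeasure \<nu> (space \<nu>) \<noteq> \<infinity>" by simp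
qed

lemma AE_arcs: "AE \<omega> in \<nu>. \<omega> \<in> arcs"
proof (rule AE_I)
 have C: "corner P ` {..<n} \<in> sets borel" by (intro borel_closed finite_imp_closed) simp
 show "{\<omega> \<in> space \<nu>. \<omega> \<notin> arcs} \<subseteq> corner P ` {..<n}" by (auto simp: space_nu arcs_eq)
 show s: "corner P ` {..<n} \<in> sets \<nu>"
  unfolding sets_nu sets_restrict_space using C corner_in_curve by (intro image_eqI[of _ _ "corner P ` {..<n}"]) auto
 have "emeasure \<nu> (corner P ` {..<n}) = (\<integral>\<^sup>+\<omega>. indicator (corner P ` {..<n}) \<omega> \<partial>\<nu>)"
  by (rule nn_integral_indicator[OF s, symmetric])
 also have "... = (\<Sum>j<n. LNINT t. indicator (corner P ` {..<n}) (ap j t) * indicator {0<..<ang j} t)"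
  by (rule nn_integral_arc_length, rule measurable_restrict_space1, rule borel_measurable_indicator[OF C])
 also have "... = (\<Sum>j<n. integral\<^sup>N (lborel :: real measure) (%t. 0))"
 proof (intro sum.cong refl nn_integral_cong)
  fix j t assume "j \<in> {..<n}"
  hence "t \<in> {0<..<ang j} ==> ap j t \<in> arcs" by (simp add: ap_in_arcs)
  thus "indicator (corner P ` {..<n}) (ap j t) * indicator {0<..<ang j} t = (0::ennreal)"
   by (auto simp: arcs_eq split: split_indicator)
 qed
 finally show "emeasure \<nu> (corner P ` {..<n}) = 0" by simp
qed

lemma scale_in_surface: "\<omega> \<in> \<gamma> ==> 0 < r ==> r *\<^sub>R \<omega> \<in> cone_surface P"
proof -
 assume w: "\<omega> \<in> \<gamma>" and r: "0 < r"
 from w consider j t where "j < n" "0 < t" "t < ang j" "\<omega> = ap j t" | j where "j < n" "\<omega> = corner P j"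
  by (auto simp: curve_split arcs_def arc_def)
 thus "r *\<^sub>R \<omega> \<in> cone_surface P"
 proof cases
  case (1 j t)
  have "r *\<^sub>R \<omega> \<in> face P j"
   unfolding face_def using 1 r by (intro CollectI exI[of _ r] exI[of _ t]) simp
  thus ?thesis using face_subset_surface[OF 1(1)] by (rule rev_subsetD)
 next
  case (2 j)
  have "r *\<^sub>R \<omega> \<in> edge P j"
   unfolding edge_def using 2 r by (intro CollectI exI[of _ r]) simp
  thus ?thesis using edge_subset_surface[OF 2(1)] by (rule rev_subsetD)
 qed
qed

definition \<Phi> :: "real \<times> (real^3) => real^3" where "\<Phi> z = exp (fst z) *\<^sub>R snd z"

lemma \<Phi>_measurable [measurable]: "\<Phi> \<in> cyl \<rightarrow>\<^sub>M surf"
proof (rule measurable_restrict_space2)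
 show "\<Phi> \<in> space cyl \<rightarrow> cone_surface P"
  by (auto simp: \<Phi>_def space_pair_measure space_nu intro!: scale_in_surface)
 have "(%\<omega>. \<omega>) \<in> \<nu> \<rightarrow>\<^sub>M borel"
  unfolding measurable_cong_sets[OF sets_nu refl] by (rule measurable_restrict_space1) simp
 hence "(%z. snd z) \<in> cyl \<rightarrow>\<^sub>M borel"
  by (rule measurable_compose[OF measurable_snd])
 moreover have "(%z. fst z) \<in> cyl \<rightarrow>\<^sub>M borel"
  using measurable_fst[of lborel \<nu>] by simp
 ultimately show "\<Phi> \<in> borel_measurable cyl"
  unfolding \<Phi>_def[abs_def] by measurable
qed

lemma emeasure_distr_\<Phi>:
 assumes [measurable]: "w \<in> borel_measurable cyl" and A [measurable]: "A \<in> sets surf"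
 shows "emeasure (distr (density cyl w) surf \<Phi>) A
  = (\<integral>\<^sup>+z. w z * indicator A (\<Phi> z) \<partial>cyl)"
proof -
 let ?D = "distr (density cyl w) surf \<Phi>"
 have "emeasure ?D A = (\<integral>\<^sup>+x. indicator A x \<partial>?D)"
  by (rule nn_integral_indicator[symmetric]) (use A in simp)
 also have "... = (\<integral>\<^sup>+z. indicator A (\<Phi> z) \<partial>density cyl w)"
  by (rule nn_integral_distr) simp_all
 also have "... = (\<integral>\<^sup>+z. w z * indicator A (\<Phi> z) \<partial>cyl)"
  by (rule nn_integral_density) measurable
 finally show ?thesis .
qed

lemma chart_in_face:
 assumes "j < n"
 shows "u *\<^sub>R corner P j + v *\<^sub>R tangent P j \<in> face P j \<longleftrightarrow>
  (\<exists>r t. 0 < r \<and> 0 < t \<and> t < ang j \<and> u = r * cos t \<and> v = r * sin t)"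
proof
 assume "u *\<^sub>R corner P j + v *\<^sub>R tangent P j \<in> face P j"
 then obtain r t where rt: "0 < r" "0 < t" "t < ang j"
  "u *\<^sub>R corner P j + v *\<^sub>R tangent P j = r *\<^sub>R (cos t *\<^sub>R corner P j + sin t *\<^sub>R tangent P j)"
  by (auto simp: face_def arc_point_def)
 note c = corner_inner[OF assms] polygon_facts(3)[OF assms] inner_commute[of "tangent P j" "corner P j"]
 have "u = r * cos t" using arg_cong[OF rt(4), of "%x. x \<bullet> corner P j"] c by (simp add: inner_add inner_left_distrib)
 moreover have "v = r * sin t" using arg_cong[OF rt(4), of "%x. x \<bullet> tangent P j"] c by (simp add: inner_add inner_left_distrib)
 ultimately show "\<exists>r t. 0 < r \<and> 0 < t \<and> t < ang j \<and> u = r * cos t \<and> v = r * sin t" using rt by blast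
next
 assume "\<exists>r t. 0 < r \<and> 0 < t \<and> t < ang j \<and> u = r * cos t \<and> v = r * sin t"
 then obtain r t where "0 < r" "0 < t" "t < ang j" "u = r * cos t" "v = r * sin t" by blast
 thus "u *\<^sub>R corner P j + v *\<^sub>R tangent P j \<in> face P j"
  unfolding face_def by (intro CollectI exI[of _ r] exI[of _ t]) (simp add: arc_point_def scaleR_add_right)
qed

lemma polar_in_face:
 assumes j: "j < n" and r: "0 < r" and t: "0 < t" "t < 2 * pi"
 shows "(r * cos t) *\<^sub>R corner P j + (r * sin t) *\<^sub>R tangent P j \<in> face P j \<longleftrightarrow> t < ang j"
proof
 assume "(r * cos t) *\<^sub>R corner P j + (r * sin t) *\<^sub>R tangent P j \<in> face P j"
 then obtain r' t' where rt: "0 < r'" "0 < t'" "t' < ang j" "r * cos t = r' * cos t'" "r * sin t = r' * sin t'"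
  unfolding chart_in_face[OF j] by blast
 have "r\<^sup>2 = (r * cos t)\<^sup>2 + (r * sin t)\<^sup>2" by (simp add: power_mult_distrib flip: distrib_left)
 also have "... = r'\<^sup>2" unfolding rt(4,5) by (simp add: power_mult_distrib flip: distrib_left)
 finally have "r = r'" using r rt(1) by (simp add: power2_eq_iff)
 hence "sin t = sin t' \<and> cos t = cos t'" using rt r by simp
 then obtain m where m: "t = t' + 2 * pi * of_int m" using sin_cos_eq_iff[of t t'] by (auto elim!: Ints_cases)
 have t': "0 < t'" "t' < 2 * pi" using rt polygon_facts(5)[OF j] by auto
 have "m = 0"
 proof -
  have lt: "2 * pi * of_int m < 2 * pi * 1" "2 * pi * (-1) < 2 * pi * of_int m" using m t t' by linarith+
  have "of_int m < (1::real)" by (rule mult_left_less_imp_less[OF lt(1)]) simp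
  moreover have "(-1::real) < of_int m" by (rule mult_left_less_imp_less[OF lt(2)]) simp
  ultimately have "m < 1" "-1 < m" by linarith+
  thus ?thesis by linarith
 qed
 thus "t < ang j" using m rt by simp
next
 assume "t < ang j"
 thus "(r * cos t) *\<^sub>R corner P j + (r * sin t) *\<^sub>R tangent P j \<in> face P j"
  unfolding chart_in_face[OF j] using r t by blast
qed

lemma face_eq_arc: "j < n ==> face P j = {x. x \<noteq> 0 \<and> x /\<^sub>R norm x \<in> arc j}"
proof (rule set_eqI)
 fix x assume j: "j < n"
 show "x \<in> face P j \<longleftrightarrow> x \<in> {x. x \<noteq> 0 \<and> x /\<^sub>R norm x \<in> arc j}"
 proof
  assume "x \<in> face P j"
  then obtain r t where "x = r *\<^sub>R ap j t" "0 < r" "0 < t" "t < ang j" by (auto simp: face_def)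
  thus "x \<in> {x. x \<noteq> 0 \<and> x /\<^sub>R norm x \<in> arc j}"
   using norm_ap[OF j, of t] by (auto simp: arc_def)
 next
  assume x: "x \<in> {x. x \<noteq> 0 \<and> x /\<^sub>R norm x \<in> arc j}"
  then obtain t where t: "x /\<^sub>R norm x = ap j t" "0 < t" "t < ang j" by (auto simp: arc_def)
  have "x = norm x *\<^sub>R (x /\<^sub>R norm x)" using x by simp
  hence "x = norm x *\<^sub>R ap j t" unfolding t(1) .
  thus "x \<in> face P j" unfolding face_def using t x by (intro CollectI exI[of _ "norm x"] exI[of _ t]) auto
 qed
qed

lemma face_sets [measurable]: "j < n ==> face P j \<in> sets borel"
 unfolding face_eq_arc by measurable

text \<open>
  Polar coordinates in the plane of each face, followed by \<open>r = e\<^sup>s\<close>: the element \<open>r dr d\<theta>\<close> turns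
  into \<open>e\<^sup>2\<^sup>s ds d\<theta>\<close>.
\<close>

theorem surface_measure_eq:
 "surface_measure P = distr (density cyl (%z. ennreal (exp (2 * fst z)))) surf \<Phi>" (is "_ = ?D")
proof (rule measure_eqI)
 show "sets (surface_measure P) = sets ?D"
  by (simp add: surface_measure_def)
 fix A assume "A \<in> sets (surface_measure P)"
 hence A: "A \<in> sets surf" by (simp add: surface_measure_def)
 let ?PM = "count_space {..<n} \<Otimes>\<^sub>M (lborel :: (real \<times> real) measure)"
 let ?\<Omega> = "SIGMA j:{..<n}. face_chart P j -` face P j"
 let ?m = "%(j, p). face_chart P j p"
 have chart [measurable]: "face_chart P j \<in> borel_measurable borel" for j
  unfolding face_chart_def split_beta' by (intro borel_measurable_continuous_onI continuous_intros)
 have chs: "face_chart P j -` face P j \<in> sets borel" if "j < n" for j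
  using measurable_sets[OF chart face_sets[OF that], of j] by simp
 have \<Omega>: "?\<Omega> \<in> sets ?PM"
 proof -
  have "?\<Omega> = (\<Union>j<n. {j} \<times> (face_chart P j -` face P j))" by auto
  also have "... \<in> sets ?PM" by (intro sets.finite_UN) (auto intro!: pair_measureI chs)
  finally show ?thesis .
 qed
 have m: "?m \<in> restrict_space ?PM ?\<Omega> \<rightarrow>\<^sub>M surf"
 proof (rule measurable_restrict_space2)
  show "?m \<in> space (restrict_space ?PM ?\<Omega>) \<rightarrow> cone_surface P"
   by (auto simp: space_restrict_space cone_surface_def)
  show "?m \<in> borel_measurable (restrict_space ?PM ?\<Omega>)"
   by (rule measurable_restrict_space1, rule measurable_pair_measure_countable1) auto
 qed
 obtain A' where A': "A' \<in> sets borel" "A = A' \<inter> cone_surface P"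
  using A by (auto simp: sets_restrict_space)
 note [measurable] = A'(1)
 have fm: "(%z. indicator A (?m z) :: ennreal) \<in> borel_measurable (restrict_space ?PM ?\<Omega>)"
  by (rule measurable_compose[OF m borel_measurable_indicator[OF A]])
 have "emeasure (surface_measure P) A = (\<integral>\<^sup>+x. indicator A x \<partial>surface_measure P)"
  by (rule nn_integral_indicator[symmetric]) (use A in \<open>simp add: surface_measure_def\<close>)
 also have "... = (\<integral>\<^sup>+z. indicator A (?m z) \<partial>restrict_space ?PM ?\<Omega>)"
  unfolding surface_measure_def by (rule nn_integral_distr[OF m]) (use A in simp)
 also have "... = (\<integral>\<^sup>+z. indicator A (?m z) * indicator ?\<Omega> z \<partial>?PM)"
  by (rule nn_integral_restrict_space) (use \<Omega> in auto)
 also have "... = (\<Sum>j<n. LNINT p. indicator A (?m (j, p)) * indicator ?\<Omega> (j, p))"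
  by (subst lborel.nn_integral_fst[symmetric],
    use fm borel_measurable_restrict_space_iff_ennreal[of ?\<Omega> ?PM "%z. indicator A (?m z)"] \<Omega> in simp,
    subst nn_integral_count_space_finite) auto
 also have "... = (\<Sum>j<n. LNINT t. (LNINT s. ennreal (exp (2 * s) * indicator A (exp s *\<^sub>R ap j t))) * indicator {0<..<ang j} t)"
 proof (rule sum.cong[OF refl])
  fix j assume "j \<in> {..<n}"
  hence j: "j < n" by simp
  note [measurable] = face_sets[OF j]
  define g :: "real \<times> real => real" where "g p = indicator (face P j \<inter> A') (face_chart P j p)" for p
  have [measurable]: "g \<in> borel_measurable borel" unfolding g_def[abs_def] by measurable
  have [measurable]: "g \<in> borel_measurable (borel \<Otimes>\<^sub>M borel)" by (simp add: borel_prod)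
  have g0: "0 <= g p" for p by (simp add: g_def)
  have fs: "face P j \<subseteq> cone_surface P" using j by (auto simp: cone_surface_def)
  have "(LNINT p. indicator A (?m (j, p)) * indicator ?\<Omega> (j, p)) = (LNINT p. ennreal (g p))"
   by (intro nn_integral_cong) (use j fs A' in \<open>auto simp: g_def split: split_indicator\<close>)
  also have "... = (LNINT t. (LNINT r. ennreal (r * g (r * cos t, r * sin t)) * indicator {0<..} r) * indicator {0<..<2*pi} t)"
   by (rule polar_coordinates) (simp_all add: g0)
  also have "... = (LNINT t. (LNINT s. ennreal (exp (2 * s) * indicator A (exp s *\<^sub>R ap j t))) * indicator {0<..<ang j} t)"
  proof (rule nn_integral_cong)
   fix t :: real
   show "(LNINT r. ennreal (r * g (r * cos t, r * sin t)) * indicator {0<..} r) * indicator {0<..<2*pi} t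
     = (LNINT s. ennreal (exp (2 * s) * indicator A (exp s *\<^sub>R ap j t))) * indicator {0<..<ang j} t"
   proof (cases "t \<in> {0<..<2*pi}")
    case True
    have e: "g (r * cos t, r * sin t) = (if t < ang j then indicator A (r *\<^sub>R ap j t) else 0)" if "0 < r" for r
     using polar_in_face[OF j that, of t] True fs A'
     by (auto simp: g_def face_chart_def arc_point_def scaleR_add_right split: split_indicator)
    have "(LNINT r. ennreal (r * g (r * cos t, r * sin t)) * indicator {0<..} r)
      = (LNINT s. ennreal (exp s) * ennreal (exp s * g (exp s * cos t, exp s * sin t)))"
     by (rule nn_integral_exp) measurable
    also have "... = (LNINT s. ennreal (exp (2 * s) * g (exp s * cos t, exp s * sin t)))"
     by (intro nn_integral_cong) (simp add: g0 exp_double power2_eq_square mult.assoc flip: ennreal_mult)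
    finally show ?thesis using True polygon_facts(5)[OF j] by (auto simp: e split: split_indicator)
   next
    case False
    hence "t \<notin> {0<..<ang j}" using polygon_facts(5)[OF j] by auto
    with False show ?thesis by simp
   qed
  qed
  finally show "(LNINT p. indicator A (?m (j, p)) * indicator ?\<Omega> (j, p)) = ..." .
 qed
 also have "... = (\<integral>\<^sup>+\<omega>. (LNINT s. ennreal (exp (2 * s)) * indicator A (\<Phi> (s, \<omega>))) \<partial>\<nu>)"
 proof (subst nn_integral_arc_length)
  have "(%z. ennreal (exp (2 * fst z)) * indicator A (\<Phi> z)) \<in> borel_measurable cyl"
   using A by measurable
  hence "(%\<omega>. LNINT s. ennreal (exp (2 * s)) * indicator A (\<Phi> (s, \<omega>))) \<in> borel_measurable \<nu>"
   by (subst (asm) measurable_pair_swap_iff) (auto dest!: lborel.borel_measurable_nn_integral_fst)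
  thus "(%\<omega>. LNINT s. ennreal (exp (2 * s)) * indicator A (\<Phi> (s, \<omega>))) \<in> borel_measurable (restrict_space borel \<gamma>)"
   by (simp add: measurable_cong_sets[OF sets_nu refl])
 qed (intro sum.cong refl nn_integral_cong arg_cong2[where f="(*)"], auto simp: \<Phi>_def split: split_indicator)
 also have "... = (\<integral>\<^sup>+z. ennreal (exp (2 * fst z)) * indicator A (\<Phi> z) \<partial>cyl)"
 proof -
  interpret pair_sigma_finite lborel \<nu>
   by (intro pair_sigma_finite.intro sigma_finite_lborel nu.sigma_finite_measure_axioms)
  show ?thesis using A by (subst nn_integral_snd[symmetric]) simp_all
 qed
 also have "... = emeasure ?D A"
  by (rule emeasure_distr_\<Phi>[symmetric]) (use A in measurable)
 finally show "emeasure (surface_measure P) A = emeasure ?D A" .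
qed

theorem cone_measure_eq:
 assumes [measurable]: "q \<in> borel_measurable \<nu>"
 shows "cone_measure P q \<alpha> = distr (density cyl (%z. ennreal (exp (fst z) * q (snd z) powr (- \<alpha>)))) surf \<Phi>" (is "_ = ?D")
proof (rule measure_eqI)
 show "sets (cone_measure P q \<alpha>) = sets ?D"
  by (simp add: cone_measure_def)
 fix A assume "A \<in> sets (cone_measure P q \<alpha>)"
 hence A [measurable]: "A \<in> sets surf" by (simp add: cone_measure_def)
 let ?w = "%\<omega>. ennreal (q \<omega> powr (- \<alpha>))"
 have [measurable_cong]: "sets (curve_measure P q \<alpha>) = sets \<nu>" by (simp add: curve_measure_def)
 have sf: "sigma_finite_measure (curve_measure P q \<alpha>)"
  unfolding curve_measure_def by (subst nu.sigma_finite_iff_density_finite) auto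
 have idm: "(%\<omega>. \<omega>) \<in> \<nu> \<rightarrow>\<^sub>M borel"
  unfolding measurable_cong_sets[OF sets_nu refl] by (rule measurable_restrict_space1) simp
 have idc: "(%\<omega>. \<omega>) \<in> curve_measure P q \<alpha> \<rightarrow>\<^sub>M borel"
  using idm by (simp add: curve_measure_def)
 let ?R = "restrict_space lborel {0::real<..}"
 have m: "(%(r, \<omega>). r *\<^sub>R \<omega>) \<in> ?R \<Otimes>\<^sub>M curve_measure P q \<alpha> \<rightarrow>\<^sub>M surf"
 proof (rule measurable_restrict_space2)
  show "(%(r, \<omega>). r *\<^sub>R \<omega>) \<in> space (?R \<Otimes>\<^sub>M curve_measure P q \<alpha>) \<rightarrow> cone_surface P"
   by (auto simp: space_pair_measure space_restrict_space curve_measure_def space_nu intro: scale_in_surface)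
  have "(%z. fst z) \<in> ?R \<Otimes>\<^sub>M curve_measure P q \<alpha> \<rightarrow>\<^sub>M borel"
   by (rule measurable_compose[OF measurable_fst]) (auto intro: measurable_restrict_space1)
  moreover have "(%z. snd z) \<in> ?R \<Otimes>\<^sub>M curve_measure P q \<alpha> \<rightarrow>\<^sub>M borel"
   by (rule measurable_compose[OF measurable_snd idc])
  ultimately show "(%(r, \<omega>). r *\<^sub>R \<omega>) \<in> borel_measurable (?R \<Otimes>\<^sub>M curve_measure P q \<alpha>)"
   unfolding split_beta' by measurable
 qed
 have im: "(%z. indicator A (case z of (r, \<omega>) => r *\<^sub>R \<omega>) :: ennreal) \<in> borel_measurable (?R \<Otimes>\<^sub>M curve_measure P q \<alpha>)"
  by (rule measurable_compose[OF m borel_measurable_indicator[OF A]])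
 obtain A' where A' [measurable]: "A' \<in> sets borel" and A'e: "A = A' \<inter> cone_surface P"
  using A by (auto simp: sets_restrict_space)
 have e: "indicator A (r *\<^sub>R \<omega>) = (indicator A' (r *\<^sub>R \<omega>) :: ennreal)" if "\<omega> \<in> \<gamma>" "0 < r" for r \<omega>
  using scale_in_surface[OF that] by (auto simp: A'e split: split_indicator)
 have A'm [measurable]: "(%z. indicator A' (fst z *\<^sub>R snd z) :: ennreal) \<in> borel_measurable (borel \<Otimes>\<^sub>M \<nu>)"
 proof -
  have "(%z. snd z) \<in> borel \<Otimes>\<^sub>M \<nu> \<rightarrow>\<^sub>M borel" by (rule measurable_compose[OF measurable_snd idm])
  hence "(%z. fst z *\<^sub>R snd z) \<in> borel_measurable ((borel :: real measure) \<Otimes>\<^sub>M \<nu>)" by measurable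
  thus ?thesis by (rule measurable_compose) measurable
 qed
 have "emeasure (cone_measure P q \<alpha>) A = (\<integral>\<^sup>+x. indicator A x \<partial>cone_measure P q \<alpha>)"
  by (rule nn_integral_indicator[symmetric]) (use A in \<open>simp add: cone_measure_def\<close>)
 also have "... = (\<integral>\<^sup>+z. indicator A (case z of (r, \<omega>) => r *\<^sub>R \<omega>) \<partial>(?R \<Otimes>\<^sub>M curve_measure P q \<alpha>))"
  unfolding cone_measure_def by (rule nn_integral_distr[OF m]) (use A in simp)
 also have "... = (\<integral>\<^sup>+r. (\<integral>\<^sup>+\<omega>. indicator A (r *\<^sub>R \<omega>) \<partial>curve_measure P q \<alpha>) \<partial>?R)"
  by (subst sigma_finite_measure.nn_integral_fst[OF sf im, symmetric]) simp
 also have "... = (LNINT r. (\<integral>\<^sup>+\<omega>. indicator A (r *\<^sub>R \<omega>) \<partial>curve_measure P q \<alpha>) * indicator {0<..} r)"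
  by (rule nn_integral_restrict_space) auto
 also have "... = (LNINT r. (\<integral>\<^sup>+\<omega>. ?w \<omega> * indicator A' (r *\<^sub>R \<omega>) \<partial>\<nu>) * indicator {0<..} r)"
 proof (rule nn_integral_cong)
  fix r :: real
  have "(\<integral>\<^sup>+\<omega>. indicator A (r *\<^sub>R \<omega>) \<partial>curve_measure P q \<alpha>) = (\<integral>\<^sup>+\<omega>. ?w \<omega> * indicator A' (r *\<^sub>R \<omega>) \<partial>\<nu>)" if r: "0 < r"
  proof -
   have "(\<integral>\<^sup>+\<omega>. indicator A (r *\<^sub>R \<omega>) \<partial>curve_measure P q \<alpha>) = (\<integral>\<^sup>+\<omega>. indicator A' (r *\<^sub>R \<omega>) \<partial>curve_measure P q \<alpha>)"
    by (rule nn_integral_cong) (use e r in \<open>simp add: curve_measure_def space_nu\<close>)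
   also have "... = (\<integral>\<^sup>+\<omega>. ?w \<omega> * indicator A' (r *\<^sub>R \<omega>) \<partial>\<nu>)"
    unfolding curve_measure_def
    using measurable_compose[OF measurable_Pair1'[of r borel \<nu>] A'm] by (subst nn_integral_density) simp_all
   finally show ?thesis .
  qed
  thus "(\<integral>\<^sup>+\<omega>. indicator A (r *\<^sub>R \<omega>) \<partial>curve_measure P q \<alpha>) * indicator {0<..} r
    = (\<integral>\<^sup>+\<omega>. ?w \<omega> * indicator A' (r *\<^sub>R \<omega>) \<partial>\<nu>) * indicator {0<..} r"
   by (auto split: split_indicator)
 qed
 also have "... = (LNINT s. ennreal (exp s) * (\<integral>\<^sup>+\<omega>. ?w \<omega> * indicator A' (exp s *\<^sub>R \<omega>) \<partial>\<nu>))"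
 proof (rule nn_integral_exp)
  have "(%z. ?w (snd z) * indicator A' (fst z *\<^sub>R snd z)) \<in> borel_measurable (borel \<Otimes>\<^sub>M \<nu>)" by measurable
  from nu.borel_measurable_nn_integral_fst[OF this]
  show "(%r. \<integral>\<^sup>+\<omega>. ?w \<omega> * indicator A' (r *\<^sub>R \<omega>) \<partial>\<nu>) \<in> borel_measurable borel" by simp
 qed
 also have "... = (LNINT s. (\<integral>\<^sup>+\<omega>. ennreal (exp s * q \<omega> powr (- \<alpha>)) * indicator A (\<Phi> (s, \<omega>)) \<partial>\<nu>))"
 proof (rule nn_integral_cong)
  fix s
  have "ennreal (exp s) * (\<integral>\<^sup>+\<omega>. ?w \<omega> * indicator A' (exp s *\<^sub>R \<omega>) \<partial>\<nu>)
    = (\<integral>\<^sup>+\<omega>. ennreal (exp s) * (?w \<omega> * indicator A' (exp s *\<^sub>R \<omega>)) \<partial>\<nu>)"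
   using measurable_compose[OF measurable_Pair1'[of "exp s" borel \<nu>] A'm]
   by (intro nn_integral_cmult[symmetric]) simp
  also have "... = (\<integral>\<^sup>+\<omega>. ennreal (exp s * q \<omega> powr (- \<alpha>)) * indicator A (\<Phi> (s, \<omega>)) \<partial>\<nu>)"
   by (rule nn_integral_cong) (simp add: space_nu e \<Phi>_def ennreal_mult mult.assoc)
  finally show "ennreal (exp s) * (\<integral>\<^sup>+\<omega>. ?w \<omega> * indicator A' (exp s *\<^sub>R \<omega>) \<partial>\<nu>) = ..." .
 qed
 also have "... = (\<integral>\<^sup>+z. ennreal (exp (fst z) * q (snd z) powr (- \<alpha>)) * indicator A (\<Phi> z) \<partial>cyl)"
  by (subst nu.nn_integral_fst[symmetric]) simp_all
 also have "... = emeasure ?D A"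
  by (rule emeasure_distr_\<Phi>[symmetric]) (use A in measurable)
 finally show "emeasure (cone_measure P q \<alpha>) A = emeasure ?D A" .
qed

end

section \<open>Outward normals\<close>

text \<open>
  If \<open>m\<close> and \<open>m'\<close> were different, moving from \<open>y\<close> in the direction \<open>m' - m\<close> would enter one half space
  and leave the other.
\<close>

lemma is_outward_normal_unique:
 assumes "is_outward_normal C y m" "is_outward_normal C y m'" shows "m = m'"
proof (rule ccontr)
 assume ne: "m \<noteq> m'"
 obtain e1 where e1: "0 < e1" "C \<inter> ball y e1 = {x \<in> ball y e1. (x - y) \<bullet> m < 0}" and m: "norm m = 1"
  using assms(1) by (auto simp: is_outward_normal_def)
 obtain e2 where e2: "0 < e2" "C \<inter> ball y e2 = {x \<in> ball y e2. (x - y) \<bullet> m' < 0}" and m': "norm m' = 1"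
  using assms(2) by (auto simp: is_outward_normal_def)
 define e where "e = min e1 e2"
 have e: "0 < e" using e1 e2 by (simp add: e_def)
 define v where "v = m' - m"
 have mm: "m \<bullet> m = 1" "m' \<bullet> m' = 1" using m m' by (simp_all add: dot_square_norm)
 have "0 < v \<bullet> v" using ne by (simp add: v_def)
 hence lt: "m \<bullet> m' < 1" using mm by (simp add: v_def inner_diff inner_commute[of m' m])
 define D where "D = norm v + 1"
 define h where "h = e / (2 * D)"
 have D: "0 < D" "norm v < D" using norm_ge_zero[of v] unfolding D_def by linarith+
 have h: "0 < h" using e D by (simp add: h_def)
 have h2: "h * norm v < e"
 proof -
  have "h * norm v <= h * D" using h D by (intro mult_left_mono) auto
  also have "... = e / 2" using D by (simp add: h_def)
  finally show ?thesis using e by simp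
 qed
 define x where "x = y + h *\<^sub>R v"
 have x: "x \<in> ball y e1" "x \<in> ball y e2" using h h2 by (auto simp: x_def dist_norm e_def)
 have "(x - y) \<bullet> m < 0"
  using h lt mm by (simp add: x_def v_def inner_diff inner_commute[of m' m] mult_pos_neg)
 hence "x \<in> C" using x(1) e1(2) by blast
 hence "(x - y) \<bullet> m' < 0" using x(2) e2(2) by blast
 moreover have "0 < (x - y) \<bullet> m'"
  using h lt mm by (simp add: x_def v_def inner_diff)
 ultimately show False by simp
qed

lemma outward_normal_eq: "is_outward_normal C y m ==> outward_normal C y = m"
 unfolding outward_normal_def by (rule the_equality) (auto intro: is_outward_normal_unique)

lemma is_outward_normal_scale:
 assumes conic: "\<And>x r. x \<in> C ==> 0 < r ==> r *\<^sub>R x \<in> C" and r: "0 < r" and m: "is_outward_normal C y m"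
 shows "is_outward_normal C (r *\<^sub>R y) m"
proof -
 obtain e where e: "0 < e" "C \<inter> ball y e = {x \<in> ball y e. (x - y) \<bullet> m < 0}" and m1: "norm m = 1"
  using m by (auto simp: is_outward_normal_def)
 have "x \<in> C \<longleftrightarrow> (x - r *\<^sub>R y) \<bullet> m < 0" if x: "x \<in> ball (r *\<^sub>R y) (r * e)" for x
 proof -
  define x' where "x' = (1 / r) *\<^sub>R x"
  have xx: "x = r *\<^sub>R x'" using r by (simp add: x'_def)
  have "r *\<^sub>R y - r *\<^sub>R x' = r *\<^sub>R (y - x')" by (simp add: scaleR_diff_right)
  hence "r * norm (y - x') < r * e" using x r by (simp add: xx dist_norm)
  hence b: "x' \<in> ball y e" using r by (simp add: dist_norm)
  have "x \<in> C \<longleftrightarrow> x' \<in> C" using conic[of x' r] conic[of x "1 / r"] r by (auto simp: xx)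
  also have "... \<longleftrightarrow> (x' - y) \<bullet> m < 0" using b e(2) by blast
  also have "... \<longleftrightarrow> r * ((x' - y) \<bullet> m) < 0" using r by (simp add: mult_less_0_iff)
  also have "r * ((x' - y) \<bullet> m) = (x - r *\<^sub>R y) \<bullet> m" by (simp add: xx inner_diff_left right_diff_distrib)
  finally show ?thesis .
 qed
 hence "C \<inter> ball (r *\<^sub>R y) (r * e) = {x \<in> ball (r *\<^sub>R y) (r * e). (x - r *\<^sub>R y) \<bullet> m < 0}" by blast
 moreover have "0 < r * e" using r e by simp
 ultimately show ?thesis unfolding is_outward_normal_def using m1 by blast
qed

lemma outward_normal_scale:
 assumes conic: "\<And>x r. x \<in> C ==> 0 < r ==> r *\<^sub>R x \<in> C" and r: "0 < r"
 shows "outward_normal C (r *\<^sub>R y) = outward_normal C y"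
proof -
 have "is_outward_normal C (r *\<^sub>R y) = is_outward_normal C y"
 proof (intro ext iffI)
  fix m assume "is_outward_normal C (r *\<^sub>R y) m"
  from is_outward_normal_scale[OF conic _ this, of "1 / r"] r
  show "is_outward_normal C y m" by simp
 qed (rule is_outward_normal_scale[OF conic r])
 thus ?thesis by (simp add: outward_normal_def)
qed

section \<open>Geometry near the corners\<close>

text \<open>
  The function is only controlled on \<open>T\<close>, an open interval or rectangle in the applications; bounds near the points of
  its closure, corners included, are patched together.
\<close>

lemma compact_locally_bounded:
 fixes S :: "'a::metric_space set" and f :: "'a => real"
 assumes S: "compact S" and loc: "\<And>z. z \<in> S ==> \<exists>e>0. \<exists>B. \<forall>w\<in>T. dist z w < e --> f w <= B"
 shows "\<exists>B>0. \<forall>w\<in>S \<inter> T. f w <= B"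
proof -
 have "\<forall>z. \<exists>e. z \<in> S --> 0 < e \<and> (\<exists>B. \<forall>w\<in>T. dist z w < e --> f w <= B)" using loc by blast
 from choice[OF this] obtain e where e: "\<And>z. z \<in> S ==> 0 < e z"
  and "\<And>z. z \<in> S ==> \<exists>B. \<forall>w\<in>T. dist z w < e z --> f w <= B" by blast
 hence "\<forall>z. \<exists>B. z \<in> S --> (\<forall>w\<in>T. dist z w < e z --> f w <= B)" by blast
 from choice[OF this] obtain B where B: "\<And>z w. z \<in> S ==> w \<in> T ==> dist z w < e z ==> f w <= B z" by blast
 have "S \<subseteq> (\<Union>z\<in>S. ball z (e z))" using e by force
 then obtain K where K: "K \<subseteq> S" "finite K" "S \<subseteq> (\<Union>z\<in>K. ball z (e z))"
  by (rule compactE_image[OF S, of S "%z. ball z (e z)", rotated]) auto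
 have "f w <= 1 + (\<Sum>z\<in>K. \<bar>B z\<bar>)" if w: "w \<in> S \<inter> T" for w
 proof -
  obtain z where z: "z \<in> K" "w \<in> ball z (e z)" using K w by blast
  hence "f w <= \<bar>B z\<bar>" using B[of z w] K(1) w by auto
  also have "... <= (\<Sum>z\<in>K. \<bar>B z\<bar>)" by (rule member_le_sum[OF z(1)]) (use K(2) in auto)
  finally show ?thesis by simp
 qed
 moreover have "0 < 1 + (\<Sum>z\<in>K. \<bar>B z\<bar>)" by (simp add: sum_nonneg add_pos_nonneg)
 ultimately show ?thesis by blast
qed

lemma one_minus_cos_le: "1 - cos x <= (x::real)\<^sup>2 / 2"
proof -
 have "1 - cos x = 2 * (sin (x / 2))\<^sup>2" using cos_double_sin[of "x / 2"] by simp
 moreover have "(sin (x / 2))\<^sup>2 <= (x / 2)\<^sup>2"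
  using abs_sin_x_le_abs_x[of "x / 2"] by (simp only: abs_le_square_iff)
 ultimately show ?thesis by (simp add: power_divide)
qed

lemma sin_ge_half:
 assumes "0 <= x" "x <= (1::real)" shows "x / 2 <= sin x"
proof -
 have "sin 0 - 0 / 2 <= sin x - x / 2"
 proof (rule DERIV_nonneg_imp_nondecreasing[OF assms(1)])
  fix y assume y: "0 <= y" "y <= x"
  have "y\<^sup>2 <= 1\<^sup>2" using y assms by (intro power_mono) auto
  hence "0 <= cos y - 1 / 2" using one_minus_cos_le[of y] by simp
  moreover have "((%x. sin x - x / 2) has_real_derivative cos y - 1 / 2) (at y)"
   by (auto intro!: derivative_eq_intros)
  ultimately show "\<exists>d. ((%x. sin x - x / 2) has_real_derivative d) (at y) \<and> 0 <= d" by blast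
 qed
 thus ?thesis by simp
qed

text \<open>Two arcs leaving a point in different directions separate at a linear rate.\<close>

lemma arcs_separate:
 fixes E b e :: "real^3"
 assumes u: "norm E = 1" "norm b = 1" "norm e = 1" and o: "E \<bullet> b = 0" "E \<bullet> e = 0" and \<kappa>: "\<bar>b \<bullet> e\<bar> < 1"
 shows "\<exists>c>0. \<forall>x\<in>{0..1}. \<forall>y\<in>{0..1}. c * (x + y) <= norm ((cos x *\<^sub>R E + sin x *\<^sub>R b) - (cos y *\<^sub>R E + sin y *\<^sub>R e))"
proof -
 define k where "k = \<bar>b \<bullet> e\<bar>"
 define c where "c = sqrt ((1 - k) / 8)"
 have k: "0 <= k" "k < 1" using \<kappa> by (auto simp: k_def)
 have "c * (x + y) <= norm ((cos x *\<^sub>R E + sin x *\<^sub>R b) - (cos y *\<^sub>R E + sin y *\<^sub>R e))"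
  if x: "0 <= x" "x <= 1" and y: "0 <= y" "y <= 1" for x y
 proof -
  let ?w = "(cos x *\<^sub>R E + sin x *\<^sub>R b) - (cos y *\<^sub>R E + sin y *\<^sub>R e)"
  have ii: "E \<bullet> E = 1" "b \<bullet> b = 1" "e \<bullet> e = 1" using u by (simp_all add: dot_square_norm)
  have sx: "x / 2 <= sin x" "y / 2 <= sin y" using sin_ge_half x y by auto
  have "?w \<bullet> ?w = (cos x - cos y)\<^sup>2 + (sin x)\<^sup>2 + (sin y)\<^sup>2 - 2 * sin x * sin y * (b \<bullet> e)"
   using ii o by (simp add: inner_diff inner_add inner_commute[of b E] inner_commute[of e E] inner_commute[of e b]
     power2_eq_square algebra_simps) (use sin_cos_squared_add[of x] sin_cos_squared_add[of y] in \<open>simp add: power2_eq_square\<close>)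
  also have "... \<ge> (sin x)\<^sup>2 + (sin y)\<^sup>2 - 2 * sin x * sin y * k"
  proof -
   have "0 <= sin x * sin y" using sx x y by (intro mult_nonneg_nonneg) auto
   hence "sin x * sin y * (b \<bullet> e) <= sin x * sin y * k" by (intro mult_left_mono) (auto simp: k_def)
   thus ?thesis using zero_le_power2[of "cos x - cos y"] by linarith
  qed
  also have "(sin x)\<^sup>2 + (sin y)\<^sup>2 - 2 * sin x * sin y * k \<ge> (1 - k) * ((sin x)\<^sup>2 + (sin y)\<^sup>2)"
   using mult_left_mono[OF sum_squares_bound[of "sin x" "sin y"] k(1)] by (simp add: algebra_simps)
  also have "(1 - k) * ((sin x)\<^sup>2 + (sin y)\<^sup>2) \<ge> (1 - k) * ((x / 2)\<^sup>2 + (y / 2)\<^sup>2)"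
   using k sx x y by (intro mult_left_mono add_mono power_mono) auto
  also have "(1 - k) * ((x / 2)\<^sup>2 + (y / 2)\<^sup>2) \<ge> (1 - k) * ((x + y)\<^sup>2 / 8)"
   using k sum_squares_bound[of x y] by (intro mult_left_mono) (auto simp: power2_sum power_divide)
  also have "(1 - k) * ((x + y)\<^sup>2 / 8) = (c * (x + y))\<^sup>2"
   using k by (simp add: c_def power_mult_distrib)
  finally have "(c * (x + y))\<^sup>2 <= (norm ?w)\<^sup>2" by (simp add: dot_square_norm)
  thus ?thesis by (rule power2_le_imp_le) simp
 qed
 moreover have "0 < c" using k by (simp add: c_def)
 ultimately show ?thesis by (intro exI[of _ c]) auto
qed

lemma unit_not_in_span:
 fixes b e :: "real^3"
 assumes "norm b = 1" "norm e = 1" "b \<in> span S" "e \<notin> span S"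
 shows "\<bar>b \<bullet> e\<bar> < 1"
proof -
 have i: "b \<bullet> b = 1" "e \<bullet> e = 1" using assms by (simp_all add: dot_square_norm)
 have "e - (b \<bullet> e) *\<^sub>R b \<noteq> 0" using assms span_scale[OF assms(3), of "b \<bullet> e"] by auto
 hence "0 < (e - (b \<bullet> e) *\<^sub>R b) \<bullet> (e - (b \<bullet> e) *\<^sub>R b)" using inner_gt_zero_iff by blast
 also have "... = 1 - (b \<bullet> e)\<^sup>2"
  using i by (simp add: inner_diff inner_commute[of e b] power2_eq_square)
 finally have "(b \<bullet> e)\<^sup>2 < 1" by simp
 thus ?thesis by (simp add: abs_square_less_1)
qed

section \<open>The symbol kernel in one variable\<close>

lemma nn_integral_even:
 fixes g :: "real => ennreal"
 assumes [measurable]: "g \<in> borel_measurable borel"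
 shows "(LNINT s. g \<bar>s\<bar>) <= 2 * (LNINT s. g s * indicator {0..} s)"
proof -
 let ?h = "%s. g s * indicator {0..} s"
 have "(LNINT s. g \<bar>s\<bar>) <= (LNINT s. ?h s + ?h (- s))"
  by (intro nn_integral_mono) (auto simp: abs_if split: split_indicator)
 also have "... = (LNINT s. ?h s) + (LNINT s. ?h (- s))"
  by (rule nn_integral_add) measurable
 also have "(LNINT s. ?h (- s)) = (LNINT s. ?h s)"
  using nn_integral_real_affine[of ?h "-1" 0] by simp
 finally show ?thesis by (simp add: mult_2)
qed

lemma nn_integral_cubic_bound:
 assumes \<delta>: "0 < \<delta>" "\<delta> <= 2"
 shows "(LNINT s. ennreal ((1 + \<bar>s\<bar>) / (\<bar>s\<bar> + \<delta>) ^ 3)) <= ennreal (5 / \<delta>\<^sup>2)"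
proof -
 let ?f = "%s. (1 + s) / (s + \<delta>) ^ 3"
 let ?F = "%s. - (1 / 2) * (1 / (s + \<delta>) * (1 / (s + \<delta>))) - 1 / (s + \<delta>)"
 let ?f' = "%s. 1 / (s + \<delta>) ^ 3 + 1 / (s + \<delta>)\<^sup>2"
 have "(LNINT s. ennreal (?f \<bar>s\<bar>)) <= 2 * (LNINT s. ennreal (?f s) * indicator {0..} s)"
  by (rule nn_integral_even) measurable
 also have "2 * (LNINT s. ennreal (?f s) * indicator {0..} s) <= 2 * (LNINT s. ennreal (?f' s) * indicator {0..} s)"
 proof (rule mult_left_mono, rule nn_integral_mono)
  fix s :: real
  show "ennreal (?f s) * indicator {0..} s <= ennreal (?f' s) * indicator {0..} s"
  proof (cases "0 <= s")
   case True
   have "?f s = 1 / (s + \<delta>) ^ 3 + s / (s + \<delta>) ^ 3" by (simp add: add_divide_distrib)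
   also have "s / (s + \<delta>) ^ 3 <= (s + \<delta>) / (s + \<delta>) ^ 3"
    using True \<delta> by (intro divide_right_mono) auto
   also have "(s + \<delta>) / (s + \<delta>) ^ 3 = 1 / (s + \<delta>)\<^sup>2"
    using True \<delta> by (simp add: power3_eq_cube power2_eq_square)
   finally show ?thesis using True by (simp add: ennreal_leI)
  qed simp
 qed simp
 also have "(LNINT s. ennreal (?f' s) * indicator {0..} s) = ennreal (0 - ?F 0)"
 proof (rule nn_integral_FTC_atLeast)
  fix s :: real assume s: "0 <= s"
  hence p: "0 < s + \<delta>" using \<delta> by simp
  show "(?F has_real_derivative ?f' s) (at s)"
  proof -
   have d: "((%s. 1 / (s + \<delta>)) has_real_derivative - (1 / (s + \<delta>) * (1 / (s + \<delta>)))) (at s)"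
    using p by (auto intro!: derivative_eq_intros)
   show ?thesis
    by (rule DERIV_cong[OF DERIV_diff[OF DERIV_cmult[OF DERIV_mult[OF d d]] d]])
      (simp add: power2_eq_square power3_eq_cube)
  qed
  show "0 <= ?f' s" using p by simp
 next
  have l: "filterlim (%s. s + \<delta>) at_top at_top"
   using filterlim_tendsto_add_at_top[OF tendsto_const filterlim_ident, of \<delta>] by (simp add: add.commute)
  have t1: "((%s. 1 / (s + \<delta>)) \<longlongrightarrow> 0) at_top"
   using tendsto_inverse_0_at_top[OF l] by (simp add: inverse_eq_divide)
  have "(?F \<longlongrightarrow> - (1 / 2) * (0 * 0) - 0) at_top"
   by (rule tendsto_diff[OF tendsto_mult_left[OF tendsto_mult[OF t1 t1]] t1])
  thus "(?F \<longlongrightarrow> 0) at_top" by simp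
 qed measurable
 also have "2 * ennreal (0 - ?F 0) = ennreal (1 / \<delta>\<^sup>2 + 2 / \<delta>)"
  using \<delta> by (subst ennreal_numeral[symmetric], subst ennreal_mult[symmetric]) (auto simp: power2_eq_square field_simps)
 also have "... <= ennreal (5 / \<delta>\<^sup>2)"
  using \<delta> by (intro ennreal_leI) (simp add: field_simps power2_eq_square)
 finally show ?thesis .
qed

text \<open>
  The square of the right-hand side is \<open>(e\<^sup>s - 1)\<^sup>2 + e\<^sup>s \<bar>\<omega> - \<omega>'\<bar>\<^sup>2\<close>.
\<close>

lemma dilated_distance_ge:
 fixes \<omega> \<omega>' :: "real^3"
 assumes "norm \<omega> = 1" "norm \<omega>' = 1"
 shows "exp (s / 2) * (\<bar>s\<bar> + norm (\<omega> - \<omega>')) / 4 <= norm (exp s *\<^sub>R \<omega> - \<omega>')"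
proof -
 define \<delta> where "\<delta> = norm (\<omega> - \<omega>')"
 have i: "\<omega> \<bullet> \<omega> = 1" "\<omega>' \<bullet> \<omega>' = 1" using assms by (simp_all add: dot_square_norm)
 have d: "\<delta>\<^sup>2 = 2 - 2 * (\<omega> \<bullet> \<omega>')"
  unfolding \<delta>_def power2_norm_eq_inner using i by (simp add: inner_diff inner_commute[of \<omega>' \<omega>])
 define a where "a = exp (s / 2)"
 have a: "0 < a" "exp s = a\<^sup>2" unfolding a_def by (simp_all add: exp_double[of "s/2", symmetric])
 have "(norm (exp s *\<^sub>R \<omega> - \<omega>'))\<^sup>2 = (a\<^sup>2)\<^sup>2 - 2 * a\<^sup>2 * (\<omega> \<bullet> \<omega>') + 1"
  unfolding power2_norm_eq_inner a(2) using i by (simp add: inner_diff inner_commute[of \<omega>' \<omega>] power2_eq_square algebra_simps)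
 also have "... = (a\<^sup>2 - 1)\<^sup>2 + a\<^sup>2 * \<delta>\<^sup>2"
  unfolding d by (simp add: power2_eq_square algebra_simps)
 finally have e: "(norm (exp s *\<^sub>R \<omega> - \<omega>'))\<^sup>2 = (a\<^sup>2 - 1)\<^sup>2 + a\<^sup>2 * \<delta>\<^sup>2" .
 have "a * (\<bar>s\<bar> / 2) <= \<bar>a\<^sup>2 - 1\<bar>"
 proof (cases "0 <= s")
  case True
  have a1: "1 <= a" "s / 2 <= a - 1" using True exp_ge_add_one_self[of "s / 2"] unfolding a_def by linarith+
  have "a * (s / 2) <= a * (a - 1)" using a1 a by (intro mult_left_mono) auto
  also have "... <= a\<^sup>2 - 1" using a1 by (simp add: power2_eq_square algebra_simps)
  finally show ?thesis using True abs_ge_self[of "a\<^sup>2 - 1"] by simp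
 next
  case False
  define b where "b = exp (- s / 2)"
  have ab: "a * b = 1" unfolding a_def b_def by (simp add: exp_add[symmetric])
  have b1: "1 <= b" "- s / 2 <= b - 1" using False exp_ge_add_one_self[of "- s / 2"] unfolding b_def by linarith+
  have "a * (- s / 2) <= a * (b - 1)" using b1 a by (intro mult_left_mono) auto
  also have "... = 1 - a" using ab by (simp add: algebra_simps)
  also have "... <= 1 - a\<^sup>2"
  proof -
   have "a <= 1" using False by (simp add: a_def)
   hence "a * a <= a * 1" using a by (intro mult_left_mono) auto
   thus ?thesis by (simp add: power2_eq_square)
  qed
  finally show ?thesis using False by simp
 qed
 hence "(a * (\<bar>s\<bar> / 2))\<^sup>2 <= (a\<^sup>2 - 1)\<^sup>2"
  using a by (subst power2_abs[of "a\<^sup>2 - 1", symmetric]) (intro power_mono, auto)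
 moreover have "(a * (\<bar>s\<bar> + \<delta>) / 4)\<^sup>2 <= (a * (\<bar>s\<bar> / 2))\<^sup>2 + a\<^sup>2 * \<delta>\<^sup>2"
 proof -
  have "(\<bar>s\<bar> + \<delta>)\<^sup>2 <= 2 * \<bar>s\<bar>\<^sup>2 + 2 * \<delta>\<^sup>2"
   using sum_squares_bound[of "\<bar>s\<bar>" \<delta>] by (simp add: power2_sum)
  hence "(\<bar>s\<bar> + \<delta>)\<^sup>2 / 16 <= \<bar>s\<bar>\<^sup>2 / 4 + \<delta>\<^sup>2" using zero_le_power2[of "\<bar>s\<bar>"] zero_le_power2[of \<delta>] by linarith
  hence "a\<^sup>2 * ((\<bar>s\<bar> + \<delta>)\<^sup>2 / 16) <= a\<^sup>2 * (\<bar>s\<bar>\<^sup>2 / 4 + \<delta>\<^sup>2)" by (rule mult_left_mono) simp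
  also have "a\<^sup>2 * (\<bar>s\<bar>\<^sup>2 / 4 + \<delta>\<^sup>2) = (a * (\<bar>s\<bar> / 2))\<^sup>2 + a\<^sup>2 * \<delta>\<^sup>2"
   by (simp add: power_mult_distrib power_divide distrib_left)
  also have "a\<^sup>2 * ((\<bar>s\<bar> + \<delta>)\<^sup>2 / 16) = (a * (\<bar>s\<bar> + \<delta>) / 4)\<^sup>2"
   unfolding power_divide power_mult_distrib by simp
  finally show ?thesis .
 qed
 ultimately have "(a * (\<bar>s\<bar> + \<delta>) / 4)\<^sup>2 <= (norm (exp s *\<^sub>R \<omega> - \<omega>'))\<^sup>2" unfolding e by linarith
 thus ?thesis unfolding a_def \<delta>_def by (rule power2_le_imp_le) simp
qed

text \<open>
  After the substitution \<open>t = e\<^sup>s\<close> the integrand \<open>e\<^sup>3\<^sup>s\<^sup>/\<^sup>2 / \<bar>e\<^sup>s \<omega> - \<omega>'\<bar>\<^sup>3\<close> of the Mellin kernel is the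
  even function \<open>(4 sinh\<^sup>2(s/2) + \<delta>\<^sup>2)\<^sup>-\<^sup>3\<^sup>/\<^sup>2\<close> of \<open>s\<close>, where \<open>\<delta> = \<bar>\<omega> - \<omega>'\<bar>\<close>; this yields
  the decay of order \<open>\<delta>\<^sup>-\<^sup>2\<close>.
\<close>

lemma mellin_integrand_bound:
 fixes \<omega> \<omega>' :: "real^3"
 assumes u: "norm \<omega> = 1" "norm \<omega>' = 1" and ne: "\<omega> \<noteq> \<omega>'"
 shows "(LNINT s. ennreal ((1 + \<bar>s\<bar>) * (exp (3 / 2 * s) / norm (exp s *\<^sub>R \<omega> - \<omega>') ^ 3)))
  <= ennreal (320 / (norm (\<omega> - \<omega>'))\<^sup>2)"
proof -
 define \<delta> where "\<delta> = norm (\<omega> - \<omega>')"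
 have \<delta>: "0 < \<delta>" "\<delta> <= 2" using ne norm_triangle_ineq4[of \<omega> \<omega>'] u by (auto simp: \<delta>_def)
 have "(LNINT s. ennreal ((1 + \<bar>s\<bar>) * (exp (3 / 2 * s) / norm (exp s *\<^sub>R \<omega> - \<omega>') ^ 3)))
   <= (LNINT s. ennreal 64 * ennreal ((1 + \<bar>s\<bar>) / (\<bar>s\<bar> + \<delta>) ^ 3))"
 proof (rule nn_integral_mono)
  fix s
  have sp: "0 < \<bar>s\<bar> + \<delta>" using \<delta> by (simp add: add_nonneg_pos)
  have "(exp (s / 2) * (\<bar>s\<bar> + \<delta>) / 4) ^ 3 <= norm (exp s *\<^sub>R \<omega> - \<omega>') ^ 3"
   using sp by (intro power_mono dilated_distance_ge[OF u, folded \<delta>_def]) simp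
  moreover have "(exp (s / 2) * (\<bar>s\<bar> + \<delta>) / 4) ^ 3 = exp (3 / 2 * s) * (\<bar>s\<bar> + \<delta>) ^ 3 / 64"
   by (simp add: power_mult_distrib power_divide exp_of_nat_mult[symmetric])
  ultimately have "exp (3 / 2 * s) / norm (exp s *\<^sub>R \<omega> - \<omega>') ^ 3 <= exp (3 / 2 * s) / (exp (3 / 2 * s) * (\<bar>s\<bar> + \<delta>) ^ 3 / 64)"
   using sp by (intro frac_le) auto
  also have "... = 64 / (\<bar>s\<bar> + \<delta>) ^ 3" by simp
  finally have "(1 + \<bar>s\<bar>) * (exp (3 / 2 * s) / norm (exp s *\<^sub>R \<omega> - \<omega>') ^ 3) <= (1 + \<bar>s\<bar>) * (64 / (\<bar>s\<bar> + \<delta>) ^ 3)"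
   by (rule mult_left_mono) simp
  also have "... = 64 * ((1 + \<bar>s\<bar>) / (\<bar>s\<bar> + \<delta>) ^ 3)" by simp
  finally have le: "(1 + \<bar>s\<bar>) * (exp (3 / 2 * s) / norm (exp s *\<^sub>R \<omega> - \<omega>') ^ 3) <= 64 * ((1 + \<bar>s\<bar>) / (\<bar>s\<bar> + \<delta>) ^ 3)" .
  have "0 <= (1 + \<bar>s\<bar>) / (\<bar>s\<bar> + \<delta>) ^ 3" using sp by simp
  hence "ennreal 64 * ennreal ((1 + \<bar>s\<bar>) / (\<bar>s\<bar> + \<delta>) ^ 3) = ennreal (64 * ((1 + \<bar>s\<bar>) / (\<bar>s\<bar> + \<delta>) ^ 3))"
   by (intro ennreal_mult[symmetric]) auto
  thus "ennreal ((1 + \<bar>s\<bar>) * (exp (3 / 2 * s) / norm (exp s *\<^sub>R \<omega> - \<omega>') ^ 3))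
    <= ennreal 64 * ennreal ((1 + \<bar>s\<bar>) / (\<bar>s\<bar> + \<delta>) ^ 3)"
   using ennreal_leI[OF le] by simp
 qed
 also have "... = ennreal 64 * (LNINT s. ennreal ((1 + \<bar>s\<bar>) / (\<bar>s\<bar> + \<delta>) ^ 3))"
  by (rule nn_integral_cmult) measurable
 also have "... <= ennreal 64 * ennreal (5 / \<delta>\<^sup>2)"
  by (rule mult_left_mono[OF nn_integral_cubic_bound[OF \<delta>]]) simp
 also have "... = ennreal (320 / \<delta>\<^sup>2)" by (subst ennreal_mult[symmetric]) auto
 finally show ?thesis by (simp add: \<delta>_def)
qed

section \<open>The normals of the faces\<close>

text \<open>
  Near a point with an outward normal the boundary is a piece of the tangent plane, and the normal is
  the same at all its points.
\<close>

lemma frontier_tangent: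
 assumes C: "open C" and m: "is_outward_normal C y m"
 shows "\<exists>e>0. \<forall>x\<in>frontier C. dist y x < e --> (x - y) \<bullet> m = 0 \<and> is_outward_normal C x m"
proof -
 obtain e where e: "0 < e" "C \<inter> ball y e = {x \<in> ball y e. (x - y) \<bullet> m < 0}" and m1: "norm m = 1"
  using m by (auto simp: is_outward_normal_def)
 have "(x - y) \<bullet> m = 0 \<and> is_outward_normal C x m" if x: "x \<in> frontier C" "dist y x < e" for x
 proof -
  have "x \<notin> C" using x C frontier_disjoint_eq[of C] by blast
  moreover have "x \<in> ball y e" using x(2) by simp
  ultimately have "\<not> (x - y) \<bullet> m < 0" using e(2) by blast
  moreover have "\<not> (x - y) \<bullet> m > 0"
  proof
   assume p: "(x - y) \<bullet> m > 0"
   define U where "U = ball y e \<inter> {z. (z - y) \<bullet> m > 0}"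
   have "open U" unfolding U_def by (intro open_Int open_ball open_Collect_less continuous_intros)
   moreover have "z \<notin> C" if z: "z \<in> U" for z
   proof
    assume "z \<in> C"
    hence "z \<in> {x \<in> ball y e. (x - y) \<bullet> m < 0}" using z unfolding e(2)[symmetric] U_def by blast
    thus False using z by (simp add: U_def)
   qed
   hence "U \<inter> C = {}" by blast
   with \<open>open U\<close> have "U \<inter> closure C = {}" by (simp only: open_Int_closure_eq_empty[OF \<open>open U\<close>])
   moreover have "x \<in> U" using p x(2) by (simp add: U_def)
   ultimately show False using x(1) by (auto simp: frontier_def)
  qed
  ultimately have 0: "(x - y) \<bullet> m = 0" by linarith
  have "z \<in> C \<longleftrightarrow> (z - x) \<bullet> m < 0" if z: "z \<in> ball x (e - dist y x)" for z
  proof -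
   have b: "z \<in> ball y e" using z dist_triangle[of y z x] by simp
   hence "z \<in> C \<longleftrightarrow> z \<in> C \<inter> ball y e" by blast
   also have "... \<longleftrightarrow> (z - y) \<bullet> m < 0" unfolding e(2) using b by blast
   also have "(z - y) \<bullet> m = (z - x) \<bullet> m" using 0 by (simp add: inner_diff_left)
   finally show ?thesis .
  qed
  hence "C \<inter> ball x (e - dist y x) = {z \<in> ball x (e - dist y x). (z - x) \<bullet> m < 0}" by blast
  moreover have "0 < e - dist y x" using x(2) by simp
  ultimately show ?thesis using 0 m1 unfolding is_outward_normal_def by blast
 qed
 thus ?thesis using e(1) by blast
qed

lemma finite_uniform_bound:
 fixes f :: "'a => 'b => real"
 assumes "finite F" "\<And>x. x \<in> F ==> \<exists>B. \<forall>y. Q x y --> f x y <= B"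
 shows "\<exists>B>0. \<forall>x\<in>F. \<forall>y. Q x y --> f x y <= B"
 using assms
proof (induction F rule: finite_induct)
 case empty
 show ?case by (intro exI[of _ 1]) simp
next
 case (insert x F)
 obtain B where B: "0 < B" "\<forall>x\<in>F. \<forall>y. Q x y --> f x y <= B" using insert by auto
 obtain B' where B': "\<forall>y. Q x y --> f x y <= B'" using insert.prems[of x] by auto
 show ?case
  using B B' by (intro exI[of _ "max B B'"]) (auto simp: le_max_iff_disj)
qed

context polygon
begin

lemma ap_inner: "j < n ==> ap j s \<bullet> ap j t = cos (s - t)"
 using corner_inner[of j] polygon_facts(3)[of j]
 by (simp add: arc_point_def inner_add inner_commute[of "tangent P j" "corner P j"] cos_diff)

lemma ap_diff_le:
 assumes "j < n" shows "norm (ap j s - ap j t) <= \<bar>s - t\<bar>"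
proof -
 have "(norm (ap j s - ap j t))\<^sup>2 = 2 * (1 - cos (s - t))"
  unfolding power2_norm_eq_inner using assms
  by (simp add: inner_diff ap_inner cos_diff mult.commute)
 also have "... <= \<bar>s - t\<bar>\<^sup>2" using one_minus_cos_le[of "s - t"] by simp
 finally show ?thesis by (rule power2_le_imp_le) simp
qed

text \<open>
  At a corner the two adjacent arcs leave in linearly independent directions, because consecutive
  faces are not coplanar. Distances between the arcs are therefore comparable to arc lengths.
\<close>

lemma corner_separation:
 assumes i: "i < n" and j: "j = Suc i mod n"
 shows "\<exists>c>0. \<forall>x\<in>{0..1}. \<forall>y\<in>{0..1}. c * (x + y) <= norm (ap i (ang i - x) - ap j y)"
proof -
 \<comment> \<open>the direction in which arc i leaves its end point when traversed backwards\<close>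
 define b where "b = sin (ang i) *\<^sub>R corner P i - cos (ang i) *\<^sub>R tangent P i"
 have jn: "j < n" using j Suc_mod_less by simp
 have E: "corner P j = cos (ang i) *\<^sub>R corner P i + sin (ang i) *\<^sub>R tangent P i"
  using polygon_facts(6)[OF i] by (simp add: j arc_point_def)
 have nb: "norm b = 1"
  using norm_chart[OF i, of "sin (ang i)" "- cos (ang i)"] by (simp add: b_def)
 have ob: "corner P j \<bullet> b = 0"
  unfolding E b_def using corner_inner[OF i] polygon_facts(3)[OF i]
  by (simp add: inner_add inner_diff inner_commute[of "tangent P i" "corner P i"] mult.commute)
 have sb: "b \<in> span {corner P i, tangent P i}"
  unfolding b_def by (intro span_diff span_scale span_base) auto
 have bt: "\<bar>b \<bullet> tangent P j\<bar> < 1"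
  by (rule unit_not_in_span[OF nb polygon_facts(2)[OF jn] sb]) (use polygon_facts(7)[OF i] j in simp)
 have e: "ap i (ang i - x) = cos x *\<^sub>R corner P j + sin x *\<^sub>R b" for x
  unfolding E b_def arc_point_def by (simp add: cos_diff sin_diff algebra_simps)
 show ?thesis
  unfolding e unfolding arc_point_def
  by (rule arcs_separate[OF polygon_facts(1)[OF jn] nb polygon_facts(2)[OF jn] ob polygon_facts(3)[OF jn] bt])
qed

end

locale cone_over_polygon =
 fixes C :: "(real^3) set" and P :: spherical_polygon
 assumes cone: "polyhedral_cone C P"

sublocale cone_over_polygon \<subseteq> polygon P
 by unfold_locales (use cone in \<open>simp add: polyhedral_cone_def\<close>)

context cone_over_polygon
begin

lemma conic: "x \<in> C ==> 0 < r ==> r *\<^sub>R x \<in> C"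
 and open_C: "open C"
 and frontier_C: "frontier C = cone_surface P"
 and face_normal_exists: "j < n ==> y \<in> face P j ==> \<exists>m. is_outward_normal C y m"
 using cone unfolding polyhedral_cone_def by blast+

lemma scaled_ap_in_face: "0 < r ==> 0 < t ==> t < ang j ==> r *\<^sub>R ap j t \<in> face P j"
 unfolding face_def by blast

lemma scaled_ap_in_frontier: "j < n ==> 0 < r ==> 0 < t ==> t < ang j ==> r *\<^sub>R ap j t \<in> frontier C"
 unfolding frontier_C using scaled_ap_in_face face_subset_surface by blast

lemma ap_normal:
 assumes "j < n" "0 < t" "t < ang j"
 shows "is_outward_normal C (ap j t) (outward_normal C (ap j t))"
proof -
 obtain m where m: "is_outward_normal C (ap j t) m"
  using face_normal_exists[OF assms(1) scaled_ap_in_face[of 1 t j]] assms by auto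
 thus ?thesis using outward_normal_eq[OF m] by simp
qed

definition normal :: "nat => real^3" where "normal j = outward_normal C (ap j (ang j / 2))"

lemma normal_on_arc:
 assumes j: "j < n" and t: "0 < t" "t < ang j"
 shows "outward_normal C (ap j t) = normal j"
 unfolding normal_def
proof (rule connected_local_const[of "{0<..<ang j}" _ _ "%t. outward_normal C (ap j t)"])
 show "\<forall>a\<in>{0<..<ang j}. eventually (%b. outward_normal C (ap j a) = outward_normal C (ap j b)) (at a within {0<..<ang j})"
 proof
  fix a assume a: "a \<in> {0<..<ang j}"
  obtain e where e: "0 < e"
   "\<And>x. x \<in> frontier C ==> dist (ap j a) x < e ==> is_outward_normal C x (outward_normal C (ap j a))"
   using frontier_tangent[OF open_C ap_normal[OF j, of a]] a by auto
  have "outward_normal C (ap j a) = outward_normal C (ap j b)" if b: "b \<in> {0<..<ang j}" "dist b a < e" for b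
  proof -
   have "dist (ap j a) (ap j b) <= dist b a" using ap_diff_le[OF j, of a b] by (simp add: dist_norm dist_real_def abs_minus_commute)
   hence "is_outward_normal C (ap j b) (outward_normal C (ap j a))"
    using scaled_ap_in_frontier[OF j, of 1 b] b by (intro e(2)) auto
   thus ?thesis using outward_normal_eq by simp
  qed
  thus "eventually (%b. outward_normal C (ap j a) = outward_normal C (ap j b)) (at a within {0<..<ang j})"
   unfolding eventually_at using e(1) by blast
 qed
qed (use t polygon_facts(4)[OF j] in auto)

text \<open>
  Both the radial and the angular displacement of a point inside a face stay in the face, so the normal
  is orthogonal to two independent vectors of its plane.
\<close>

lemma normal_orthogonal:
 assumes j: "j < n" shows "ap j t \<bullet> normal j = 0"
proof -
 define s where "s = ang j / 2"
 define m where "m = normal j"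
 have s: "0 < s" "s < ang j" using polygon_facts(4)[OF j] by (auto simp: s_def)
 obtain e where e: "0 < e" "\<And>x. x \<in> frontier C ==> dist (ap j s) x < e ==> (x - ap j s) \<bullet> m = 0"
  using frontier_tangent[OF open_C ap_normal[OF j s]] unfolding m_def normal_def s_def[symmetric] by auto
 define h where "h = min (min 1 (ang j - s)) e / 2"
 have h: "0 < h" "h < 1" "s + h < ang j" "h < e"
 proof -
  have h': "h <= 1 / 2" "h <= (ang j - s) / 2" "h <= e / 2" by (auto simp: h_def)
  show "h < 1" using h'(1) by simp
  show "s + h < ang j" using h'(2) s(2) by argo
  show "h < e" using h'(3) e(1) by argo
  show "0 < h" using s e by (simp add: h_def)
 qed
 have "((1 + h) *\<^sub>R ap j s - ap j s) \<bullet> m = 0"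
  by (rule e(2)[OF scaled_ap_in_frontier[OF j]]) (use s h norm_ap[OF j] in \<open>auto simp: dist_norm algebra_simps\<close>)
 hence 1: "ap j s \<bullet> m = 0" using h by (simp add: scaleR_add_left)
 have "dist (ap j s) (ap j (s + h)) < e" using ap_diff_le[OF j, of s "s + h"] h by (simp add: dist_norm)
 hence "(ap j (s + h) - ap j s) \<bullet> m = 0"
  using e(2)[of "ap j (s + h)"] scaled_ap_in_frontier[OF j, of 1 "s + h"] s h by simp
 hence 2: "ap j (s + h) \<bullet> m = 0" using 1 by (simp add: inner_diff_left)
 define A where "A = corner P j \<bullet> m"
 define B where "B = tangent P j \<bullet> m"
 have ab: "ap j t \<bullet> m = cos t * A + sin t * B" for t by (simp add: arc_point_def A_def B_def inner_add_left)
 have sh: "sin h > 0" using h pi_gt3 by (intro sin_gt_zero) auto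
 have sd: "sin h = sin (s + h) * cos s - cos (s + h) * sin s" using sin_diff[of "s + h" s] by simp
 have "sin h * A = sin (s + h) * (cos s * A + sin s * B) - sin s * (cos (s + h) * A + sin (s + h) * B)"
  unfolding sd by (simp add: algebra_simps)
 hence "A = 0" using 1 2 sh unfolding ab by simp
 moreover have "sin h * B = cos s * (cos (s + h) * A + sin (s + h) * B) - cos (s + h) * (cos s * A + sin s * B)"
  unfolding sd by (simp add: algebra_simps)
 hence "B = 0" using 1 2 sh unfolding ab by simp
 ultimately show ?thesis using ab[of t] by (simp add: m_def)
qed

lemma norm_normal: "j < n ==> norm (normal j) = 1"
 using ap_normal[of j "ang j / 2"] polygon_facts(4)[of j] by (simp add: normal_def is_outward_normal_def)

lemma outward_normal_measurable: "outward_normal C \<in> \<nu> \<rightarrow>\<^sub>M borel"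
proof -
 define N where "N \<omega> = (\<Sum>j<n. indicator (arc j) \<omega> *\<^sub>R normal j)" for \<omega>
 have "N \<in> borel_measurable (restrict_space borel \<gamma>)"
  unfolding N_def[abs_def] by (rule measurable_restrict_space1) measurable
 hence N: "N \<in> \<nu> \<rightarrow>\<^sub>M borel" unfolding measurable_cong_sets[OF sets_nu refl] .
 have C: "corner P i \<in> space \<nu>" "{corner P i} \<in> sets \<nu>" if "i < n" for i
 proof -
  show c: "corner P i \<in> space \<nu>" using corner_in_curve[OF that] by (simp add: space_nu)
  hence "{corner P i} = \<gamma> \<inter> {corner P i}" by (auto simp: space_nu)
  thus "{corner P i} \<in> sets \<nu>" unfolding sets_nu sets_restrict_space by (rule image_eqI) simp
 qed
 show ?thesis
 proof (rule measurable_discrete_difference[OF N, of "corner P ` {..<n}"])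
  fix \<omega> assume "\<omega> \<in> space \<nu>" "\<omega> \<notin> corner P ` {..<n}"
  hence "\<omega> \<in> arcs" by (simp add: arcs_eq space_nu)
  then obtain j where j: "j < n" "\<omega> \<in> arc j" by (auto simp: arcs_def)
  have "N \<omega> = (\<Sum>i<n. if i = j then normal j else 0)"
   unfolding N_def
  proof (rule sum.cong[OF refl])
   fix i assume "i \<in> {..<n}"
   hence "\<omega> \<in> arc i \<longleftrightarrow> i = j" using arc_disjoint[of i j \<omega>] j by blast
   thus "indicator (arc i) \<omega> *\<^sub>R normal i = (if i = j then normal j else 0)" by (simp add: indicator_def)
  qed
  also have "... = normal j" using j(1) by simp
  also have "... = outward_normal C \<omega>"
  proof -
   obtain t where "\<omega> = ap j t" "t \<in> {0<..<ang j}" using j(2) unfolding arc_def by (rule imageE)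
   thus ?thesis using normal_on_arc[OF j(1), of t] by simp
  qed
  finally show "N \<omega> = outward_normal C \<omega>" .
 next
  show "countable (corner P ` {..<n})" by (rule countable_finite) simp
  show "{x} \<in> sets \<nu>" if "x \<in> corner P ` {..<n}" for x
   using that C(2) by (elim imageE) simp
  show "outward_normal C x \<in> space borel" for x by simp
 qed
qed

end

section \<open>The corner weight and the size of the kernel\<close>

locale weighted_cone = cone_over_polygon +
 fixes q :: "real^3 => real" and \<alpha> :: real
 assumes weight: "corner_weight P q" and alpha: "0 <= \<alpha>" "\<alpha> < 1"
begin

lemma q_near_corner:
 assumes "j < n"
 obtains \<delta> where "0 < \<delta>" "\<And>t. 0 <= t ==> t <= ang j ==> t < \<delta> ==> q (ap j t) = t"
  "\<And>t. 0 <= t ==> t <= ang j ==> ang j - t < \<delta> ==> q (ap j t) = ang j - t"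
proof -
 obtain \<delta> where "0 < \<delta>" and "\<forall>t\<in>{0..ang j}. (t < \<delta> --> q (ap j t) = t) \<and> (ang j - t < \<delta> --> q (ap j t) = ang j - t)"
  using weight assms unfolding corner_weight_def by blast
 thus thesis by (intro that[of \<delta>]) auto
qed

lemma q_continuous: "continuous_on \<gamma> q"
 using weight lipschitz_on_continuous_on unfolding corner_weight_def by blast

lemma q_measurable [measurable]: "q \<in> borel_measurable \<nu>"
 unfolding measurable_cong_sets[OF sets_nu refl]
 by (rule borel_measurable_continuous_on_restrict[OF q_continuous])

lemma q_ap_continuous: "j < n ==> continuous_on {0..ang j} (%t. q (ap j t))"
 by (rule continuous_on_compose2[OF q_continuous ap_continuous]) (auto intro: ap_in_curve_closed)

text \<open>
  The weight does not vanish on the open arc and equals the arc length near its ends.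
\<close>

lemma q_pos:
 assumes "\<omega> \<in> arcs" shows "0 < q \<omega>"
proof (rule ccontr)
 assume neg: "\<not> 0 < q \<omega>"
 obtain j t where j: "j < n" "0 < t" "t < ang j" "\<omega> = ap j t" using assms by (auto simp: arcs_def arc_def)
 obtain \<delta> where \<delta>: "0 < \<delta>" "\<And>t. 0 <= t ==> t <= ang j ==> t < \<delta> ==> q (ap j t) = t"
  using q_near_corner[OF j(1)] by metis
 define r where "r = min t \<delta> / 2"
 have r: "0 < r" "r < \<delta>" "r < t" using \<delta> j by (auto simp: r_def)
 have qr: "q (ap j r) = r" using \<delta>(2)[of r] r j by simp
 have "\<exists>x\<ge>r. x <= t \<and> q (ap j x) = 0"
  by (rule IVT2'[of "%x. q (ap j x)" t 0 r])
    (use neg j r qr in \<open>auto intro: continuous_on_subset[OF q_ap_continuous[OF j(1)]]\<close>)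
 then obtain x where x: "r <= x" "x <= t" "q (ap j x) = 0" by blast
 have "ap j x \<in> arcs" using x r j by (intro ap_in_arcs) auto
 hence "ap j x \<in> \<gamma>" "ap j x \<notin> corner P ` {..<n}" by (auto simp: arcs_eq)
 thus False using weight x(3) by (auto simp: corner_weight_def)
qed

lemma q_bounded: "\<exists>Q>0. \<forall>\<omega>\<in>\<gamma>. q \<omega> <= Q"
proof -
 obtain L where L: "L-lipschitz_on \<gamma> q" using weight by (auto simp: corner_weight_def)
 have L0: "0 <= L" using lipschitz_on_nonneg[OF L] .
 have c: "corner P 0 \<in> \<gamma>" using corner_in_curve n_ge_3 by auto
 have "q \<omega> <= \<bar>q (corner P 0)\<bar> + L * 2 + 1" if w: "\<omega> \<in> \<gamma>" for \<omega>
 proof -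
  have "dist \<omega> (corner P 0) <= 2"
   using w c norm_triangle_ineq4[of \<omega> "corner P 0"] by (auto simp: polygon_curve_def dist_norm)
  hence "L * dist \<omega> (corner P 0) <= L * 2" using L0 by (rule mult_left_mono)
  moreover have "\<bar>q \<omega> - q (corner P 0)\<bar> <= L * dist \<omega> (corner P 0)"
   using lipschitz_onD[OF L w c] by (simp add: dist_real_def)
  ultimately show ?thesis by linarith
 qed
 moreover have "0 < \<bar>q (corner P 0)\<bar> + L * 2 + 1" using L0 by simp
 ultimately show ?thesis by blast
qed

text \<open>
  The weight is comparable to the distance to the nearest corner of the arc; this turns integrals over the
  curve into integrals over an interval.
\<close>

lemma q_lower: "\<exists>\<kappa>>0. \<forall>j<n. \<forall>t. 0 < t \<and> t < ang j --> \<kappa> * min t (ang j - t) <= q (ap j t)"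
proof -
 have "\<exists>B>0. \<forall>j\<in>{..<n}. \<forall>t. (0 < t \<and> t < ang j) --> min t (ang j - t) / q (ap j t) <= B"
 proof (rule finite_uniform_bound)
  fix j assume "j \<in> {..<n}"
  hence j: "j < n" by simp
  obtain \<delta> where \<delta>: "0 < \<delta>" "\<And>t. 0 <= t ==> t <= ang j ==> t < \<delta> ==> q (ap j t) = t"
   "\<And>t. 0 <= t ==> t <= ang j ==> ang j - t < \<delta> ==> q (ap j t) = ang j - t"
   using q_near_corner[OF j] by metis
  have "\<exists>B>0. \<forall>t\<in>{0..ang j} \<inter> {0<..<ang j}. min t (ang j - t) / q (ap j t) <= B"
  proof (rule compact_locally_bounded)
   fix z assume z: "z \<in> {0..ang j}"
   consider "z = 0" | "z = ang j" | "0 < z" "z < ang j" using z by fastforce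
   thus "\<exists>e>0. \<exists>B. \<forall>w\<in>{0<..<ang j}. dist z w < e --> min w (ang j - w) / q (ap j w) <= B"
   proof cases
    case 1
    have "min w (ang j - w) / q (ap j w) <= 1" if "w \<in> {0<..<ang j}" "dist z w < \<delta>" for w
     using \<delta>(2)[of w] that 1 by (auto simp: dist_real_def divide_le_eq)
    thus ?thesis using \<delta>(1) by blast
   next
    case 2
    have "min w (ang j - w) / q (ap j w) <= 1" if "w \<in> {0<..<ang j}" "dist z w < \<delta>" for w
     using \<delta>(3)[of w] that 2 by (auto simp: dist_real_def divide_le_eq)
    thus ?thesis using \<delta>(1) by blast
   next
    case 3
    have q0: "0 < q (ap j z)" using q_pos[OF ap_in_arcs[OF j 3]] .
    obtain e where e: "0 < e" "\<And>w. w \<in> {0..ang j} ==> dist w z < e ==> dist (q (ap j w)) (q (ap j z)) < q (ap j z) / 2"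
     using q_ap_continuous[OF j, unfolded continuous_on_iff, rule_format, OF z, of "q (ap j z) / 2"] q0 by auto
    have "min w (ang j - w) / q (ap j w) <= ang j / (q (ap j z) / 2)" if w: "w \<in> {0<..<ang j}" "dist z w < e" for w
    proof (rule frac_le)
     show "q (ap j z) / 2 <= q (ap j w)"
      using e(2)[of w] w abs_diff_less_iff[of "q (ap j w)" "q (ap j z)" "q (ap j z) / 2"]
      by (simp add: dist_commute dist_real_def)
    qed (use w q0 in auto)
    thus ?thesis using e(1) by blast
   qed
  qed simp
  then obtain B where "\<forall>t\<in>{0..ang j} \<inter> {0<..<ang j}. min t (ang j - t) / q (ap j t) <= B" by blast
  hence "min t (ang j - t) / q (ap j t) <= B" if "0 < t \<and> t < ang j" for t using that by simp
  thus "\<exists>B. \<forall>t. 0 < t \<and> t < ang j --> min t (ang j - t) / q (ap j t) <= B" by blast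
 qed simp
 then obtain B where B: "0 < B" "\<And>j t. j < n ==> 0 < t ==> t < ang j ==> min t (ang j - t) / q (ap j t) <= B" by blast
 have "1 / B * min t (ang j - t) <= q (ap j t)" if "j < n" "0 < t" "t < ang j" for j t
  using B(2)[OF that] B(1) q_pos[OF ap_in_arcs[OF that]] by (simp add: field_simps)
 thus ?thesis using B(1) by (intro exI[of _ "1 / B"]) auto
qed

text \<open>
  Away from the corners the distance between points of different faces is bounded below. Next to a
  common corner, at arc-length distances \<open>x\<close> and \<open>y\<close> from it, \<open>\<omega> \<bullet> n\<close> is at most \<open>x\<close> because the
  corner lies in the plane orthogonal to \<open>n\<close>, while the distance is comparable to \<open>x + y\<close>.
\<close>

lemma corner_ratio:
 fixes x y N D c :: real
 assumes c: "0 < c" and x: "0 < x" and y: "0 < y" and N: "N <= x" and D: "c * (x + y) <= D"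
 shows "N / (D\<^sup>2 * (1 + x / (x + y)\<^sup>2)) <= 1 / c\<^sup>2"
proof -
 \<comment> \<open>The factor 1 + x / (x + y)^2 restores the power of x + y that N = x does not supply.\<close>
 have "c\<^sup>2 * x <= D\<^sup>2 * (1 + x / (x + y)\<^sup>2)"
 proof -
  have "c\<^sup>2 * x = (c * (x + y))\<^sup>2 * (x / (x + y)\<^sup>2)"
  proof -
   define u where "u = x + y"
   have "u \<noteq> 0" using x y by (simp add: u_def)
   thus ?thesis unfolding u_def[symmetric] by (simp add: power_mult_distrib)
  qed
  also have "... <= D\<^sup>2 * (1 + x / (x + y)\<^sup>2)"
   using c x y D by (intro mult_mono power_mono) auto
  finally show ?thesis .
 qed
 hence "N / (D\<^sup>2 * (1 + x / (x + y)\<^sup>2)) <= x / (c\<^sup>2 * x)"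
  using N c x by (intro frac_le) auto
 thus ?thesis using x by simp
qed

lemma ap_inner_normal_le:
 assumes "i < n" "j < n" "ap i z \<bullet> normal j = 0" shows "\<bar>ap i s \<bullet> normal j\<bar> <= \<bar>s - z\<bar>"
proof -
 have "\<bar>ap i s \<bullet> normal j\<bar> = \<bar>(ap i s - ap i z) \<bullet> normal j\<bar>" using assms by (simp add: inner_diff_left)
 also have "... <= norm (ap i s - ap i z) * norm (normal j)" by (rule Cauchy_Schwarz_ineq2)
 also have "... <= \<bar>s - z\<bar>" using ap_diff_le[OF assms(1)] norm_normal[OF assms(2)] by simp
 finally show ?thesis .
qed

definition ratio :: "nat => nat => real \<times> real => real" where
 "ratio i j w = \<bar>ap i (fst w) \<bullet> normal j\<bar> / ((norm (ap i (fst w) - ap j (snd w)))\<^sup>2 *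
   (1 + q (ap i (fst w)) / (q (ap i (fst w)) + q (ap j (snd w)))\<^sup>2))"

lemma ratio_bounded:
 assumes i: "i < n" and j: "j < n" and ij: "i \<noteq> j"
 shows "\<exists>B. \<forall>w. (w \<in> {0<..<ang i} \<times> {0<..<ang j}) --> ratio i j w <= B"
proof -
 let ?T = "{0<..<ang i} \<times> {0<..<ang j}"
 have "\<exists>B>0. \<forall>w\<in>({0..ang i} \<times> {0..ang j}) \<inter> ?T. ratio i j w <= B"
 proof (rule compact_locally_bounded)
  show "compact ({0..ang i} \<times> {0..ang j})" by (intro compact_Times) auto
  fix z assume z: "z \<in> {0..ang i} \<times> {0..ang j}"
  obtain z1 z2 where zz: "z = (z1, z2)" "0 <= z1" "z1 <= ang i" "0 <= z2" "z2 <= ang j" using z by (cases z) auto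
  have dz: "\<bar>z1 - fst w\<bar> <= dist z w" "\<bar>z2 - snd w\<bar> <= dist z w" for w
   using dist_fst_le[of z w] dist_snd_le[of z w] by (simp_all add: zz dist_real_def)
  obtain \<delta>i where \<delta>i: "0 < \<delta>i" "\<And>t. 0 <= t ==> t <= ang i ==> t < \<delta>i ==> q (ap i t) = t"
   "\<And>t. 0 <= t ==> t <= ang i ==> ang i - t < \<delta>i ==> q (ap i t) = ang i - t" using q_near_corner[OF i] by metis
  obtain \<delta>j where \<delta>j: "0 < \<delta>j" "\<And>t. 0 <= t ==> t <= ang j ==> t < \<delta>j ==> q (ap j t) = t"
   "\<And>t. 0 <= t ==> t <= ang j ==> ang j - t < \<delta>j ==> q (ap j t) = ang j - t" using q_near_corner[OF j] by metis
  define e where "e = min 1 (min \<delta>i \<delta>j)"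
  have e: "0 < e" "e <= 1" "e <= \<delta>i" "e <= \<delta>j" using \<delta>i \<delta>j by (auto simp: e_def)
  show "\<exists>e>0. \<exists>B. \<forall>w\<in>?T. dist z w < e --> ratio i j w <= B"
  proof (cases "ap i z1 = ap j z2")
   case False
   define d where "d = norm (ap i z1 - ap j z2)"
   have d: "0 < d" using False by (simp add: d_def)
   have "ratio i j w <= 1 / (d / 2)\<^sup>2" if w: "w \<in> ?T" "dist z w < d / 4" for w
   proof -
    obtain s t where st: "w = (s, t)" "0 < s" "s < ang i" "0 < t" "t < ang j" using w by (cases w) auto
    have "norm (ap i z1 - ap j z2) <= norm (ap i s - ap j t) + norm (ap i z1 - ap i s) + norm (ap j t - ap j z2)"
     using norm_triangle_ineq[of "ap i s - ap j t + (ap i z1 - ap i s)" "ap j t - ap j z2"]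
      norm_triangle_ineq[of "ap i s - ap j t" "ap i z1 - ap i s"] by (simp add: algebra_simps)
    hence D: "d / 2 <= norm (ap i s - ap j t)"
     using dz[of w] ap_diff_le[OF i, of z1 s] ap_diff_le[OF j, of t z2] w(2) unfolding d_def st fst_conv snd_conv
     by linarith
    have q: "0 < q (ap i s)" "0 < q (ap j t)" using q_pos ap_in_arcs i j st by auto
    have "(d / 2)\<^sup>2 * 1 <= (norm (ap i s - ap j t))\<^sup>2 * (1 + q (ap i s) / (q (ap i s) + q (ap j t))\<^sup>2)"
     using D d q by (intro mult_mono power_mono) auto
    moreover have "\<bar>ap i s \<bullet> normal j\<bar> <= 1"
     using Cauchy_Schwarz_ineq2[of "ap i s" "normal j"] norm_ap[OF i] norm_normal[OF j] by simp
    ultimately show ?thesis unfolding ratio_def st fst_conv snd_conv using d by (intro frac_le) auto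
   qed
   thus ?thesis using d by (intro exI[of _ "d / 4"]) auto
  next
   case True
   have "z1 = ang i \<or> z2 = ang j" using ap_inj[OF i j, of z1 z2] zz True ij by force
   have Si: "ap i (ang i) = ap (Suc i mod n) 0" "ap j (ang j) = ap (Suc j mod n) 0"
    using polygon_facts(6) i j by (simp_all add: ap_0)
   have an: "0 < ang k" if "k < n" for k using polygon_facts(4)[OF that] .
   consider (A) "j = Suc i mod n" "z1 = ang i" "z2 = 0" | (B) "i = Suc j mod n" "z1 = 0" "z2 = ang j"
   proof -
    consider "z1 = ang i" "z2 < ang j" | "z1 < ang i" "z2 = ang j" | "z1 = ang i" "z2 = ang j"
     using \<open>z1 = ang i \<or> z2 = ang j\<close> zz by linarith
    thus thesis
    proof cases
     case 1
     thus ?thesis using ap_inj[OF Suc_mod_less[of i] j, of 0 z2] True Si zz an[OF Suc_mod_less] by (intro A) auto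
    next
     case 2
     thus ?thesis using ap_inj[OF i Suc_mod_less[of j], of z1 0] True Si zz an[OF Suc_mod_less] by (intro B) auto
    next
     case 3
     hence "Suc i mod n = Suc j mod n"
      using ap_inj[OF Suc_mod_less[of i] Suc_mod_less[of j], of 0 0] True Si an[OF Suc_mod_less] by auto
     hence "i = j" using i j by (cases "Suc i = n"; cases "Suc j = n") auto
     thus ?thesis using ij by simp
    qed
   qed
   thus ?thesis
   proof cases
    case A
    obtain c where c: "0 < c" "\<And>x y. x \<in> {0..1} ==> y \<in> {0..1} ==> c * (x + y) <= norm (ap i (ang i - x) - ap j y)"
     using corner_separation[OF i A(1)] by blast
    have "ratio i j w <= 1 / c\<^sup>2" if w: "w \<in> ?T" "dist z w < e" for w
    proof -
     define x y where "x = ang i - fst w" and "y = snd w"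
     have xy: "0 < x" "x < e" "x <= ang i" "0 < y" "y < e" "y <= ang j" and s: "fst w = ang i - x"
      using w dz[of w] A(2,3) by (auto simp: x_def y_def)
     have "q (ap i (fst w)) = x" "q (ap j (snd w)) = y"
      using \<delta>i(3)[of "fst w"] \<delta>j(2)[of "snd w"] xy e s unfolding y_def[symmetric] by auto
     moreover have "ap i (ang i) \<bullet> normal j = 0" using normal_orthogonal[OF j, of 0] Si A(1) by simp
     hence "\<bar>ap i (fst w) \<bullet> normal j\<bar> <= x"
      using ap_inner_normal_le[OF i j, of "ang i" "fst w"] xy by (simp add: s)
     moreover have "c * (x + y) <= norm (ap i (fst w) - ap j (snd w))"
      using c(2)[of x y] xy e unfolding s y_def[symmetric] by auto
     ultimately show ?thesis unfolding ratio_def using corner_ratio[OF c(1) xy(1,4)] by simp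
    qed
    thus ?thesis using e(1) by blast
   next
    case B
    obtain c where c: "0 < c" "\<And>x y. x \<in> {0..1} ==> y \<in> {0..1} ==> c * (x + y) <= norm (ap j (ang j - x) - ap i y)"
     using corner_separation[OF j B(1)] by blast
    have "ratio i j w <= 1 / c\<^sup>2" if w: "w \<in> ?T" "dist z w < e" for w
    proof -
     define x y where "x = fst w" and "y = ang j - snd w"
     have xy: "0 < x" "x < e" "x <= ang i" "0 < y" "y < e" "y <= ang j" and s: "snd w = ang j - y"
      using w dz[of w] B(2,3) by (auto simp: x_def y_def)
     have "q (ap i (fst w)) = x" "q (ap j (snd w)) = y"
      using \<delta>i(2)[of "fst w"] \<delta>j(3)[of "snd w"] xy e s unfolding x_def[symmetric] by auto
     moreover have "ap i 0 \<bullet> normal j = 0" using normal_orthogonal[OF j, of "ang j"] Si B(1) by simp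
     hence "\<bar>ap i (fst w) \<bullet> normal j\<bar> <= x"
      using ap_inner_normal_le[OF i j, of 0 "fst w"] xy by (simp add: x_def)
     moreover have "c * (x + y) <= norm (ap i (fst w) - ap j (snd w))"
      using c(2)[of y x] xy e unfolding s x_def[symmetric] by (auto simp: norm_minus_commute add.commute)
     ultimately show ?thesis unfolding ratio_def using corner_ratio[OF c(1) xy(1,4)] by simp
    qed
    thus ?thesis using e(1) by blast
   qed
  qed
 qed
 then obtain B where B: "\<forall>w\<in>({0..ang i} \<times> {0..ang j}) \<inter> ?T. ratio i j w <= B" by blast
 have "?T \<subseteq> {0..ang i} \<times> {0..ang j}" by auto
 hence "ratio i j w <= B" if "w \<in> ?T" for w using that B by blast
 thus ?thesis by blast
qed

lemma normal_component_bound: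
 "\<exists>B>0. \<forall>\<omega>\<in>arcs. \<forall>\<omega>'\<in>arcs. \<bar>\<omega> \<bullet> outward_normal C \<omega>'\<bar> <= B * (norm (\<omega> - \<omega>'))\<^sup>2 * (1 + q \<omega> / (q \<omega> + q \<omega>')\<^sup>2)"
proof -
 let ?I = "{(i, j). i < n \<and> j < n \<and> i \<noteq> j}"
 have "\<exists>B>0. \<forall>ij\<in>?I. \<forall>w. w \<in> {0<..<ang (fst ij)} \<times> {0<..<ang (snd ij)} --> ratio (fst ij) (snd ij) w <= B"
 proof (rule finite_uniform_bound)
  show "finite ?I" by (rule finite_subset[of _ "{..<n} \<times> {..<n}"]) auto
  fix ij assume "ij \<in> ?I"
  thus "\<exists>B. \<forall>w. w \<in> {0<..<ang (fst ij)} \<times> {0<..<ang (snd ij)} --> ratio (fst ij) (snd ij) w <= B"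
   using ratio_bounded[of "fst ij" "snd ij"] by (simp add: split_beta')
 qed
 then obtain B where B0: "0 < B" and B': "\<forall>ij\<in>?I. \<forall>w. w \<in> {0<..<ang (fst ij)} \<times> {0<..<ang (snd ij)} --> ratio (fst ij) (snd ij) w <= B"
  by blast
 have B: "ratio i j w <= B" if "i < n" "j < n" "i \<noteq> j" "w \<in> {0<..<ang i} \<times> {0<..<ang j}" for i j w
  using B'[rule_format, of "(i, j)" w] that by simp
 have "\<bar>\<omega> \<bullet> outward_normal C \<omega>'\<bar> <= B * (norm (\<omega> - \<omega>'))\<^sup>2 * (1 + q \<omega> / (q \<omega> + q \<omega>')\<^sup>2)"
  if w: "\<omega> \<in> arcs" "\<omega>' \<in> arcs" for \<omega> \<omega>'
 proof -
  obtain i s where i: "i < n" "0 < s" "s < ang i" "\<omega> = ap i s" using w by (auto simp: arcs_def arc_def)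
  obtain j t where j: "j < n" "0 < t" "t < ang j" "\<omega>' = ap j t" using w by (auto simp: arcs_def arc_def)
  have q: "0 < q \<omega>" "0 < q \<omega>'" using q_pos w by auto
  have N: "outward_normal C \<omega>' = normal j" using normal_on_arc[OF j(1-3)] j by simp
  show ?thesis
  proof (cases "i = j")
   case True
   hence "\<omega> \<bullet> outward_normal C \<omega>' = 0" unfolding N using normal_orthogonal[OF j(1)] i by simp
   thus ?thesis using B0 q by simp
  next
   case False
   have "\<omega> \<noteq> \<omega>'" using ap_inj[OF i(1) j(1), of s t] i j False by auto
   hence "0 < (norm (\<omega> - \<omega>'))\<^sup>2 * (1 + q \<omega> / (q \<omega> + q \<omega>')\<^sup>2)" using q by (intro mult_pos_pos add_pos_nonneg) auto
   moreover have "ratio i j (s, t) <= B" using B[OF i(1) j(1) False, of "(s, t)"] i j by simp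
   ultimately show ?thesis unfolding N ratio_def fst_conv snd_conv i(4)[symmetric] j(4)[symmetric]
    by (simp add: divide_le_eq mult.assoc)
  qed
 qed
 thus ?thesis using B0 by blast
qed

end

section \<open>The Mellin kernel satisfies the Schur condition\<close>

lemma nn_integral_powr_0:
 assumes "b < 1" "0 < A"
 shows "(LNINT x. ennreal (x powr (- b)) * indicator {0<..<A} x) <= ennreal (A powr (1 - b) / (1 - b))"
proof -
 have "(LNINT x. ennreal (x powr (- b)) * indicator {0<..<A} x)
   <= (LNINT x. ennreal (x powr (- b)) * indicator {0..A} x)"
  by (rule nn_integral_mono) (auto split: split_indicator)
 also have "... = ennreal (A powr (- b + 1) / (- b + 1))"
  by (rule nn_integral_has_integral_lebesgue'[OF _ has_integral_powr_from_0]) (use assms in auto)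
 finally show ?thesis by (simp add: add.commute)
qed

lemma nn_integral_powr_inf:
 assumes e: "1 < e" and q0: "0 < q0"
 shows "(LNINT x. ennreal ((x + q0) powr (- e)) * indicator {0<..} x) <= ennreal (q0 powr (1 - e) / (e - 1))"
proof -
 let ?h = "%x. ennreal (x powr (- e)) * indicator {q0..} x"
 have "(LNINT x. ennreal ((x + q0) powr (- e)) * indicator {0<..} x) <= (LNINT x. ?h (q0 + 1 * x))"
  by (rule nn_integral_mono) (auto simp: add.commute split: split_indicator)
 also have "... = (LNINT x. ?h x)"
  using nn_integral_real_affine[of ?h 1 q0] by simp
 also have "... = ennreal (- (q0 powr (- e + 1)) / (- e + 1))"
  by (rule nn_integral_has_integral_lebesgue'[OF _ has_integral_powr_to_inf]) (use assms in auto)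
 also have "- (q0 powr (- e + 1)) / (- e + 1) = q0 powr (1 - e) / (e - 1)"
  using e by (simp add: field_simps)
 finally show ?thesis .
qed

text \<open>
  Below \<open>q0\<close> the denominator is replaced by \<open>q0\<^sup>2\<close>, above it the power by \<open>q0 powr (- b)\<close>.
\<close>

lemma nn_integral_powr_quadratic:
 assumes b: "0 <= b" "b < 1" and q0: "0 < q0"
 shows "(LNINT x. ennreal (q0 * (x powr (- b) / (q0 + x)\<^sup>2)) * indicator {0<..} x) <= ennreal ((1 / (1 - b) + 1) * q0 powr (- b))"
proof -
 let ?u = "%x. ennreal (x powr (- b)) * indicator {0<..<q0} x"
 let ?v = "%x. ennreal ((x + q0) powr (- 2)) * indicator {0<..} x"
 have "(LNINT x. ennreal (q0 * (x powr (- b) / (q0 + x)\<^sup>2)) * indicator {0<..} x)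
   <= (LNINT x. ennreal (1 / q0) * ?u x + ennreal (q0 * q0 powr (- b)) * ?v x)"
 proof (rule nn_integral_mono)
  fix x
  show "ennreal (q0 * (x powr (- b) / (q0 + x)\<^sup>2)) * indicator {0<..} x <= ennreal (1 / q0) * ?u x + ennreal (q0 * q0 powr (- b)) * ?v x"
  proof (cases "0 < x")
   case x: True
   have v: "(x + q0) powr (- 2) = 1 / (q0 + x)\<^sup>2"
    using x q0 by (simp add: powr_minus powr_numeral add.commute inverse_eq_divide)
   show ?thesis
   proof (cases "x < q0")
    case True
    have "q0 * (x powr (- b) / (q0 + x)\<^sup>2) <= q0 * (x powr (- b) / q0\<^sup>2)"
     using x q0 by (intro mult_left_mono divide_left_mono power_mono mult_pos_pos) auto
    also have "... = 1 / q0 * x powr (- b)" using q0 by (simp add: power2_eq_square)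
    finally have "ennreal (q0 * (x powr (- b) / (q0 + x)\<^sup>2)) <= ennreal (1 / q0) * ennreal (x powr (- b))"
     using q0 by (simp add: ennreal_leI flip: ennreal_mult)
    thus ?thesis using x True by (simp add: add_increasing2)
   next
    case False
    have "x powr (- b) <= q0 powr (- b)" using False q0 b by (intro powr_mono2') auto
    hence "q0 * (x powr (- b) / (q0 + x)\<^sup>2) <= q0 * (q0 powr (- b) / (q0 + x)\<^sup>2)"
     using q0 by (intro mult_left_mono divide_right_mono) auto
    also have "... = q0 * q0 powr (- b) * (x + q0) powr (- 2)" by (simp add: v)
    finally have "ennreal (q0 * (x powr (- b) / (q0 + x)\<^sup>2)) <= ennreal (q0 * q0 powr (- b)) * ennreal ((x + q0) powr (- 2))"
     using q0 by (subst ennreal_mult[symmetric]) (auto intro: ennreal_leI)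
    thus ?thesis using x by (simp add: add_increasing)
   qed
  qed simp
 qed
 also have "... = ennreal (1 / q0) * (LNINT x. ?u x) + ennreal (q0 * q0 powr (- b)) * (LNINT x. ?v x)"
  by (subst nn_integral_add, simp, simp, subst nn_integral_cmult, simp, subst nn_integral_cmult, simp_all)
 also have "... <= ennreal (1 / q0) * ennreal (q0 powr (1 - b) / (1 - b)) + ennreal (q0 * q0 powr (- b)) * ennreal (q0 powr (1 - 2) / (2 - 1))"
  by (intro add_mono mult_left_mono nn_integral_powr_0 nn_integral_powr_inf) (use b q0 in auto)
 also have "... = ennreal (1 / q0 * (q0 powr (1 - b) / (1 - b)) + q0 * q0 powr (- b) * (q0 powr (1 - 2) / (2 - 1)))"
 proof -
  have "ennreal a * ennreal b + ennreal c * ennreal d = ennreal (a * b + c * d)"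
   if "0 <= a" "0 <= b" "0 <= c" "0 <= d" for a b c d :: real
   using that by (simp add: ennreal_mult)
  thus ?thesis using b q0 by simp
 qed
 also have "1 / q0 * (q0 powr (1 - b) / (1 - b)) + q0 * q0 powr (- b) * (q0 powr (1 - 2) / (2 - 1)) = (1 / (1 - b) + 1) * q0 powr (- b)"
 proof -
  have "q0 powr (1 - b) = q0 * q0 powr (- b)" using q0 powr_add[of q0 1 "- b"] by simp
  moreover have "q0 powr (1 - 2) = 1 / q0" using q0 by (simp add: powr_minus_divide)
  ultimately show ?thesis using q0 by (simp add: distrib_right)
 qed
 finally show ?thesis .
qed

context weighted_cone
begin

lemma arcs_sets [measurable]: "arcs \<in> sets \<nu>"
proof -
 have "arcs \<in> sets borel" unfolding arcs_def by (intro sets.finite_UN) auto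
 moreover have "arcs = \<gamma> \<inter> arcs" using arcs_sub by blast
 ultimately show ?thesis unfolding sets_nu sets_restrict_space by (intro image_eqI)
qed

lemma id_measurable: "(%\<omega>. \<omega>) \<in> \<nu> \<rightarrow>\<^sub>M borel"
 unfolding measurable_cong_sets[OF sets_nu refl] by (rule measurable_restrict_space1) simp

lemmas outward_normal_measurable [measurable]

lemma integral_antimono_weight:
 "\<exists>K>0. \<exists>A>0. \<forall>G. G \<in> borel_measurable borel \<and> (\<forall>x y. 0 < x --> x <= y --> G y <= G x) -->
  (\<integral>\<^sup>+\<omega>. G (q \<omega>) \<partial>\<nu>) <= ennreal K * (LNINT x. G x * indicator {0<..<A} x)"
proof -
 obtain \<kappa> where \<kappa>: "0 < \<kappa>" "\<And>j t. j < n ==> 0 < t ==> t < ang j ==> \<kappa> * min t (ang j - t) <= q (ap j t)"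
  using q_lower by blast
 define A where "A = \<kappa> * (2 * pi)"
 have "(\<integral>\<^sup>+\<omega>. G (q \<omega>) \<partial>\<nu>) <= ennreal (real n * (2 / \<kappa>)) * (LNINT x. G x * indicator {0<..<A} x)"
  if G [measurable]: "G \<in> borel_measurable borel" and anti: "\<And>x y. 0 < x ==> x <= y ==> G y <= G x" for G :: "real => ennreal"
 proof -
  let ?F = "LNINT x. G x * indicator {0<..<A} x"
  have arc: "(LNINT t. G (q (ap j t)) * indicator {0<..<ang j} t) <= ennreal (2 / \<kappa>) * ?F" if j: "j < n" for j
  proof -
   let ?g = "%t. G (\<kappa> * t) * indicator {0<..<ang j} t"
   have "(LNINT t. G (q (ap j t)) * indicator {0<..<ang j} t) <= (LNINT t. ?g t + ?g (ang j + (- 1) * t))"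
   proof (rule nn_integral_mono)
    fix t
    show "G (q (ap j t)) * indicator {0<..<ang j} t <= ?g t + ?g (ang j + (- 1) * t)"
    proof (cases "t \<in> {0<..<ang j}")
     case True
     hence t: "0 < t" "t < ang j" by auto
     have "G (q (ap j t)) <= G (\<kappa> * min t (ang j - t))" using \<kappa> t j by (intro anti) auto
     also have "... <= G (\<kappa> * t) + G (\<kappa> * (ang j - t))"
      by (auto simp: min_def add_increasing add_increasing2)
     finally show ?thesis using t by simp
    qed simp
   qed
   also have "... = (LNINT t. ?g t) + (LNINT t. ?g (ang j + (- 1) * t))"
    by (rule nn_integral_add) measurable
   also have "(LNINT t. ?g (ang j + (- 1) * t)) = (LNINT t. ?g t)"
    using nn_integral_real_affine[of ?g "- 1" "ang j"] by simp
   also have "(LNINT t. ?g t) <= ennreal (1 / \<kappa>) * ?F"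
   proof -
    let ?h = "%x. G x * indicator {0<..<A} x"
    have "?F = ennreal \<kappa> * (LNINT t. ?h (0 + \<kappa> * t))"
     using nn_integral_real_affine[of ?h \<kappa> 0] \<kappa>(1) by simp
    hence "ennreal (1 / \<kappa>) * ?F = ennreal (1 / \<kappa>) * ennreal \<kappa> * (LNINT t. ?h (0 + \<kappa> * t))" by (simp only: mult.assoc)
    also have "ennreal (1 / \<kappa>) * ennreal \<kappa> = 1" using \<kappa>(1) by (simp flip: ennreal_mult)
    finally have "ennreal (1 / \<kappa>) * ?F = (LNINT t. ?h (0 + \<kappa> * t))" by simp
    moreover have "(LNINT t. ?g t) <= (LNINT t. ?h (0 + \<kappa> * t))"
     using \<kappa>(1) polygon_facts(5)[OF j] by (intro nn_integral_mono) (auto simp: A_def split: split_indicator)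
    ultimately show ?thesis by simp
   qed
   hence "(LNINT t. ?g t) + (LNINT t. ?g t) <= ennreal (1 / \<kappa>) * ?F + ennreal (1 / \<kappa>) * ?F" by (intro add_mono)
   also have "... = ennreal (2 / \<kappa>) * ?F"
    using \<kappa>(1) by (simp flip: distrib_right ennreal_plus)
   finally show ?thesis .
  qed
  have "(\<integral>\<^sup>+\<omega>. G (q \<omega>) \<partial>\<nu>) = (\<Sum>j<n. LNINT t. G (q (ap j t)) * indicator {0<..<ang j} t)"
  proof (rule nn_integral_arc_length)
   have "(%\<omega>. G (q \<omega>)) \<in> borel_measurable \<nu>" by measurable
   thus "(%\<omega>. G (q \<omega>)) \<in> borel_measurable (restrict_space borel \<gamma>)" unfolding measurable_cong_sets[OF sets_nu refl] .
  qed
  also have "... <= of_nat (card {..<n}) * (ennreal (2 / \<kappa>) * ?F)"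
   by (rule sum_bounded_above) (use arc in auto)
  also have "... = ennreal (real n * (2 / \<kappa>)) * ?F"
  proof -
   have "ennreal (real n * (2 / \<kappa>)) = of_nat n * ennreal (2 / \<kappa>)"
    using \<kappa>(1) by (subst ennreal_mult) (auto simp: ennreal_of_nat_eq_real_of_nat)
   thus ?thesis by (simp add: mult.assoc)
  qed
  finally show ?thesis .
 qed
 moreover have "0 < real n * (2 / \<kappa>)" "0 < A" using \<kappa>(1) n_ge_3 by (auto simp: A_def)
 ultimately show ?thesis by blast
qed

text \<open>
  A decreasing function of \<open>q\<close> is integrated by means of \<open>q_lower\<close>. The constant \<open>K\<close> is independent of
  \<open>h\<close>, which will depend on the other variable of the kernel.
\<close>

lemma weight_integral:
 assumes b: "0 <= b" "b < 1"
 shows "\<exists>K>0. \<forall>c h D. 0 <= c \<and> 0 <= D \<and> h \<in> borel_measurable borel \<and> (\<forall>x y. 0 < x --> x <= y --> 0 <= h y \<and> h y <= h x) \<and>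
   (LNINT x. ennreal (h x) * indicator {0<..} x) <= ennreal D -->
  (\<integral>\<^sup>+\<omega>. ennreal (c * (q \<omega> powr (- b) + h (q \<omega>))) \<partial>\<nu>) <= ennreal (c * (K * (1 + D)))"
proof -
 obtain K A where K: "0 < K" "0 < A" and KA: "\<And>G. G \<in> borel_measurable borel ==> (\<And>x y. 0 < x ==> x <= y ==> G y <= G x) ==>
  (\<integral>\<^sup>+\<omega>. G (q \<omega>) \<partial>\<nu>) <= ennreal K * (LNINT x. G x * indicator {0<..<A} x)"
  using integral_antimono_weight by blast
 define E where "E = A powr (1 - b) / (1 - b)"
 have E: "0 <= E" using b by (simp add: E_def)
 have "(\<integral>\<^sup>+\<omega>. ennreal (c * (q \<omega> powr (- b) + h (q \<omega>))) \<partial>\<nu>) <= ennreal (c * (K * (1 + E) * (1 + D)))"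
  if c: "0 <= c" and D: "0 <= D" and h [measurable]: "h \<in> borel_measurable borel"
   and anti: "\<forall>x y. 0 < x --> x <= y --> 0 <= h y \<and> h y <= h x"
   and hD: "(LNINT x. ennreal (h x) * indicator {0<..} x) <= ennreal D" for c D h
 proof -
  let ?G = "%x. ennreal (c * (x powr (- b) + h x))"
  let ?u = "%x. ennreal (x powr (- b)) * indicator {0<..<A} x"
  let ?v = "%x. ennreal (h x) * indicator {0<..} x"
  have "(\<integral>\<^sup>+\<omega>. ?G (q \<omega>) \<partial>\<nu>) <= ennreal K * (LNINT x. ?G x * indicator {0<..<A} x)"
  proof (rule KA)
   fix x y :: real assume "0 < x" "x <= y"
   thus "?G y <= ?G x" using b c anti by (intro ennreal_leI mult_left_mono add_mono powr_mono2') auto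
  qed measurable
  also have "... <= ennreal K * (LNINT x. ennreal c * (?u x + ?v x))"
  proof (rule mult_left_mono, rule nn_integral_mono)
   fix x
   show "?G x * indicator {0<..<A} x <= ennreal c * (?u x + ?v x)"
   proof (cases "x \<in> {0<..<A}")
    case True
    hence "0 <= h x" using anti by auto
    thus ?thesis using True c by (simp add: ennreal_mult ennreal_plus)
   qed simp
  qed simp
  also have "(LNINT x. ennreal c * (?u x + ?v x)) = ennreal c * ((LNINT x. ?u x) + (LNINT x. ?v x))"
   by (subst nn_integral_cmult, simp, subst nn_integral_add, simp_all)
  also have "ennreal K * (ennreal c * ((LNINT x. ?u x) + (LNINT x. ?v x))) <= ennreal K * (ennreal c * (ennreal E + ennreal D))"
   unfolding E_def by (intro mult_left_mono add_mono nn_integral_powr_0 hD) (use b K in auto)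
  also have "ennreal K * (ennreal c * (ennreal E + ennreal D)) = ennreal (K * (c * (E + D)))"
   using K c E D by (simp add: ennreal_mult ennreal_plus)
  also have "... <= ennreal (c * (K * (1 + E) * (1 + D)))"
  proof (rule ennreal_leI)
   have "E + D <= (1 + E) * (1 + D)" using E D by (simp add: algebra_simps)
   hence "K * c * (E + D) <= K * c * ((1 + E) * (1 + D))" using K c by (intro mult_left_mono) auto
   thus "K * (c * (E + D)) <= c * (K * (1 + E) * (1 + D))" by (simp add: mult_ac)
  qed
  finally show ?thesis .
 qed
 moreover have "0 < K * (1 + E)" using K E by simp
 ultimately show ?thesis by (intro exI[of _ "K * (1 + E)"]) blast
qed

text \<open>
  The kernel of the operator in the coordinates \<open>x = e\<^sup>s \<omega>\<close>, conjugated by the powers of \<open>q\<close> and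
  \<open>\<bar>x\<bar>\<close> that turn the weighted space into an unweighted one. It is set to zero on the null set of
  corners, where no outward normal exists.
\<close>

definition k :: "real => real^3 => real^3 => real" where
 "k s \<omega> \<omega>' = (if \<omega> \<in> arcs \<and> \<omega>' \<in> arcs then
   - (1 / (4 * pi)) * (q \<omega> powr (- \<alpha> / 2) * q \<omega>' powr (\<alpha> / 2)) *
    (exp (3 / 2 * s) * (\<omega> \<bullet> outward_normal C \<omega>') / norm (exp s *\<^sub>R \<omega> - \<omega>') ^ 3) else 0)"

abbreviation mass :: "real^3 => real^3 => ennreal" where
 "mass \<omega> \<omega>' == LNINT s. ennreal ((1 + \<bar>s\<bar>) * \<bar>k s \<omega> \<omega>'\<bar>)"

definition p :: "real^3 => real" where
 "p \<omega> = (if \<omega> \<in> arcs then q \<omega> powr (- 1 / 2) else 1)"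

lemma k_measurable: "(%(s, x, y). k s x y) \<in> borel_measurable (borel \<Otimes>\<^sub>M \<nu> \<Otimes>\<^sub>M \<nu>)"
proof -
 note [measurable] = id_measurable
 show ?thesis unfolding k_def split_beta' by measurable
qed

lemma kernel_integral_bound:
 "\<exists>A>0. \<forall>\<omega>\<in>arcs. \<forall>\<omega>'\<in>arcs. mass \<omega> \<omega>'
   <= ennreal (A * (q \<omega> powr (- \<alpha> / 2) * q \<omega>' powr (\<alpha> / 2)) * (1 + q \<omega> / (q \<omega> + q \<omega>')\<^sup>2))"
proof -
 obtain B where B: "0 < B" and nb: "\<And>\<omega> \<omega>'. \<omega> \<in> arcs ==> \<omega>' \<in> arcs ==>
   \<bar>\<omega> \<bullet> outward_normal C \<omega>'\<bar> <= B * (norm (\<omega> - \<omega>'))\<^sup>2 * (1 + q \<omega> / (q \<omega> + q \<omega>')\<^sup>2)"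
  using normal_component_bound by blast
 have "mass \<omega> \<omega>'
   <= ennreal (320 * B * (q \<omega> powr (- \<alpha> / 2) * q \<omega>' powr (\<alpha> / 2)) * (1 + q \<omega> / (q \<omega> + q \<omega>')\<^sup>2))"
  if w: "\<omega> \<in> arcs" "\<omega>' \<in> arcs" for \<omega> \<omega>'
 proof (cases "\<omega> = \<omega>'")
  case True
  hence "k s \<omega> \<omega>' = 0" for s using nb[OF w] by (simp add: k_def)
  thus ?thesis by simp
 next
  case False
  define W where "W = q \<omega> powr (- \<alpha> / 2) * q \<omega>' powr (\<alpha> / 2)"
  define c where "c = 1 / (4 * pi) * W * \<bar>\<omega> \<bullet> outward_normal C \<omega>'\<bar>"
  define R where "R = 1 + q \<omega> / (q \<omega> + q \<omega>')\<^sup>2"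
  define \<delta> where "\<delta> = norm (\<omega> - \<omega>')"
  have W: "0 <= W" by (simp add: W_def)
  have c: "0 <= c" using W by (simp add: c_def)
  have \<delta>: "0 < \<delta>" using False by (simp add: \<delta>_def)
  have u: "norm \<omega> = 1" "norm \<omega>' = 1" using w arcs_sub by (auto simp: polygon_curve_def)
  let ?i = "%s. (1 + \<bar>s\<bar>) * (exp (3 / 2 * s) / norm (exp s *\<^sub>R \<omega> - \<omega>') ^ 3)"
  have "mass \<omega> \<omega>' = (LNINT s. ennreal c * ennreal (?i s))"
  proof (rule nn_integral_cong)
   fix s
   have "\<bar>k s \<omega> \<omega>'\<bar> = c * (exp (3 / 2 * s) / norm (exp s *\<^sub>R \<omega> - \<omega>') ^ 3)"
    using w W unfolding k_def W_def[symmetric] by (simp add: c_def abs_mult)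
   hence "(1 + \<bar>s\<bar>) * \<bar>k s \<omega> \<omega>'\<bar> = c * ?i s" by simp
   moreover have "0 <= ?i s" by simp
   ultimately show "ennreal ((1 + \<bar>s\<bar>) * \<bar>k s \<omega> \<omega>'\<bar>) = ennreal c * ennreal (?i s)"
    using c by (simp only: ennreal_mult)
  qed
  also have "... = ennreal c * (LNINT s. ennreal (?i s))"
   by (rule nn_integral_cmult) measurable
  also have "... <= ennreal c * ennreal (320 / \<delta>\<^sup>2)"
   unfolding \<delta>_def by (rule mult_left_mono[OF mellin_integrand_bound[OF u False]]) simp
  also have "... = ennreal (c * (320 / \<delta>\<^sup>2))" using c by (intro ennreal_mult[symmetric]) auto
  also have "... <= ennreal (320 * B * W * R)"
  proof (rule ennreal_leI)
   have "c <= 1 * W * (B * \<delta>\<^sup>2 * R)"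
    unfolding c_def using nb[OF w] W pi_gt3 by (intro mult_mono) (auto simp: \<delta>_def R_def)
   hence "c * (320 / \<delta>\<^sup>2) <= 1 * W * (B * \<delta>\<^sup>2 * R) * (320 / \<delta>\<^sup>2)" by (rule mult_right_mono) simp
   also have "... = 320 * B * W * R" using \<delta> by simp
   finally show "c * (320 / \<delta>\<^sup>2) <= 320 * B * W * R" .
  qed
  finally show ?thesis unfolding W_def R_def .
 qed
 thus ?thesis using B by (intro exI[of _ "320 * B"]) auto
qed

lemma powr_le_bound:
 assumes Q: "\<forall>\<omega>\<in>\<gamma>. q \<omega> <= Q" and w: "\<omega> \<in> arcs" and a: "0 <= a + 1 / 2"
 shows "q \<omega> powr a <= Q powr (a + 1 / 2) * q \<omega> powr (- 1 / 2)"
proof -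
 have q: "0 < q \<omega>" "q \<omega> <= Q" using q_pos[OF w] Q w arcs_sub by auto
 have "q \<omega> powr a = q \<omega> powr (a + 1 / 2) * q \<omega> powr (- 1 / 2)" by (simp flip: powr_add)
 also have "... <= Q powr (a + 1 / 2) * q \<omega> powr (- 1 / 2)" using q a by (intro mult_right_mono powr_mono2) auto
 finally show ?thesis .
qed

text \<open>
  Both halves of Schur's condition compare an integral over the curve with the weight
  \<open>p = q\<^sup>-\<^sup>1\<^sup>/\<^sup>2\<close>. The term \<open>q(\<omega>')\<^sup>-\<^sup>b\<close> is integrable because \<open>b < 1\<close>; the term \<open>h\<close> carries the
  corner singularity, and homogeneity makes its integral scale exactly like the weight.
\<close>

lemma schur_half:
 fixes J :: "real^3 => real^3 => ennreal" and h :: "real => real => real"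
 assumes b: "0 <= b" "b < 1" and A: "0 < A" and E: "0 < E" and a: "0 <= a + 1 / 2" and e: "a + e = - 1 / 2"
  and J: "\<And>\<omega> \<omega>'. \<omega> \<in> arcs ==> \<omega>' \<in> arcs ==> J \<omega> \<omega>' <= ennreal (A * q \<omega> powr a * (q \<omega>' powr (- b) + h (q \<omega>) (q \<omega>')))"
  and J0: "\<And>\<omega> \<omega>'. \<omega> \<notin> arcs ==> J \<omega> \<omega>' = 0"
  and h: "\<And>s. 0 < s ==> h s \<in> borel_measurable borel" "\<And>s x y. 0 < s ==> 0 < x ==> x <= y ==> 0 <= h s y \<and> h s y <= h s x"
   "\<And>s. 0 < s ==> (LNINT x. ennreal (h s x) * indicator {0<..} x) <= ennreal (E * s powr e)"
 shows "\<exists>D>0. \<forall>\<omega>\<in>\<gamma>. (\<integral>\<^sup>+\<omega>'. J \<omega> \<omega>' \<partial>\<nu>) <= ennreal (D * p \<omega>)"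
proof -
 obtain Q where Q: "0 < Q" "\<forall>\<omega>\<in>\<gamma>. q \<omega> <= Q" using q_bounded by blast
 obtain K where K: "0 < K" "\<And>c h D. 0 <= c ==> 0 <= D ==> h \<in> borel_measurable borel ==>
   (\<forall>x y. 0 < x --> x <= y --> 0 <= h y \<and> h y <= h x) ==> (LNINT x. ennreal (h x) * indicator {0<..} x) <= ennreal D ==>
  (\<integral>\<^sup>+\<omega>. ennreal (c * (q \<omega> powr (- b) + h (q \<omega>))) \<partial>\<nu>) <= ennreal (c * (K * (1 + D)))"
  using weight_integral[OF b] by blast
 define D where "D = A * K * (Q powr (a + 1 / 2) + E)"
 have "(\<integral>\<^sup>+\<omega>'. J \<omega> \<omega>' \<partial>\<nu>) <= ennreal (D * p \<omega>)" for \<omega>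
 proof (cases "\<omega> \<in> arcs")
  case False
  thus ?thesis by (simp add: J0)
 next
  case w: True
  define s where "s = q \<omega>"
  have s: "0 < s" using q_pos[OF w] by (simp add: s_def)
  have "(\<integral>\<^sup>+\<omega>'. J \<omega> \<omega>' \<partial>\<nu>) <= (\<integral>\<^sup>+\<omega>'. ennreal (A * s powr a * (q \<omega>' powr (- b) + h s (q \<omega>'))) \<partial>\<nu>)"
  proof (rule nn_integral_mono_AE)
   show "AE \<omega>' in \<nu>. J \<omega> \<omega>' <= ennreal (A * s powr a * (q \<omega>' powr (- b) + h s (q \<omega>')))"
    using AE_arcs by eventually_elim (use J[OF w] in \<open>simp add: s_def\<close>)
  qed
  also have "... <= ennreal (A * s powr a * (K * (1 + E * s powr e)))"
   by (rule K(2)) (use A E h s in auto)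
  also have "... <= ennreal (D * p \<omega>)"
  proof (rule ennreal_leI)
   have 1: "s powr a <= Q powr (a + 1 / 2) * s powr (- 1 / 2)"
    using powr_le_bound[OF Q(2) w a] unfolding s_def .
   have 2: "s powr a * s powr e = s powr (- 1 / 2)" by (simp only: e powr_add[symmetric])
   have "A * s powr a * (K * (1 + E * s powr e)) = A * K * (s powr a + E * (s powr a * s powr e))"
    by (simp add: algebra_simps)
   also have "... <= A * K * (Q powr (a + 1 / 2) * s powr (- 1 / 2) + E * s powr (- 1 / 2))"
    unfolding 2 using 1 A K by (intro mult_left_mono add_right_mono) auto
   also have "... = D * p \<omega>" using w by (simp add: D_def p_def s_def algebra_simps)
   finally show "A * s powr a * (K * (1 + E * s powr e)) <= D * p \<omega>" .
  qed
  finally show ?thesis .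
 qed
 moreover have "0 < D" using A K E by (simp add: D_def add_nonneg_pos)
 ultimately show ?thesis by blast
qed

lemma schur_row:
 "\<exists>D>0. \<forall>\<omega>\<in>\<gamma>. (\<integral>\<^sup>+\<omega>'. mass \<omega> \<omega>' * ennreal (p \<omega>') \<partial>\<nu>) <= ennreal (D * p \<omega>)"
proof -
 define b where "b = (1 - \<alpha>) / 2"
 have b: "0 <= b" "b < 1" using alpha by (auto simp: b_def)
 obtain A where A: "0 < A" and J: "\<And>\<omega> \<omega>'. \<omega> \<in> arcs ==> \<omega>' \<in> arcs ==> mass \<omega> \<omega>'
   <= ennreal (A * (q \<omega> powr (- \<alpha> / 2) * q \<omega>' powr (\<alpha> / 2)) * (1 + q \<omega> / (q \<omega> + q \<omega>')\<^sup>2))"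
  using kernel_integral_bound by blast
 let ?h = "%s x. s * (x powr (- b) / (s + x)\<^sup>2)"
 show ?thesis
 proof (rule schur_half[OF b A, where a = "- \<alpha> / 2" and e = "- b" and h = ?h and E = "1 / (1 - b) + 1"])
  fix \<omega> \<omega>' assume w: "\<omega> \<in> arcs" "\<omega>' \<in> arcs"
  have e: "q \<omega>' powr (- b) = q \<omega>' powr (\<alpha> / 2) * q \<omega>' powr (- 1 / 2)"
  proof -
   have "- b = \<alpha> / 2 + - 1 / 2" by (simp add: b_def field_simps)
   thus ?thesis by (simp only: powr_add)
  qed
  have "mass \<omega> \<omega>' * ennreal (p \<omega>')
    <= ennreal (A * (q \<omega> powr (- \<alpha> / 2) * q \<omega>' powr (\<alpha> / 2)) * (1 + q \<omega> / (q \<omega> + q \<omega>')\<^sup>2)) * ennreal (q \<omega>' powr (- 1 / 2))"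
   using J[OF w] w unfolding p_def by (intro mult_mono) auto
  also have "... = ennreal (A * (q \<omega> powr (- \<alpha> / 2) * q \<omega>' powr (\<alpha> / 2)) * (1 + q \<omega> / (q \<omega> + q \<omega>')\<^sup>2) * q \<omega>' powr (- 1 / 2))"
   using A q_pos[OF w(1)] by (intro ennreal_mult[symmetric]) auto
  also have "A * (q \<omega> powr (- \<alpha> / 2) * q \<omega>' powr (\<alpha> / 2)) * (1 + q \<omega> / (q \<omega> + q \<omega>')\<^sup>2) * q \<omega>' powr (- 1 / 2)
    = A * q \<omega> powr (- \<alpha> / 2) * (q \<omega>' powr (- b) + ?h (q \<omega>) (q \<omega>'))" unfolding e by (simp add: algebra_simps)
  finally show "mass \<omega> \<omega>' * ennreal (p \<omega>')
    <= ennreal (A * q \<omega> powr (- \<alpha> / 2) * (q \<omega>' powr (- b) + ?h (q \<omega>) (q \<omega>')))" .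
 next
  fix s x y :: real assume s: "0 < s" and xy: "0 < x" "x <= y"
  have "?h s y <= ?h s x" using s xy b by (intro mult_left_mono frac_le power_mono powr_mono2') auto
  thus "0 <= ?h s y \<and> ?h s y <= ?h s x" using s by simp
 next
  show "- \<alpha> / 2 + - b = - 1 / 2" by (simp add: b_def field_simps)
  show "0 < 1 / (1 - b) + 1" using b by (simp add: add_pos_pos)
 qed (use alpha nn_integral_powr_quadratic[OF b] in \<open>auto simp: k_def\<close>)
qed

lemma schur_col:
 "\<exists>D>0. \<forall>\<omega>'\<in>\<gamma>. (\<integral>\<^sup>+\<omega>. mass \<omega> \<omega>' * ennreal (p \<omega>) \<partial>\<nu>) <= ennreal (D * p \<omega>')"
proof -
 define b where "b = (1 + \<alpha>) / 2"
 define e where "e = 2 - (1 - \<alpha>) / 2"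
 have b: "0 <= b" "b < 1" and e: "1 < e" using alpha by (auto simp: b_def e_def)
 obtain A where A: "0 < A" and J: "\<And>\<omega> \<omega>'. \<omega> \<in> arcs ==> \<omega>' \<in> arcs ==> mass \<omega> \<omega>'
   <= ennreal (A * (q \<omega> powr (- \<alpha> / 2) * q \<omega>' powr (\<alpha> / 2)) * (1 + q \<omega> / (q \<omega> + q \<omega>')\<^sup>2))"
  using kernel_integral_bound by blast
 let ?h = "%s x. if 0 < x then (x + s) powr (- e) else 0"
 show ?thesis
 proof (rule schur_half[OF b A, where a = "\<alpha> / 2" and e = "1 - e" and h = ?h and E = "1 / (e - 1)"])
  fix \<omega>' \<omega> assume w: "\<omega>' \<in> arcs" "\<omega> \<in> arcs"
  have q: "0 < q \<omega>" "0 < q \<omega>'" using q_pos w by auto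
  have e1: "q \<omega> powr (- b) = q \<omega> powr (- \<alpha> / 2) * q \<omega> powr (- 1 / 2)"
  proof -
   have "- b = - \<alpha> / 2 + - 1 / 2" by (simp add: b_def field_simps)
   thus ?thesis by (simp only: powr_add)
  qed
  have e2: "q \<omega> powr (- b) * (q \<omega> / (q \<omega> + q \<omega>')\<^sup>2) <= (q \<omega> + q \<omega>') powr (- e)"
  proof -
   have "(1 - \<alpha>) / 2 = - b + 1" by (simp add: b_def field_simps)
   hence "q \<omega> powr ((1 - \<alpha>) / 2) = q \<omega> powr (- b) * q \<omega>" using q by (simp only: powr_add powr_one)
   hence "q \<omega> powr (- b) * (q \<omega> / (q \<omega> + q \<omega>')\<^sup>2) = q \<omega> powr ((1 - \<alpha>) / 2) / (q \<omega> + q \<omega>')\<^sup>2" by simp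
   also have "... <= (q \<omega> + q \<omega>') powr ((1 - \<alpha>) / 2) / (q \<omega> + q \<omega>')\<^sup>2"
    using q alpha by (intro divide_right_mono powr_mono2) auto
   also have "... = (q \<omega> + q \<omega>') powr (- e)" using q by (simp add: e_def powr_diff powr_numeral)
   finally show ?thesis .
  qed
  have "mass \<omega> \<omega>' * ennreal (p \<omega>)
    <= ennreal (A * (q \<omega> powr (- \<alpha> / 2) * q \<omega>' powr (\<alpha> / 2)) * (1 + q \<omega> / (q \<omega> + q \<omega>')\<^sup>2)) * ennreal (q \<omega> powr (- 1 / 2))"
   using J[OF w(2,1)] w unfolding p_def by (intro mult_mono) auto
  also have "... = ennreal (A * (q \<omega> powr (- \<alpha> / 2) * q \<omega>' powr (\<alpha> / 2)) * (1 + q \<omega> / (q \<omega> + q \<omega>')\<^sup>2) * q \<omega> powr (- 1 / 2))"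
   using A q by (intro ennreal_mult[symmetric]) auto
  also have "A * (q \<omega> powr (- \<alpha> / 2) * q \<omega>' powr (\<alpha> / 2)) * (1 + q \<omega> / (q \<omega> + q \<omega>')\<^sup>2) * q \<omega> powr (- 1 / 2)
    = A * q \<omega>' powr (\<alpha> / 2) * (q \<omega> powr (- b) + q \<omega> powr (- b) * (q \<omega> / (q \<omega> + q \<omega>')\<^sup>2))" unfolding e1 by (simp add: algebra_simps)
  also have "ennreal ... <= ennreal (A * q \<omega>' powr (\<alpha> / 2) * (q \<omega> powr (- b) + ?h (q \<omega>') (q \<omega>)))"
   using e2 q A by (intro ennreal_leI mult_left_mono add_left_mono) auto
  finally show "mass \<omega> \<omega>' * ennreal (p \<omega>)
    <= ennreal (A * q \<omega>' powr (\<alpha> / 2) * (q \<omega> powr (- b) + ?h (q \<omega>') (q \<omega>)))" .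
 next
  fix s x y :: real assume s: "0 < s" and xy: "0 < x" "x <= y"
  have "(y + s) powr (- e) <= (x + s) powr (- e)" using s xy e by (intro powr_mono2') auto
  thus "0 <= ?h s y \<and> ?h s y <= ?h s x" using xy by simp
 next
  fix s :: real assume s: "0 < s"
  have "(LNINT x. ennreal (?h s x) * indicator {0<..} x) = (LNINT x. ennreal ((x + s) powr (- e)) * indicator {0<..} x)"
   by (rule nn_integral_cong) (auto split: split_indicator)
  thus "(LNINT x. ennreal (?h s x) * indicator {0<..} x) <= ennreal (1 / (e - 1) * s powr (1 - e))"
   using nn_integral_powr_inf[OF e s] by simp
 next
  show "\<alpha> / 2 + (1 - e) = - 1 / 2" by (simp add: e_def field_simps)
 qed (use alpha e in \<open>auto simp: k_def\<close>)
qed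

theorem convolution_kernel_k: "\<exists>D. convolution_kernel \<nu> k p D"
proof -
 obtain D1 where D1: "0 < D1" "\<And>\<omega>. \<omega> \<in> \<gamma> ==>
  (\<integral>\<^sup>+\<omega>'. mass \<omega> \<omega>' * ennreal (p \<omega>') \<partial>\<nu>) <= ennreal (D1 * p \<omega>)" using schur_row by blast
 obtain D2 where D2: "0 < D2" "\<And>\<omega>'. \<omega>' \<in> \<gamma> ==>
  (\<integral>\<^sup>+\<omega>. mass \<omega> \<omega>' * ennreal (p \<omega>) \<partial>\<nu>) <= ennreal (D2 * p \<omega>')" using schur_col by blast
 have pp: "0 < p \<omega>" for \<omega>
 proof (cases "\<omega> \<in> arcs")
  case True
  thus ?thesis using q_pos[OF True] by (simp add: p_def)
 qed (simp add: p_def)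
 have m: "ennreal (D1 * p \<omega>) <= ennreal (max D1 D2 * p \<omega>)" "ennreal (D2 * p \<omega>) <= ennreal (max D1 D2 * p \<omega>)" for \<omega>
  using pp[of \<omega>] by (auto intro!: ennreal_leI mult_right_mono)
 have "convolution_kernel \<nu> k p (max D1 D2)"
 proof (intro convolution_kernel.intro convolution_kernel_axioms.intro)
  show "p \<in> borel_measurable \<nu>" unfolding p_def[abs_def] by measurable
  show "0 <= max D1 D2" using D1 by simp
 qed (use k_measurable pp nu.sigma_finite_measure_axioms in
   \<open>auto simp: space_nu intro: order_trans[OF D1(2) m(1)] order_trans[OF D2(2) m(2)]\<close>)
 thus ?thesis ..
qed

definition schur_const :: real where "schur_const = (SOME D. convolution_kernel \<nu> k p D)"

sublocale conv: convolution_kernel \<nu> k p schur_const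
 unfolding schur_const_def by (rule someI_ex[OF convolution_kernel_k])

end

section \<open>Weighted substitutions as unitary equivalences\<close>

text \<open>
  A change of variables \<open>F\<close> together with the square root \<open>h\<close> of its density is a unitary equivalence; \<open>G\<close> and
  \<open>g\<close> provide the inverse.
\<close>

locale weighted_pullback =
 fixes M S :: "'a measure" and N :: "'b measure" and F :: "'b => 'a" and G :: "'a => 'b"
  and h :: "'b => real" and g :: "'a => real"
 assumes F_measurable [measurable]: "F \<in> N \<rightarrow>\<^sub>M S" and G_measurable [measurable]: "G \<in> S \<rightarrow>\<^sub>M N"
  and h_measurable [measurable]: "h \<in> borel_measurable N" and g_measurable [measurable]: "g \<in> borel_measurable S"
  and M_eq: "M = distr (density N (%z. ennreal ((h z)\<^sup>2))) S F"
  and inverse: "AE z in N. G (F z) = z \<and> h z * g (F z) = 1"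
begin

definition V :: "('a => complex) => 'b => complex" where "V u = (%z. of_real (h z) * u (F z))"
definition W :: "('b => complex) => 'a => complex" where "W U = (%x. of_real (g x) * U (G x))"

lemma sets_M: "sets M = sets S"
 by (simp add: M_eq)

lemma measurable_M: "measurable M = measurable S"
 by (intro ext measurable_cong_sets sets_M refl)

lemma nn_integral_M:
 assumes [measurable]: "u \<in> borel_measurable S"
 shows "(\<integral>\<^sup>+x. u x \<partial>M) = (\<integral>\<^sup>+z. ennreal ((h z)\<^sup>2) * u (F z) \<partial>N)"
 unfolding M_eq by (subst nn_integral_distr, simp, simp, subst nn_integral_density) simp_all

lemma integral_M:
 fixes u :: "'a => complex"
 assumes [measurable]: "u \<in> borel_measurable S"
 shows "(\<integral>x. u x \<partial>M) = (\<integral>z. of_real ((h z)\<^sup>2) * u (F z) \<partial>N)"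
 unfolding M_eq by (subst integral_distr, simp, simp, subst integral_density) (simp_all add: scaleR_conv_of_real)

lemma AE_M:
 assumes [measurable]: "{x \<in> space S. P x} \<in> sets S" and "AE z in N. P (F z)" shows "AE x in M. P x"
 unfolding M_eq
 by (subst AE_distr_iff, simp, simp, subst AE_density) (use assms(2) in \<open>auto elim: eventually_mono\<close>)

lemma V_measurable:
 assumes [measurable]: "u \<in> borel_measurable S" shows "V u \<in> borel_measurable N"
 unfolding V_def by measurable

lemma W_measurable:
 assumes [measurable]: "U \<in> borel_measurable N" shows "W U \<in> borel_measurable S"
 unfolding W_def by measurable

lemma V_L2_iff:
 assumes u [measurable]: "u \<in> borel_measurable S" shows "V u \<in> L2 N \<longleftrightarrow> u \<in> L2 M"
proof -
 have "(\<integral>\<^sup>+z. ennreal ((cmod (V u z))\<^sup>2) \<partial>N) = (\<integral>\<^sup>+z. ennreal ((h z)\<^sup>2) * ennreal ((cmod (u (F z)))\<^sup>2) \<partial>N)"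
  by (rule nn_integral_cong) (simp add: V_def norm_mult power_mult_distrib flip: ennreal_mult)
 also have "... = (\<integral>\<^sup>+x. ennreal ((cmod (u x))\<^sup>2) \<partial>M)"
  by (rule nn_integral_M[symmetric]) measurable
 finally show ?thesis using u V_measurable[OF u] by (simp add: L2_iff measurable_M)
qed

sublocale unitary_equivalence M N V W
proof
 show VW: "AE z in N. V (W U) z = U z" for U
  using inverse
 proof eventually_elim
  case (elim z)
  have "complex_of_real (h z) * of_real (g (F z)) = 1" using elim by (simp flip: of_real_mult)
  thus ?case using elim by (simp add: V_def W_def mult.assoc[symmetric])
 qed
 show "V f \<in> L2 N" if "f \<in> L2 M" for f
  using that V_L2_iff[of f] L2_measurable[OF that] by (simp add: measurable_M)
 show "W U \<in> L2 M" if U: "U \<in> L2 N" for U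
 proof -
  note m = W_measurable[OF L2_measurable[OF U]]
  have "V (W U) \<in> L2 N" by (rule L2_cong_AE[OF U V_measurable[OF m] VW])
  thus ?thesis using V_L2_iff[OF m] by simp
 qed
 show "L2_inner N (V f) (V f') = L2_inner M f f'" if "f \<in> L2 M" "f' \<in> L2 M" for f f'
 proof -
  have [measurable]: "f \<in> borel_measurable S" "f' \<in> borel_measurable S"
   using L2_measurable[OF that(1)] L2_measurable[OF that(2)] by (simp_all add: measurable_M)
  show ?thesis unfolding L2_inner_def
   by (subst integral_M) (auto simp: V_def power2_eq_square mult_ac intro!: Bochner_Integration.integral_cong)
 qed
 show "AE x in M. W (V f) x = f x" if "f \<in> L2 M" for f
 proof (rule AE_M)
  have [measurable]: "f \<in> borel_measurable S" using L2_measurable[OF that] by (simp add: measurable_M)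
  have [measurable]: "W (V f) \<in> borel_measurable S" by (intro W_measurable V_measurable) measurable
  show "{x \<in> space S. W (V f) x = f x} \<in> sets S" by measurable
  show "AE z in N. W (V f) (F z) = f (F z)"
   using inverse
  proof eventually_elim
   case (elim z)
   have "complex_of_real (g (F z)) * of_real (h z) = 1" using elim by (simp add: mult.commute flip: of_real_mult)
   thus ?case using elim by (simp add: V_def W_def mult.assoc[symmetric])
  qed
 qed
qed (auto simp: V_def W_def distrib_left mult_ac)

end

lemma (in unitary_equivalence) Weyl_sequence_pullback:
 assumes TS: "intertwines T S" and S: "bounded_op N S" and w: "singular_Weyl_sequence N S w"
 shows "singular_Weyl_sequence M T (%n. W (w n))"
proof -
 have wL: "w n \<in> L2 N" "L2_norm N (w n) = 1" for n using w by (auto simp: singular_Weyl_sequence_def)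
 have WL: "W (w n) \<in> L2 M" for n by (rule W_L2[OF wL(1)])
 have T: "T (W (w n)) \<in> L2 M" "AE y in N. V (T (W (w n))) y = S (V (W (w n))) y" for n
  using TS WL by (auto simp: intertwines_def)
 have "L2_norm M (T (W (w n))) = L2_norm N (S (w n))" for n
 proof -
  have "L2_norm M (T (W (w n))) = L2_norm N (V (T (W (w n))))" by (rule V_norm[OF T(1), symmetric])
  also have "... = L2_norm N (S (V (W (w n))))"
   by (rule L2_norm_cong_AE[OF V_L2[OF T(1)] bounded_op_L2[OF S V_L2[OF WL]] T(2)])
  also have "... = L2_norm N (S (w n))"
   by (rule L2_norm_cong_AE[OF bounded_op_L2[OF S V_L2[OF WL]] bounded_op_L2[OF S wL(1)]
      bounded_op_cong_AE[OF S V_L2[OF WL] wL(1) VW[OF wL(1)]]])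
  finally show ?thesis .
 qed
 moreover have "L2_inner M (W (w n)) f = L2_inner N (w n) (V f)" if f: "f \<in> L2 M" for f n
 proof -
  have "L2_inner M (W (w n)) f = L2_inner N (V (W (w n))) (V f)" by (rule V_inner[OF WL f, symmetric])
  also have "... = L2_inner N (w n) (V f)"
   by (rule L2_inner_cong_AE) (use VW wL V_L2 WL f in auto)
  finally show ?thesis .
 qed
 ultimately show ?thesis
  using w WL wL W_norm V_L2 unfolding singular_Weyl_sequence_def L2_weakly_null_def by simp
qed

section \<open>The operators in cylindrical coordinates\<close>

context weighted_cone
begin

lemmas of_real_compose = measurable_compose[OF _ borel_measurable_of_real]
lemmas norm_compose = measurable_compose[OF _ borel_measurable_norm]
lemmas exp_compose = measurable_compose[OF _ borel_measurable_exp]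

lemma id_surf: "(%x. x) \<in> surf \<rightarrow>\<^sub>M borel"
 by (rule measurable_restrict_space1) simp

text \<open>The value at the vertex is immaterial, as long as it lies on the curve.\<close>

definition dir :: "real^3 => real^3" where "dir x = (if x = 0 then corner P 0 else x /\<^sub>R norm x)"

lemma dir_in_curve:
 assumes "x \<in> cone_surface P" shows "dir x \<in> \<gamma>"
proof (cases "x = 0")
 case True
 thus ?thesis using corner_in_curve n_ge_3 by (simp add: dir_def)
next
 case x: False
 then obtain j where j: "j < n" "x \<in> face P j \<or> x \<in> edge P j" using assms by (auto simp: cone_surface_def)
 from j(2) show ?thesis
 proof
  assume "x \<in> face P j"
  hence "x /\<^sub>R norm x \<in> arc j" using face_eq_arc[OF j(1)] by blast
  hence "x /\<^sub>R norm x \<in> arcs" using j(1) by (auto simp: arcs_def)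
  thus ?thesis using x arcs_sub by (auto simp: dir_def)
 next
  assume "x \<in> edge P j"
  then obtain r where r: "x = r *\<^sub>R corner P j" "0 < r" by (auto simp: edge_def)
  thus ?thesis using x polygon_facts(1)[OF j(1)] corner_in_curve[OF j(1)] by (simp add: dir_def)
 qed
qed

lemma norm_\<Phi>: "snd z \<in> \<gamma> ==> norm (\<Phi> z) = exp (fst z)"
 by (simp add: \<Phi>_def polygon_curve_def)

lemma dir_\<Phi>: "snd z \<in> \<gamma> ==> dir (\<Phi> z) = snd z"
 using norm_\<Phi>[of z] by (auto simp: dir_def \<Phi>_def polygon_curve_def)

lemma dir_measurable [measurable]: "dir \<in> surf \<rightarrow>\<^sub>M \<nu>"
 unfolding measurable_cong_sets[OF refl sets_nu]
proof (rule measurable_restrict_space2)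
 show "dir \<in> space surf \<rightarrow> \<gamma>" using dir_in_curve by (auto simp: space_restrict_space)
 have "dir \<in> borel_measurable borel" unfolding dir_def[abs_def] by measurable
 thus "dir \<in> borel_measurable surf" by (rule measurable_restrict_space1)
qed

lemma outward_normal_surf_measurable [measurable]: "outward_normal C \<in> borel_measurable surf"
proof -
 have "outward_normal C = (%x. if x = 0 then outward_normal C 0 else outward_normal C (dir x))"
 proof
  fix x show "outward_normal C x = (if x = 0 then outward_normal C 0 else outward_normal C (dir x))"
   using outward_normal_scale[of C "inverse (norm x)" x] conic by (simp add: dir_def)
 qed
 note eq = this
 note [measurable] = id_surf
 show ?thesis by (subst eq) measurable
qed

definition scale :: "real => real \<times> (real^3) => real" where
 "scale \<beta> z = exp (fst z / 2) * q (snd z) powr (- \<beta> / 2)"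

definition unscale :: "real => real^3 => real" where
 "unscale \<beta> x = norm x powr (- 1 / 2) * q (dir x) powr (\<beta> / 2)"

abbreviation \<Psi> :: "real^3 => real \<times> (real^3)" where "\<Psi> == %x. (ln (norm x), dir x)"

lemma AE_cyl_arcs: "AE z in cyl. snd z \<in> arcs"
proof (rule pair_sigma_finite.AE_pair_measure
  [OF pair_sigma_finite.intro[OF sigma_finite_lborel nu.sigma_finite_measure_axioms]])
 show "{z \<in> space cyl. snd z \<in> arcs} \<in> sets cyl" by measurable
qed (use AE_arcs in simp)

lemma weighted_pullback_cone:
 "weighted_pullback (cone_measure P q \<beta>) surf cyl \<Phi> \<Psi> (scale \<beta>) (unscale \<beta>)"
proof
 have "(%x :: real^3. ln (norm x)) \<in> borel_measurable borel" by measurable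
 hence "(%x. ln (norm x)) \<in> surf \<rightarrow>\<^sub>M lborel" unfolding measurable_lborel1 by (rule measurable_restrict_space1)
 thus "(%x. (ln (norm x), dir x)) \<in> surf \<rightarrow>\<^sub>M cyl" by (rule measurable_Pair[OF _ dir_measurable])
 show "scale \<beta> \<in> borel_measurable cyl" unfolding scale_def[abs_def] by measurable
 note [measurable] = id_surf
 show "unscale \<beta> \<in> borel_measurable surf" unfolding unscale_def[abs_def] by measurable
 have "(scale \<beta> z)\<^sup>2 = exp (fst z) * q (snd z) powr (- \<beta>)" for z
  unfolding scale_def power_mult_distrib
  by (simp add: power2_eq_square flip: powr_add exp_add)
 thus "cone_measure P q \<beta> = distr (density cyl (%z. ennreal ((scale \<beta> z)\<^sup>2))) surf \<Phi>"
  by (simp add: cone_measure_eq[OF q_measurable])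
 show "AE z in cyl. \<Psi> (\<Phi> z) = z \<and> scale \<beta> z * unscale \<beta> (\<Phi> z) = 1"
  using AE_cyl_arcs
 proof eventually_elim
  case (elim z)
  hence z: "snd z \<in> \<gamma>" "0 < q (snd z)" using arcs_sub q_pos by auto
  have "scale \<beta> z * unscale \<beta> (\<Phi> z)
    = (exp (fst z / 2) * exp (fst z) powr (- 1 / 2)) * (q (snd z) powr (- \<beta> / 2) * q (snd z) powr (\<beta> / 2))"
   by (simp add: scale_def unscale_def norm_\<Phi>[OF z(1)] dir_\<Phi>[OF z(1)])
  also have "exp (fst z / 2) * exp (fst z) powr (- 1 / 2) = 1" by (simp add: powr_def flip: exp_add)
  also have "q (snd z) powr (- \<beta> / 2) * q (snd z) powr (\<beta> / 2) = 1" using z by (simp flip: powr_add)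
  finally show ?case using z by (simp add: norm_\<Phi> dir_\<Phi>)
 qed
qed measurable

sublocale cone: weighted_pullback "cone_measure P q \<alpha>" surf cyl \<Phi> \<Psi> "scale \<alpha>" "unscale \<alpha>"
 by (rule weighted_pullback_cone)

sublocale dual: weighted_pullback "cone_measure P q (- \<alpha>)" surf cyl \<Phi> \<Psi> "scale (- \<alpha>)" "unscale (- \<alpha>)"
 by (rule weighted_pullback_cone)

sublocale curve: weighted_pullback "curve_measure P q \<alpha>" \<nu> \<nu> "%\<omega>. \<omega>" "%\<omega>. \<omega>" "%\<omega>. q \<omega> powr (- \<alpha> / 2)" "%\<omega>. q \<omega> powr (\<alpha> / 2)"
proof
 have "(q \<omega> powr (- \<alpha> / 2))\<^sup>2 = q \<omega> powr (- \<alpha>)" for \<omega>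
  by (simp add: power2_eq_square flip: powr_add)
 thus "curve_measure P q \<alpha> = distr (density \<nu> (%\<omega>. ennreal ((q \<omega> powr (- \<alpha> / 2))\<^sup>2))) \<nu> (%\<omega>. \<omega>)"
  by (simp add: curve_measure_def distr_id2)
 show "AE \<omega> in \<nu>. \<omega> = \<omega> \<and> q \<omega> powr (- \<alpha> / 2) * q \<omega> powr (\<alpha> / 2) = 1"
  using AE_arcs
 proof eventually_elim
  case (elim \<omega>)
  have "q \<omega> powr (- \<alpha> / 2) * q \<omega> powr (\<alpha> / 2) = q \<omega> powr (- \<alpha> / 2 + \<alpha> / 2)" by (rule powr_add[symmetric])
  thus ?case using q_pos[OF elim] by simp
 qed
qed measurable

lemma normal_orthogonal_arcs: "\<omega> \<in> arcs ==> \<omega> \<bullet> outward_normal C \<omega> = 0"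
proof -
 assume "\<omega> \<in> arcs"
 then obtain j t where j: "j < n" "0 < t" "t < ang j" "\<omega> = ap j t" by (auto simp: arcs_def arc_def)
 show ?thesis unfolding j(4) normal_on_arc[OF j(1-3)] by (rule normal_orthogonal[OF j(1)])
qed

text \<open>
  Homogeneity: the kernel has degree \<open>-2\<close>, so after factoring out \<open>e\<^sup>t\<close> it depends on \<open>s - t\<close> only.
  The component of \<open>\<omega>'\<close> along its own normal vanishes.
\<close>

lemma kernel_identity:
 assumes w: "\<omega> \<in> arcs" "\<omega>' \<in> arcs"
 shows "exp (s / 2) * q \<omega> powr (- \<alpha> / 2) * (1 / (4 * pi)) *
   (exp (2 * t) * (((exp t *\<^sub>R \<omega>' - exp s *\<^sub>R \<omega>) \<bullet> outward_normal C (exp t *\<^sub>R \<omega>')) / norm (exp s *\<^sub>R \<omega> - exp t *\<^sub>R \<omega>') ^ 3))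
  = k (s - t) \<omega> \<omega>' * (exp (t / 2) * q \<omega>' powr (- \<alpha> / 2))"
proof -
 define N where "N = \<omega> \<bullet> outward_normal C \<omega>'"
 define D where "D = norm (exp (s - t) *\<^sub>R \<omega> - \<omega>')"
 define X where "X = N / D ^ 3"
 define a where "a = exp (s / 2)"
 define b where "b = exp (t / 2)"
 define A where "A = q \<omega> powr (- \<alpha> / 2)"
 have b: "b \<noteq> 0" by (simp add: b_def)
 have nr: "outward_normal C (exp t *\<^sub>R \<omega>') = outward_normal C \<omega>'" using outward_normal_scale[of C "exp t" \<omega>'] conic by simp
 have q': "q \<omega>' powr (\<alpha> / 2) * q \<omega>' powr (- \<alpha> / 2) = 1"
 proof -
  have "q \<omega>' powr (\<alpha> / 2) * q \<omega>' powr (- \<alpha> / 2) = q \<omega>' powr (\<alpha> / 2 + - \<alpha> / 2)" by (rule powr_add[symmetric])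
  thus ?thesis using q_pos[OF w(2)] by simp
 qed
 have es: "exp s = a\<^sup>2" "exp t = b\<^sup>2" "exp (2 * t) = b ^ 4"
  by (simp_all add: a_def b_def flip: exp_of_nat_mult)
 have e3: "exp (3 / 2 * (s - t)) = a ^ 3 / b ^ 3"
 proof -
  have "a ^ 3 = exp (3 / 2 * s)" "b ^ 3 = exp (3 / 2 * t)"
   unfolding a_def b_def by (simp_all flip: exp_of_nat_mult)
  thus ?thesis by (simp add: right_diff_distrib exp_diff)
 qed
 have inner: "(exp t *\<^sub>R \<omega>' - exp s *\<^sub>R \<omega>) \<bullet> outward_normal C \<omega>' = - (a\<^sup>2 * N)"
  using normal_orthogonal_arcs[OF w(2)] by (simp add: inner_diff_left N_def es)
 have "exp s *\<^sub>R \<omega> - exp t *\<^sub>R \<omega>' = exp t *\<^sub>R (exp (s - t) *\<^sub>R \<omega> - \<omega>')"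
  by (simp add: scaleR_diff_right exp_diff)
 hence dist: "norm (exp s *\<^sub>R \<omega> - exp t *\<^sub>R \<omega>') = b\<^sup>2 * D" by (simp add: D_def es(2)[symmetric])
 have "a * A * (1 / (4 * pi)) * (b ^ 4 * (- (a\<^sup>2 * N) / (b\<^sup>2 * D) ^ 3)) = - (1 / (4 * pi)) * A * (a ^ 3 / b\<^sup>2) * X"
 proof -
  have "- (a\<^sup>2 * N) / (b\<^sup>2 * D) ^ 3 = - (a\<^sup>2 / b ^ 6 * X)" by (simp add: X_def power_mult_distrib flip: power_mult)
  hence "a * A * (1 / (4 * pi)) * (b ^ 4 * (- (a\<^sup>2 * N) / (b\<^sup>2 * D) ^ 3)) = a * A * (1 / (4 * pi)) * (b ^ 4 * (- (a\<^sup>2 / b ^ 6 * X)))" by simp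
  also have "... = - (1 / (4 * pi)) * A * (a ^ 3 / b\<^sup>2) * X" using b by (simp add: field_simps power2_eq_square power3_eq_cube eval_nat_numeral)
  finally show ?thesis .
 qed
 also have "... = - (1 / (4 * pi)) * (A * (q \<omega>' powr (\<alpha> / 2) * q \<omega>' powr (- \<alpha> / 2))) * (a ^ 3 / b ^ 3 * X) * b"
  unfolding q' using b by (simp add: power2_eq_square power3_eq_cube)
 also have "... = - (1 / (4 * pi)) * (A * q \<omega>' powr (\<alpha> / 2)) * (a ^ 3 / b ^ 3 * N / D ^ 3) * (b * q \<omega>' powr (- \<alpha> / 2))"
  by (simp add: X_def mult_ac)
 also have "... = k (s - t) \<omega> \<omega>' * (exp (t / 2) * q \<omega>' powr (- \<alpha> / 2))"
  using w unfolding k_def e3 N_def[symmetric] D_def[symmetric] by (simp add: A_def b_def)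
 finally show ?thesis unfolding nr inner dist es(3) by (simp only: a_def A_def)
qed

lemma sigma_finite_cyl: "sigma_finite_measure cyl"
 by (intro sigma_finite_pair_measure sigma_finite_lborel nu.sigma_finite_measure_axioms)

lemma NP_op_eq:
 assumes [measurable]: "f \<in> borel_measurable surf"
 shows "NP_op C P f x = of_real (1 / (4 * pi)) * (\<integral>w. of_real (exp (2 * fst w)) *
  (f (\<Phi> w) * of_real (((\<Phi> w - x) \<bullet> outward_normal C (\<Phi> w)) / norm (x - \<Phi> w) ^ 3)) \<partial>cyl)"
proof -
 let ?I = "%y. f y * complex_of_real (((y - x) \<bullet> outward_normal C y) / norm (x - y) ^ 3)"
 let ?w = "%z :: real \<times> (real^3). exp (2 * fst z)"
 have m: "?I \<in> borel_measurable surf"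
  by (intro borel_measurable_times of_real_compose borel_measurable_divide borel_measurable_inner
    borel_measurable_diff borel_measurable_power norm_compose borel_measurable_const
    assms id_surf outward_normal_surf_measurable)
 have I\<Phi>: "(%z. ?I (\<Phi> z)) \<in> borel_measurable cyl" by (rule measurable_compose[OF \<Phi>_measurable m])
 have w: "?w \<in> borel_measurable cyl" by measurable
 have \<Phi>d: "\<Phi> \<in> density cyl (%z. ennreal (?w z)) \<rightarrow>\<^sub>M surf" by simp
 have "(\<integral>y. ?I y \<partial>surface_measure P) = (\<integral>z. ?I (\<Phi> z) \<partial>density cyl (%z. ennreal (?w z)))"
  unfolding surface_measure_eq by (rule integral_distr[OF \<Phi>d m])
 also have "... = (\<integral>z. ?w z *\<^sub>R ?I (\<Phi> z) \<partial>cyl)"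
  by (rule integral_density[OF I\<Phi> w]) simp
 finally show ?thesis unfolding NP_op_def by (simp only: scaleR_conv_of_real)
qed

lemma NP_op_measurable:
 assumes [measurable]: "f \<in> borel_measurable surf" shows "NP_op C P f \<in> borel_measurable surf"
proof -
 have "(%x. \<integral>w. of_real (exp (2 * fst w)) *
   (f (\<Phi> w) * of_real (((\<Phi> w - x) \<bullet> outward_normal C (\<Phi> w)) / norm (x - \<Phi> w) ^ 3)) \<partial>cyl) \<in> borel_measurable surf"
 proof (rule sigma_finite_measure.borel_measurable_lebesgue_integral[OF sigma_finite_cyl])
  note \<Phi>2 = measurable_compose[OF measurable_snd \<Phi>_measurable, of surf]
  have "(%z. fst (snd z)) \<in> surf \<Otimes>\<^sub>M cyl \<rightarrow>\<^sub>M borel" by measurable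
  thus "(%(x, w). of_real (exp (2 * fst w)) *
   (f (\<Phi> w) * of_real (((\<Phi> w - x) \<bullet> outward_normal C (\<Phi> w)) / norm (x - \<Phi> w) ^ 3)) :: complex)
   \<in> borel_measurable (surf \<Otimes>\<^sub>M cyl)"
   unfolding split_beta'
   by (intro borel_measurable_times of_real_compose borel_measurable_divide borel_measurable_inner
     borel_measurable_diff borel_measurable_power norm_compose borel_measurable_const exp_compose
     measurable_compose[OF \<Phi>2 assms] measurable_compose[OF \<Phi>2 id_surf] measurable_compose[OF measurable_fst id_surf]
     measurable_compose[OF \<Phi>2 outward_normal_surf_measurable])
 qed
 thus ?thesis unfolding NP_op_eq[OF assms, abs_def] by measurable
qed

lemma cone_intertwines: "cone.intertwines (NP_op C P) conv.conv"
 unfolding cone.intertwines_def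
proof (intro ballI conjI)
 fix f assume f: "f \<in> L2 (cone_measure P q \<alpha>)"
 have fm [measurable]: "f \<in> borel_measurable surf" using L2_measurable[OF f] by (simp add: cone.measurable_M)
 have [measurable]: "cone.V f \<in> borel_measurable cyl" by (rule cone.V_measurable[OF fm])
 show ae: "AE z in cyl. cone.V (NP_op C P f) z = conv.conv (cone.V f) z"
  using AE_cyl_arcs AE_space
 proof eventually_elim
  case (elim z)
  have zs: "snd z \<in> space \<nu>" using elim(2) by (auto simp: space_pair_measure)
  let ?I = "%w. of_real (exp (2 * fst w)) *
   (f (\<Phi> w) * of_real (((\<Phi> w - \<Phi> z) \<bullet> outward_normal C (\<Phi> w)) / norm (\<Phi> z - \<Phi> w) ^ 3)) :: complex"
  let ?c = "complex_of_real (scale \<alpha> z * (1 / (4 * pi)))"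
  have "cone.V (NP_op C P f) z = ?c * (\<integral>w. ?I w \<partial>cyl)" unfolding cone.V_def NP_op_eq[OF fm] by simp
  also have "... = (\<integral>w. ?c * ?I w \<partial>cyl)" by (rule integral_mult_right_zero[symmetric])
  also have "... = (\<integral>w. conv.cyl_kernel z w * cone.V f w \<partial>cyl)"
  proof (rule integral_cong_AE)
   have "(%w. fst w) \<in> cyl \<rightarrow>\<^sub>M borel" by measurable
   thus "(%w. ?c * ?I w) \<in> borel_measurable cyl"
    by (intro borel_measurable_times of_real_compose borel_measurable_divide borel_measurable_inner
      borel_measurable_diff borel_measurable_power norm_compose borel_measurable_const exp_compose
      measurable_compose[OF \<Phi>_measurable fm] measurable_compose[OF \<Phi>_measurable id_surf]
      measurable_compose[OF \<Phi>_measurable outward_normal_surf_measurable])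
   have m: "(%w. (fst z - fst w, snd z, snd w)) \<in> cyl \<rightarrow>\<^sub>M borel \<Otimes>\<^sub>M \<nu> \<Otimes>\<^sub>M \<nu>" using zs by measurable
   have "(%w. k (fst z - fst w) (snd z) (snd w)) \<in> borel_measurable cyl"
    using measurable_compose[OF m k_measurable] by (simp only: prod.case)
   hence "(%w. conv.cyl_kernel z w) \<in> borel_measurable cyl"
    unfolding conv.cyl_kernel_def by (rule of_real_compose)
   thus "(%w. conv.cyl_kernel z w * cone.V f w) \<in> borel_measurable cyl"
    by (rule borel_measurable_times[OF _ cone.V_measurable[OF fm]])
   show "AE w in cyl. ?c * ?I w = conv.cyl_kernel z w * cone.V f w"
    using AE_cyl_arcs
   proof eventually_elim
    fix w :: "real \<times> (real^3)" assume w: "snd w \<in> arcs"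
    have "?c * ?I w = of_real (scale \<alpha> z * (1 / (4 * pi)) * (exp (2 * fst w) *
      (((\<Phi> w - \<Phi> z) \<bullet> outward_normal C (\<Phi> w)) / norm (\<Phi> z - \<Phi> w) ^ 3))) * f (\<Phi> w)"
     by (simp add: mult_ac)
    also have "scale \<alpha> z * (1 / (4 * pi)) * (exp (2 * fst w) *
      (((\<Phi> w - \<Phi> z) \<bullet> outward_normal C (\<Phi> w)) / norm (\<Phi> z - \<Phi> w) ^ 3)) = k (fst z - fst w) (snd z) (snd w) * scale \<alpha> w"
     unfolding \<Phi>_def scale_def by (rule kernel_identity[OF elim(1) w])
    finally show "?c * ?I w = conv.cyl_kernel z w * cone.V f w"
     by (simp add: conv.cyl_kernel_def cone.V_def mult.assoc)
   qed
  qed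
  finally show ?case by (simp add: conv.conv_def)
 qed
 have "conv.conv (cone.V f) \<in> L2 cyl" by (rule bounded_op_L2[OF conv.bounded_conv cone.V_L2[OF f]])
 hence "cone.V (NP_op C P f) \<in> L2 cyl"
  by (rule L2_cong_AE[OF _ cone.V_measurable[OF NP_op_measurable[OF fm]] ae])
 thus "NP_op C P f \<in> L2 (cone_measure P q \<alpha>)" using cone.V_L2_iff[OF NP_op_measurable[OF fm]] by simp
qed

text \<open>
  The weights \<open>q\<^sup>-\<^sup>\<alpha>\<^sup>/\<^sup>2\<close> and \<open>q\<^sup>\<alpha>\<^sup>/\<^sup>2\<close> of the two spaces cancel, and \<open>e\<^sup>s\<^sup>/\<^sup>2 e\<^sup>s\<^sup>/\<^sup>2\<close> is the density of \<open>dr\<close>.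
\<close>

lemma pairing:
 assumes [measurable]: "u \<in> borel_measurable surf" "v \<in> borel_measurable surf"
 shows "L2_inner (cone_measure P q 0) u v = L2_inner cyl (cone.V u) (dual.V v)"
proof -
 interpret flat: weighted_pullback "cone_measure P q 0" surf cyl \<Phi> \<Psi> "scale 0" "unscale 0"
  by (rule weighted_pullback_cone)
 have [measurable]: "cone.V u \<in> borel_measurable cyl" "dual.V v \<in> borel_measurable cyl"
  by (auto intro: cone.V_measurable dual.V_measurable)
 have "L2_inner (cone_measure P q 0) u v = (\<integral>z. of_real ((scale 0 z)\<^sup>2) * (u (\<Phi> z) * cnj (v (\<Phi> z))) \<partial>cyl)"
  unfolding L2_inner_def by (rule flat.integral_M) measurable
 also have "... = (\<integral>z. cone.V u z * cnj (dual.V v z) \<partial>cyl)"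
 proof (rule integral_cong_AE)
  show "AE z in cyl. of_real ((scale 0 z)\<^sup>2) * (u (\<Phi> z) * cnj (v (\<Phi> z))) = cone.V u z * cnj (dual.V v z)"
   using AE_cyl_arcs
  proof eventually_elim
   case (elim z)
   have q: "0 < q (snd z)" by (rule q_pos[OF elim])
   have qq: "q (snd z) powr (- \<alpha> / 2) * q (snd z) powr (- (- \<alpha>) / 2) = 1" using q by (simp flip: powr_add)
   have "(scale 0 z)\<^sup>2 = exp (fst z / 2) * exp (fst z / 2) * (q (snd z) powr (- \<alpha> / 2) * q (snd z) powr (- (- \<alpha>) / 2))"
    unfolding qq using q by (simp add: scale_def power2_eq_square)
   also have "... = scale \<alpha> z * scale (- \<alpha>) z" by (simp add: scale_def mult_ac)
   finally show ?case by (simp add: cone.V_def dual.V_def mult_ac)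
  qed
 qed measurable
 finally show ?thesis by (simp add: L2_inner_def)
qed

text \<open>
  In cylindrical coordinates the unweighted pairing of the two weighted spaces becomes the inner
  product, so the adjoint exists and is the convolution with the flipped kernel.
\<close>

lemma dual_intertwines: "dual.intertwines (NP_adj C P q \<alpha>) conv.conv'"
proof -
 let ?A = "cone_measure P q \<alpha>" and ?B = "cone_measure P q (- \<alpha>)" and ?K = "NP_op C P"
 define Q where "Q T \<longleftrightarrow> bounded_op ?B T \<and> (\<forall>u\<in>L2 ?A. \<forall>v\<in>L2 ?B.
  L2_inner (cone_measure P q 0) (?K u) v = L2_inner (cone_measure P q 0) u (T v))" for T
 have adj: "L2_inner cyl (conv.conv U) U' = L2_inner cyl U (conv.conv' U')" if "U \<in> L2 cyl" "U' \<in> L2 cyl" for U U'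
  using conv.conv_adjoint that by (simp add: adjoint_pair_def)
 have bc': "bounded_op cyl conv.conv'" using conv.conv_adjoint by (simp add: adjoint_pair_def)
 have mA: "u \<in> borel_measurable surf" if "u \<in> L2 ?A" for u using L2_measurable[OF that] by (simp add: cone.measurable_M)
 have mB: "v \<in> borel_measurable surf" if "v \<in> L2 ?B" for v using L2_measurable[OF that] by (simp add: dual.measurable_M)
 have left: "L2_inner (cone_measure P q 0) (?K u) v = L2_inner cyl (cone.V u) (conv.conv' (dual.V v))"
  if u: "u \<in> L2 ?A" and v: "v \<in> L2 ?B" for u v
 proof -
  have K: "?K u \<in> L2 ?A" "AE z in cyl. cone.V (?K u) z = conv.conv (cone.V u) z"
   using cone_intertwines u by (auto simp: cone.intertwines_def)
  have "L2_inner (cone_measure P q 0) (?K u) v = L2_inner cyl (cone.V (?K u)) (dual.V v)"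
   by (rule pairing[OF mA[OF K(1)] mB[OF v]])
  also have "... = L2_inner cyl (conv.conv (cone.V u)) (dual.V v)"
   by (rule L2_inner_cong_AE[OF cone.V_L2[OF K(1)] bounded_op_L2[OF conv.bounded_conv cone.V_L2[OF u]]
      dual.V_L2[OF v] dual.V_L2[OF v] K(2)]) simp
  also have "... = L2_inner cyl (cone.V u) (conv.conv' (dual.V v))" by (rule adj[OF cone.V_L2[OF u] dual.V_L2[OF v]])
  finally show ?thesis .
 qed
 have "Q (%v. dual.W (conv.conv' (dual.V v)))" (is "Q ?T")
 proof -
  have T: "?T v \<in> L2 ?B" "AE z in cyl. dual.V (?T v) z = conv.conv' (dual.V v) z" if "v \<in> L2 ?B" for v
   using dual.W_L2 dual.VW bounded_op_L2[OF bc' dual.V_L2[OF that]] by auto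
  hence "dual.intertwines ?T conv.conv'" by (simp add: dual.intertwines_def)
  moreover have "L2_inner (cone_measure P q 0) u (?T v) = L2_inner cyl (cone.V u) (conv.conv' (dual.V v))"
   if u: "u \<in> L2 ?A" and v: "v \<in> L2 ?B" for u v
   unfolding pairing[OF mA[OF u] mB[OF T(1)[OF v]]]
   by (rule L2_inner_cong_AE[OF cone.V_L2[OF u] cone.V_L2[OF u] dual.V_L2[OF T(1)[OF v]]
      bounded_op_L2[OF bc' dual.V_L2[OF v]] _ T(2)[OF v]]) simp
  ultimately show ?thesis unfolding Q_def using dual.bounded_op_pullback[OF _ bc'] left by auto
 qed
 hence "Q (SOME T. Q T)" by (rule someI[of Q])
 moreover have "(SOME T. Q T) = NP_adj C P q \<alpha>" unfolding NP_adj_def Q_def ..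
 ultimately have QN: "Q (NP_adj C P q \<alpha>)" by simp
 show ?thesis unfolding dual.intertwines_def
 proof (intro ballI conjI)
  fix v assume v: "v \<in> L2 ?B"
  let ?N = "NP_adj C P q \<alpha> v"
  show N: "?N \<in> L2 ?B" using QN v bounded_op_L2 unfolding Q_def by blast
  let ?d = "%z. dual.V ?N z - conv.conv' (dual.V v) z"
  have c': "conv.conv' (dual.V v) \<in> L2 cyl" by (rule bounded_op_L2[OF bc' dual.V_L2[OF v]])
  have d: "?d \<in> L2 cyl" by (rule L2_diff[OF dual.V_L2[OF N] c'])
  \<comment> \<open>Test the adjoint identity with the element that represents the difference itself.\<close>
  let ?u = "cone.W ?d"
  have u: "?u \<in> L2 ?A" by (rule cone.W_L2[OF d])
  have Vu: "AE z in cyl. cone.V ?u z = ?d z" by (rule cone.VW[OF d])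
  have "L2_inner cyl (cone.V ?u) (dual.V ?N) = L2_inner cyl (cone.V ?u) (conv.conv' (dual.V v))"
   using QN u v left[OF u v] pairing[OF mA[OF u] mB[OF N]] unfolding Q_def by simp
  hence "L2_inner cyl (dual.V ?N) (cone.V ?u) = L2_inner cyl (conv.conv' (dual.V v)) (cone.V ?u)"
   by (subst (1 2) L2_inner_cnj) simp
  hence "L2_inner cyl ?d (cone.V ?u) = 0"
   using L2_inner_diff[OF dual.V_L2[OF N] c' cone.V_L2[OF u]] by simp
  hence "L2_inner cyl (cone.V ?u) ?d = 0" by (subst L2_inner_cnj) simp
  moreover have "L2_inner cyl (cone.V ?u) ?d = L2_inner cyl ?d ?d"
   by (rule L2_inner_cong_AE[OF cone.V_L2[OF u] d d d Vu]) simp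
  ultimately have "complex_of_real ((L2_norm cyl ?d)\<^sup>2) = 0" using L2_inner_self[of cyl ?d] by simp
  hence "L2_norm cyl ?d <= 0" by simp
  thus "AE z in cyl. dual.V ?N z = conv.conv' (dual.V v) z" by (rule L2_eqI[OF dual.V_L2[OF N] c'])
 qed
qed

text \<open>
  On the imaginary axis the substitution \<open>t = e\<^sup>s\<close> turns the Mellin transform into a Fourier transform.
\<close>

lemma mellin_kernel_eq:
 assumes z: "Re z = 0"
 shows "mellin_kernel C z \<omega> \<omega>' = (\<integral>s. of_real (exp (3 / 2 * s) * (\<omega> \<bullet> outward_normal C \<omega>') / norm (exp s *\<^sub>R \<omega> - \<omega>') ^ 3) * cis (Im z * s) \<partial>lborel)"
proof -
 define H where "H t = complex_of_real ((t *\<^sub>R \<omega>) \<bullet> outward_normal C \<omega>' / norm (t *\<^sub>R \<omega> - \<omega>') ^ 3)" for t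
 define f where "f t = exp ((z + 1 / 2) * complex_of_real (ln t)) * H t / complex_of_real t" for t
 have [measurable]: "f \<in> borel_measurable borel"
  unfolding f_def[abs_def] H_def by measurable
 have "mellin_kernel C z \<omega> \<omega>' = (LINT t:{0<..}|lborel. f t)"
  unfolding mellin_kernel_def f_def H_def
  by (rule set_lebesgue_integral_cong) (auto simp: powr_def Ln_of_real)
 also have "... = (\<integral>s. of_real (exp s) * f (exp s) \<partial>lborel)" by (rule integral_exp_substitution) measurable
 also have "... = (\<integral>s. of_real (exp (3 / 2 * s) * (\<omega> \<bullet> outward_normal C \<omega>') / norm (exp s *\<^sub>R \<omega> - \<omega>') ^ 3) * cis (Im z * s) \<partial>lborel)"
 proof (rule Bochner_Integration.integral_cong[OF refl])
  fix s :: real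
  have zi: "z = \<i> * of_real (Im z)" using z by (simp add: complex_eq_iff)
  have "exp ((z + 1 / 2) * complex_of_real s) = exp (of_real (s / 2)) * cis (Im z * s)"
   unfolding cis_conv_exp exp_add[symmetric] by (subst zi) (simp add: algebra_simps)
  hence "of_real (exp s) * f (exp s) = of_real (exp (s / 2)) * cis (Im z * s) * H (exp s)"
   by (simp add: f_def flip: exp_of_real)
  also have "... = of_real (exp (s / 2) * exp s * (\<omega> \<bullet> outward_normal C \<omega>') / norm (exp s *\<^sub>R \<omega> - \<omega>') ^ 3) * cis (Im z * s)"
   by (simp add: H_def)
  also have "exp (s / 2) * exp s = exp (3 / 2 * s)" by (simp flip: exp_add)
  finally show "of_real (exp s) * f (exp s) = of_real (exp (3 / 2 * s) * (\<omega> \<bullet> outward_normal C \<omega>') / norm (exp s *\<^sub>R \<omega> - \<omega>') ^ 3) * cis (Im z * s)" .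
 qed
 finally show ?thesis .
qed

lemma symbol_kernel_eq:
 assumes z: "Re z = 0"
 shows "conv.symbol_kernel (- Im z) \<omega> \<omega>' = (if \<omega> \<in> arcs \<and> \<omega>' \<in> arcs then
  of_real (- (1 / (4 * pi)) * (q \<omega> powr (- \<alpha> / 2) * q \<omega>' powr (\<alpha> / 2))) * mellin_kernel C z \<omega> \<omega>' else 0)"
proof (cases "\<omega> \<in> arcs \<and> \<omega>' \<in> arcs")
 case True
 thus ?thesis
  unfolding conv.symbol_kernel_def mellin_kernel_eq[OF z] integral_mult_right_zero[symmetric]
  by (auto simp: k_def mult.assoc intro!: Bochner_Integration.integral_cong)
next
 case False
 hence k0: "k s \<omega> \<omega>' = 0" for s by (auto simp: k_def)
 show ?thesis unfolding if_not_P[OF False] conv.symbol_kernel_def k0 by simp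
qed

lemma mellin_kernel_measurable:
 assumes z: "Re z = 0" shows "(%(\<omega>, \<omega>'). mellin_kernel C z \<omega> \<omega>') \<in> borel_measurable (\<nu> \<Otimes>\<^sub>M \<nu>)"
proof -
 note [measurable] = id_measurable
 show ?thesis unfolding mellin_kernel_eq[OF z] split_beta'
  by (rule lborel.borel_measurable_lebesgue_integral) measurable
qed

lemma curve_intertwines:
 assumes z: "Re z = 0" shows "curve.intertwines (mellin_op C P z) (conv.symbol (- Im z))"
 unfolding curve.intertwines_def
proof (intro ballI conjI)
 fix v assume v: "v \<in> L2 (curve_measure P q \<alpha>)"
 have vm [measurable]: "v \<in> borel_measurable \<nu>" using L2_measurable[OF v] by (simp add: curve.measurable_M)
 note mk = mellin_kernel_measurable[OF z]
 have mo: "mellin_op C P z v \<in> borel_measurable \<nu>"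
 proof -
  note [measurable] = mk
  have "(%\<omega>. \<integral>\<omega>'. mellin_kernel C z \<omega> \<omega>' * v \<omega>' \<partial>\<nu>) \<in> borel_measurable \<nu>"
   by (rule nu.borel_measurable_lebesgue_integral) measurable
  thus ?thesis unfolding mellin_op_def[abs_def] by measurable
 qed
 show ae: "AE \<omega> in \<nu>. curve.V (mellin_op C P z v) \<omega> = conv.symbol (- Im z) (curve.V v) \<omega>"
  using AE_arcs AE_space
 proof eventually_elim
  case (elim \<omega>)
  let ?c = "complex_of_real (q \<omega> powr (- \<alpha> / 2)) * (- complex_of_real (1 / (4 * pi)))"
  have m: "(%\<omega>'. mellin_kernel C z \<omega> \<omega>') \<in> borel_measurable \<nu>"
   using measurable_compose[OF measurable_Pair1'[OF elim(2)] mk] by (simp only: prod.case)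
  have "curve.V (mellin_op C P z v) \<omega> = ?c * (\<integral>\<omega>'. mellin_kernel C z \<omega> \<omega>' * v \<omega>' \<partial>\<nu>)"
   unfolding curve.V_def mellin_op_def by simp
  also have "... = (\<integral>\<omega>'. ?c * (mellin_kernel C z \<omega> \<omega>' * v \<omega>') \<partial>\<nu>)" by (rule integral_mult_right_zero[symmetric])
  also have "... = (\<integral>\<omega>'. conv.symbol_kernel (- Im z) \<omega> \<omega>' * curve.V v \<omega>' \<partial>\<nu>)"
  proof (rule integral_cong_AE)
   show "AE \<omega>' in \<nu>. ?c * (mellin_kernel C z \<omega> \<omega>' * v \<omega>') = conv.symbol_kernel (- Im z) \<omega> \<omega>' * curve.V v \<omega>'"
    using AE_arcs
   proof eventually_elim
    fix \<omega>' assume w: "\<omega>' \<in> arcs"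
    have "q \<omega>' powr (\<alpha> / 2) * q \<omega>' powr (- \<alpha> / 2) = q \<omega>' powr (\<alpha> / 2 + - \<alpha> / 2)" by (rule powr_add[symmetric])
    hence "q \<omega>' powr (\<alpha> / 2) * q \<omega>' powr (- \<alpha> / 2) = 1" using q_pos[OF w] by simp
    hence "complex_of_real (q \<omega>' powr (\<alpha> / 2)) * of_real (q \<omega>' powr (- \<alpha> / 2)) = 1" by (simp flip: of_real_mult)
    moreover have "conv.symbol_kernel (- Im z) \<omega> \<omega>' * curve.V v \<omega>' = ?c *
      (complex_of_real (q \<omega>' powr (\<alpha> / 2)) * of_real (q \<omega>' powr (- \<alpha> / 2))) * (mellin_kernel C z \<omega> \<omega>' * v \<omega>')"
     unfolding symbol_kernel_eq[OF z] curve.V_def using elim(1) w by (simp add: mult_ac)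
    ultimately show "?c * (mellin_kernel C z \<omega> \<omega>' * v \<omega>') = conv.symbol_kernel (- Im z) \<omega> \<omega>' * curve.V v \<omega>'" by simp
   qed
   show "(%\<omega>'. ?c * (mellin_kernel C z \<omega> \<omega>' * v \<omega>')) \<in> borel_measurable \<nu>"
    by (intro borel_measurable_times borel_measurable_const m vm)
   have "(%\<omega>'. complex_of_real (- (1 / (4 * pi)) * (q \<omega> powr (- \<alpha> / 2) * q \<omega>' powr (\<alpha> / 2)))) \<in> borel_measurable \<nu>"
    by measurable
   from borel_measurable_times[OF this m]
   have "(%\<omega>'. if \<omega>' \<in> arcs then of_real (- (1 / (4 * pi)) * (q \<omega> powr (- \<alpha> / 2) * q \<omega>' powr (\<alpha> / 2))) * mellin_kernel C z \<omega> \<omega>' else 0) \<in> borel_measurable \<nu>"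
    by (rule measurable_If) (simp, measurable)
   thus "(%\<omega>'. conv.symbol_kernel (- Im z) \<omega> \<omega>' * curve.V v \<omega>') \<in> borel_measurable \<nu>"
    unfolding symbol_kernel_eq[OF z] using elim(1)
    by (simp only: simp_thms) (rule borel_measurable_times[OF _ curve.V_measurable[OF vm]])
  qed
  finally show ?case by (simp add: conv.symbol_def)
 qed
 have "conv.symbol (- Im z) (curve.V v) \<in> L2 \<nu>" by (rule bounded_op_L2[OF conv.bounded_symbol curve.V_L2[OF v]])
 hence "curve.V (mellin_op C P z v) \<in> L2 \<nu>" by (rule L2_cong_AE[OF _ curve.V_measurable[OF mo] ae])
 thus "mellin_op C P z v \<in> L2 (curve_measure P q \<alpha>)" using curve.V_L2_iff[OF mo] by simp
qed

section \<open>Conclusion\<close>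

lemma invertible_iff_elliptic:
 "invertible_op (cone_measure P q \<alpha>) (shift (NP_op C P) \<mu>) \<longleftrightarrow> conv.uniformly_elliptic \<mu>"
proof
 note i = cone.intertwines_shift[OF cone_intertwines, of \<mu>]
 note b = bounded_op_shift[OF conv.bounded_conv, of \<mu>]
 {
  assume "conv.uniformly_elliptic \<mu>"
  thus "invertible_op (cone_measure P q \<alpha>) (shift (NP_op C P) \<mu>)"
   by (rule cone.invertible_pullback[OF i conv.invertible_if_elliptic])
 next
  assume "invertible_op (cone_measure P q \<alpha>) (shift (NP_op C P) \<mu>)"
  then obtain R where "is_inverse_op (cone_measure P q \<alpha>) (shift (NP_op C P) \<mu>) R" by (auto simp: invertible_op_def)
  from cone.inverse_pushforward[OF i b this] b have "invertible_op cyl (shift conv.conv \<mu>)"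
   unfolding invertible_op_def by blast
  thus "conv.uniformly_elliptic \<mu>" by (rule conv.elliptic_if_invertible)
 }
qed

lemma symbols_invertible_iff_elliptic:
 "(\<forall>z. Re z = 0 --> \<mu> \<notin> spectrum (curve_measure P q \<alpha>) (mellin_op C P z)) \<and>
  bdd_above ((%z. op_norm (curve_measure P q \<alpha>) (inverse_op (curve_measure P q \<alpha>) (shift (mellin_op C P z) \<mu>))) ` {z. Re z = 0})
  \<longleftrightarrow> conv.uniformly_elliptic \<mu>"
proof
 let ?M = "curve_measure P q \<alpha>"
 let ?T = "%z. shift (mellin_op C P z) \<mu>"
 note i = curve.intertwines_shift[where \<mu> = \<mu>, OF curve_intertwines]
 note b = bounded_op_shift[where \<mu> = \<mu>, OF conv.bounded_symbol]
 have inv: "is_inverse_op ?M (?T z) (inverse_op ?M (?T z))" if "invertible_op ?M (?T z)" for z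
 proof -
  have "\<exists>S. is_inverse_op ?M (?T z) S" using that by (simp add: invertible_op_def)
  thus ?thesis unfolding inverse_op_def by (rule someI_ex)
 qed
 {
  assume "(\<forall>z. Re z = 0 --> \<mu> \<notin> spectrum ?M (mellin_op C P z)) \<and> bdd_above ((%z. op_norm ?M (inverse_op ?M (?T z))) ` {z. Re z = 0})"
  then obtain B where I: "\<And>z. Re z = 0 ==> invertible_op ?M (?T z)" and B: "\<And>z. Re z = 0 ==> op_norm ?M (inverse_op ?M (?T z)) <= B"
   by (auto simp: spectrum_def bdd_above_def)
  define c where "c = 1 / max B 1"
  have "bounded_below \<nu> (shift (conv.symbol \<xi>) \<mu>) c \<and> bounded_below \<nu> (shift (conv.symbol' \<xi>) (cnj \<mu>)) c" for \<xi>
  proof -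
   \<comment> \<open>the point of the imaginary axis whose Mellin operator has frequency \<xi>\<close>
   define z where "z = \<i> * of_real (- \<xi>)"
   have z: "Re z = 0" "- Im z = \<xi>" by (simp_all add: z_def)
   let ?R = "inverse_op ?M (?T z)"
   note R = inv[OF I[OF z(1)]]
   have Rb: "bounded_op ?M ?R" using R by (simp add: is_inverse_op_def)
   have S: "is_inverse_op \<nu> (shift (conv.symbol \<xi>) \<mu>) (%f. curve.V (?R (curve.W f)))"
    using curve.inverse_pushforward[OF i[OF z(1)] b R] by (simp add: z(2))
   have le: "L2_norm \<nu> (curve.V (?R (curve.W f))) <= max B 1 * L2_norm \<nu> f" if f: "f \<in> L2 \<nu>" for f
   proof -
    have "L2_norm \<nu> (curve.V (?R (curve.W f))) = L2_norm ?M (?R (curve.W f))"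
     by (rule curve.V_norm[OF bounded_op_L2[OF Rb curve.W_L2[OF f]]])
    also have "... <= op_norm ?M ?R * L2_norm ?M (curve.W f)" by (rule op_norm_bound[OF Rb curve.W_L2[OF f]])
    also have "... <= max B 1 * L2_norm ?M (curve.W f)"
     using B[OF z(1)] by (intro mult_right_mono L2_norm_nonneg) auto
    finally show ?thesis by (simp add: curve.W_norm[OF f])
   qed
   show ?thesis
    using bounded_below_if_inverse[OF S conv.shifted_symbol_adjoint _ le] unfolding c_def by simp
  qed
  moreover have "0 < c" by (simp add: c_def)
  ultimately show "conv.uniformly_elliptic \<mu>" unfolding conv.uniformly_elliptic_def by blast
 next
  assume "conv.uniformly_elliptic \<mu>"
  then obtain c where c: "0 < c" "\<And>\<xi>. bounded_below \<nu> (shift (conv.symbol \<xi>) \<mu>) c"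
   "\<And>\<xi>. bounded_below \<nu> (shift (conv.symbol' \<xi>) (cnj \<mu>)) c"
   by (auto simp: conv.uniformly_elliptic_def)
  have I: "invertible_op ?M (?T z)" if "Re z = 0" for z
   by (rule curve.invertible_pullback[OF i[OF that] invertible_if_bounded_below[OF conv.shifted_symbol_adjoint c(1) c(2) c(3)]])
  have "op_norm ?M (inverse_op ?M (?T z)) <= 1 / c" if z: "Re z = 0" for z
   by (rule op_norm_inverse_le[OF inv[OF I[OF z]] _ c(1) curve.bounded_below_pullback[OF i[OF z] b c(2)]])
     (use I[OF z] in \<open>simp add: invertible_op_def\<close>)
  thus "(\<forall>z. Re z = 0 --> \<mu> \<notin> spectrum ?M (mellin_op C P z)) \<and> bdd_above ((%z. op_norm ?M (inverse_op ?M (?T z))) ` {z. Re z = 0})"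
   using I by (auto simp: spectrum_def intro!: bdd_aboveI2)
 }
qed

text \<open>
  The region \<open>\<bar>x\<bar> \<le> d\<close> corresponds to \<open>s \<le> ln d\<close>.
\<close>

lemma Weyl_sequence_near_vertex:
 assumes d: "0 < d" and ne: "\<not> conv.uniformly_elliptic \<mu>"
 shows "\<exists>w. (\<forall>n. AE x in cone_measure P q 0. d < norm x --> w n x = 0) \<and>
  (singular_Weyl_sequence (cone_measure P q \<alpha>) (shift (NP_op C P) \<mu>) w \<or>
   singular_Weyl_sequence (cone_measure P q (- \<alpha>)) (shift (NP_adj C P q \<alpha>) (cnj \<mu>)) w)"
proof -
 obtain w where w: "\<And>n z. fst z > ln d ==> w n z = 0"
  "singular_Weyl_sequence cyl (shift conv.conv \<mu>) w \<or> singular_Weyl_sequence cyl (shift conv.conv' (cnj \<mu>)) w"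
  using conv.Weyl_sequence_if_not_elliptic[OF ne, of "ln d"] by blast
 have s: "w m (\<Psi> x) = 0" if "d < norm x" for m x
 proof (rule w(1))
  have "0 < norm x" using that d by linarith
  thus "fst (\<Psi> x) > ln d" using that d by (simp add: ln_less_cancel_iff)
 qed
 have bc': "bounded_op cyl conv.conv'" using conv.conv_adjoint by (simp add: adjoint_pair_def)
 from w(2) show ?thesis
 proof
  assume "singular_Weyl_sequence cyl (shift conv.conv \<mu>) w"
  from cone.Weyl_sequence_pullback[OF cone.intertwines_shift[OF cone_intertwines] bounded_op_shift[OF conv.bounded_conv] this]
  show ?thesis by (intro exI[of _ "%m. cone.W (w m)"]) (simp add: cone.W_def s)
 next
  assume "singular_Weyl_sequence cyl (shift conv.conv' (cnj \<mu>)) w"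
  from dual.Weyl_sequence_pullback[OF dual.intertwines_shift[OF dual_intertwines] bounded_op_shift[OF bc'] this]
  show ?thesis by (intro exI[of _ "%m. dual.W (w m)"]) (simp add: dual.W_def s)
 qed
qed

lemma spectrum_eq_essential_spectrum:
 "spectrum (cone_measure P q \<alpha>) (NP_op C P) = essential_spectrum (cone_measure P q \<alpha>) (NP_op C P)"
proof -
 have "\<not> fredholm (cone_measure P q \<alpha>) (shift (NP_op C P) \<mu>)" if "\<not> conv.uniformly_elliptic \<mu>" for \<mu>
  using conv.not_fredholm_if_not_elliptic[OF that]
   cone.fredholm_pushforward[OF cone.intertwines_shift[OF cone_intertwines] bounded_op_shift[OF conv.bounded_conv]] by blast
 thus ?thesis unfolding spectrum_def essential_spectrum_def
  using fredholm_if_invertible invertible_iff_elliptic by blast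
qed

end

theorem theorem17:
  fixes C :: "(real^3) set" and P :: spherical_polygon and q :: "real^3 \<Rightarrow> real"
    and \<alpha> d :: real and \<mu> :: complex
  assumes "polyhedral_cone C P"
    and "corner_weight P q"
    and "0 \<le> \<alpha>" and "\<alpha> < 1"
    and "0 < d"
  shows "(invertible_op (cone_measure P q \<alpha>) (shift (NP_op C P) \<mu>) \<longleftrightarrow>
           (\<forall>z. Re z = 0 \<longrightarrow> \<mu> \<notin> spectrum (curve_measure P q \<alpha>) (mellin_op C P z)) \<and>
           bdd_above ((\<lambda>z. op_norm (curve_measure P q \<alpha>)
               (inverse_op (curve_measure P q \<alpha>) (shift (mellin_op C P z) \<mu>))) ` {z. Re z = 0})) \<and>
         (\<not> invertible_op (cone_measure P q \<alpha>) (shift (NP_op C P) \<mu>) \<longrightarrow>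
           (\<exists>w. (\<forall>n. AE x in cone_measure P q 0. d < norm x \<longrightarrow> w n x = 0) \<and>
             (singular_Weyl_sequence (cone_measure P q \<alpha>) (shift (NP_op C P) \<mu>) w \<or>
              singular_Weyl_sequence (cone_measure P q (- \<alpha>))
                (shift (NP_adj C P q \<alpha>) (cnj \<mu>)) w))) \<and>
         spectrum (cone_measure P q \<alpha>) (NP_op C P) =
           essential_spectrum (cone_measure P q \<alpha>) (NP_op C P)"
proof -
 interpret weighted_cone C P q \<alpha> by unfold_locales (use assms in auto)
 show ?thesis
  unfolding symbols_invertible_iff_elliptic invertible_iff_elliptic
  using Weyl_sequence_near_vertex[OF assms(5)] spectrum_eq_essential_spectrum by blast
qed

end
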